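(* Let $k\ge 1$ be an integer, let $V_{-1},V_0$ be finite dimensional real vector spaces, let $V_1,\dots,V_k$ and $W_k(V_{-1},V_0)$ be the spaces built from them as in the context, let $V_k^0$ be a linear subspace of $V_k$, and put $W_k^0=V_{-1}\oplus V_0\oplus\cdots\oplus V_{k-1}\oplus V_k^0$. Let $R_k$ be a differentiable ($C^\infty$) manifold with $\dim R_k=\dim W_k^0$. Suppose there exist a $W_k^0$-valued absolute parallelism $\omega=\omega^{-1}+\omega^0+\cdots+\omega^k$ on $R_k$ (with $\omega^p$ the $V_p$-component for $-1\le p\le k-1$ and $\omega^k$ the $V_k^0$-component) and a differentiable mapping $T:R_k\to \mathrm{Hom}(V_{-1}\times V_k^0:V_{k-1})$ such that the following hold. (C$_1$) For each $x\in R_k$ and each $X_k\in V_k^0$: if $T_x(X_{-1},X_k)=0$ for all $X_{-1}\in V_{-1}$, then $X_k=0$. (C$_2$) (i) $d\omega^{-1}\equiv 0 \pmod{\omega^{-1}}$; (ii) (if $k\ge 2$) for $p=0,1,\dots,k-2$: $d\omega^p+[\omega^{-1}\wedge\omega^{p+1}]\equiv 0 \pmod{\omega^0,\dots,\omega^p}$; (iii) $d\omega^{k-1}+T(\omega^{-1}\wedge\omega^k)\equiv 0 \pmod{\omega^{-1}\wedge\omega^{-1},\omega^0,\dots,\omega^{k-1}}$. Then $R_k$ can be locally embedded into $W_k(V_{-1},V_0)$ as a local differential equation of order $k$; that is, every point of $R_k$ has an open neighborhood that admits an embedding into $W_k(V_{-1},V_0)$ whose image is a local differential equation of order $k$.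
   Context: Everything is of class $C^\infty$. **The spaces.** For finite dimensional real vector spaces $V_{-1},V_0$, put $V_1=\mathrm{Hom}(V_{-1},V_0)$ and, inductively for $j\ge 2$, $V_j=\{X\in\mathrm{Hom}(V_{-1},V_{j-1}) : X(u)(v)=X(v)(u)\ \text{for all } u,v\in V_{-1}\}$ (so $V_j\cong V_0\otimes S^j(V_{-1}^* )$). For $k\ge 1$, $W_k(V_{-1},V_0)=V_{-1}\oplus V_0\oplus\cdots\oplus V_k$, with the bracket determined by $[X_p,X_{-1}]=-[X_{-1},X_p]=X_p(X_{-1})$ for $X_{-1}\in V_{-1}$, $X_p\in V_p$, $1\le p\le k$, and zero for all other combinations of homogeneous elements. Also $W_0(V_{-1},V_0)=V_{-1}\oplus V_0$. The map $\rho^k:W_k(V_{-1},V_0)\to W_{k-1}(V_{-1},V_0)$ is the natural projection. **Local differential equation.** A submanifold $R$ of $W_k(V_{-1},V_0)$ is a *local differential equation of order $k$* if $R$ admits an absolute parallelism and there is an open submanifold $U$ of $W_{k-1}(V_{-1},V_0)$ such that $\rho^k(R)=U$ and $\rho^k|_R:R\to U$ is a fibered submanifold of $\rho^k:(\rho^k)^{-1}(U)\to U$ (i.e. $R$ is a submanifold of $(\rho^k)^{-1}(U)$ and $\rho^k|_R:R\to U$ is a surjective submersion). **Conventions on forms.** A $W$-valued absolute parallelism on a manifold $R$, for a vector space $W$ with $\dim W=\dim R$, is a $W$-valued 1-form $\omega$ such that $\omega_x:T_xR\to W$ is a linear isomorphism for every $x$. $\mathrm{Hom}(V_{-1}\times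 V_k^0:V_{k-1})$ is the space of bilinear maps $V_{-1}\times V_k^0\to V_{k-1}$. For vector fields $X,Y$: $[\omega^{-1}\wedge\omega^{q}](X,Y)=[\omega^{-1}(X),\omega^{q}(Y)]-[\omega^{-1}(Y),\omega^{q}(X)]$ and $T(\omega^{-1}\wedge\omega^k)(X,Y)=T(\omega^{-1}(X),\omega^k(Y))-T(\omega^{-1}(Y),\omega^k(X))$. A congruence of vector-valued 2-forms "mod" a list of vector-valued forms means that the scalar components of the difference lie in the ideal of the algebra of differential forms generated by the scalar components of the listed forms; for "$\omega^{-1}\wedge\omega^{-1}$" the generators are all products of two scalar components of $\omega^{-1}$. *)

theory Defs
  imports "HOL-Analysis.Analysis" "HOL-Library.Function_Algebras"
begin

section \<open>Linear algebra\<close>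

text \<open>Pointwise real vector space structure on functions, so that \<^const>\<open>subspace\<close>,
  \<^const>\<open>dim\<close> and \<^const>\<open>linear\<close> apply to spaces of functions.\<close>

instantiation "fun" :: (type, real_vector) real_vector
begin

definition scaleR_fun :: "real \<Rightarrow> ('a \<Rightarrow> 'b) \<Rightarrow> 'a \<Rightarrow> 'b"
  where "scaleR_fun c f = (\<lambda>x. c *\<^sub>R f x)"

instance
  by standard (auto simp: scaleR_fun_def plus_fun_def fun_eq_iff scaleR_add_left scaleR_add_right)

end

definition linear_on :: "'v::real_vector set \<Rightarrow> ('v \<Rightarrow> 'w::real_vector) \<Rightarrow> bool"
  where "linear_on S f \<longleftrightarrow>
    (\<forall>x\<in>S. \<forall>y\<in>S. f (x + y) = f x + f y) \<and> (\<forall>c. \<forall>x\<in>S. f (c *\<^sub>R x) = c *\<^sub>R f x)"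


section \<open>Smooth functions on open subsets of Euclidean n-space\<close>

text \<open>Points of Euclidean n-space are the sequences vanishing from index n on, as in
  \<^const>\<open>Euclidean_space\<close>; this includes n = 0.\<close>

definition partial_deriv :: "nat \<Rightarrow> ((nat \<Rightarrow> real) \<Rightarrow> real) \<Rightarrow> (nat \<Rightarrow> real) \<Rightarrow> real"
  where "partial_deriv i f x = deriv (\<lambda>t. f (x(i := t))) (x i)"

fun C_times :: "nat \<Rightarrow> nat \<Rightarrow> (nat \<Rightarrow> real) set \<Rightarrow> ((nat \<Rightarrow> real) \<Rightarrow> real) \<Rightarrow> bool"
  where
    "C_times n 0 S f \<longleftrightarrow> continuous_map (subtopology (Euclidean_space n) S) euclideanreal f"
  | "C_times n (Suc r) S f \<longleftrightarrow> continuous_map (subtopology (Euclidean_space n) S) euclideanreal f \<and>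
      (\<forall>i<n. (\<forall>x\<in>S. (\<lambda>t. f (x(i := t))) differentiable (at (x i))) \<and>
             C_times n r S (partial_deriv i f))"

definition C_infinity :: "nat \<Rightarrow> (nat \<Rightarrow> real) set \<Rightarrow> ((nat \<Rightarrow> real) \<Rightarrow> real) \<Rightarrow> bool"
  where "C_infinity n S f \<longleftrightarrow> (\<forall>r. C_times n r S f)"


section \<open>Smooth manifolds\<close>

text \<open>A chart is a pair of its open domain and its coordinate map. The atlas need not be
  maximal.\<close>

record 'm mfd =
  mtop :: "'m topology"
  mdim :: nat
  atlas :: "('m set \<times> ('m \<Rightarrow> nat \<Rightarrow> real)) set"

abbreviation points :: "'m mfd \<Rightarrow> 'm set"
  where "points M \<equiv> topspace (mtop M)"

definition smooth_manifold :: "'m mfd \<Rightarrow> bool"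
  where "smooth_manifold M \<longleftrightarrow>
    Hausdorff_space (mtop M) \<and> second_countable (mtop M) \<and>
    (\<Union>(U, \<phi>)\<in>atlas M. U) = points M \<and>
    (\<forall>(U, \<phi>)\<in>atlas M. openin (mtop M) U \<and> openin (Euclidean_space (mdim M)) (\<phi> ` U) \<and>
       homeomorphic_map (subtopology (mtop M) U)
         (subtopology (Euclidean_space (mdim M)) (\<phi> ` U)) \<phi>) \<and>
    (\<forall>(U, \<phi>)\<in>atlas M. \<forall>(V, \<psi>)\<in>atlas M. \<forall>i<mdim M.
       C_infinity (mdim M) (\<phi> ` (U \<inter> V)) (\<lambda>z. \<psi> (inv_into U \<phi> z) i))"

definition smooth_map :: "'m mfd \<Rightarrow> 'n mfd \<Rightarrow> ('m \<Rightarrow> 'n) \<Rightarrow> bool"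
  where "smooth_map M N f \<longleftrightarrow> continuous_map (mtop M) (mtop N) f \<and>
    (\<forall>(U, \<phi>)\<in>atlas M. \<forall>(V, \<psi>)\<in>atlas N. \<forall>i<mdim N.
       C_infinity (mdim M) (\<phi> ` (U \<inter> f -` V)) (\<lambda>z. \<psi> (f (inv_into U \<phi> z)) i))"

definition smooth_fun :: "'m mfd \<Rightarrow> ('m \<Rightarrow> real) set"
  where "smooth_fun M = {f. \<forall>(U, \<phi>)\<in>atlas M.
    C_infinity (mdim M) (\<phi> ` U) (\<lambda>z. f (inv_into U \<phi> z))}"

definition open_submfd :: "'m mfd \<Rightarrow> 'm set \<Rightarrow> 'm mfd"
  where "open_submfd M S =
    \<lparr>mtop = subtopology (mtop M) S, mdim = mdim M, atlas = (\<lambda>(U, \<phi>). (U \<inter> S, \<phi>)) ` atlas M\<rparr>"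

text \<open>The standard smooth structure of a finite dimensional linear subspace V: its charts are
  the linear isomorphisms onto Euclidean space.\<close>

definition linear_charts :: "'v::real_vector set \<Rightarrow> ('v \<Rightarrow> nat \<Rightarrow> real) set"
  where "linear_charts V =
    {\<phi>. linear_on V \<phi> \<and> bij_betw \<phi> V (topspace (Euclidean_space (dim V)))}"

definition vector_mfd :: "'v::real_vector set \<Rightarrow> 'v mfd"
  where "vector_mfd V =
    \<lparr>mtop = topology (\<lambda>S. S \<subseteq> V \<and>
       (\<forall>\<phi>\<in>linear_charts V. openin (Euclidean_space (dim V)) (\<phi> ` S))),
     mdim = dim V, atlas = {V} \<times> linear_charts V\<rparr>"

lemma openin_vector_mfd:
  "openin (mtop (vector_mfd V)) S \<longleftrightarrow>
    S \<subseteq> V \<and> (\<forall>\<phi>\<in>linear_charts V. openin (Euclidean_space (dim V)) (\<phi> ` S))"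
proof -
  have "istopology (\<lambda>S. S \<subseteq> V \<and>
      (\<forall>\<phi>\<in>linear_charts V. openin (Euclidean_space (dim V)) (\<phi> ` S)))"
    unfolding istopology_def
  proof (intro conjI allI impI ballI)
    fix S T \<phi>
    assume S: "S \<subseteq> V \<and> (\<forall>\<phi>\<in>linear_charts V. openin (Euclidean_space (dim V)) (\<phi> ` S))"
      and T: "T \<subseteq> V \<and> (\<forall>\<phi>\<in>linear_charts V. openin (Euclidean_space (dim V)) (\<phi> ` T))"
      and \<phi>: "\<phi> \<in> linear_charts V"
    then have "\<phi> ` (S \<inter> T) = \<phi> ` S \<inter> \<phi> ` T"
      by (intro inj_on_image_Int[of \<phi> V]) (auto simp: linear_charts_def bij_betw_def)
    then show "openin (Euclidean_space (dim V)) (\<phi> ` (S \<inter> T))"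
      using S T \<phi> by auto
  qed (auto simp: image_Union)
  then show ?thesis
    by (simp add: vector_mfd_def topology_inverse')
qed

text \<open>Tangent vectors are derivations of the algebra of smooth functions, set to 0 on functions
  that are not smooth.\<close>

type_synonym 'm tvec = "('m \<Rightarrow> real) \<Rightarrow> real"

definition tangent :: "'m mfd \<Rightarrow> 'm \<Rightarrow> 'm tvec set"
  where "tangent M x = {v. (\<forall>f. f \<notin> smooth_fun M \<longrightarrow> v f = 0) \<and> linear_on (smooth_fun M) v \<and>
    (\<forall>f\<in>smooth_fun M. \<forall>g\<in>smooth_fun M. v (\<lambda>y. f y * g y) = f x * v g + g x * v f)}"

definition differential :: "'m mfd \<Rightarrow> 'n mfd \<Rightarrow> ('m \<Rightarrow> 'n) \<Rightarrow> 'm tvec \<Rightarrow> 'n tvec"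
  where "differential M N f v = (\<lambda>g. if g \<in> smooth_fun N then v (\<lambda>y. g (f y)) else 0)"

definition smooth_embedding :: "'m mfd \<Rightarrow> 'n mfd \<Rightarrow> ('m \<Rightarrow> 'n) \<Rightarrow> bool"
  where "smooth_embedding M N f \<longleftrightarrow> smooth_map M N f \<and> embedding_map (mtop M) (mtop N) f \<and>
    (\<forall>x\<in>points M. inj_on (differential M N f) (tangent M x))"

definition submersion :: "'m mfd \<Rightarrow> 'n mfd \<Rightarrow> ('m \<Rightarrow> 'n) \<Rightarrow> bool"
  where "submersion M N f \<longleftrightarrow> smooth_map M N f \<and>
    (\<forall>x\<in>points M. differential M N f ` tangent M x = tangent N (f x))"

definition submanifold :: "'m mfd \<Rightarrow> 'm mfd \<Rightarrow> bool"
  where "submanifold N M \<longleftrightarrow> smooth_manifold N \<and> points N \<subseteq> points M \<and>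
    smooth_embedding N M (\<lambda>x. x)"


section \<open>Differential forms\<close>

type_synonym 'm vfield = "'m \<Rightarrow> 'm tvec"
type_synonym ('m, 'v) form1 = "'m \<Rightarrow> 'm tvec \<Rightarrow> 'v"
type_synonym ('m, 'v) form2 = "'m vfield \<Rightarrow> 'm vfield \<Rightarrow> 'm \<Rightarrow> 'v"

definition vector_field :: "'m mfd \<Rightarrow> 'm vfield \<Rightarrow> bool"
  where "vector_field M X \<longleftrightarrow> (\<forall>x\<in>points M. X x \<in> tangent M x) \<and>
    (\<forall>f\<in>smooth_fun M. (\<lambda>x. X x f) \<in> smooth_fun M)"

definition lie_bracket :: "'m vfield \<Rightarrow> 'm vfield \<Rightarrow> 'm vfield"
  where "lie_bracket X Y = (\<lambda>x f. X x (\<lambda>y. Y y f) - Y x (\<lambda>y. X y f))"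

definition one_form :: "'m mfd \<Rightarrow> 'v::real_vector set \<Rightarrow> ('m, 'v) form1 \<Rightarrow> bool"
  where "one_form M V \<omega> \<longleftrightarrow>
    (\<forall>x\<in>points M. linear_on (tangent M x) (\<omega> x) \<and> \<omega> x ` tangent M x \<subseteq> V) \<and>
    (\<forall>X. vector_field M X \<longrightarrow> smooth_map M (vector_mfd V) (\<lambda>x. \<omega> x (X x)))"

definition absolute_parallelism :: "'m mfd \<Rightarrow> 'v::real_vector set \<Rightarrow> ('m, 'v) form1 \<Rightarrow> bool"
  where "absolute_parallelism M W \<omega> \<longleftrightarrow> subspace W \<and> dim W = mdim M \<and> one_form M W \<omega> \<and>
    (\<forall>x\<in>points M. bij_betw (\<omega> x) (tangent M x) W)"

definition ext_deriv :: "('m, real) form1 \<Rightarrow> ('m, real) form2"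
  where "ext_deriv \<alpha> X Y x =
    X x (\<lambda>y. \<alpha> y (Y y)) - Y x (\<lambda>y. \<alpha> y (X y)) - \<alpha> x (lie_bracket X Y x)"

definition wedge :: "('m, real) form1 \<Rightarrow> ('m, real) form1 \<Rightarrow> ('m, real) form2"
  where "wedge \<alpha> \<beta> X Y x = \<alpha> x (X x) * \<beta> x (Y x) - \<alpha> x (Y x) * \<beta> x (X x)"

text \<open>The wedge product of vector valued forms with respect to a pairing that may depend on the
  point.\<close>

definition wedge_by :: "('m \<Rightarrow> 'u \<Rightarrow> 'v \<Rightarrow> 'w::real_vector) \<Rightarrow>
    ('m, 'u) form1 \<Rightarrow> ('m, 'v) form1 \<Rightarrow> ('m, 'w) form2"
  where "wedge_by B \<alpha> \<beta> X Y x = B x (\<alpha> x (X x)) (\<beta> x (Y x)) - B x (\<alpha> x (Y x)) (\<beta> x (X x))"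

definition scalar_components :: "('m, 'v::real_vector) form1 \<Rightarrow> ('m, real) form1 set"
  where "scalar_components \<theta> = {\<lambda>x v. l (\<theta> x v) | l. linear l}"

text \<open>The degree 2 part of the ideal generated by the 1-forms in \<open>G1\<close> and the 2-forms in
  \<open>G2\<close>.\<close>

definition in_ideal :: "'m mfd \<Rightarrow> ('m, real) form1 set \<Rightarrow> ('m, real) form2 set \<Rightarrow>
    ('m, real) form2 \<Rightarrow> bool"
  where "in_ideal M G1 G2 \<Theta> \<longleftrightarrow>
    (\<exists>(r::nat) \<alpha> \<eta> (s::nat) f \<Omega>.
      (\<forall>i<r. \<alpha> i \<in> G1 \<and> one_form M (UNIV :: real set) (\<eta> i)) \<and>
      (\<forall>j<s. f j \<in> smooth_fun M \<and> \<Omega> j \<in> G2) \<and>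
      (\<forall>X Y. vector_field M X \<longrightarrow> vector_field M Y \<longrightarrow> (\<forall>x\<in>points M.
        \<Theta> X Y x = (\<Sum>i<r. wedge (\<eta> i) (\<alpha> i) X Y x) + (\<Sum>j<s. f j x * \<Omega> j X Y x))))"

text \<open>\<open>d\<theta> + \<Phi> \<equiv> 0\<close> modulo the ideal, for a vector valued 1-form \<open>\<theta>\<close>, whose exterior derivative
  is taken componentwise.\<close>

definition structure_congruence :: "'m mfd \<Rightarrow> ('m, real) form1 set \<Rightarrow> ('m, real) form2 set \<Rightarrow>
    ('m, 'v::real_vector) form1 \<Rightarrow> ('m, 'v) form2 \<Rightarrow> bool"
  where "structure_congruence M G1 G2 \<theta> \<Phi> \<longleftrightarrow>
    (\<forall>l :: 'v \<Rightarrow> real. linear l \<longrightarrow>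
      in_ideal M G1 G2 (\<lambda>X Y x. ext_deriv (\<lambda>y v. l (\<theta> y v)) X Y x + l (\<Phi> X Y x)))"


section \<open>The spaces and local differential equations\<close>

text \<open>The spaces \<open>V\<^sub>-\<^sub>1\<close> and \<open>V\<^sub>0\<close> are the types \<open>'a\<close> and \<open>'b\<close>. An element X of \<open>V\<^sub>j\<close> with
  \<open>j \<ge> 0\<close> is stored in uncurried form as a function on lists, supported on lists of length j, with
  \<open>X [u\<^sub>1, \<dots>, u\<^sub>j] = X(u\<^sub>1)\<dots>(u\<^sub>j)\<close>; thus \<open>X(u)\<close> is \<open>appl X u\<close>, and an element of \<open>V\<^sub>0\<close> is its
  value at the empty list.\<close>

type_synonym ('a, 'b) tensor = "'a list \<Rightarrow> 'b"

definition appl :: "('a, 'b) tensor \<Rightarrow> 'a \<Rightarrow> ('a, 'b) tensor"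
  where "appl X u = (\<lambda>us. X (u # us))"

definition Hom_into :: "('a::real_vector, 'b::real_vector) tensor set \<Rightarrow> ('a, 'b) tensor set"
  where "Hom_into S = {X. X [] = 0 \<and> linear (appl X) \<and> (\<forall>u. appl X u \<in> S)}"

fun VV :: "nat \<Rightarrow> ('a::real_vector, 'b::real_vector) tensor set"
  where
    "VV 0 = {X. \<forall>us. us \<noteq> [] \<longrightarrow> X us = 0}"
  | "VV (Suc 0) = Hom_into (VV 0)"
  | "VV (Suc (Suc j)) =
      {X \<in> Hom_into (VV (Suc j)). \<forall>u v. appl (appl X u) v = appl (appl X v) u}"

text \<open>A pair \<open>(x, X)\<close> has the \<open>V\<^sub>-\<^sub>1\<close>-component x and the \<open>V\<^sub>p\<close>-components \<open>X p\<close>.\<close>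

type_synonym ('a, 'b) graded = "'a \<times> (nat \<Rightarrow> ('a, 'b) tensor)"

definition WW :: "nat \<Rightarrow> ('a::real_vector, 'b::real_vector) graded set"
  where "WW k = {(x, X). (\<forall>p\<le>k. X p \<in> VV p) \<and> (\<forall>p>k. X p = 0)}"

definition WW0 :: "nat \<Rightarrow> ('a::real_vector, 'b::real_vector) tensor set \<Rightarrow> ('a, 'b) graded set"
  where "WW0 k Vk0 = {w \<in> WW k. snd w k \<in> Vk0}"

definition W_bracket :: "('a, 'b::real_vector) graded \<Rightarrow> ('a::real_vector, 'b) graded \<Rightarrow> ('a, 'b) graded"
  where "W_bracket v w =
    (0, \<lambda>p. appl (snd v (Suc p)) (fst w) - appl (snd w (Suc p)) (fst v))"

definition hom_m1 :: "'a \<Rightarrow> ('a, 'b::real_vector) graded"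
  where "hom_m1 x = (x, 0)"

definition hom_p :: "nat \<Rightarrow> ('a, 'b) tensor \<Rightarrow> ('a::real_vector, 'b::real_vector) graded"
  where "hom_p p X = (0, (\<lambda>_. 0)(p := X))"

definition rho :: "nat \<Rightarrow> ('a, 'b::real_vector) graded \<Rightarrow> ('a, 'b) graded"
  where "rho k w = (fst w, (snd w)(k := 0))"

text \<open>Bilinear maps \<open>V\<^sub>-\<^sub>1 \<times> A \<rightarrow> B\<close>, set to 0 when the second argument is outside A.\<close>

definition Bilinear_maps :: "('a::real_vector, 'b::real_vector) tensor set \<Rightarrow> ('a, 'b) tensor set \<Rightarrow>
    ('a \<Rightarrow> ('a, 'b) tensor \<Rightarrow> ('a, 'b) tensor) set"
  where "Bilinear_maps A B = {t.
    (\<forall>X\<in>A. linear (\<lambda>u. t u X)) \<and> (\<forall>u. linear_on A (t u)) \<and>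
    (\<forall>u. \<forall>X\<in>A. t u X \<in> B) \<and> (\<forall>u X. X \<notin> A \<longrightarrow> t u X = 0)}"

definition local_diff_eq :: "nat \<Rightarrow> ('a::real_vector, 'b::real_vector) graded set \<Rightarrow> bool"
  where "local_diff_eq k S \<longleftrightarrow> k \<ge> 1 \<and>
    (\<exists>N. points N = S \<and> submanifold N (vector_mfd (WW k)) \<and>
      (\<exists>\<omega>. absolute_parallelism N (topspace (Euclidean_space (mdim N))) \<omega>) \<and>
      (\<exists>U. openin (mtop (vector_mfd (WW (k - 1)))) U \<and> rho k ` S = U \<and>
        submanifold N (open_submfd (vector_mfd (WW k)) {w \<in> WW k. rho k w \<in> U}) \<and>
        submersion N (open_submfd (vector_mfd (WW (k - 1))) U) (rho k)))"


section \<open>Components of a graded 1-form\<close>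

definition form_m1 :: "('m, ('a, 'b) graded) form1 \<Rightarrow> ('m, 'a) form1"
  where "form_m1 \<omega> = (\<lambda>x v. fst (\<omega> x v))"

definition form_p :: "nat \<Rightarrow> ('m, ('a, 'b) graded) form1 \<Rightarrow> ('m, ('a, 'b) tensor) form1"
  where "form_p p \<omega> = (\<lambda>x v. snd (\<omega> x v) p)"

text \<open>The bracket \<open>V\<^sub>-\<^sub>1 \<times> V\<^sub>p\<^sub>+\<^sub>1 \<rightarrow> V\<^sub>p\<close>.\<close>

definition bracket_m1 :: "nat \<Rightarrow> 'a \<Rightarrow> ('a::real_vector, 'b::real_vector) tensor \<Rightarrow> ('a, 'b) tensor"
  where "bracket_m1 p u X = snd (W_bracket (hom_m1 u) (hom_p (Suc p) X)) p"

lemma bracket_m1_eq: "bracket_m1 p u X = - appl X u"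
  by (simp add: bracket_m1_def W_bracket_def hom_m1_def hom_p_def appl_def fun_eq_iff)

definition lower_components :: "nat \<Rightarrow> ('m, ('a, 'b::real_vector) graded) form1 \<Rightarrow>
    ('m, real) form1 set"
  where "lower_components p \<omega> = (\<Union>q\<le>p. scalar_components (form_p q \<omega>))"

definition wedge_m1_m1 :: "('m, ('a::real_vector, 'b) graded) form1 \<Rightarrow> ('m, real) form2 set"
  where "wedge_m1_m1 \<omega> =
    {wedge \<alpha> \<beta> | \<alpha> \<beta>. \<alpha> \<in> scalar_components (form_m1 \<omega>) \<and> \<beta> \<in> scalar_components (form_m1 \<omega>)}"

end

theory Submission
  imports Defs "Jordan_Normal_Form.Determinant"
begin

text \<open>Frobenius' theorem yields local functions x and y with values in \<open>V\<^sub>-\<^sub>1\<close> and \<open>V\<^sub>0\<close> such that dx spans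
  \<open>\<omega>\<^sup>-\<^sup>1\<close>, and dx, dy span \<open>\<omega>\<^sup>-\<^sup>1, \<omega>\<^sup>0\<close>. Replace \<open>\<omega>\<^sup>-\<^sup>1\<close> by dx in the coframe and let \<open>X\<^sub>u\<close> be the dual field in the
  direction \<open>u \<in> V\<^sub>-\<^sub>1\<close>. Consider the map F = (x, y, Xy, XXy, \dots) into the space of k-jets. By the structure
  equations below the top degree the iterated derivatives are symmetric, those of order less than p are constant along
  the \<open>V\<^sub>p\<close>-directions, and the ones of order p have the identity as their derivative there. In the top degree that
  derivative is T, up to sign, so (C1) makes F an immersion whose (k-1)-jet is a submersion. Linear coordinates of
  (k-1)-jets extend to linear functions on k-jets that restrict to coordinates of the image of F, which therefore is
  parametrised by a cube compatibly with the projection.\<close>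

section \<open>Calculus on Euclidean n-space\<close>

text \<open>Replacing \<open>\<omega>\<^sup>-\<^sup>1\<close> by the closed dx is what keeps the
  brackets of the dual fields free of a degree -1 component. The price is that the structure
  equations survive only in part. On a neighbourhood the vanishing statements remain, because the
  components of degree 0 and higher and the kernel of \<open>\<omega>\<^sup>-\<^sup>1\<close> are
  untouched. The exact coefficients remain at the base point, where x is normalised so that dx =
  \<open>\<omega>\<^sup>-\<^sup>1\<close>; this suffices, since the inverse function theorem needs
  the Jacobian at one point only. The congruence of degree k - 1 leaves that component of the
  bracket of \<open>X\<^sub>u\<close> and \<open>X\<^sub>v\<close> undetermined. Derivatives of
  order at most k - 2 do not see it, so even those of order k are symmetric. The congruences are
  tested on global fields, so coordinate fields must be extended by bump functions. A single lemma
  on flows, with parameters entering linearly in the field and in the initial point, yields both the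
  inverse function theorem and Frobenius' theorem. Time always runs over [0,1]; small parameters
  bring the Lipschitz constants down to 1/2.\<close>

abbreviation pd :: "nat \<Rightarrow> ((nat \<Rightarrow> real) \<Rightarrow> real) \<Rightarrow> (nat \<Rightarrow> real) \<Rightarrow> real"
  where "pd \<equiv> partial_deriv"

definition Rn :: "nat \<Rightarrow> (nat \<Rightarrow> real) set"
  where "Rn n = {x. \<forall>i\<ge>n. x i = 0}"

text \<open>The product shape matters twice: moving one coordinate at a time stays inside, and
  forgetting the last coordinates turns a cube into a cube of the same radius, as the projection
  between jet spaces will require.\<close>

definition cube :: "nat \<Rightarrow> (nat \<Rightarrow> real) \<Rightarrow> real \<Rightarrow> (nat \<Rightarrow> real) set"
  where "cube n z r = {x \<in> Rn n. \<forall>i<n. \<bar>x i - z i\<bar> < r}"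

abbreviation openR :: "nat \<Rightarrow> (nat \<Rightarrow> real) set \<Rightarrow> bool"
  where "openR n S \<equiv> openin (Euclidean_space n) S"

lemma topspace_Rn: "topspace (Euclidean_space n) = Rn n"
  by (simp add: Rn_def topspace_Euclidean_space)

lemma Euclidean_space_eq: "Euclidean_space n = top_of_set (Rn n)"
  by (simp add: Euclidean_space_def euclidean_product_topology Rn_def)

lemma openR_subset: "openR n S \<Longrightarrow> S \<subseteq> Rn n"
  using openin_subset topspace_Rn by blast

lemma Rn_eqI: "x \<in> Rn n \<Longrightarrow> y \<in> Rn n \<Longrightarrow> (\<And>i. i < n \<Longrightarrow> x i = y i) \<Longrightarrow> x = y"
  by (rule ext) (metis (mono_tags, lifting) Rn_def linorder_not_less mem_Collect_eq)

lemma Rn_upd: "x \<in> Rn n \<Longrightarrow> i < n \<Longrightarrow> x(i := t) \<in> Rn n"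
  by (auto simp: Rn_def)

lemma openR_cube [simp]: "openR n (cube n z r)"
proof -
  have "open (\<Inter>i\<in>{..<n}. {x :: nat \<Rightarrow> real. \<bar>x i - z i\<bar> < r})"
    by (intro open_INT ballI open_Collect_less continuous_intros) auto
  moreover have "cube n z r = Rn n \<inter> (\<Inter>i\<in>{..<n}. {x. \<bar>x i - z i\<bar> < r})"
    by (auto simp: cube_def)
  ultimately show ?thesis
    unfolding Euclidean_space_eq by auto
qed

lemma openR_iff: "openR n S \<longleftrightarrow> S \<subseteq> Rn n \<and> (\<forall>x\<in>S. \<exists>r>0. cube n x r \<subseteq> S)"
proof
  assume S: "openR n S"
  then obtain T where T: "open T" "S = Rn n \<inter> T"
    by (auto simp: Euclidean_space_eq openin_open)
  have "\<exists>r>0. cube n x r \<subseteq> S" if "x \<in> S" for x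
  proof -
    have "openin (product_topology (\<lambda>i::nat. euclideanreal) UNIV) T" "x \<in> T"
      using T that by (auto simp: open_fun_def)
    from product_topology_open_contains_basis[OF this]
    obtain X where X: "x \<in> (\<Pi>\<^sub>E i\<in>UNIV. X i)" "\<And>i. open (X i)" "(\<Pi>\<^sub>E i\<in>UNIV. X i) \<subseteq> T"
      by auto
    have "\<exists>d>0. \<forall>y. \<bar>y - x i\<bar> < d \<longrightarrow> y \<in> X i" for i
      using X(1) X(2)[of i] unfolding open_dist dist_real_def by (auto simp: PiE_iff)
    then obtain d where d: "\<And>i. d i > 0" "\<And>i y. \<bar>y - x i\<bar> < d i \<Longrightarrow> y \<in> X i"
      by metis
    \<comment> \<open>The extra element 1 keeps the minimum meaningful for n = 0. Only the first n
      factors of the basic open set have to be controlled, since the other coordinates vanish on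
      \<open>Rn n\<close>.\<close>
    define r where "r = Min (insert 1 (d ` {..<n}))"
    have r: "r > 0" "\<And>i. i < n \<Longrightarrow> r \<le> d i"
      using d(1) by (auto simp: r_def)
    have "cube n x r \<subseteq> S"
    proof
      fix y assume y: "y \<in> cube n x r"
      have "y i \<in> X i" for i
      proof (cases "i < n")
        case True
        with y r(2)[OF True] have "\<bar>y i - x i\<bar> < d i"
          by (auto simp: cube_def intro: less_le_trans)
        then show ?thesis using d(2) by blast
      next
        case False
        then have "y i = x i"
          using y that T(2) by (auto simp: cube_def Rn_def)
        then show ?thesis using X(1) by (auto simp: PiE_iff)
      qed
      then have "y \<in> T" using X(3) by (auto simp: PiE_iff)
      then show "y \<in> S" using y T(2) by (auto simp: cube_def)
    qed
    then show ?thesis using r(1) by blast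
  qed
  then show "S \<subseteq> Rn n \<and> (\<forall>x\<in>S. \<exists>r>0. cube n x r \<subseteq> S)"
    using openR_subset[OF S] by blast
next
  assume *: "S \<subseteq> Rn n \<and> (\<forall>x\<in>S. \<exists>r>0. cube n x r \<subseteq> S)"
  have "\<exists>T. openR n T \<and> x \<in> T \<and> T \<subseteq> S" if "x \<in> S" for x
  proof -
    obtain r where "r > 0" "cube n x r \<subseteq> S" using conjunct2[OF *] \<open>x \<in> S\<close> by meson
    moreover have "x \<in> cube n x r" using \<open>r > 0\<close> * that by (auto simp: cube_def)
    ultimately show ?thesis using openR_cube by blast
  qed
  then show "openR n S"
    by (subst openin_subopen) blast
qed

lemma cube_self: "r > 0 \<Longrightarrow> x \<in> Rn n \<Longrightarrow> x \<in> cube n x r"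
  by (auto simp: cube_def)

lemma cube_mono: "r \<le> s \<Longrightarrow> cube n z r \<subseteq> cube n z s"
  by (auto simp: cube_def)

lemma cube_subset_Rn: "cube n z r \<subseteq> Rn n"
  by (auto simp: cube_def)

lemma openR_cubeE:
  assumes "openR n S" "x \<in> S"
  obtains r where "r > 0" "cube n x r \<subseteq> S"
  using assms openR_iff by blast

lemma continuous_map_Rn_iff:
  "S \<subseteq> Rn n \<Longrightarrow> continuous_map (subtopology (Euclidean_space n) S) euclideanreal f \<longleftrightarrow> continuous_on S f"
  by (simp add: Euclidean_space_eq subtopology_subtopology Int_absorb1)

lemma continuous_cubeE:
  fixes f :: "(nat \<Rightarrow> real) \<Rightarrow> real"
  assumes "continuous_on S f" "openR n S" "x \<in> S" "e > 0"
  obtains d where "d > 0" "cube n x d \<subseteq> S" "\<And>y. y \<in> cube n x d \<Longrightarrow> \<bar>f y - f x\<bar> < e"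
proof -
  have "openin (top_of_set S) (S \<inter> f -` ball (f x) e)"
    using assms(1) by (intro continuous_openin_preimage_gen) auto
  then have "openR n (S \<inter> f -` ball (f x) e)"
    by (metis Euclidean_space_eq assms(2) openin_trans)
  from openR_cubeE[OF this, of x] assms obtain d where "d > 0" "cube n x d \<subseteq> S \<inter> f -` ball (f x) e"
    by auto
  then show thesis
    by (intro that[of d]) (auto simp: dist_real_def subset_iff abs_minus_commute)
qed

lemma openR_line:
  assumes "openR n S" "x \<in> S" "i < n"
  shows "\<forall>\<^sub>F t in nhds (x i). x(i := t) \<in> S"
proof -
  obtain r where r: "r > 0" "cube n x r \<subseteq> S"
    using assms openR_cubeE by metis
  have "x \<in> Rn n" using assms openR_subset by blast
  have "x(i := t) \<in> S" if "dist t (x i) < r" for t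
  proof -
    have "x(i := t) \<in> cube n x r"
      using that r(1) \<open>x \<in> Rn n\<close> assms(3) by (auto simp: cube_def dist_real_def Rn_upd)
    then show ?thesis using r by blast
  qed
  then show ?thesis
    using r(1) unfolding eventually_nhds_metric by blast
qed

lemma partial_derivI:
  "((\<lambda>t. f (x(i := t))) has_real_derivative D) (at (x i)) \<Longrightarrow> pd i f x = D"
  by (simp add: partial_deriv_def DERIV_imp_deriv)

lemma partial_deriv_cong:
  assumes "openR n S" "x \<in> S" "i < n" "\<And>z. z \<in> S \<Longrightarrow> f z = g z"
  shows "pd i f x = pd i g x"
  unfolding partial_deriv_def
  by (rule deriv_cong_ev) (use eventually_mono[OF openR_line[OF assms(1-3)]] assms(4) in auto)

lemma has_partial_cong:
  assumes "openR n S" "x \<in> S" "i < n" "\<And>z. z \<in> S \<Longrightarrow> f z = g z"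
    and "((\<lambda>t. f (x(i := t))) has_real_derivative D) (at (x i))"
  shows "((\<lambda>t. g (x(i := t))) has_real_derivative D) (at (x i))"
proof -
  have ev: "\<forall>\<^sub>F t in nhds (x i). f (x(i := t)) = g (x(i := t))"
    using eventually_mono[OF openR_line[OF assms(1-3)]] assms(4) by auto
  show ?thesis
    using DERIV_cong_ev[OF refl ev refl] assms(5) by blast
qed

subsection \<open>Differentiability with parameters\<close>

text \<open>A version of \<^const>\<open>C_times\<close> with a parameter p, all derivatives being jointly continuous; it serves
  both plain functions (a single parameter) and solutions of differential equations (the parameter being time).\<close>

fun C_param :: "nat \<Rightarrow> 'p::topological_space set \<Rightarrow> nat \<Rightarrow> (nat \<Rightarrow> real) set \<Rightarrow> ('p \<Rightarrow> (nat \<Rightarrow> real) \<Rightarrow> real) \<Rightarrow> bool"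
  where
    "C_param n P 0 S f \<longleftrightarrow> continuous_on (S \<times> P) (\<lambda>(z, p). f p z)"
  | "C_param n P (Suc r) S f \<longleftrightarrow> continuous_on (S \<times> P) (\<lambda>(z, p). f p z) \<and>
      (\<forall>i<n. (\<forall>p\<in>P. \<forall>x\<in>S. (\<lambda>t. f p (x(i := t))) differentiable (at (x i))) \<and>
             C_param n P r S (\<lambda>p. pd i (f p)))"

lemma C_param_continuous: "C_param n P r S f \<Longrightarrow> continuous_on (S \<times> P) (\<lambda>(z, p). f p z)"
  by (cases r) auto

lemma continuous_on_single_param:
  "continuous_on (S \<times> {c}) (\<lambda>(z, p). f z) \<longleftrightarrow> continuous_on S f"
proof
  assume "continuous_on (S \<times> {c}) (\<lambda>(z, p). f z)"
  then have "continuous_on S ((\<lambda>(z, p). f z) \<circ> (\<lambda>z. (z, c)))"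
    by (intro continuous_on_compose) (auto intro!: continuous_intros simp: image_def elim: continuous_on_subset)
  then show "continuous_on S f" by (simp add: o_def)
next
  assume "continuous_on S f"
  then show "continuous_on (S \<times> {c}) (\<lambda>(z, p). f z)"
    unfolding split_beta by (rule continuous_on_compose2[of _ f]) (auto intro!: continuous_intros)
qed

lemma C_times_iff_param:
  "S \<subseteq> Rn n \<Longrightarrow> C_times n r S f \<longleftrightarrow> C_param n {0::real} r S (\<lambda>_. f)"
  by (induction r arbitrary: f) (auto simp: continuous_map_Rn_iff continuous_on_single_param)

text \<open>A partial derivative at x depends only on values on a short line through x, which stays
  in S because S is open.\<close>

lemma C_param_cong:
  assumes "openR n S" "\<And>p x. p \<in> P \<Longrightarrow> x \<in> S \<Longrightarrow> f p x = g p x" "C_param n P r S f"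
  shows "C_param n P r S g"
  using assms(2,3)
proof (induction r arbitrary: f g)
  case 0
  have "continuous_on (S \<times> P) (\<lambda>(z, p). g p z) \<longleftrightarrow> continuous_on (S \<times> P) (\<lambda>(z, p). f p z)"
    using 0 by (intro continuous_on_cong) auto
  then show ?case using 0 by simp
next
  case (Suc r)
  have "continuous_on (S \<times> P) (\<lambda>(z, p). g p z) \<longleftrightarrow> continuous_on (S \<times> P) (\<lambda>(z, p). f p z)"
    using Suc.prems by (intro continuous_on_cong) auto
  moreover have "(\<lambda>t. g p (x(i := t))) differentiable (at (x i))" if "i < n" "p \<in> P" "x \<in> S" for i p x
  proof -
    have "(\<lambda>t. f p (x(i := t))) differentiable (at (x i))"
      using Suc.prems(2) that by auto
    then obtain D where "((\<lambda>t. f p (x(i := t))) has_real_derivative D) (at (x i))"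
      by (auto simp: real_differentiable_def)
    from has_partial_cong[OF assms(1) that(3,1) _ this, of "g p"] show ?thesis
      using Suc.prems(1) that by (auto simp: real_differentiable_def)
  qed
  moreover have "C_param n P r S (\<lambda>p. pd i (g p))" if "i < n" for i
  proof (rule Suc.IH[of "\<lambda>p. pd i (f p)"])
    show "pd i (f p) x = pd i (g p) x" if "p \<in> P" "x \<in> S" for p x
      by (rule partial_deriv_cong[OF assms(1) that(2) \<open>i < n\<close>]) (rule Suc.prems(1)[OF that(1)])
  qed (use Suc.prems(2) that in simp)
  ultimately show ?case
    using Suc.prems by auto
qed

text \<open>The derivative may be supplied by any formula g; uniqueness identifies it with
  \<open>pd\<close> on S. All closure properties and the solutions of differential equations enter
  the class through this rule.\<close>

lemma C_param_SucI:
  assumes "openR n S" "continuous_on (S \<times> P) (\<lambda>(z, p). f p z)"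
    and d: "\<And>i p x. i < n \<Longrightarrow> p \<in> P \<Longrightarrow> x \<in> S \<Longrightarrow> ((\<lambda>t. f p (x(i := t))) has_real_derivative g i p x) (at (x i))"
    and g: "\<And>i. i < n \<Longrightarrow> C_param n P r S (g i)"
  shows "C_param n P (Suc r) S f"
proof -
  have "C_param n P r S (\<lambda>p. pd i (f p))" if "i < n" for i
    by (rule C_param_cong[OF assms(1) _ g[OF that]]) (use d[OF that] partial_derivI in metis)
  then show ?thesis
    using assms(2) d by (auto simp: real_differentiable_def) blast
qed

lemma C_param_has_partial:
  assumes "C_param n P (Suc r) S f" "i < n" "p \<in> P" "x \<in> S"
  shows "((\<lambda>t. f p (x(i := t))) has_real_derivative pd i (f p) x) (at (x i))"
proof -
  have "(\<lambda>t. f p (x(i := t))) differentiable (at (x i))"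
    using assms by auto
  then obtain D where "((\<lambda>t. f p (x(i := t))) has_real_derivative D) (at (x i))"
    by (auto simp: real_differentiable_def)
  then show ?thesis using partial_derivI by metis
qed

lemma C_param_Suc_mono: "C_param n P (Suc r) S f \<Longrightarrow> C_param n P r S f"
proof (induction r arbitrary: f)
  case (Suc r)
  then show ?case by (metis C_param.simps(2))
qed simp

lemma C_param_subset: "C_param n P r S f \<Longrightarrow> T \<subseteq> S \<Longrightarrow> Q \<subseteq> P \<Longrightarrow> C_param n Q r T f"
proof (induction r arbitrary: f)
  case 0
  then show ?case by (auto elim: continuous_on_subset)
next
  case (Suc r)
  have "continuous_on (T \<times> Q) (\<lambda>(z, p). f p z)"
    by (rule continuous_on_subset[OF C_param_continuous[OF Suc.prems(1)]]) (use Suc.prems in auto)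
  with Suc show ?case by (auto simp: subset_iff)
qed

lemma C_param_const: "openR n S \<Longrightarrow> continuous_on P c \<Longrightarrow> C_param n P r S (\<lambda>p z. c p)"
proof (induction r arbitrary: c)
  case 0
  then show ?case by (auto simp: split_beta intro!: continuous_on_compose2[of P c] continuous_intros)
next
  case (Suc r)
  show ?case
    by (rule C_param_SucI[where g="\<lambda>i p x. 0"])
      (use Suc.prems Suc.IH[of "\<lambda>p. 0"] in \<open>auto simp: split_beta intro!: continuous_on_compose2[of P c] continuous_intros\<close>)
qed

lemma C_param_coord: "openR n S \<Longrightarrow> C_param n P r S (\<lambda>p z. z j)"
proof (cases r)
  case 0
  have "continuous_on (S \<times> P) (\<lambda>w. fst w j)"
    by (rule continuous_on_product_then_coordinatewise[OF continuous_on_fst[OF continuous_on_id]])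
  then show ?thesis using 0 by (simp add: split_beta)
next
  case (Suc r')
  assume S: "openR n S"
  have *: "continuous_on (S \<times> P) (\<lambda>w. fst w j)"
    by (rule continuous_on_product_then_coordinatewise[OF continuous_on_fst[OF continuous_on_id]])
  have "((\<lambda>t. (x(i := t)) j) has_real_derivative (if i = j then 1 else 0)) (at (x i))" for x :: "nat \<Rightarrow> real" and i
    by auto
  moreover have "C_param n P r' S (\<lambda>p x. if i = j then 1 else 0)" for i
    by (rule C_param_const) (auto intro!: S)
  ultimately show ?thesis unfolding Suc
    by (intro C_param_SucI[where g="\<lambda>i p x. if i = j then 1 else 0"] S) (use * in \<open>auto simp: split_beta\<close>)
qed

lemma C_param_add:
  "openR n S \<Longrightarrow> C_param n P r S f \<Longrightarrow> C_param n P r S g \<Longrightarrow> C_param n P r S (\<lambda>p z. f p z + g p z)"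
proof (induction r arbitrary: f g)
  case 0
  then show ?case by (auto simp: split_beta intro!: continuous_intros)
next
  case (Suc r)
  note c = C_param_continuous[OF Suc.prems(2)] C_param_continuous[OF Suc.prems(3)]
  show ?case
  proof (rule C_param_SucI[where g="\<lambda>i p x. pd i (f p) x + pd i (g p) x"])
    show "continuous_on (S \<times> P) (\<lambda>(z, p). f p z + g p z)"
      using c by (auto simp: split_beta intro!: continuous_intros)
    show "C_param n P r S (\<lambda>p x. pd i (f p) x + pd i (g p) x)" if "i < n" for i
      using Suc that by auto
    show "((\<lambda>t. f p (x(i := t)) + g p (x(i := t))) has_real_derivative
        pd i (f p) x + pd i (g p) x) (at (x i))"
      if "i < n" "p \<in> P" "x \<in> S" for i p x
      by (rule DERIV_add[OF C_param_has_partial[OF Suc.prems(2) that] C_param_has_partial[OF Suc.prems(3) that]])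
  qed (use Suc.prems in auto)
qed

lemma C_param_mult:
  "openR n S \<Longrightarrow> C_param n P r S f \<Longrightarrow> C_param n P r S g \<Longrightarrow> C_param n P r S (\<lambda>p z. f p z * g p z)"
proof (induction r arbitrary: f g)
  case 0
  then show ?case by (auto simp: split_beta intro!: continuous_intros)
next
  case (Suc r)
  note c = C_param_continuous[OF Suc.prems(2)] C_param_continuous[OF Suc.prems(3)]
  show ?case
  proof (rule C_param_SucI[where g="\<lambda>i p x. pd i (f p) x * g p x + pd i (g p) x * f p x"])
    show "continuous_on (S \<times> P) (\<lambda>(z, p). f p z * g p z)"
      using c by (auto simp: split_beta intro!: continuous_intros)
    show "C_param n P r S (\<lambda>p x. pd i (f p) x * g p x + pd i (g p) x * f p x)" if "i < n" for i
      using Suc.IH Suc.prems that C_param_Suc_mono[OF Suc.prems(2)] C_param_Suc_mono[OF Suc.prems(3)]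
      by (intro C_param_add) auto
    show "((\<lambda>t. f p (x(i := t)) * g p (x(i := t))) has_real_derivative
        pd i (f p) x * g p x + pd i (g p) x * f p x) (at (x i))"
      if "i < n" "p \<in> P" "x \<in> S" for i p x
      using DERIV_mult[OF C_param_has_partial[OF Suc.prems(2) that] C_param_has_partial[OF Suc.prems(3) that]]
      by (simp only: fun_upd_triv)
  qed (use Suc.prems in auto)
qed

lemma C_param_sum:
  "openR n S \<Longrightarrow> (\<And>j. j \<in> J \<Longrightarrow> C_param n P r S (f j)) \<Longrightarrow> C_param n P r S (\<lambda>p z. \<Sum>j\<in>J. f j p z)"
  by (induction J rule: infinite_finite_induct) (auto intro!: C_param_const C_param_add)

lemma C_param_prod:
  "openR n S \<Longrightarrow> (\<And>j. j \<in> J \<Longrightarrow> C_param n P r S (f j)) \<Longrightarrow> C_param n P r S (\<lambda>p z. \<Prod>j\<in>J. f j p z)"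
  by (induction J rule: infinite_finite_induct) (auto intro!: C_param_const C_param_mult)

lemma C_param_minus: "openR n S \<Longrightarrow> C_param n P r S f \<Longrightarrow> C_param n P r S (\<lambda>p z. - f p z)"
  using C_param_mult[of n S P r "\<lambda>p z. -1" f] C_param_const[of n S P "\<lambda>p. -1" r] by simp

lemma C_param_diff:
  "openR n S \<Longrightarrow> C_param n P r S f \<Longrightarrow> C_param n P r S g \<Longrightarrow> C_param n P r S (\<lambda>p z. f p z - g p z)"
  using C_param_add[of n S P r f "\<lambda>p z. - g p z"] C_param_minus[of n S P r g] by simp

lemma C_param_inverse:
  "openR n S \<Longrightarrow> C_param n P r S f \<Longrightarrow> (\<And>p x. p \<in> P \<Longrightarrow> x \<in> S \<Longrightarrow> f p x \<noteq> 0) \<Longrightarrow> C_param n P r S (\<lambda>p z. inverse (f p z))"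
proof (induction r arbitrary: f)
  case 0
  then show ?case by (auto simp: split_beta intro!: continuous_intros)
next
  case (Suc r)
  note c = C_param_continuous[OF Suc.prems(2)]
  show ?case
  proof (rule C_param_SucI[where g="\<lambda>i p x. - (pd i (f p) x * (inverse (f p x) * inverse (f p x)))"])
    show "continuous_on (S \<times> P) (\<lambda>(z, p). inverse (f p z))"
      using c Suc.prems by (auto simp: split_beta intro!: continuous_intros)
    show "C_param n P r S (\<lambda>p x. - (pd i (f p) x * (inverse (f p x) * inverse (f p x))))" if "i < n" for i
      using Suc.IH Suc.prems that C_param_Suc_mono[OF Suc.prems(2)]
      by (intro C_param_minus C_param_mult) auto
    show "((\<lambda>t. inverse (f p (x(i := t)))) has_real_derivative
        - (pd i (f p) x * (inverse (f p x) * inverse (f p x)))) (at (x i))"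
      if "i < n" "p \<in> P" "x \<in> S" for i p x
      by (rule DERIV_cong[OF DERIV_inverse_fun[OF C_param_has_partial[OF Suc.prems(2) that]]])
        (use Suc.prems(3)[OF that(2,3)] in \<open>auto simp: power2_eq_square field_simps\<close>)
  qed (use Suc.prems in auto)
qed

lemma C_param_const_param:
  fixes F :: "(nat \<Rightarrow> real) \<Rightarrow> real"
  assumes "S \<subseteq> Rn n" "C_times n r S F" shows "C_param n P r S (\<lambda>p. F)"
  using assms(2)
proof (induction r arbitrary: F)
  case (Suc r)
  have "continuous_on (S \<times> P) (\<lambda>w. F (fst w))"
    by (rule continuous_on_compose2[of S F, OF _ continuous_on_fst[OF continuous_on_id]])
      (use Suc.prems in \<open>auto simp: assms(1) continuous_map_Rn_iff\<close>)
  then show ?case using Suc by (auto simp: split_beta)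
qed (auto simp: assms(1) continuous_map_Rn_iff split_beta
    intro!: continuous_on_compose2[of S _ _ fst, OF _ continuous_on_fst[OF continuous_on_id]])

subsection \<open>The mean value theorem and the chain rule\<close>

text \<open>The condition is symmetric about a, so no order of a and b has to be known and a = b is
  allowed.\<close>

lemma mvt_segment:
  fixes f f' :: "real \<Rightarrow> real"
  assumes "\<And>s. \<bar>s - a\<bar> \<le> \<bar>b - a\<bar> \<Longrightarrow> (f has_real_derivative f' s) (at s)"
  obtains s where "\<bar>s - a\<bar> \<le> \<bar>b - a\<bar>" "f b - f a = f' s * (b - a)"
proof -
  consider "a < b" | "a = b" | "b < a" by linarith
  then show thesis
  proof cases
    case 1
    from MVT2[OF this, of f f'] assms obtain z where "a < z" "z < b" "f b - f a = (b - a) * f' z"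
      by force
    then show thesis by (intro that[of z]) auto
  next
    case 2
    then show thesis by (intro that[of a]) auto
  next
    case 3
    from MVT2[OF this, of f f'] assms obtain z where "b < z" "z < a" "f a - f b = (a - b) * f' z"
      by force
    then show thesis by (intro that[of z]) (auto simp: algebra_simps)
  qed
qed

text \<open>Passing from a to b by changing one coordinate at a time reduces the increment to
  one-dimensional mean value theorems. The intermediate points lie in the box around a with
  half-widths |b i - a i|.\<close>

lemma mvt_telescope:
  assumes F: "\<And>j x. j < m \<Longrightarrow> x \<in> T \<Longrightarrow> ((\<lambda>t. F (x(j := t))) has_real_derivative F' j x) (at (x j))"
    and ab: "a \<in> Rn m" "b \<in> Rn m"
    and T: "\<And>x. x \<in> Rn m \<Longrightarrow> (\<forall>i<m. \<bar>x i - a i\<bar> \<le> \<bar>b i - a i\<bar>) \<Longrightarrow> x \<in> T"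
  obtains \<xi> where "\<And>j. j < m \<Longrightarrow> \<xi> j \<in> T" "\<And>j i. j < m \<Longrightarrow> i < m \<Longrightarrow> \<bar>\<xi> j i - a i\<bar> \<le> \<bar>b i - a i\<bar>"
    "\<And>j. j < m \<Longrightarrow> \<xi> j \<in> Rn m" "F b - F a = (\<Sum>j<m. F' j (\<xi> j) * (b j - a j))"
proof -
  define c where "c j = (\<lambda>i. if i < j then b i else a i)" for j :: nat
  have "\<exists>x. x \<in> Rn m \<and> (\<forall>i<m. \<bar>x i - a i\<bar> \<le> \<bar>b i - a i\<bar>) \<and> F (c (Suc j)) - F (c j) = F' j x * (b j - a j)"
    if j: "j < m" for j
  proof -
    have cj: "c j \<in> Rn m" using ab by (auto simp: c_def Rn_def)
    have in_T: "(c j)(j := s) \<in> T \<and> (c j)(j := s) \<in> Rn m \<and> (\<forall>i<m. \<bar>((c j)(j := s)) i - a i\<bar> \<le> \<bar>b i - a i\<bar>)" if "\<bar>s - a j\<bar> \<le> \<bar>b j - a j\<bar>" for s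
    proof -
      have 1: "(c j)(j := s) \<in> Rn m" using cj j by (rule Rn_upd)
      have 2: "\<forall>i<m. \<bar>((c j)(j := s)) i - a i\<bar> \<le> \<bar>b i - a i\<bar>"
        using that by (auto simp: c_def)
      show ?thesis using 1 2 T[OF 1 2] by blast
    qed
    obtain s where s: "\<bar>s - a j\<bar> \<le> \<bar>b j - a j\<bar>"
      "F ((c j)(j := b j)) - F ((c j)(j := a j)) = F' j ((c j)(j := s)) * (b j - a j)"
    proof (rule mvt_segment[of "a j" "b j" "\<lambda>s. F ((c j)(j := s))" "\<lambda>s. F' j ((c j)(j := s))"])
      fix s assume "\<bar>s - a j\<bar> \<le> \<bar>b j - a j\<bar>"
      from F[OF j in_T[OF this, THEN conjunct1]]
      show "((\<lambda>s. F ((c j)(j := s))) has_real_derivative F' j ((c j)(j := s))) (at s)" by simp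
    qed
    have "(c j)(j := b j) = c (Suc j)" "(c j)(j := a j) = c j"
      by (auto simp: c_def fun_eq_iff less_Suc_eq)
    then show ?thesis using s(2) in_T[OF s(1)] by metis
  qed
  then obtain \<xi> where \<xi>: "\<And>j. j < m \<Longrightarrow> \<xi> j \<in> Rn m" "\<And>j i. j < m \<Longrightarrow> i < m \<Longrightarrow> \<bar>\<xi> j i - a i\<bar> \<le> \<bar>b i - a i\<bar>"
    "\<And>j. j < m \<Longrightarrow> F (c (Suc j)) - F (c j) = F' j (\<xi> j) * (b j - a j)"
    by metis
  have "c m = b"
    using ab by (intro ext) (auto simp: c_def Rn_def)
  moreover have "c 0 = a" by (auto simp: c_def)
  ultimately have "F b - F a = (\<Sum>j<m. F (c (Suc j)) - F (c j))"
    by (simp add: sum_lessThan_telescope[of "\<lambda>j. F (c j)"])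
  then show thesis
    using \<xi> T by (intro that[of \<xi>]) auto
qed

text \<open>Continuity of the partial derivatives replaces total differentiability: in the
  telescoped increment the intermediate points tend to \<open>y t0\<close>. The filter within A
  covers one-sided derivatives at the ends of [0,1].\<close>

lemma chain_rule_curve:
  assumes T: "openR m T"
    and F: "\<And>j x. j < m \<Longrightarrow> x \<in> T \<Longrightarrow> ((\<lambda>t. F (x(j := t))) has_real_derivative F' j x) (at (x j))"
    and F': "\<And>j. j < m \<Longrightarrow> continuous_on T (F' j)"
    and y: "y t0 \<in> T" "\<forall>\<^sub>F t in at t0 within A. y t \<in> Rn m"
    and y': "\<And>j. j < m \<Longrightarrow> ((\<lambda>t. y t j) has_real_derivative y' j) (at t0 within A)"
  shows "((\<lambda>t. F (y t)) has_real_derivative (\<Sum>j<m. F' j (y t0) * y' j)) (at t0 within A)"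
proof -
  have y0: "y t0 \<in> Rn m" using y(1) T openR_subset by blast
  obtain r where r: "r > 0" "cube m (y t0) r \<subseteq> T" using T y(1) by (rule openR_cubeE)
  have lim: "((\<lambda>t. y t j) \<longlongrightarrow> y t0 j) (at t0 within A)" if "j < m" for j
    using y'[OF that] DERIV_continuous continuous_within by blast
  have near: "\<forall>\<^sub>F t in at t0 within A. y t \<in> cube m (y t0) d" if "d > 0" for d
  proof -
    have "\<forall>\<^sub>F t in at t0 within A. \<forall>j\<in>{..<m}. \<bar>y t j - y t0 j\<bar> < d"
      using lim that by (intro eventually_ball_finite) (auto simp: tendsto_iff dist_real_def)
    with y(2) show ?thesis by eventually_elim (auto simp: cube_def)
  qed
  define P where "P = (\<lambda>t \<xi>. (\<forall>j<m. \<xi> j \<in> Rn m) \<and> (\<forall>j<m. \<forall>i<m. \<bar>\<xi> j i - y t0 i\<bar> \<le> \<bar>y t i - y t0 i\<bar>) \<and>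
     F (y t) - F (y t0) = (\<Sum>j<m. F' j (\<xi> j) * (y t j - y t0 j)))"
  have "\<forall>\<^sub>F t in at t0 within A. \<exists>\<xi>. P t \<xi>"
    using near[OF r(1)]
  proof eventually_elim
    case (elim t)
    have "x \<in> T" if "x \<in> Rn m" "\<forall>i<m. \<bar>x i - y t0 i\<bar> \<le> \<bar>y t i - y t0 i\<bar>" for x
    proof -
      have "x \<in> cube m (y t0) r" using that elim by (fastforce simp: cube_def)
      then show ?thesis using r by blast
    qed
    moreover have "y t \<in> Rn m" using elim by (simp add: cube_def)
    ultimately obtain \<xi> where "\<And>j. j < m \<Longrightarrow> \<xi> j \<in> T"
      "\<And>j i. j < m \<Longrightarrow> i < m \<Longrightarrow> \<bar>\<xi> j i - y t0 i\<bar> \<le> \<bar>y t i - y t0 i\<bar>"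
      "\<And>j. j < m \<Longrightarrow> \<xi> j \<in> Rn m" "F (y t) - F (y t0) = (\<Sum>j<m. F' j (\<xi> j) * (y t j - y t0 j))"
      using mvt_telescope[of m T F F' "y t0" "y t" thesis, OF F y0] by presburger
    then show ?case unfolding P_def by blast
  qed
  \<comment> \<open>An arbitrary choice for each t is enough: the box condition in P alone forces
    the chosen points to converge.\<close>
  define \<xi> where "\<xi> t = (SOME \<xi>. P t \<xi>)" for t
  have P: "\<forall>\<^sub>F t in at t0 within A. P t (\<xi> t)"
    using \<open>\<forall>\<^sub>F t in at t0 within A. \<exists>\<xi>. P t \<xi>\<close> unfolding \<xi>_def
    by (rule eventually_mono) (metis someI_ex)
  have lim2: "((\<lambda>t. F' j (\<xi> t j)) \<longlongrightarrow> F' j (y t0)) (at t0 within A)" if j: "j < m" for j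
  proof (rule tendstoI)
    fix e :: real assume "e > 0"
    from continuous_cubeE[OF F'[OF j] T y(1) this]
    obtain d where d: "d > 0" "\<And>x. x \<in> cube m (y t0) d \<Longrightarrow> \<bar>F' j x - F' j (y t0)\<bar> < e" by metis
    show "\<forall>\<^sub>F t in at t0 within A. dist (F' j (\<xi> t j)) (F' j (y t0)) < e"
      using near[OF d(1)] P
    proof eventually_elim
      case (elim t)
      then have "\<xi> t j \<in> cube m (y t0) d"
        using j unfolding cube_def P_def by fastforce
      then show ?case using d(2) by (simp add: dist_real_def)
    qed
  qed
  have "((\<lambda>t. \<Sum>j<m. F' j (\<xi> t j) * ((y t j - y t0 j) / (t - t0))) \<longlongrightarrow> (\<Sum>j<m. F' j (y t0) * y' j)) (at t0 within A)"
    using lim2 y' by (intro tendsto_intros) (auto simp: has_field_derivative_iff)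
  moreover have "\<forall>\<^sub>F t in at t0 within A. (\<Sum>j<m. F' j (\<xi> t j) * ((y t j - y t0 j) / (t - t0))) = (F (y t) - F (y t0)) / (t - t0)"
    using P
  proof eventually_elim
    case (elim t)
    then have "F (y t) - F (y t0) = (\<Sum>j<m. F' j (\<xi> t j) * (y t j - y t0 j))"
      by (simp add: P_def)
    then show ?case by (simp add: sum_divide_distrib)
  qed
  ultimately show ?thesis
    unfolding has_field_derivative_iff by (rule Lim_transform_eventually)
qed

text \<open>Induction on the order: the chain rule writes the derivative of the composite as a sum
  of products, in which the partials of F are again composed with the same g.\<close>

lemma C_param_compose:
  assumes T: "openR m T" and S: "openR n S"
  shows "C_param m P r T F \<Longrightarrow> (\<And>j. j < m \<Longrightarrow> C_param n P r S (\<lambda>p x. g p x j)) \<Longrightarrow>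
    (\<And>p x. p \<in> P \<Longrightarrow> x \<in> S \<Longrightarrow> g p x \<in> T) \<Longrightarrow> C_param n P r S (\<lambda>p x. F p (g p x))"
proof (induction r arbitrary: F)
  case prems: 0
  have cont: "continuous_on (S \<times> P) (\<lambda>(z, p). F p (g p z))"
    if "C_param m P r T F" "\<And>j. j < m \<Longrightarrow> C_param n P r S (\<lambda>p x. g p x j)" for F r
  proof -
    have "continuous_on (S \<times> P) (\<lambda>w. g (snd w) (fst w) j)" for j
    proof (cases "j < m")
      case True
      then show ?thesis using C_param_continuous[OF that(2)[OF True]] by (simp add: split_beta)
    next
      case False
      have "continuous_on (S \<times> P) (\<lambda>w. g (snd w) (fst w) j) \<longleftrightarrow> continuous_on (S \<times> P) (\<lambda>w. 0::real)"
        using prems(3) openR_subset[OF T] False by (intro continuous_on_cong) (fastforce simp: Rn_def)+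
      then show ?thesis by simp
    qed
    then have "continuous_on (S \<times> P) (\<lambda>w. (g (snd w) (fst w), snd w))"
      by (intro continuous_intros continuous_on_coordinatewise_then_product)
    moreover have "(\<lambda>w. (g (snd w) (fst w), snd w)) ` (S \<times> P) \<subseteq> T \<times> P"
      using prems(3) by auto
    ultimately have "continuous_on (S \<times> P) (\<lambda>w. (\<lambda>(z, p). F p z) (g (snd w) (fst w), snd w))"
      by (rule continuous_on_compose2[OF C_param_continuous[OF that(1)]])
    then show ?thesis by (simp add: split_beta)
  qed
  show ?case using cont[of 0 F] prems by simp
next
  case (Suc r)
  have cont: "continuous_on (S \<times> P) (\<lambda>(z, p). F p (g p z))"
    using Suc.IH[of F] Suc.prems C_param_Suc_mono C_param_continuous by blast
  show ?case
  proof (rule C_param_SucI[OF S cont, where g="\<lambda>i p x. \<Sum>j<m. pd j (F p) (g p x) * pd i (\<lambda>x. g p x j) x"])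
    fix i p x assume ipx: "i < n" "p \<in> P" "x \<in> S"
    have FP: "C_param m {p} (Suc r) T F"
      using Suc.prems(1) ipx by (auto intro: C_param_subset simp del: C_param.simps)
    have cF: "continuous_on T (pd j (F p))" if "j < m" for j
    proof -
      have "C_param m {p} r T (\<lambda>p. pd j (F p))" using FP that by auto
      then have "continuous_on (T \<times> {p}) (\<lambda>(z, p). pd j (F p) z)" by (rule C_param_continuous)
      then have "continuous_on (T \<times> {p}) (\<lambda>(z, q). pd j (F p) z)"
        by (rule continuous_on_eq) auto
      then show ?thesis by (simp add: continuous_on_single_param)
    qed
    have inT: "\<forall>\<^sub>F t in at (x i). g p (x(i := t)) \<in> Rn m"
    proof -
      have "\<forall>\<^sub>F t in at (x i). x(i := t) \<in> S"
        using openR_line[OF S ipx(3,1)] by (simp add: eventually_nhds_conv_at)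
      then show ?thesis
        by eventually_elim (use Suc.prems(3)[OF ipx(2)] openR_subset[OF T] in blast)
    qed
    have "((\<lambda>t. F p (g p (x(i := t)))) has_real_derivative
        (\<Sum>j<m. pd j (F p) (g p (x(i := x i))) * pd i (\<lambda>x. g p x j) x)) (at (x i))"
    proof (rule chain_rule_curve[OF T _ cF _ inT])
      show "((\<lambda>t. F p (x(j := t))) has_real_derivative pd j (F p) x) (at (x j))"
        if "j < m" "x \<in> T" for j x
        by (rule C_param_has_partial[OF FP that(1) _ that(2)]) simp
      show "g p (x(i := x i)) \<in> T" using Suc.prems(3)[OF ipx(2,3)] by simp
      show "((\<lambda>t. g p (x(i := t)) j) has_real_derivative pd i (\<lambda>x. g p x j) x) (at (x i))"
        if "j < m" for j
        by (rule C_param_has_partial[OF Suc.prems(2)[OF that] ipx])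
    qed
    then show "((\<lambda>t. F p (g p (x(i := t)))) has_real_derivative
        (\<Sum>j<m. pd j (F p) (g p x) * pd i (\<lambda>x. g p x j) x)) (at (x i))"
      by simp
  next
    fix i assume "i < n"
    show "C_param n P r S (\<lambda>p x. \<Sum>j<m. pd j (F p) (g p x) * pd i (\<lambda>x. g p x j) x)"
    proof (intro C_param_sum C_param_mult S)
      fix j assume "j \<in> {..<m}"
      then have j: "j < m" by simp
      show "C_param n P r S (\<lambda>p x. pd j (F p) (g p x))"
      proof (rule Suc.IH)
        show "C_param m P r T (\<lambda>p. pd j (F p))" using Suc.prems(1) j by simp
        show "C_param n P r S (\<lambda>p x. g p x j)" if "j < m" for j
          using Suc.prems(2)[OF that] by (rule C_param_Suc_mono)
      qed (rule Suc.prems(3))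
      show "C_param n P r S (\<lambda>p x. pd i (\<lambda>x. g p x j) x)"
        using Suc.prems(2)[OF j] \<open>i < n\<close> by simp
    qed
  qed
qed

subsection \<open>Smooth functions\<close>

lemma smooth_iff_param:
  "openR n S \<Longrightarrow> C_infinity n S f \<longleftrightarrow> (\<forall>r. C_param n {0::real} r S (\<lambda>_. f))"
  by (simp add: C_infinity_def C_times_iff_param openR_subset)

lemma smooth_param: "openR n S \<Longrightarrow> C_infinity n S f \<Longrightarrow> C_param n P r S (\<lambda>_. f)"
  by (simp add: C_infinity_def C_param_const_param openR_subset)

lemma smooth_cong:
  "openR n S \<Longrightarrow> C_infinity n S f \<Longrightarrow> (\<And>x. x \<in> S \<Longrightarrow> f x = g x) \<Longrightarrow> C_infinity n S g"
  by (auto simp: smooth_iff_param intro: C_param_cong[where f="\<lambda>_. f"])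

lemma smooth_subset: "C_infinity n S f \<Longrightarrow> openR n S \<Longrightarrow> openR n T \<Longrightarrow> T \<subseteq> S \<Longrightarrow> C_infinity n T f"
  by (auto simp: smooth_iff_param intro: C_param_subset)

lemma smooth_const: "openR n S \<Longrightarrow> C_infinity n S (\<lambda>x. c)"
  by (auto simp: smooth_iff_param intro!: C_param_const)

lemma smooth_coord: "openR n S \<Longrightarrow> C_infinity n S (\<lambda>x. x j)"
  by (auto simp: smooth_iff_param intro!: C_param_coord)

lemma smooth_add:
  "openR n S \<Longrightarrow> C_infinity n S f \<Longrightarrow> C_infinity n S g \<Longrightarrow> C_infinity n S (\<lambda>x. f x + g x)"
  by (auto simp: smooth_iff_param intro!: C_param_add)

lemma smooth_mult:
  "openR n S \<Longrightarrow> C_infinity n S f \<Longrightarrow> C_infinity n S g \<Longrightarrow> C_infinity n S (\<lambda>x. f x * g x)"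
  by (auto simp: smooth_iff_param intro!: C_param_mult)

lemma smooth_diff:
  "openR n S \<Longrightarrow> C_infinity n S f \<Longrightarrow> C_infinity n S g \<Longrightarrow> C_infinity n S (\<lambda>x. f x - g x)"
  by (auto simp: smooth_iff_param intro!: C_param_diff)

lemma smooth_sum:
  "openR n S \<Longrightarrow> (\<And>j. j \<in> J \<Longrightarrow> C_infinity n S (f j)) \<Longrightarrow> C_infinity n S (\<lambda>x. \<Sum>j\<in>J. f j x)"
  by (auto simp: smooth_iff_param intro!: C_param_sum)

lemma smooth_prod:
  "openR n S \<Longrightarrow> (\<And>j. j \<in> J \<Longrightarrow> C_infinity n S (f j)) \<Longrightarrow> C_infinity n S (\<lambda>x. \<Prod>j\<in>J. f j x)"
  by (auto simp: smooth_iff_param intro!: C_param_prod)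

lemma smooth_inverse:
  "openR n S \<Longrightarrow> C_infinity n S f \<Longrightarrow> (\<And>x. x \<in> S \<Longrightarrow> f x \<noteq> 0) \<Longrightarrow> C_infinity n S (\<lambda>x. inverse (f x))"
  by (auto simp: smooth_iff_param intro!: C_param_inverse)

lemma smooth_compose:
  assumes "openR m T" "openR n S" "C_infinity m T F" "\<And>j. j < m \<Longrightarrow> C_infinity n S (\<lambda>x. g x j)"
    "\<And>x. x \<in> S \<Longrightarrow> g x \<in> T"
  shows "C_infinity n S (\<lambda>x. F (g x))"
  using assms by (auto simp: smooth_iff_param intro!: C_param_compose[where F="\<lambda>_. F" and g="\<lambda>_. g"])

lemma smooth_partial: "openR n S \<Longrightarrow> C_infinity n S f \<Longrightarrow> i < n \<Longrightarrow> C_infinity n S (pd i f)"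
  unfolding C_infinity_def by (metis C_times.simps(2))

lemma smooth_continuous: "openR n S \<Longrightarrow> C_infinity n S f \<Longrightarrow> continuous_on S f"
  unfolding C_infinity_def by (metis C_times.simps(1) continuous_map_Rn_iff openR_subset)

lemma smooth_has_partial:
  assumes "openR n S" "C_infinity n S f" "x \<in> S" "i < n"
  shows "((\<lambda>t. f (x(i := t))) has_real_derivative pd i f x) (at (x i))"
  using C_param_has_partial[of n "{0::real}" 0 S "\<lambda>_. f" i 0 x] assms
  by (auto simp: smooth_iff_param simp del: C_param.simps)

lemma smooth_chain_curve:
  assumes "openR m T" "C_infinity m T F" "y t0 \<in> T" "\<forall>\<^sub>F t in at t0 within A. y t \<in> Rn m"
    and "\<And>j. j < m \<Longrightarrow> ((\<lambda>t. y t j) has_real_derivative y' j) (at t0 within A)"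
  shows "((\<lambda>t. F (y t)) has_real_derivative (\<Sum>j<m. pd j F (y t0) * y' j)) (at t0 within A)"
  by (rule chain_rule_curve[OF assms(1) smooth_has_partial[OF assms(1,2)]
        smooth_continuous[OF assms(1) smooth_partial[OF assms(1,2)]] assms(3-5)])

lemma smooth_chain_has_partial:
  assumes T: "openR m T" and S: "openR n S" and F: "C_infinity m T F"
    and g: "\<And>j. j < m \<Longrightarrow> C_infinity n S (\<lambda>x. g x j)" "\<And>x. x \<in> S \<Longrightarrow> g x \<in> T"
    and x: "x \<in> S" "i < n"
  shows "((\<lambda>t. F (g (x(i := t)))) has_real_derivative
    (\<Sum>j<m. pd j F (g x) * pd i (\<lambda>x. g x j) x)) (at (x i))"
proof -
  have "\<forall>\<^sub>F t in at (x i). x(i := t) \<in> S"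
    using openR_line[OF S x] by (simp add: eventually_nhds_conv_at)
  then have "\<forall>\<^sub>F t in at (x i). g (x(i := t)) \<in> Rn m"
    by eventually_elim (use g(2) openR_subset[OF T] in blast)
  moreover have "g (x(i := x i)) \<in> T" using g(2)[OF x(1)] by simp
  ultimately have "((\<lambda>t. F (g (x(i := t)))) has_real_derivative
    (\<Sum>j<m. pd j F (g (x(i := x i))) * pd i (\<lambda>x. g x j) x)) (at (x i))"
    by (intro smooth_chain_curve[OF T F] smooth_has_partial[OF S g(1) x])
  then show ?thesis by (simp only: fun_upd_triv)
qed

lemma partial_chain:
  assumes "openR m T" "openR n S" "C_infinity m T F"
    "\<And>j. j < m \<Longrightarrow> C_infinity n S (\<lambda>x. g x j)" "\<And>x. x \<in> S \<Longrightarrow> g x \<in> T" "x \<in> S" "i < n"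
  shows "pd i (\<lambda>x. F (g x)) x = (\<Sum>j<m. pd j F (g x) * pd i (\<lambda>x. g x j) x)"
  by (rule partial_derivI[OF smooth_chain_has_partial[OF assms]])

lemma partial_coord: "pd i (\<lambda>x. x j) x = (if i = j then 1 else 0)"
  by (rule partial_derivI) auto

lemma partial_add:
  assumes "openR n S" "C_infinity n S f" "C_infinity n S g" "x \<in> S" "i < n"
  shows "pd i (\<lambda>x. f x + g x) x = pd i f x + pd i g x"
  by (rule partial_derivI[OF DERIV_add[OF smooth_has_partial[OF assms(1,2,4,5)] smooth_has_partial[OF assms(1,3,4,5)]]])

lemma partial_const: "pd i (\<lambda>x. c) x = 0"
  by (rule partial_derivI) simp

lemma partial_mult:
  assumes "openR n S" "C_infinity n S f" "C_infinity n S g" "x \<in> S" "i < n"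
  shows "pd i (\<lambda>x. f x * g x) x = pd i f x * g x + f x * pd i g x"
  using DERIV_mult[OF smooth_has_partial[OF assms(1,2,4,5)] smooth_has_partial[OF assms(1,3,4,5)]]
  by (intro partial_derivI) (simp only: fun_upd_triv mult.commute)

lemma partial_cmult:
  assumes "openR n S" "C_infinity n S f" "x \<in> S" "i < n"
  shows "pd i (\<lambda>x. c * f x) x = c * pd i f x"
  by (rule partial_derivI[OF DERIV_cmult[OF smooth_has_partial[OF assms]]])

lemma partial_sum:
  assumes "openR n S" "\<And>j. j \<in> J \<Longrightarrow> C_infinity n S (f j)" "x \<in> S" "i < n"
  shows "pd i (\<lambda>x. \<Sum>j\<in>J. f j x) x = (\<Sum>j\<in>J. pd i (f j) x)"
  by (rule partial_derivI[OF DERIV_sum[OF smooth_has_partial[OF assms(1,2,3,4)]]])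

section \<open>Locality of smoothness and symmetry of second partial derivatives\<close>

lemma continuous_on_local:
  fixes f :: "(nat \<Rightarrow> real) \<Rightarrow> real"
  assumes "S \<subseteq> Rn n" "\<And>x. x \<in> S \<Longrightarrow> \<exists>T. openR n T \<and> x \<in> T \<and> continuous_on T f"
  shows "continuous_on S f"
  unfolding continuous_on_eq_continuous_within
proof
  fix x assume x: "x \<in> S"
  obtain T where T: "openR n T" "x \<in> T" "continuous_on T f" using assms(2)[OF x] by blast
  obtain A where A: "open A" "T = Rn n \<inter> A" using T(1) by (auto simp: Euclidean_space_eq openin_open)
  have "at x within S = at x within (S \<inter> T)"
    by (rule at_within_nhd[of x A]) (use A T x assms(1) in auto)
  moreover have "continuous (at x within (S \<inter> T)) f"
    using continuous_on_subset[OF T(3), of "S \<inter> T"] x T by (auto simp: continuous_on_eq_continuous_within)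
  ultimately show "continuous (at x within S) f" by simp
qed

lemma smooth_local:
  assumes "S \<subseteq> Rn n" "\<And>x. x \<in> S \<Longrightarrow> \<exists>T. openR n T \<and> x \<in> T \<and> C_infinity n T f"
  shows "C_infinity n S f"
proof -
  have "C_times n r S f" if "\<And>x. x \<in> S \<Longrightarrow> \<exists>T. openR n T \<and> x \<in> T \<and> C_times n r T f" for r f
    using that
  proof (induction r arbitrary: f)
    case 0
    then have "continuous_on S f"
      by (intro continuous_on_local[OF assms(1)]) (metis C_times.simps(1) continuous_map_Rn_iff openR_subset)
    then show ?case by (simp add: continuous_map_Rn_iff assms(1))
  next
    case (Suc r)
    have "continuous_on S f"
      using Suc.prems by (intro continuous_on_local[OF assms(1)]) (metis C_times.simps(2) continuous_map_Rn_iff openR_subset)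
    moreover have "C_times n r S (pd i f)" if "i < n" for i
      by (rule Suc.IH) (metis C_times.simps(2) Suc.prems that)
    moreover have "(\<lambda>t. f (x(i := t))) differentiable (at (x i))" if "i < n" "x \<in> S" for i x
      by (metis C_times.simps(2) Suc.prems that)
    ultimately show ?case by (simp add: continuous_map_Rn_iff assms(1))
  qed
  then show ?thesis using assms(2) unfolding C_infinity_def by meson
qed

text \<open>The second difference is symmetric in i and j, but applying the mean value theorem first
  in direction i and then in direction j turns it into one particular mixed partial.\<close>

lemma mixed_difference:
  assumes S: "openR n S" "C_infinity n S f" and ij: "i < n" "j < n" "i \<noteq> j" and h: "h > 0" "cube n x h \<subseteq> S" "0 < e" "e < h" and x: "x \<in> Rn n"
  obtains y where "y \<in> cube n x h"
    "f (x(i := x i + e, j := x j + e)) - f (x(i := x i + e)) - f (x(j := x j + e)) + f x = e * e * pd j (pd i f) y"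
proof -
  have in_S: "x(i := s, j := t) \<in> cube n x h" if "\<bar>s - x i\<bar> \<le> e" "\<bar>t - x j\<bar> \<le> e" for s t
    using that ij h x by (auto simp: cube_def Rn_def)
  have d: "((\<lambda>s. f (x(i := s, j := t))) has_real_derivative pd i f (x(i := s, j := t))) (at s)"
    if "\<bar>s - x i\<bar> \<le> e" "\<bar>t - x j\<bar> \<le> e" for s t
  proof -
    have "x(i := s, j := t) \<in> S" using in_S[OF that] h by blast
    from smooth_has_partial[OF S this ij(1)] ij show ?thesis
      by (simp add: fun_upd_twist)
  qed
  obtain s where s: "\<bar>s - x i\<bar> \<le> \<bar>x i + e - x i\<bar>"
    "(f (x(i := x i + e, j := x j + e)) - f (x(i := x i + e, j := x j))) - (f (x(i := x i, j := x j + e)) - f (x(i := x i, j := x j)))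
      = (pd i f (x(i := s, j := x j + e)) - pd i f (x(i := s, j := x j))) * (x i + e - x i)"
  proof (rule mvt_segment[of "x i" "x i + e" "\<lambda>s. f (x(i := s, j := x j + e)) - f (x(i := s, j := x j))"
      "\<lambda>s. pd i f (x(i := s, j := x j + e)) - pd i f (x(i := s, j := x j))"])
    fix s assume s: "\<bar>s - x i\<bar> \<le> \<bar>x i + e - x i\<bar>"
    show "((\<lambda>s. f (x(i := s, j := x j + e)) - f (x(i := s, j := x j))) has_real_derivative
      pd i f (x(i := s, j := x j + e)) - pd i f (x(i := s, j := x j))) (at s)"
      by (rule DERIV_diff; rule d) (use s h in auto)
  qed
  obtain t where t: "\<bar>t - x j\<bar> \<le> \<bar>x j + e - x j\<bar>"
    "pd i f (x(i := s, j := x j + e)) - pd i f (x(i := s, j := x j))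
      = pd j (pd i f) (x(i := s, j := t)) * (x j + e - x j)"
  proof (rule mvt_segment[of "x j" "x j + e" "\<lambda>t. pd i f (x(i := s, j := t))"
      "\<lambda>t. pd j (pd i f) (x(i := s, j := t))"])
    fix t assume t: "\<bar>t - x j\<bar> \<le> \<bar>x j + e - x j\<bar>"
    have "x(i := s, j := t) \<in> S" using in_S[of s t] s t h by auto
    from smooth_has_partial[OF S(1) smooth_partial[OF S ij(1)] this ij(2)]
    show "((\<lambda>t. pd i f (x(i := s, j := t))) has_real_derivative
      pd j (pd i f) (x(i := s, j := t))) (at t)" by simp
  qed
  have eq: "x(i := x i + e, j := x j) = x(i := x i + e)"
    using ij by (auto simp: fun_eq_iff)
  show thesis
  proof (rule that[of "x(i := s, j := t)"])
    show "x(i := s, j := t) \<in> cube n x h" using s(1) t(1) in_S[of s t] h by simp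
    show "f (x(i := x i + e, j := x j + e)) - f (x(i := x i + e)) - f (x(j := x j + e)) + f x
      = e * e * pd j (pd i f) (x(i := s, j := t))"
      using s(2) unfolding t(2) eq fun_upd_triv by (simp add: algebra_simps)
  qed
qed

lemma partial_commute:
  assumes S: "openR n S" "C_infinity n S f" and x: "x \<in> S" and ij: "i < n" "j < n"
  shows "pd i (pd j f) x = pd j (pd i f) x"
proof (cases "i = j")
  case False
  have xR: "x \<in> Rn n" using S x openR_subset by blast
  let ?A = "pd i (pd j f)" and ?B = "pd j (pd i f)"
  have cA: "continuous_on S ?A" and cB: "continuous_on S ?B"
    by (intro smooth_continuous[OF S(1)] smooth_partial[OF S(1)] S(2) ij)+
  have "\<bar>?A x - ?B x\<bar> \<le> 2 * d" if "d > 0" for d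
  proof -
    obtain a where a: "a > 0" "cube n x a \<subseteq> S" "\<And>y. y \<in> cube n x a \<Longrightarrow> \<bar>?A y - ?A x\<bar> < d"
      using continuous_cubeE[OF cA S(1) x \<open>d > 0\<close>] by metis
    obtain b where b: "b > 0" "cube n x b \<subseteq> S" "\<And>y. y \<in> cube n x b \<Longrightarrow> \<bar>?B y - ?B x\<bar> < d"
      using continuous_cubeE[OF cB S(1) x \<open>d > 0\<close>] by metis
    define h where "h = min a b"
    have h: "h > 0" "cube n x h \<subseteq> S" "h \<le> a" "h \<le> b" using a b cube_mono[of h a n x] by (auto simp: h_def)
    have e: "0 < h/2" "h/2 < h" using h by auto
    obtain y where y: "y \<in> cube n x h"
      "f (x(i := x i + h/2, j := x j + h/2)) - f (x(i := x i + h/2)) - f (x(j := x j + h/2)) + f x = h/2 * (h/2) * ?B y"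
      by (rule mixed_difference[OF S ij False h(1,2) e xR])
    obtain y' where y': "y' \<in> cube n x h"
      "f (x(j := x j + h/2, i := x i + h/2)) - f (x(j := x j + h/2)) - f (x(i := x i + h/2)) + f x = h/2 * (h/2) * ?A y'"
      by (rule mixed_difference[OF S ij(2,1) False[symmetric] h(1,2) e xR])
    \<comment> \<open>Both sides are the same second difference, so the two mixed partials agree at
      a pair of points near x; continuity carries this to x up to 2 d.\<close>
    have "h/2 * (h/2) * ?B y = h/2 * (h/2) * ?A y'"
      using y(2) y'(2) unfolding fun_upd_twist[OF False, of x] by linarith
    then have "?B y = ?A y'" using h by simp
    moreover have "\<bar>?A y' - ?A x\<bar> < d" using a(3) y'(1) cube_mono[OF h(3)] by blast
    moreover have "\<bar>?B y - ?B x\<bar> < d" using b(3) y(1) cube_mono[OF h(4)] by blast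
    ultimately show ?thesis by linarith
  qed
  from this[of "\<bar>?A x - ?B x\<bar> / 4"] show ?thesis by (cases "?A x = ?B x") auto
qed simp

subsection \<open>Smooth families of matrices\<close>

lemma smooth_det:
  assumes "openR n S" "\<And>i j. i < N \<Longrightarrow> j < N \<Longrightarrow> C_infinity n S (M i j)"
  shows "C_infinity n S (\<lambda>z. Determinant.det (Matrix.mat N N (\<lambda>(i, j). M i j z)))"
proof -
  have eq: "Determinant.det (Matrix.mat N N (\<lambda>(i, j). M i j z)) =
      (\<Sum>p\<in>{p. p permutes {0..<N}}. signof p * (\<Prod>i\<in>{0..<N}. M i (p i) z))" for z
  proof -
    have "Matrix.mat N N (\<lambda>(i, j). M i j z) \<in> carrier_mat N N" by simp
    from det_def'[OF this] show ?thesis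
      by (auto intro!: sum.cong prod.cong simp: permutes_in_image)
  qed
  have "p i < N" if "p permutes {0..<N}" "i < N" for p i
    using permutes_in_image[OF that(1), of i] that(2) by simp
  then show ?thesis unfolding eq
    using assms by (intro smooth_sum smooth_mult smooth_const smooth_prod) auto
qed

text \<open>Cramer's rule: the inverse is the adjugate divided by the determinant, both polynomial
  in the entries. Injectivity makes the determinant nonzero at \<open>z0\<close>, and continuity
  keeps it so on a cube.\<close>

lemma smooth_matrix_inverse:
  fixes N :: nat
  assumes S: "openR n S" "z0 \<in> S" and M: "\<And>i j. i < N \<Longrightarrow> j < N \<Longrightarrow> C_infinity n S (M i j)"
    and inj: "\<And>\<xi>. (\<forall>i<N. (\<Sum>j<N. M i j z0 * \<xi> j) = 0) \<Longrightarrow> (\<forall>j<N. \<xi> j = 0)"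
  obtains r K where "r > 0" "cube n z0 r \<subseteq> S" "\<And>i j. i < N \<Longrightarrow> j < N \<Longrightarrow> C_infinity n (cube n z0 r) (K i j)"
    "\<And>z i j. z \<in> cube n z0 r \<Longrightarrow> i < N \<Longrightarrow> j < N \<Longrightarrow> (\<Sum>l<N. K i l z * M l j z) = (if i = j then 1 else 0)"
    "\<And>z i j. z \<in> cube n z0 r \<Longrightarrow> i < N \<Longrightarrow> j < N \<Longrightarrow> (\<Sum>l<N. M i l z * K l j z) = (if i = j then 1 else 0)"
proof -
  define A where "A z = Matrix.mat N N (\<lambda>(i, j). M i j z)" for z
  have A: "A z \<in> carrier_mat N N" for z by (simp add: A_def)
  have sdet: "C_infinity n S (\<lambda>z. Determinant.det (A z))"
    unfolding A_def by (rule smooth_det) (use S M in auto)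
  have det0: "Determinant.det (A z0) \<noteq> 0"
  proof
    assume "Determinant.det (A z0) = 0"
    then obtain v where v: "v \<in> carrier_vec N" "v \<noteq> 0\<^sub>v N" "A z0 *\<^sub>v v = 0\<^sub>v N"
      using det_0_iff_vec_prod_zero_field[OF A] by blast
    have "(\<Sum>j<N. M i j z0 * vec_index v j) = 0" if "i < N" for i
    proof -
      have "vec_index (A z0 *\<^sub>v v) i = 0" using v(3) that by simp
      then show ?thesis using that v(1) by (auto simp: A_def scalar_prod_def atLeast0LessThan)
    qed
    then have "\<forall>j<N. vec_index v j = 0" using inj by blast
    then have "v = 0\<^sub>v N" using v(1) by (intro eq_vecI) auto
    then show False using v(2) by blast
  qed
  obtain r where r: "r > 0" "cube n z0 r \<subseteq> S"
      "\<And>y. y \<in> cube n z0 r \<Longrightarrow> \<bar>Determinant.det (A y) - Determinant.det (A z0)\<bar> < \<bar>Determinant.det (A z0)\<bar>"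
    using continuous_cubeE[OF smooth_continuous[OF S(1) sdet] S, of "\<bar>Determinant.det (A z0)\<bar>"] det0 by auto
  have nz: "Determinant.det (A y) \<noteq> 0" if "y \<in> cube n z0 r" for y
    using r(3)[OF that] by auto
  define K where "K i j z = inverse (Determinant.det (A z)) * (adj_mat (A z)) $$ (i, j)" for i j z
  have sadj: "C_infinity n S (\<lambda>z. (adj_mat (A z)) $$ (i, j))" if "i < N" "j < N" for i j
  proof -
    \<comment> \<open>Deleting row j and column i is a shift of indices that does not depend on z,
      so a cofactor is again the determinant of a smooth family.\<close>
    have eq: "(adj_mat (A z)) $$ (i, j) = (-1) ^ (j + i) * Determinant.det (Matrix.mat (N - 1) (N - 1)
        (\<lambda>(i', j'). M (if i' < j then i' else Suc i') (if j' < i then j' else Suc j') z))" for z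
    proof -
      have "mat_delete (A z) j i = Matrix.mat (N - 1) (N - 1)
        (\<lambda>(i', j'). M (if i' < j then i' else Suc i') (if j' < i then j' else Suc j') z)"
        unfolding mat_delete_def by (rule eq_matI) (use that in \<open>auto simp: A_def\<close>)
      then show ?thesis using that A[of z] by (auto simp: adj_mat_def cofactor_def)
    qed
    show ?thesis unfolding eq
      by (intro smooth_mult smooth_const smooth_det S M) (use that in auto)
  qed
  have sub: "openR n (cube n z0 r)" by simp
  have sK: "C_infinity n (cube n z0 r) (K i j)" if "i < N" "j < N" for i j
    unfolding K_def
    by (intro smooth_mult smooth_inverse sub smooth_subset[OF sdet S(1) sub r(2)]
        smooth_subset[OF sadj[OF that] S(1) sub r(2)] nz)
  have adjc: "adj_mat (A z) \<in> carrier_mat N N" for z using adj_mat[OF A] by blast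
  have 1: "(\<Sum>l<N. K i l z * M l j z) = (if i = j then 1 else 0)" if "z \<in> cube n z0 r" "i < N" "j < N" for z i j
  proof -
    have "(adj_mat (A z) * A z) $$ (i, j) = (Determinant.det (A z) \<cdot>\<^sub>m 1\<^sub>m N) $$ (i, j)"
      using adj_mat(3)[OF A] by simp
    then have "(\<Sum>l<N. adj_mat (A z) $$ (i, l) * M l j z) = (if i = j then Determinant.det (A z) else 0)"
      using that adjc[of z] A[of z] by (auto simp: scalar_prod_def atLeast0LessThan A_def[of z] times_mat_def split: if_splits)
    then show ?thesis
      using nz[OF that(1)] by (simp add: K_def mult.assoc flip: sum_distrib_left)
  qed
  have 2: "(\<Sum>l<N. M i l z * K l j z) = (if i = j then 1 else 0)" if "z \<in> cube n z0 r" "i < N" "j < N" for z i j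
  proof -
    have "(A z * adj_mat (A z)) $$ (i, j) = (Determinant.det (A z) \<cdot>\<^sub>m 1\<^sub>m N) $$ (i, j)"
      using adj_mat(2)[OF A] by simp
    then have "(\<Sum>l<N. M i l z * adj_mat (A z) $$ (l, j)) = (if i = j then Determinant.det (A z) else 0)"
      using that adjc[of z] A[of z] by (auto simp: scalar_prod_def atLeast0LessThan A_def[of z] times_mat_def split: if_splits)
    then show ?thesis
      using nz[OF that(1)] by (simp add: K_def mult.left_commute[of _ "inverse (Determinant.det (A z))"] flip: sum_distrib_left)
  qed
  show thesis by (rule that[OF r(1,2) sK 1 2])
qed

section \<open>Ordinary differential equations\<close>

text \<open>A substitute for Gronwall's inequality on the unit interval: the maximum M of all
  components over all times satisfies M \<le> d + M / 2 + e, and the half of M can be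
  absorbed.\<close>

lemma half_lipschitz_bound:
  fixes \<phi> \<phi>' :: "nat \<Rightarrow> real \<Rightarrow> real"
  assumes der: "\<And>i t. i < m \<Longrightarrow> t \<in> {0..1} \<Longrightarrow> (\<phi> i has_real_derivative \<phi>' i t) (at t within {0..1})"
    and init: "\<And>i. i < m \<Longrightarrow> \<bar>\<phi> i 0\<bar> \<le> d"
    and bd: "\<And>i t c. i < m \<Longrightarrow> t \<in> {0..1} \<Longrightarrow> (\<forall>j<m. \<bar>\<phi> j t\<bar> \<le> c) \<Longrightarrow> \<bar>\<phi>' i t\<bar> \<le> c / 2 + e"
    and i: "i < m" "t \<in> {0..1}"
  shows "\<bar>\<phi> i t\<bar> \<le> 2 * (d + e)"
proof -
  have cont: "continuous_on {0..1} (\<phi> i)" if "i < m" for i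
    using der[OF that] by (rule DERIV_continuous_on)
  have "\<exists>s\<in>{0..1}. \<forall>t\<in>{0..1}. \<bar>\<phi> i t\<bar> \<le> \<bar>\<phi> i s\<bar>" if "i < m" for i
    by (rule continuous_attains_sup) (use cont[OF that] in \<open>auto intro!: continuous_intros\<close>)
  then obtain s where s: "\<And>i. i < m \<Longrightarrow> s i \<in> {0..1}" "\<And>i t. i < m \<Longrightarrow> t \<in> {0..1} \<Longrightarrow> \<bar>\<phi> i t\<bar> \<le> \<bar>\<phi> i (s i)\<bar>"
    by metis
  define M where "M = Max ((\<lambda>i. \<bar>\<phi> i (s i)\<bar>) ` {..<m})"
  have fin: "finite ((\<lambda>i. \<bar>\<phi> i (s i)\<bar>) ` {..<m})" "(\<lambda>i. \<bar>\<phi> i (s i)\<bar>) ` {..<m} \<noteq> {}" using i by auto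
  have M: "\<bar>\<phi> i t\<bar> \<le> M" if "i < m" "t \<in> {0..1}" for i t
  proof -
    have "\<bar>\<phi> i (s i)\<bar> \<le> M" unfolding M_def using fin that by (intro Max_ge) auto
    then show ?thesis using s(2)[OF that] by linarith
  qed
  obtain k where k: "k < m" "M = \<bar>\<phi> k (s k)\<bar>"
    using Max_in[OF fin] unfolding M_def by auto
  have b: "\<bar>\<phi>' k t\<bar> \<le> M / 2 + e" if "t \<in> {0..1}" for t
    using bd[OF k(1) that] M that by auto
  have "norm (\<phi> k (s k) - \<phi> k 0) \<le> (M / 2 + e) * norm (s k - 0)"
    by (rule field_differentiable_bound[of "{0..1}" "\<phi> k" "\<phi>' k"])
      (use der[OF k(1)] b s(1)[OF k(1)] in auto)
  also have "\<dots> \<le> (M / 2 + e) * 1"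
    using s(1)[OF k(1)] b[of 0] by (intro mult_left_mono) auto
  finally have "M \<le> d + M / 2 + e" using k(2) init[OF k(1)] by auto
  then have "M \<le> 2 * (d + e)" by (simp add: field_simps)
  then show ?thesis using M[OF i] by (rule order_trans[rotated])
qed

lemma has_real_derivative_transform:
  fixes f g :: "real \<Rightarrow> real"
  assumes "t \<in> T" "\<And>s. s \<in> T \<Longrightarrow> g s = f s" "(f has_real_derivative D) (at t within T)"
  shows "(g has_real_derivative D) (at t within T)"
  using has_derivative_transform[of t T g f "(*) D"] assms by (auto simp: has_field_derivative_def)

lemma eventually_nhds_imp_at: "\<forall>\<^sub>F x in nhds a. P x \<Longrightarrow> \<forall>\<^sub>F x in at a. P x"
  by (simp add: eventually_nhds_conv_at)

text \<open>Picard iteration; the Lipschitz constant 1/2 makes the iteration contract on the whole unit interval.\<close>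

lemma picard:
  fixes G :: "real \<Rightarrow> (nat \<Rightarrow> real) \<Rightarrow> nat \<Rightarrow> real" and p w0 :: "nat \<Rightarrow> real" and \<rho> :: real
  assumes D_def: "D = {x \<in> Rn m. \<forall>i<m. \<bar>x i - p i\<bar> \<le> \<rho>}"
    and p: "p \<in> Rn m"
    and contG: "\<And>i. i < m \<Longrightarrow> continuous_on ({0..1} \<times> D) (\<lambda>(t, x). G t x i)"
    and lip: "\<And>i t x y c. i < m \<Longrightarrow> t \<in> {0..1} \<Longrightarrow> x \<in> D \<Longrightarrow> y \<in> D \<Longrightarrow> (\<forall>j<m. \<bar>x j - y j\<bar> \<le> c) \<Longrightarrow> \<bar>G t x i - G t y i\<bar> \<le> c / 2"
    and w0: "\<And>i. i < m \<Longrightarrow> \<bar>w0 i - p i\<bar> \<le> \<rho> / 4"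
    and G0: "\<And>i t. i < m \<Longrightarrow> t \<in> {0..1} \<Longrightarrow> \<bar>G t p i\<bar> \<le> \<rho> / 4"
  obtains u where "\<And>t. t \<in> {0..1} \<Longrightarrow> u t \<in> D" "\<And>i. i < m \<Longrightarrow> u 0 i = w0 i"
    "\<And>i t. i < m \<Longrightarrow> t \<in> {0..1} \<Longrightarrow> ((\<lambda>t. u t i) has_real_derivative G t (u t) i) (at t within {0..1})"
\<comment> \<open>For m = 0 nothing forces \<open>\<rho>\<close> to be nonnegative; otherwise the
  bound on \<open>w0 0\<close> does.\<close>
proof (cases "m = 0")
  case True
  then show ?thesis using p by (intro that[of "\<lambda>t. p"]) (auto simp: D_def)
next
  case False
  have \<rho>: "\<rho> \<ge> 0" using order_trans[OF abs_ge_zero w0[of 0]] False by simp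
  have pD: "p \<in> D" using p \<rho> by (auto simp: D_def)
  define U where "U = rec_nat (\<lambda>t i. if i < m then w0 i else 0)
    (\<lambda>_ V t i. if i < m then w0 i + integral {0..t} (\<lambda>s. G s (V s) i) else 0)"
  have U0: "U 0 t i = (if i < m then w0 i else 0)" for t i by (simp add: U_def)
  have US: "U (Suc n) t i = (if i < m then w0 i + integral {0..t} (\<lambda>s. G s (U n s) i) else 0)" for n t i
    by (simp add: U_def)
  have comp: "continuous_on {0..1} (\<lambda>s. G s (V s) i)"
    if "i < m" "\<And>t. t \<in> {0..1} \<Longrightarrow> V t \<in> D" "\<And>i. continuous_on {0..1} (\<lambda>t. V t i)" for V i
  proof -
    have "continuous_on {0..1} (\<lambda>s. (\<lambda>(t, x). G t x i) (s, V s))"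
      by (rule continuous_on_compose2[OF contG[OF that(1)]])
        (use that in \<open>auto intro!: continuous_intros continuous_on_coordinatewise_then_product\<close>)
    then show ?thesis by simp
  qed
  have int_bound: "\<bar>integral {0..t} h\<bar> \<le> B"
    if "continuous_on {0..1} h" "\<And>s. s \<in> {0..1} \<Longrightarrow> \<bar>h s\<bar> \<le> B" "t \<in> {0..1}" for h :: "real \<Rightarrow> real" and t B :: real
  proof -
    have "norm (integral {0..t} h) \<le> B * (t - 0)"
      using that by (intro integral_bound continuous_on_subset[OF that(1)]) auto
    also have "\<dots> \<le> B * 1" using that(2)[of 0] that(3) by (intro mult_left_mono) auto
    finally show ?thesis by simp
  qed
  \<comment> \<open>The radius is split as follows: \<rho>/4 bounds G at the centre and \<rho>/2 its
    variation over D, hence 3\<rho>/4 in all; together with \<rho>/4 for the initial value the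
    iterates never leave D.\<close>
  have Gbound: "\<bar>G s x i\<bar> \<le> 3 * \<rho> / 4" if "s \<in> {0..1}" "x \<in> D" "i < m" for s x i
  proof -
    have "\<bar>G s x i - G s p i\<bar> \<le> \<rho> / 2"
      by (rule lip[OF that(3,1,2) pD]) (use that(2) in \<open>auto simp: D_def\<close>)
    then show ?thesis using G0[OF that(3,1)] by linarith
  qed
  have inv: "(\<forall>t\<in>{0..1}. U n t \<in> D) \<and> (\<forall>i. continuous_on {0..1} (\<lambda>t. U n t i))" for n
  proof (induction n)
    case 0
    have "U 0 t \<in> D" for t using w0 \<rho> by (fastforce simp: U0 D_def Rn_def)
    moreover have "continuous_on {0..1} (\<lambda>t. U 0 t i)" for i by (simp add: U0)
    ultimately show ?case by blast
  next
    case (Suc n)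
    have c: "continuous_on {0..1} (\<lambda>s. G s (U n s) i)" if "i < m" for i
      using comp[OF that] Suc by blast
    have "U (Suc n) t \<in> D" if "t \<in> {0..1}" for t
    proof -
      have "\<bar>U (Suc n) t i - p i\<bar> \<le> \<rho>" if i: "i < m" for i
      proof -
        have "\<bar>integral {0..t} (\<lambda>s. G s (U n s) i)\<bar> \<le> 3 * \<rho> / 4"
          by (rule int_bound[OF c[OF i] Gbound]) (use Suc i \<open>t \<in> {0..1}\<close> in auto)
        moreover have "U (Suc n) t i = w0 i + integral {0..t} (\<lambda>s. G s (U n s) i)" using i by (simp add: US)
        ultimately show ?thesis using w0[OF i] by linarith
      qed
      then show ?thesis by (auto simp: D_def Rn_def US)
    qed
    moreover have "continuous_on {0..1} (\<lambda>t. U (Suc n) t i)" for i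
    proof (cases "i < m")
      case True
      have "((\<lambda>t. integral {0..t} (\<lambda>s. G s (U n s) i)) has_real_derivative G t (U n t) i) (at t within {0..1})"
        if "t \<in> {0..1}" for t
        by (rule integral_has_real_derivative[OF c[OF True] that])
      then have "continuous_on {0..1} (\<lambda>t. integral {0..t} (\<lambda>s. G s (U n s) i))"
        by (rule DERIV_continuous_on)
      then show ?thesis using True by (auto simp: US intro!: continuous_intros)
    qed (simp add: US)
    ultimately show ?case by blast
  qed
  have UD: "U n t \<in> D" if "t \<in> {0..1}" for n t using inv that by blast
  have Uc: "continuous_on {0..1} (\<lambda>t. U n t i)" for n i using inv by blast
  have cG: "continuous_on {0..1} (\<lambda>s. G s (U n s) i)" if "i < m" for n i
    by (rule comp[OF that UD Uc])
  have sub: "continuous_on {0..t} h" if "continuous_on {0..1} h" "t \<in> {0..1}" for h :: "real \<Rightarrow> real" and t :: real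
    using that by (auto elim: continuous_on_subset)
  have diff: "\<bar>U (Suc n) t i - U n t i\<bar> \<le> \<rho> * (1/2) ^ n" if "i < m" "t \<in> {0..1}" for n t i
    using that
  proof (induction n arbitrary: t i)
    case 0
    have "\<bar>integral {0..t} (\<lambda>s. G s (U 0 s) i)\<bar> \<le> \<rho>"
    proof (rule int_bound[OF cG[OF 0(1)] _ 0(2)])
      show "\<bar>G s (U 0 s) i\<bar> \<le> \<rho>" if "s \<in> {0..1}" for s
        using Gbound[OF that UD[OF that, of 0] 0(1)] \<rho> by linarith
    qed
    then show ?case using 0 by (simp add: US U0)
  next
    case (Suc n)
    have "integral {0..t} (\<lambda>s. G s (U (Suc n) s) i) - integral {0..t} (\<lambda>s. G s (U n s) i)
        = integral {0..t} (\<lambda>s. G s (U (Suc n) s) i - G s (U n s) i)"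
      by (rule integral_diff[OF integrable_continuous_real integrable_continuous_real, symmetric])
        (rule sub[OF cG[OF Suc.prems(1)] Suc.prems(2)])+
    also have "\<bar>\<dots>\<bar> \<le> (\<rho> * (1/2) ^ n) / 2"
    proof (rule int_bound[OF _ _ Suc.prems(2)])
      show "continuous_on {0..1} (\<lambda>s. G s (U (Suc n) s) i - G s (U n s) i)"
        by (intro continuous_intros cG Suc.prems)
      show "\<bar>G s (U (Suc n) s) i - G s (U n s) i\<bar> \<le> (\<rho> * (1/2) ^ n) / 2" if "s \<in> {0..1}" for s
        by (rule lip[OF Suc.prems(1) that UD[OF that] UD[OF that]]) (use Suc.IH that in blast)
    qed
    finally show ?case using Suc.prems by (simp add: US[of "Suc n"] US[of n])
  qed
  \<comment> \<open>The limit is written as a telescoping series because the geometric bound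
    \<open>diff\<close> then gives uniform convergence by the Weierstrass test.\<close>
  define u where "u t i = U 0 t i + suminf (\<lambda>n. U (Suc n) t i - U n t i)" for t i
  have lim: "uniform_limit {0..1} (\<lambda>n t. U n t i) (\<lambda>t. u t i) sequentially" for i
  proof (cases "i < m")
    case True
    have "uniform_limit {0..1} (\<lambda>n t. \<Sum>k<n. U (Suc k) t i - U k t i) (\<lambda>t. suminf (\<lambda>n. U (Suc n) t i - U n t i)) sequentially"
      by (rule Weierstrass_m_test[where M="\<lambda>n. \<rho> * (1/2) ^ n"])
        (use diff[OF True] in \<open>auto intro!: summable_mult summable_geometric\<close>)
    then have "uniform_limit {0..1} (\<lambda>n t. U 0 t i + (\<Sum>k<n. U (Suc k) t i - U k t i)) (\<lambda>t. u t i) sequentially"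
      unfolding u_def by (intro uniform_limit_add uniform_limit_const) 
    then show ?thesis by (simp add: sum_lessThan_telescope[of "\<lambda>k. U k _ i"])
  next
    case False
    have "U n t i = 0" for n t using False by (cases n) (auto simp: U0 US)
    then show ?thesis by (simp add: u_def uniform_limit_const)
  qed
  have pt: "(\<lambda>n. U n t i) \<longlonglongrightarrow> u t i" if "t \<in> {0..1}" for t i
    using tendsto_uniform_limitI[OF lim that] .
  have uD: "u t \<in> D" if t: "t \<in> {0..1}" for t
  proof -
    have "u t i = 0" if "i \<ge> m" for i
    proof -
      have "U n t i = 0" for n using that by (cases n) (auto simp: U0 US)
      then show ?thesis using pt[OF t, of i] by (simp add: LIMSEQ_const_iff)
    qed
    moreover have "\<bar>u t i - p i\<bar> \<le> \<rho>" if "i < m" for i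
      by (rule LIMSEQ_le_const2[OF tendsto_rabs[OF tendsto_diff[OF pt[OF t] tendsto_const]]])
        (use UD[OF t] that in \<open>auto simp: D_def\<close>)
    ultimately show ?thesis by (auto simp: D_def Rn_def)
  qed
  have uc: "continuous_on {0..1} (\<lambda>t. u t i)" for i
    by (rule uniform_limit_theorem[OF _ lim]) (use Uc in auto)
  have cGu: "continuous_on {0..1} (\<lambda>s. G s (u s) i)" if "i < m" for i
    by (rule comp[OF that uD uc])
  have eq: "u t i = w0 i + integral {0..t} (\<lambda>s. G s (u s) i)" if i: "i < m" and t: "t \<in> {0..1}" for t i
  proof -
    have "\<bar>u t i - (w0 i + integral {0..t} (\<lambda>s. G s (u s) i))\<bar> \<le> 2 * e" if e: "e > 0" for e
    proof -
      have *: "\<forall>\<^sub>F n in sequentially. \<forall>j\<in>{..<m}. \<forall>t\<in>{0..1}. dist (U n t j) (u t j) < e"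
        using lim e unfolding uniform_limit_iff by (intro eventually_ball_finite) auto
      then have "\<forall>\<^sub>F n in sequentially. \<forall>j\<in>{..<m}. \<forall>t\<in>{0..1}. dist (U (Suc n) t j) (u t j) < e"
        by (subst eventually_sequentially_Suc)
      with * obtain n where n: "\<forall>j\<in>{..<m}. \<forall>t\<in>{0..1}. dist (U n t j) (u t j) < e"
        "\<forall>j\<in>{..<m}. \<forall>t\<in>{0..1}. dist (U (Suc n) t j) (u t j) < e"
        using eventually_happens[OF eventually_conj] by (metis (mono_tags, lifting) trivial_limit_sequentially)
      have "integral {0..t} (\<lambda>s. G s (U n s) i) - integral {0..t} (\<lambda>s. G s (u s) i)
        = integral {0..t} (\<lambda>s. G s (U n s) i - G s (u s) i)"
        by (rule integral_diff[OF integrable_continuous_real integrable_continuous_real, symmetric])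
          (rule sub[OF cG[OF i] t] sub[OF cGu[OF i] t])+
      also have "\<bar>\<dots>\<bar> \<le> e / 2"
      proof (rule int_bound[OF _ _ t])
        show "continuous_on {0..1} (\<lambda>s. G s (U n s) i - G s (u s) i)"
          by (intro continuous_intros cG cGu i)
        show "\<bar>G s (U n s) i - G s (u s) i\<bar> \<le> e / 2" if "s \<in> {0..1}" for s
          by (rule lip[OF i that UD[OF that] uD[OF that]]) (use n(1) that in \<open>force simp: dist_real_def\<close>)
      qed
      finally have "\<bar>integral {0..t} (\<lambda>s. G s (U n s) i) - integral {0..t} (\<lambda>s. G s (u s) i)\<bar> \<le> e / 2" .
      moreover have "\<bar>U (Suc n) t i - u t i\<bar> < e" using n(2) i t by (auto simp: dist_real_def)
      moreover have "U (Suc n) t i = w0 i + integral {0..t} (\<lambda>s. G s (U n s) i)" using i by (simp add: US)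
      ultimately show ?thesis using e by linarith
    qed
    \<comment> \<open>With e a quarter of the discrepancy the estimate says that the discrepancy is
      at most half of itself, so it is zero.\<close>
    from this[of "\<bar>u t i - (w0 i + integral {0..t} (\<lambda>s. G s (u s) i))\<bar> / 4"]
    show ?thesis by (cases "u t i = w0 i + integral {0..t} (\<lambda>s. G s (u s) i)") auto
  qed
  show ?thesis
  proof (rule that[OF uD])
    show "u 0 i = w0 i" if "i < m" for i using eq[OF that, of 0] by simp
    show "((\<lambda>t. u t i) has_real_derivative G t (u t) i) (at t within {0..1})" if "i < m" "t \<in> {0..1}" for i t
    proof -
      have "((\<lambda>t. w0 i + integral {0..t} (\<lambda>s. G s (u s) i)) has_real_derivative 0 + G t (u t) i) (at t within {0..1})"
        by (intro DERIV_add DERIV_const integral_has_real_derivative cGu that)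
      then show ?thesis
        using has_real_derivative_transform[OF that(2) eq[OF that(1)]] by simp
    qed
  qed
qed

subsection \<open>Linear equations\<close>

text \<open>Row sums at most 1/2 give the Lipschitz constant 1/2 on every box, so the box can be
  taken as large as the data demand and the solution exists on all of [0,1].\<close>

lemma linear_ode_exists:
  fixes A :: "nat \<Rightarrow> nat \<Rightarrow> real \<Rightarrow> real" and b :: "nat \<Rightarrow> real \<Rightarrow> real" and m :: nat
  assumes A: "\<And>i l. i < m \<Longrightarrow> l < m \<Longrightarrow> continuous_on {0..1} (A i l)"
    and b: "\<And>i. i < m \<Longrightarrow> continuous_on {0..1} (b i)"
    and half: "\<And>i t. i < m \<Longrightarrow> t \<in> {0..1} \<Longrightarrow> (\<Sum>l<m. \<bar>A i l t\<bar>) \<le> 1 / 2"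
  obtains w where "\<And>i. i < m \<Longrightarrow> w i 0 = w0 i"
    "\<And>i t. i < m \<Longrightarrow> t \<in> {0..1} \<Longrightarrow> (w i has_real_derivative (\<Sum>l<m. A i l t * w l t) + b i t) (at t within {0..1})"
proof -
  have "\<exists>B. \<forall>t\<in>{0..1}. \<bar>b i t\<bar> \<le> B" if "i < m" for i
    using compact_imp_bounded[OF compact_continuous_image[OF b[OF that]]] by (auto simp: bounded_iff)
  then obtain B where B: "\<And>i t. i < m \<Longrightarrow> t \<in> {0..1} \<Longrightarrow> \<bar>b i t\<bar> \<le> B i" by metis
  \<comment> \<open>Chosen so that the initial value and the value b of the right-hand side at the
    origin are both at most \<rho>/4 in size.\<close>
  define \<rho> where "\<rho> = 4 * (\<Sum>i<m. \<bar>B i\<bar> + \<bar>w0 i\<bar>)"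
  have le: "\<bar>B i\<bar> + \<bar>w0 i\<bar> \<le> \<rho> / 4" if "i < m" for i
    unfolding \<rho>_def using that member_le_sum[of i "{..<m}" "\<lambda>i. \<bar>B i\<bar> + \<bar>w0 i\<bar>"] by auto
  define G where "G t x i = (\<Sum>l<m. A i l t * x l) + b i t" for t x i
  define D :: "(nat \<Rightarrow> real) set" where "D = {x \<in> Rn m. \<forall>i<m. \<bar>x i - 0 i\<bar> \<le> \<rho>}"
  have c: "continuous_on ({0..1} \<times> D) (\<lambda>(t, x). G t x i)" if "i < m" for i
  proof -
    have "continuous_on ({0..1} \<times> D) (\<lambda>w. snd w l)" for l
      by (rule continuous_on_product_then_coordinatewise[OF continuous_on_snd[OF continuous_on_id]])
    moreover have "continuous_on ({0..1} \<times> D) (\<lambda>w. A i l (fst w))" if "l < m" for l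
      by (rule continuous_on_compose2[OF A[OF \<open>i < m\<close> that] continuous_on_fst[OF continuous_on_id]]) auto
    moreover have "continuous_on ({0..1} \<times> D) (\<lambda>w. b i (fst w))"
      by (rule continuous_on_compose2[OF b[OF \<open>i < m\<close>] continuous_on_fst[OF continuous_on_id]]) auto
    ultimately show ?thesis unfolding G_def split_beta
      by (intro continuous_on_add continuous_on_sum continuous_on_mult) auto
  qed
  have lip: "\<bar>G t x i - G t y i\<bar> \<le> c / 2" if "i < m" "t \<in> {0..1}" "\<forall>j<m. \<bar>x j - y j\<bar> \<le> c" for i t x y c
  proof -
    have c0: "c \<ge> 0" using that(1,3) by force
    have "G t x i - G t y i = (\<Sum>l<m. A i l t * (x l - y l))"
      by (simp add: G_def sum_subtractf right_diff_distrib)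
    also have "\<bar>\<dots>\<bar> \<le> (\<Sum>l<m. \<bar>A i l t\<bar> * c)"
      by (rule order_trans[OF sum_abs], rule sum_mono) (use that in \<open>auto simp: abs_mult intro!: mult_left_mono\<close>)
    also have "\<dots> \<le> 1 / 2 * c" unfolding sum_distrib_right[symmetric]
      by (rule mult_right_mono[OF half[OF that(1,2)] c0])
    finally show ?thesis by simp
  qed
  obtain u where u: "\<And>t. t \<in> {0..1} \<Longrightarrow> u t \<in> D" "\<And>i. i < m \<Longrightarrow> u 0 i = w0 i"
    "\<And>i t. i < m \<Longrightarrow> t \<in> {0..1} \<Longrightarrow> ((\<lambda>t. u t i) has_real_derivative G t (u t) i) (at t within {0..1})"
  proof (rule picard[OF D_def, where G=G and ?w0.0=w0])
    show "0 \<in> Rn m" by (simp add: Rn_def)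
    show "continuous_on ({0..1} \<times> D) (\<lambda>(t, x). G t x i)" if "i < m" for i
      using c[OF that] .
    show "\<bar>w0 i - 0 i\<bar> \<le> \<rho> / 4" if "i < m" for i using le[OF that] by simp
    show "\<bar>G t 0 i\<bar> \<le> \<rho> / 4" if "i < m" "t \<in> {0..1}" for i t
      using le[OF that(1)] B[OF that] by (simp add: G_def)
  qed (use lip in blast)+
  show thesis
    by (rule that[of "\<lambda>i t. u t i"]) (use u in \<open>auto simp: G_def\<close>)
qed

text \<open>The difference solves the equation with matrix \<open>A1\<close> and inhomogeneity (A1 -
  A0) w + (b1 - b0), whose size is at most m B \<epsilon> + \<epsilon>. The estimate serves both for
  continuity in a parameter and for convergence of difference quotients; on \<open>A1\<close> it
  asks for bounds only.\<close>

lemma linear_ode_perturb: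
  fixes A0 A1 :: "nat \<Rightarrow> nat \<Rightarrow> real \<Rightarrow> real" and b0 b1 v w :: "nat \<Rightarrow> real \<Rightarrow> real" and m :: nat
  assumes v: "\<And>i t. i < m \<Longrightarrow> t \<in> {0..1} \<Longrightarrow> (v i has_real_derivative (\<Sum>l<m. A1 i l t * v l t) + b1 i t) (at t within {0..1})"
    and w: "\<And>i t. i < m \<Longrightarrow> t \<in> {0..1} \<Longrightarrow> (w i has_real_derivative (\<Sum>l<m. A0 i l t * w l t) + b0 i t) (at t within {0..1})"
    and half: "\<And>i t. i < m \<Longrightarrow> t \<in> {0..1} \<Longrightarrow> (\<Sum>l<m. \<bar>A1 i l t\<bar>) \<le> 1 / 2"
    and B: "\<And>l t. l < m \<Longrightarrow> t \<in> {0..1} \<Longrightarrow> \<bar>w l t\<bar> \<le> B"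
    and A: "\<And>i l t. i < m \<Longrightarrow> l < m \<Longrightarrow> t \<in> {0..1} \<Longrightarrow> \<bar>A1 i l t - A0 i l t\<bar> \<le> \<epsilon>"
    and b: "\<And>i t. i < m \<Longrightarrow> t \<in> {0..1} \<Longrightarrow> \<bar>b1 i t - b0 i t\<bar> \<le> \<epsilon>"
    and init: "\<And>i. i < m \<Longrightarrow> \<bar>v i 0 - w i 0\<bar> \<le> \<epsilon>"
    and it: "i < m" "t \<in> {0..1}"
  shows "\<bar>v i t - w i t\<bar> \<le> (4 + 2 * real m * B) * \<epsilon>"
proof -
  have "\<bar>v i t - w i t\<bar> \<le> 2 * (\<epsilon> + (real m * (\<epsilon> * B) + \<epsilon>))"
  proof (rule half_lipschitz_bound[where m=m and \<phi>="\<lambda>i t. v i t - w i t" and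
      \<phi>'="\<lambda>i t. ((\<Sum>l<m. A1 i l t * v l t) + b1 i t) - ((\<Sum>l<m. A0 i l t * w l t) + b0 i t)"])
    fix i t c assume it: "i < m" "t \<in> {0..1}" and c: "\<forall>j<m. \<bar>v j t - w j t\<bar> \<le> c"
    have c0: "c \<ge> 0" using it c by force
    have "((\<Sum>l<m. A1 i l t * v l t) + b1 i t) - ((\<Sum>l<m. A0 i l t * w l t) + b0 i t)
      = (\<Sum>l<m. A1 i l t * (v l t - w l t)) + (\<Sum>l<m. (A1 i l t - A0 i l t) * w l t) + (b1 i t - b0 i t)"
      by (simp add: algebra_simps sum_subtractf sum.distrib)
    moreover have "\<bar>\<Sum>l<m. A1 i l t * (v l t - w l t)\<bar> \<le> c / 2"
    proof -
      have "\<bar>\<Sum>l<m. A1 i l t * (v l t - w l t)\<bar> \<le> (\<Sum>l<m. \<bar>A1 i l t\<bar> * c)"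
        by (rule order_trans[OF sum_abs], rule sum_mono) (use c in \<open>auto simp: abs_mult intro!: mult_left_mono\<close>)
      also have "\<dots> \<le> 1 / 2 * c" unfolding sum_distrib_right[symmetric]
        by (rule mult_right_mono[OF half[OF it] c0])
      finally show ?thesis by simp
    qed
    moreover have "\<bar>\<Sum>l<m. (A1 i l t - A0 i l t) * w l t\<bar> \<le> real m * (\<epsilon> * B)"
    proof -
      have "\<bar>\<Sum>l<m. (A1 i l t - A0 i l t) * w l t\<bar> \<le> (\<Sum>l<m. \<epsilon> * B)"
      proof (rule order_trans[OF sum_abs], rule sum_mono)
        fix l assume "l \<in> {..<m}"
        then have l: "l < m" by simp
        show "\<bar>(A1 i l t - A0 i l t) * w l t\<bar> \<le> \<epsilon> * B" unfolding abs_mult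
          by (rule mult_mono) (use A[OF it(1) l it(2)] B[OF l it(2)] in auto)
      qed
      then show ?thesis by simp
    qed
    ultimately show "\<bar>((\<Sum>l<m. A1 i l t * v l t) + b1 i t) - ((\<Sum>l<m. A0 i l t * w l t) + b0 i t)\<bar>
      \<le> c / 2 + (real m * (\<epsilon> * B) + \<epsilon>)"
      using b[OF it] by linarith
  qed (use v w init it in \<open>auto intro!: DERIV_diff\<close>)
  then show ?thesis by (simp add: algebra_simps)
qed

text \<open>Tube lemma: compactness of [0,1] makes the neighbourhood of \<open>z0\<close>
  independent of t.\<close>

lemma tube_nhds:
  fixes g :: "real \<Rightarrow> (nat \<Rightarrow> real) \<Rightarrow> real"
  assumes "continuous_on (S \<times> {0..1}) (\<lambda>(z, t). g t z)" "z0 \<in> S" "e > 0"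
  shows "\<forall>\<^sub>F z in nhds z0. z \<in> S \<longrightarrow> (\<forall>t\<in>{0..1}. \<bar>g t z - g t z0\<bar> \<le> e)"
proof -
  obtain X where "z0 \<in> X" "open X" "\<forall>x\<in>X \<inter> S. \<forall>t\<in>{0..1}. dist ((\<lambda>(z, t). g t z) (x, t)) ((\<lambda>(z, t). g t z) (z0, t)) \<le> e"
    using continuous_on_prod_compactE[OF assms(1) _ assms(2,3)] compact_Icc by blast
  then show ?thesis
    unfolding eventually_nhds by (auto simp: dist_real_def)
qed

lemma filterlim_line:
  fixes z :: "nat \<Rightarrow> real"
  shows "filterlim (\<lambda>s. z(j := s)) (nhds z) (nhds (z j))"
proof -
  have "continuous_on UNIV (\<lambda>s i. (z(j := s)) i)"
  proof (rule continuous_on_coordinatewise_then_product)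
    show "continuous_on UNIV (\<lambda>s. (z(j := s)) i)" for i by (cases "i = j") auto
  qed
  then have "continuous_on UNIV (\<lambda>s. z(j := s))" .
  then have "isCont (\<lambda>s. z(j := s)) (z j)"
    by (simp add: continuous_on_eq_continuous_at)
  then show ?thesis
    unfolding continuous_at using tendsto_nhds_iff[of "\<lambda>s. z(j := s)" "z(j := z j)" "z j"] by simp
qed

lemma continuous_slice:
  fixes g :: "real \<Rightarrow> (nat \<Rightarrow> real) \<Rightarrow> real"
  assumes "continuous_on (S \<times> T) (\<lambda>(z, t). g t z)" "z \<in> S"
  shows "continuous_on T (\<lambda>t. g t z)"
proof -
  have "continuous_on T (\<lambda>t. (\<lambda>(z, t). g t z) (z, t))"
    by (rule continuous_on_compose2[OF assms(1) continuous_on_Pair[OF continuous_on_const continuous_on_id]])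
      (use assms(2) in auto)
  then show ?thesis by simp
qed

text \<open>By the mean value theorem each quotient is a value of the partial derivative at a nearby
  point, and the tube lemma makes the error uniform in time.\<close>

lemma quotient_nhds:
  fixes g :: "real \<Rightarrow> (nat \<Rightarrow> real) \<Rightarrow> real"
  assumes S: "openR n S" and g: "C_param n {0..1} (Suc r) S g" and z: "z \<in> S" and j: "j < n" and e: "e > 0"
  shows "\<forall>\<^sub>F s in at (z j). \<forall>t\<in>{0..1}. \<bar>(g t (z(j := s)) - g t z) / (s - z j) - pd j (g t) z\<bar> \<le> e"
proof -
  have "C_param n {0..1} r S (\<lambda>t. pd j (g t))" using g j by simp
  from tube_nhds[OF C_param_continuous[OF this] z e]
  have "\<forall>\<^sub>F s in nhds (z j). z(j := s) \<in> S \<longrightarrow> (\<forall>t\<in>{0..1}. \<bar>pd j (g t) (z(j := s)) - pd j (g t) z\<bar> \<le> e)"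
    by (rule eventually_compose_filterlim[OF _ filterlim_line])
  with openR_line[OF S z j]
  have "\<forall>\<^sub>F s in nhds (z j). z(j := s) \<in> S \<and> (\<forall>t\<in>{0..1}. \<bar>pd j (g t) (z(j := s)) - pd j (g t) z\<bar> \<le> e)"
    by eventually_elim auto
  then obtain d where d: "d > 0" "\<And>s. dist s (z j) < d \<Longrightarrow> z(j := s) \<in> S \<and> (\<forall>t\<in>{0..1}. \<bar>pd j (g t) (z(j := s)) - pd j (g t) z\<bar> \<le> e)"
    unfolding eventually_nhds_metric by blast
  have "\<bar>(g t (z(j := s)) - g t z) / (s - z j) - pd j (g t) z\<bar> \<le> e"
    if s: "s \<noteq> z j" "dist s (z j) < d" and t: "t \<in> {0..1}" for s t
  proof -
    obtain q where q: "\<bar>q - z j\<bar> \<le> \<bar>s - z j\<bar>" "g t (z(j := s)) - g t (z(j := z j)) = pd j (g t) (z(j := q)) * (s - z j)"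
    proof (rule mvt_segment[of "z j" s "\<lambda>s. g t (z(j := s))" "\<lambda>s. pd j (g t) (z(j := s))"])
      fix q assume "\<bar>q - z j\<bar> \<le> \<bar>s - z j\<bar>"
      then have "z(j := q) \<in> S" using d(2)[of q] s by (simp add: dist_real_def)
      from C_param_has_partial[OF g j t this]
      show "((\<lambda>s. g t (z(j := s))) has_real_derivative pd j (g t) (z(j := q))) (at q)" by simp
    qed
    then have "(g t (z(j := s)) - g t z) / (s - z j) = pd j (g t) (z(j := q))"
      using s(1) by (simp add: field_simps)
    then show ?thesis using d(2)[of q] q(1) s(2) t by (simp add: dist_real_def)
  qed
  then show ?thesis
    unfolding eventually_at using d(1) by blast
qed

text \<open>Continuity in t for each fixed z, combined with continuity in z that is uniform in t:
  the error splits into the two halves of a triangle inequality.\<close>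

lemma joint_continuityI:
  fixes f :: "real \<Rightarrow> (nat \<Rightarrow> real) \<Rightarrow> real"
  assumes "\<And>z. z \<in> S \<Longrightarrow> continuous_on T (\<lambda>t. f t z)"
    and "\<And>z e. z \<in> S \<Longrightarrow> e > 0 \<Longrightarrow> \<forall>\<^sub>F y in nhds z. y \<in> S \<longrightarrow> (\<forall>t\<in>T. \<bar>f t y - f t z\<bar> \<le> e)"
  shows "continuous_on (S \<times> T) (\<lambda>(z, t). f t z)"
  unfolding continuous_on_def
proof
  fix q assume "q \<in> S \<times> T"
  then obtain z t where q: "q = (z, t)" and zt: "z \<in> S" "t \<in> T" by auto
  have "((\<lambda>(z, t). f t z) \<longlongrightarrow> f t z) (at (z, t) within S \<times> T)"
  proof (rule tendstoI)
  fix e :: real assume e: "e > 0"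
  have 1: "\<forall>\<^sub>F p in at (z, t) within S \<times> T. fst p \<in> S \<longrightarrow> (\<forall>s\<in>T. \<bar>f s (fst p) - f s z\<bar> \<le> e/2)"
    by (rule eventually_compose_filterlim[OF assms(2)[OF zt(1), of "e/2"]])
      (use e in \<open>auto intro!: tendsto_eq_intros\<close>)
  have "((\<lambda>s. f s z) \<longlongrightarrow> f t z) (at t within T)"
    using assms(1)[OF zt(1)] zt(2) by (auto simp: continuous_on_def)
  then have "\<forall>\<^sub>F s in at t within T. dist (f s z) (f t z) < e/2"
    using e by (intro tendstoD) auto
  then have "\<forall>\<^sub>F s in nhds t. s \<in> T \<longrightarrow> dist (f s z) (f t z) < e/2"
    using e unfolding eventually_at_filter by (auto elim!: eventually_mono)
  then have 2: "\<forall>\<^sub>F p in at (z, t) within S \<times> T. snd p \<in> T \<longrightarrow> dist (f (snd p) z) (f t z) < e/2"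
    by (rule eventually_compose_filterlim) (auto intro!: tendsto_eq_intros)
  have 3: "\<forall>\<^sub>F p in at (z, t) within S \<times> T. p \<in> S \<times> T"
    by (simp add: eventually_at_filter)
  show "\<forall>\<^sub>F p in at (z, t) within S \<times> T. dist (case p of (z, t) \<Rightarrow> f t z) (f t z) < e"
    using 1 2 3
  proof eventually_elim
    case (elim p)
    then have "\<bar>f (snd p) (fst p) - f (snd p) z\<bar> \<le> e/2" "\<bar>f (snd p) z - f t z\<bar> < e/2"
      by (auto simp: dist_real_def)
    then have "\<bar>f (snd p) (fst p) - f t z\<bar> < e/2 + e/2"
      using abs_triangle_ineq[of "f (snd p) (fst p) - f (snd p) z" "f (snd p) z - f t z"] by simp
    then show ?case by (simp add: split_beta dist_real_def)
  qed
  qed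
  then show "((\<lambda>(z, t). f t z) \<longlongrightarrow> (case q of (z, t) \<Rightarrow> f t z)) (at q within S \<times> T)"
    by (simp add: q)
qed

text \<open>Differentiating the equation in the parameter gives a linear equation with the same matrix A, so that
  the order of differentiability can be raised by induction.\<close>

lemma linear_ode_smooth:
  fixes A :: "nat \<Rightarrow> nat \<Rightarrow> real \<Rightarrow> (nat \<Rightarrow> real) \<Rightarrow> real" and m :: nat
  assumes S: "openR n S"
    and half: "\<And>z i t. z \<in> S \<Longrightarrow> i < m \<Longrightarrow> t \<in> {0..1} \<Longrightarrow> (\<Sum>l<m. \<bar>A i l t z\<bar>) \<le> 1 / 2"
  shows "(\<And>i l. i < m \<Longrightarrow> l < m \<Longrightarrow> C_param n {0..1} r S (A i l)) \<Longrightarrow> (\<And>i. i < m \<Longrightarrow> C_param n {0..1} r S (b i)) \<Longrightarrow>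
    (\<And>i. i < m \<Longrightarrow> C_param n {0..1::real} r S (\<lambda>t. w0 i)) \<Longrightarrow> (\<And>i z. i < m \<Longrightarrow> z \<in> S \<Longrightarrow> w i 0 z = w0 i z) \<Longrightarrow>
    (\<And>i z t. i < m \<Longrightarrow> z \<in> S \<Longrightarrow> t \<in> {0..1} \<Longrightarrow>
      ((\<lambda>t. w i t z) has_real_derivative (\<Sum>l<m. A i l t z * w l t z) + b i t z) (at t within {0..1})) \<Longrightarrow>
    i < m \<Longrightarrow> C_param n {0..1} r S (w i)"
proof (induction r arbitrary: b w0 w i)
  \<comment> \<open>The base case. Moving z changes A, b and the initial value by little, uniformly
    in t, so the perturbation estimate compares the two solutions.\<close>
  have cont: "continuous_on (S \<times> {0..1}) (\<lambda>(z, t). w i t z)"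
    if A: "\<And>i l. i < m \<Longrightarrow> l < m \<Longrightarrow> continuous_on (S \<times> {0..1}) (\<lambda>(z, t). A i l t z)"
      and b: "\<And>i. i < m \<Longrightarrow> continuous_on (S \<times> {0..1}) (\<lambda>(z, t). b i t z)"
      and w0: "\<And>i. i < m \<Longrightarrow> continuous_on (S \<times> {0..1::real}) (\<lambda>(z, t). w0 i z)"
      and init: "\<And>i z. i < m \<Longrightarrow> z \<in> S \<Longrightarrow> w i 0 z = w0 i z"
      and w: "\<And>i z t. i < m \<Longrightarrow> z \<in> S \<Longrightarrow> t \<in> {0..1} \<Longrightarrow>
      ((\<lambda>t. w i t z) has_real_derivative (\<Sum>l<m. A i l t z * w l t z) + b i t z) (at t within {0..1})"
      and i: "i < m" for b w0 w i
  proof (rule joint_continuityI)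
    have c: "continuous_on {0..1} (\<lambda>t. w i t z)" if "z \<in> S" "i < m" for z i
      using w that by (intro DERIV_continuous_on) auto
    then show "continuous_on {0..1} (\<lambda>t. w i t z)" if "z \<in> S" for z using i that by blast
    fix z and e :: real assume z: "z \<in> S" and e: "e > 0"
    have "\<exists>B. \<forall>t\<in>{0..1}. \<bar>w i t z\<bar> \<le> B" if "i < m" for i
      using compact_imp_bounded[OF compact_continuous_image[OF c[OF z that]]] by (auto simp: bounded_iff)
    then obtain B' where B': "\<And>i t. i < m \<Longrightarrow> t \<in> {0..1} \<Longrightarrow> \<bar>w i t z\<bar> \<le> B' i" by metis
    define B where "B = (\<Sum>i<m. \<bar>B' i\<bar>)"
    have B: "\<bar>w i t z\<bar> \<le> B" if "i < m" "t \<in> {0..1}" for i t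
      using B'[OF that] member_le_sum[of i "{..<m}" "\<lambda>i. \<bar>B' i\<bar>"] that by (auto simp: B_def)
    have B0: "B \<ge> 0" by (auto simp: B_def sum_nonneg)
    define \<epsilon> where "\<epsilon> = e / (4 + 2 * real m * B)"
    have pos: "4 + 2 * real m * B > 0" using B0 by (smt (verit) mult_nonneg_nonneg of_nat_0_le_iff)
    have \<epsilon>: "\<epsilon> > 0" "(4 + 2 * real m * B) * \<epsilon> = e" using e pos by (auto simp: \<epsilon>_def)
    have "\<forall>\<^sub>F y in nhds z. \<forall>i\<in>{..<m}. \<forall>l\<in>{..<m}. y \<in> S \<longrightarrow> (\<forall>t\<in>{0..1}. \<bar>A i l t y - A i l t z\<bar> \<le> \<epsilon>)"
      using tube_nhds[OF A z \<epsilon>(1)] by (intro eventually_ball_finite ballI) auto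
    moreover have "\<forall>\<^sub>F y in nhds z. \<forall>i\<in>{..<m}. y \<in> S \<longrightarrow> (\<forall>t\<in>{0..1}. \<bar>b i t y - b i t z\<bar> \<le> \<epsilon>)"
      using tube_nhds[OF b z \<epsilon>(1)] by (intro eventually_ball_finite ballI) auto
    moreover have "\<forall>\<^sub>F y in nhds z. \<forall>i\<in>{..<m}. y \<in> S \<longrightarrow> (\<forall>t\<in>{0..1::real}. \<bar>w0 i y - w0 i z\<bar> \<le> \<epsilon>)"
      using tube_nhds[OF w0 z \<epsilon>(1)] by (intro eventually_ball_finite ballI) auto
    ultimately show "\<forall>\<^sub>F y in nhds z. y \<in> S \<longrightarrow> (\<forall>t\<in>{0..1}. \<bar>w i t y - w i t z\<bar> \<le> e)"
    proof eventually_elim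
      case (elim y)
      show ?case
      proof (intro impI ballI)
        fix t :: real assume y: "y \<in> S" and t: "t \<in> {0..1}"
        have "\<bar>w i t y - w i t z\<bar> \<le> (4 + 2 * real m * B) * \<epsilon>"
          by (rule linear_ode_perturb[where v="\<lambda>i t. w i t y" and w="\<lambda>i t. w i t z" and
               ?A1.0="\<lambda>i l t. A i l t y" and ?A0.0="\<lambda>i l t. A i l t z" and ?b1.0="\<lambda>i t. b i t y" and ?b0.0="\<lambda>i t. b i t z"])
            (use elim w y z t i half B init in auto)
        then show "\<bar>w i t y - w i t z\<bar> \<le> e" using \<epsilon> by simp
      qed
    qed
  qed
  {
    case prems: 0
    show ?case
      using cont[of b w0 w i] prems by simp
  next
    case (Suc r)
    note A = Suc.prems(1) and b = Suc.prems(2) and w0 = Suc.prems(3) and init = Suc.prems(4) and w = Suc.prems(5)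
    have wr: "C_param n {0..1} r S (w i)" if "i < m" for i
        by (rule Suc.IH[OF C_param_Suc_mono[OF A] C_param_Suc_mono[OF b] C_param_Suc_mono[OF w0] init w that])
    \<comment> \<open>The inhomogeneous term obtained by formally differentiating the equation in
      the j-th parameter: (\<partial>A) w + \<partial>b. It has one order less than A and b, which
      is why the induction hypothesis is general in b and \<open>w0\<close>.\<close>
    define bj where "bj j i t z = (\<Sum>l<m. pd j (A i l t) z * w l t z) + pd j (b i t) z" for j i t z
    have bj: "C_param n {0..1} r S (bj j i)" if "j < n" "i < m" for j i
      unfolding bj_def using A b that wr by (intro C_param_add C_param_sum C_param_mult S) auto
    have cA: "continuous_on {0..1} (\<lambda>t. A i l t z)" if "i < m" "l < m" "z \<in> S" for i l z
      by (rule continuous_slice[OF C_param_continuous[OF A[OF that(1,2)]] that(3)])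
    have cb: "continuous_on {0..1} (\<lambda>t. bj j i t z)" if "j < n" "i < m" "z \<in> S" for j i z
      by (rule continuous_slice[OF C_param_continuous[OF bj[OF that(1,2)]] that(3)])
    define Q where "Q j z D \<longleftrightarrow> (\<forall>i<m. D i 0 = pd j (w0 i) z) \<and> (\<forall>i<m. \<forall>t\<in>{0..1}. (D i has_real_derivative
        (\<Sum>l<m. A i l t z * D l t) + bj j i t z) (at t within {0..1}))" for j z D
    have ex: "\<exists>D. Q j z D" if "j < n" "z \<in> S" for j z
    proof -
      note jz = that
      show ?thesis
      proof (rule linear_ode_exists[where m=m and A="\<lambda>i l t. A i l t z" and b="\<lambda>i t. bj j i t z" and ?w0.0="\<lambda>i. pd j (w0 i) z",
              OF cA[OF _ _ jz(2)] cb[OF jz(1) _ jz(2)] half[OF jz(2)]])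
        fix D assume "\<And>i. i < m \<Longrightarrow> D i 0 = pd j (w0 i) z"
          "\<And>i t. i < m \<Longrightarrow> t \<in> {0..1} \<Longrightarrow> (D i has_real_derivative (\<Sum>l<m. A i l t z * D l t) + bj j i t z) (at t within {0..1})"
        then show ?thesis by (intro exI[of _ D]) (simp add: Q_def)
      qed
    qed
    define D where "D j z = (SOME D. Q j z D)" for j z
    have QD: "Q j z (D j z)" if "j < n" "z \<in> S" for j z
      unfolding D_def by (rule someI_ex[OF ex[OF that]])
    have D: "\<And>j z i. j < n \<Longrightarrow> z \<in> S \<Longrightarrow> i < m \<Longrightarrow> D j z i 0 = pd j (w0 i) z"
      "\<And>j z i t. j < n \<Longrightarrow> z \<in> S \<Longrightarrow> i < m \<Longrightarrow> t \<in> {0..1} \<Longrightarrow> (D j z i has_real_derivative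
        (\<Sum>l<m. A i l t z * D j z l t) + bj j i t z) (at t within {0..1})"
      using QD unfolding Q_def by blast+
    \<comment> \<open>D solves the formally differentiated equation. Its regularity comes from the
      induction hypothesis before it is known to be the derivative of w; \<open>deriv\<close> then
      identifies the two.\<close>
    have DC: "C_param n {0..1} r S (\<lambda>t z. D j z i t)" if "j < n" "i < m" for j i
    proof (rule Suc.IH[where b="bj j" and ?w0.0="\<lambda>i. pd j (w0 i)" and w="\<lambda>i t z. D j z i t"])
      show "C_param n {0..1} r S (A i l)" if "i < m" "l < m" for i l
        using A[OF that] by (rule C_param_Suc_mono)
      show "C_param n {0..1::real} r S (\<lambda>t. pd j (w0 i))" if "i < m" for i
        using w0[OF that] \<open>j < n\<close> by simp
    qed (use bj D that in auto)
    have deriv: "((\<lambda>s. w i t (z(j := s))) has_real_derivative D j z i t) (at (z j))"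
      if j: "j < n" and t: "t \<in> {0..1}" and z: "z \<in> S" and i: "i < m" for j t z i
      unfolding has_field_derivative_iff
    proof (rule tendstoI)
      fix e :: real assume e: "e > 0"
      have "\<exists>B. \<forall>t\<in>{0..1}. \<bar>D j z i t\<bar> \<le> B" if "i < m" for i
        using compact_imp_bounded[OF compact_continuous_image[OF continuous_slice[OF C_param_continuous[OF DC[OF j that]] z]]]
        by (auto simp: bounded_iff)
      then obtain B1 where B1: "\<And>i t. i < m \<Longrightarrow> t \<in> {0..1} \<Longrightarrow> \<bar>D j z i t\<bar> \<le> B1 i" by metis
      have "\<exists>B. \<forall>t\<in>{0..1}. \<bar>w i t z\<bar> \<le> B" if "i < m" for i
        using compact_imp_bounded[OF compact_continuous_image[OF continuous_slice[OF C_param_continuous[OF wr[OF that]] z]]]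
        by (auto simp: bounded_iff)
      then obtain B2 where B2: "\<And>i t. i < m \<Longrightarrow> t \<in> {0..1} \<Longrightarrow> \<bar>w i t z\<bar> \<le> B2 i" by metis
      define B where "B = (\<Sum>i<m. \<bar>B1 i\<bar> + \<bar>B2 i\<bar>)"
      have B: "\<bar>D j z i t\<bar> \<le> B" "\<bar>w i t z\<bar> \<le> B" if "i < m" "t \<in> {0..1}" for i t
        using B1[OF that] B2[OF that] member_le_sum[of i "{..<m}" "\<lambda>i. \<bar>B1 i\<bar> + \<bar>B2 i\<bar>"] that by (auto simp: B_def)
      have B0: "B \<ge> 0" by (auto simp: B_def intro!: sum_nonneg)
      have mB: "real m * B \<ge> 0" using B0 by simp
      define c where "c = (4 + 2 * real m * B) * (real m * B + 1)"
      \<comment> \<open>The constant c collects the factor of the perturbation estimate and the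
        factor m B + 1 by which the quotients of A and b disturb the inhomogeneity; the total error
        becomes e/2.\<close>
      define \<eta> where "\<eta> = e / (2 * c)"
      have pos: "c > 0" unfolding c_def using mB by (intro mult_pos_pos) auto
      have c: "c * \<eta> = e / 2" using pos by (simp add: \<eta>_def)
      have "(4 + 2 * real m * B) * ((real m * B + 1) * \<eta>) = c * \<eta>" by (simp only: c_def mult.assoc)
      then have \<eta>: "\<eta> > 0" "(4 + 2 * real m * B) * ((real m * B + 1) * \<eta>) < e"
        using e pos c by (simp add: \<eta>_def, linarith)
      let ?\<epsilon> = "(real m * B + 1) * \<eta>"
      have \<eta>\<epsilon>: "\<eta> \<le> ?\<epsilon>" using mB \<eta>(1) by simp
      have 1: "\<forall>\<^sub>F s in at (z j). \<forall>i\<in>{..<m}. \<forall>l\<in>{..<m}. \<forall>t\<in>{0..1}. \<bar>(A i l t (z(j := s)) - A i l t z) / (s - z j) - pd j (A i l t) z\<bar> \<le> \<eta>"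
        by (intro eventually_ball_finite[OF finite_lessThan] ballI quotient_nhds[OF S A z j \<eta>(1)]) auto
      have 2: "\<forall>\<^sub>F s in at (z j). \<forall>i\<in>{..<m}. \<forall>t\<in>{0..1}. \<bar>(b i t (z(j := s)) - b i t z) / (s - z j) - pd j (b i t) z\<bar> \<le> \<eta>"
        by (intro eventually_ball_finite[OF finite_lessThan] ballI quotient_nhds[OF S b z j \<eta>(1)]) auto
      have 3: "\<forall>\<^sub>F s in at (z j). \<forall>i\<in>{..<m}. \<forall>t\<in>{0..1::real}. \<bar>(w0 i (z(j := s)) - w0 i z) / (s - z j) - pd j (w0 i) z\<bar> \<le> \<eta>"
        by (intro eventually_ball_finite[OF finite_lessThan] ballI quotient_nhds[OF S w0 z j \<eta>(1)]) auto
      have "\<forall>\<^sub>F y in nhds z. \<forall>i\<in>{..<m}. \<forall>l\<in>{..<m}. y \<in> S \<longrightarrow> (\<forall>t\<in>{0..1}. \<bar>A i l t y - A i l t z\<bar> \<le> \<eta>)"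
        using tube_nhds[OF C_param_continuous[OF A] z \<eta>(1)] by (intro eventually_ball_finite ballI) auto
      from eventually_compose_filterlim[OF this filterlim_line]
      have 4: "\<forall>\<^sub>F s in at (z j). \<forall>i\<in>{..<m}. \<forall>l\<in>{..<m}. z(j := s) \<in> S \<longrightarrow> (\<forall>t\<in>{0..1}. \<bar>A i l t (z(j := s)) - A i l t z\<bar> \<le> \<eta>)"
        by (rule eventually_nhds_imp_at)
      have 5: "\<forall>\<^sub>F s in at (z j). z(j := s) \<in> S"
        using openR_line[OF S z j] by (rule eventually_nhds_imp_at)
      have 6: "\<forall>\<^sub>F s in at (z j). s \<noteq> z j" by (simp add: eventually_at_filter)
      show "\<forall>\<^sub>F s in at (z j). dist ((w i t (z(j := s)) - w i t (z(j := z j))) / (s - z j)) (D j z i t) < e"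
        using 1 2 3 4 5 6
      proof eventually_elim
        case (elim s)
        define y where "y = z(j := s)"
        define h where "h = s - z j"
        have h: "h \<noteq> 0" using elim by (simp add: h_def)
        have y: "y \<in> S" using elim by (simp add: y_def)
        \<comment> \<open>The difference quotient solves a linear equation with the matrix at the
          displaced point y; as y tends to z its coefficients tend to those of the equation for
          D.\<close>
        have "\<bar>(w i t y - w i t z) / h - D j z i t\<bar> \<le> (4 + 2 * real m * B) * ?\<epsilon>"
        proof (rule linear_ode_perturb[where v="\<lambda>i t. (w i t y - w i t z) / h" and w="\<lambda>i t. D j z i t" and
               ?A1.0="\<lambda>i l t. A i l t y" and ?A0.0="\<lambda>i l t. A i l t z" and ?b0.0="\<lambda>i t. bj j i t z"
               and ?b1.0="\<lambda>i t. (\<Sum>l<m. (A i l t y - A i l t z) / h * w l t z) + (b i t y - b i t z) / h"])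
          fix i t assume it: "i < m" "t \<in> {0..1::real}"
          have "((\<lambda>t. (w i t y - w i t z) / h) has_real_derivative
              (((\<Sum>l<m. A i l t y * w l t y) + b i t y) - ((\<Sum>l<m. A i l t z * w l t z) + b i t z)) / h) (at t within {0..1})"
            by (intro DERIV_cdivide DERIV_diff w it y z)
          also have "(((\<Sum>l<m. A i l t y * w l t y) + b i t y) - ((\<Sum>l<m. A i l t z * w l t z) + b i t z)) / h =
            (\<Sum>l<m. A i l t y * ((w l t y - w l t z) / h)) + ((\<Sum>l<m. (A i l t y - A i l t z) / h * w l t z) + (b i t y - b i t z) / h)"
            by (simp add: diff_divide_distrib add_divide_distrib sum_divide_distrib sum.distrib[symmetric] sum_subtractf[symmetric]
              algebra_simps)
          finally show "((\<lambda>t. (w i t y - w i t z) / h) has_real_derivative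
            (\<Sum>l<m. A i l t y * ((w l t y - w l t z) / h)) + ((\<Sum>l<m. (A i l t y - A i l t z) / h * w l t z) + (b i t y - b i t z) / h)) (at t within {0..1})" .
          show "(\<Sum>l<m. \<bar>A i l t y\<bar>) \<le> 1 / 2" by (rule half[OF y it])
          have "\<bar>(\<Sum>l<m. ((A i l t y - A i l t z) / h - pd j (A i l t) z) * w l t z)\<bar> \<le> (\<Sum>l<m. \<eta> * B)"
          proof (rule order_trans[OF sum_abs], rule sum_mono)
            fix l assume "l \<in> {..<m}"
            then show "\<bar>((A i l t y - A i l t z) / h - pd j (A i l t) z) * w l t z\<bar> \<le> \<eta> * B"
              unfolding abs_mult using elim(1) it B(2) \<eta>(1) by (intro mult_mono) (auto simp: y_def h_def)
          qed
          moreover have "\<bar>(b i t y - b i t z) / h - pd j (b i t) z\<bar> \<le> \<eta>"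
            using elim(2) it by (simp add: y_def h_def)
          moreover have "(\<Sum>l<m. (A i l t y - A i l t z) / h * w l t z) + (b i t y - b i t z) / h - bj j i t z
            = (\<Sum>l<m. ((A i l t y - A i l t z) / h - pd j (A i l t) z) * w l t z) + ((b i t y - b i t z) / h - pd j (b i t) z)"
            by (simp add: bj_def left_diff_distrib sum_subtractf)
          ultimately show "\<bar>(\<Sum>l<m. (A i l t y - A i l t z) / h * w l t z) + (b i t y - b i t z) / h - bj j i t z\<bar> \<le> ?\<epsilon>"
            by (simp add: algebra_simps)
          show "\<bar>D j z i t\<bar> \<le> B" by (rule B(1)[OF it])
          show "\<bar>A i l t y - A i l t z\<bar> \<le> ?\<epsilon>" if "l < m" for l
          proof -
            have "\<bar>A i l t y - A i l t z\<bar> \<le> \<eta>" using elim(4,5) it that by (simp add: y_def)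
            then show ?thesis using \<eta>\<epsilon> by linarith
          qed
          show "(D j z i has_real_derivative (\<Sum>l<m. A i l t z * D j z l t) + bj j i t z) (at t within {0..1})"
            by (rule D(2)[OF j z it])
        next
          fix i assume im: "i < m"
          have "\<bar>(w0 i (z(j := s)) - w0 i z) / (s - z j) - pd j (w0 i) z\<bar> \<le> \<eta>"
            using elim(3) im by auto
          then show "\<bar>(w i 0 y - w i 0 z) / h - D j z i 0\<bar> \<le> ?\<epsilon>"
            unfolding init[OF im y] init[OF im z] D(1)[OF j z im] unfolding y_def h_def
            using \<eta>\<epsilon> by linarith
        qed (use i t in auto)
        then show ?case using \<eta>(2) by (simp add: y_def h_def dist_real_def)
      qed
    qed
    show ?case
    proof (rule C_param_SucI[OF S, where g="\<lambda>j t z. D j z i t"])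
      show "continuous_on (S \<times> {0..1}) (\<lambda>(z, p). w i p z)"
        by (rule C_param_continuous[OF wr[OF Suc.prems(6)]])
      show "((\<lambda>s. w i t (z(j := s))) has_real_derivative D j z i t) (at (z j))"
        if "j < n" "t \<in> {0..1}" "z \<in> S" for j t z
        by (rule deriv[OF that Suc.prems(6)])
    qed (rule DC[OF _ Suc.prems(6)])
  }
qed

subsection \<open>Smooth dependence on parameters\<close>

lemma compact_closed_cube:
  fixes p :: "nat \<Rightarrow> real"
  shows "compact {x \<in> Rn m. \<forall>i<m. \<bar>x i - p i\<bar> \<le> \<rho>}"
proof -
  have "{x \<in> Rn m. \<forall>i<m. \<bar>x i - p i\<bar> \<le> \<rho>} = Pi\<^sub>E UNIV (\<lambda>i. if i < m then {p i - \<rho>..p i + \<rho>} else {0})"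
    by (auto simp: Rn_def PiE_iff abs_le_iff split: if_splits) (smt (verit))+
  moreover have "compactin (product_topology (\<lambda>i. euclideanreal) UNIV) (Pi\<^sub>E UNIV (\<lambda>i. if i < m then {p i - \<rho>..p i + \<rho>} else {0}))"
    by (subst compactin_PiE) auto
  ultimately show ?thesis
    by (simp add: euclidean_product_topology)
qed

lemma C_param_slice:
  fixes f :: "real \<Rightarrow> (nat \<Rightarrow> real) \<Rightarrow> real"
  assumes "S \<subseteq> Rn n" "p \<in> P" shows "C_param n P r S f \<Longrightarrow> C_times n r S (f p)"
proof (induction r arbitrary: f)
  case (0 f)
  have "continuous_on S (\<lambda>z. (\<lambda>(z, t). f t z) (z, p))"
    by (rule continuous_on_compose2[OF C_param_continuous[OF 0] continuous_on_Pair[OF continuous_on_id continuous_on_const]])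
      (use assms(2) in auto)
  then show ?case using assms by (simp add: continuous_map_Rn_iff)
next
  case (Suc r f)
  have "continuous_on S (\<lambda>z. (\<lambda>(z, t). f t z) (z, p))"
    by (rule continuous_on_compose2[OF C_param_continuous[OF Suc.prems] continuous_on_Pair[OF continuous_on_id continuous_on_const]])
      (use assms(2) in auto)
  then show ?case using assms Suc by (auto simp: continuous_map_Rn_iff)
qed

lemma derivative_limitI:
  fixes f :: "real \<Rightarrow> real"
  assumes "\<forall>\<^sub>F s in at a. \<bar>(f s - f a) / (s - a) - D\<bar> \<le> M * \<bar>s - a\<bar>"
  shows "(f has_real_derivative D) (at a)"
  unfolding has_field_derivative_iff
proof (rule LIM_zero_cancel, rule Lim_null_comparison)
  show "\<forall>\<^sub>F s in at a. norm ((f s - f a) / (s - a) - D) \<le> M * \<bar>s - a\<bar>" using assms by simp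
  have "((\<lambda>s. M * \<bar>s - a\<bar>) \<longlongrightarrow> M * \<bar>a - a\<bar>) (at a)" by (intro tendsto_intros)
  then show "((\<lambda>s. M * \<bar>s - a\<bar>) \<longlongrightarrow> 0) (at a)" by simp
qed

text \<open>Time-one flows of the fields with coefficients \<open>K v\<close>, started at the point
  z0 + A v. Smallness of v plays the part of short time, so time can be fixed to [0,1]. The last two
  conclusions are the initial value and the variational equation of the derivative in v, which the
  Frobenius theorem needs.\<close>

lemma flow_exists:
  fixes K :: "nat \<Rightarrow> nat \<Rightarrow> (nat \<Rightarrow> real) \<Rightarrow> real" and A :: "nat \<Rightarrow> nat \<Rightarrow> real" and N :: nat
  assumes S0: "openR N S0" "z0 \<in> S0" and K: "\<And>i j. i < N \<Longrightarrow> j < N \<Longrightarrow> C_infinity N S0 (K i j)"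
  obtains \<delta> u where "\<delta> > 0"
    "\<forall>v\<in>cube N (\<lambda>_. 0) \<delta>. \<forall>t\<in>{0..1}. u t v \<in> S0"
    "\<forall>v\<in>cube N (\<lambda>_. 0) \<delta>. \<forall>i<N. u 0 v i = z0 i + (\<Sum>j<N. A i j * v j)"
    "\<forall>v\<in>cube N (\<lambda>_. 0) \<delta>. \<forall>i<N. \<forall>t\<in>{0..1}.
      ((\<lambda>t. u t v i) has_real_derivative (\<Sum>j<N. K i j (u t v) * v j)) (at t within {0..1})"
    "\<forall>i<N. \<forall>r. C_param N {0..1} r (cube N (\<lambda>_. 0) \<delta>) (\<lambda>t v. u t v i)"
    "\<forall>v\<in>cube N (\<lambda>_. 0) \<delta>. \<forall>i<N. \<forall>q<N. pd q (\<lambda>v. u 0 v i) v = A i q"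
    "\<forall>v\<in>cube N (\<lambda>_. 0) \<delta>. \<forall>i<N. \<forall>q<N. \<forall>t\<in>{0..1}. ((\<lambda>t. pd q (\<lambda>v. u t v i) v) has_real_derivative
        (\<Sum>l<N. (\<Sum>j<N. pd l (K i j) (u t v) * v j) * pd q (\<lambda>v. u t v l) v) + K i q (u t v)) (at t within {0..1})"
proof -
  have z0R: "z0 \<in> Rn N" using S0 openR_subset by blast
  obtain r where r: "r > 0" "cube N z0 r \<subseteq> S0" using S0 by (rule openR_cubeE)
  \<comment> \<open>Two points of the box D of radius \<rho> differ by at most 2\<rho> in each
    coordinate, so the intermediate points of a mean value step from D lie in the box
    \<open>D3\<close> of radius 3\<rho>, still inside the cube of radius r.\<close>
  define \<rho> where "\<rho> = r / 4"
  have \<rho>: "\<rho> > 0" using r by (simp add: \<rho>_def)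
  define D where "D = {x \<in> Rn N. \<forall>i<N. \<bar>x i - z0 i\<bar> \<le> \<rho>}"
  define D3 where "D3 = {x \<in> Rn N. \<forall>i<N. \<bar>x i - z0 i\<bar> \<le> 3 * \<rho>}"
  have D3S: "D3 \<subseteq> S0"
  proof
    fix x assume x: "x \<in> D3"
    have "\<bar>x i - z0 i\<bar> < r" if "i < N" for i
    proof -
      have "\<bar>x i - z0 i\<bar> \<le> 3 * \<rho>" using x that by (simp add: D3_def)
      then show ?thesis using r(1) unfolding \<rho>_def by linarith
    qed
    then show "x \<in> S0" using x r(2) by (auto simp: D3_def cube_def)
  qed
  have DD3: "D \<subseteq> D3"
  proof
    fix x assume x: "x \<in> D"
    have "\<bar>x i - z0 i\<bar> \<le> 3 * \<rho>" if "i < N" for i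
    proof -
      have "\<bar>x i - z0 i\<bar> \<le> \<rho>" using x that by (simp add: D_def)
      then show ?thesis using \<rho> by linarith
    qed
    then show "x \<in> D3" using x by (auto simp: D_def D3_def)
  qed
  have z0D: "z0 \<in> D" using z0R \<rho> by (simp add: D_def)
  \<comment> \<open>Everything to be bounded on the compact \<open>D3\<close>: first derivatives of
    K control the flow, second derivatives the coefficients of the variational equation.\<close>
  define FF where "FF = (\<lambda>(i, j). K i j) ` ({..<N} \<times> {..<N}) \<union> (\<lambda>(i, j, l). pd l (K i j)) ` ({..<N} \<times> {..<N} \<times> {..<N})
    \<union> (\<lambda>(i, j, l, k). pd k (pd l (K i j))) ` ({..<N} \<times> {..<N} \<times> {..<N} \<times> {..<N})"
  have finF: "finite FF" by (auto simp: FF_def)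
  have sm1: "C_infinity N S0 (pd l (K i j))" if "i < N" "j < N" "l < N" for i j l
    using K that S0 smooth_partial by blast
  have sm2: "C_infinity N S0 (pd k (pd l (K i j)))" if "i < N" "j < N" "l < N" "k < N" for i j l k
    using sm1 that S0 smooth_partial by blast
  have FFs: "C_infinity N S0 f" if "f \<in> FF" for f
    using that K sm1 sm2 by (auto simp: FF_def)
  have "\<exists>C. \<forall>x\<in>D3. \<bar>f x\<bar> \<le> C" if "f \<in> FF" for f
  proof -
    have "continuous_on D3 f" using smooth_continuous[OF S0(1) FFs[OF that]] D3S continuous_on_subset by blast
    then have "compact (f ` D3)" unfolding D3_def by (rule compact_continuous_image[OF _ compact_closed_cube])
    then show ?thesis using compact_imp_bounded[of "f ` D3"] by (auto simp: bounded_iff)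
  qed
  then obtain c where c: "\<And>f x. f \<in> FF \<Longrightarrow> x \<in> D3 \<Longrightarrow> \<bar>f x\<bar> \<le> c f" by metis
  define C where "C = (\<Sum>f\<in>FF. \<bar>c f\<bar>)"
  have C0: "C \<ge> 0" by (auto simp: C_def sum_nonneg)
  have CF: "\<bar>f x\<bar> \<le> C" if "f \<in> FF" "x \<in> D3" for f x
    using c[OF that] member_le_sum[of f FF "\<lambda>f. \<bar>c f\<bar>"] that finF unfolding C_def by fastforce
  have C: "\<bar>K i j x\<bar> \<le> C" "\<bar>pd l (K i j) x\<bar> \<le> C" "\<bar>pd k (pd l (K i j)) x\<bar> \<le> C"
    if "i < N" "j < N" "l < N" "k < N" "x \<in> D3" for i j l k x
  proof -
    have "K i j \<in> FF" unfolding FF_def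
      by (rule UnI1, rule UnI1, rule image_eqI[of _ _ "(i, j)"]) (use that in auto)
    moreover have "pd l (K i j) \<in> FF" unfolding FF_def
      by (rule UnI1, rule UnI2, rule image_eqI[of _ _ "(i, j, l)"]) (use that in auto)
    moreover have "pd k (pd l (K i j)) \<in> FF" unfolding FF_def
      by (rule UnI2, rule image_eqI[of _ _ "(i, j, l, k)"]) (use that in auto)
    ultimately show "\<bar>K i j x\<bar> \<le> C" "\<bar>pd l (K i j) x\<bar> \<le> C" "\<bar>pd k (pd l (K i j)) x\<bar> \<le> C"
      using CF that(5) by blast+
  qed
  define a where "a = (\<Sum>i<N. \<Sum>j<N. \<bar>A i j\<bar>)"
  have a0: "a \<ge> 0" by (auto simp: a_def intro!: sum_nonneg)
  have aA: "(\<Sum>j<N. \<bar>A i j\<bar>) \<le> a" if "i < N" for i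
    unfolding a_def using that by (intro member_le_sum[of i "{..<N}" "\<lambda>i. \<Sum>j<N. \<bar>A i j\<bar>"]) (auto intro: sum_nonneg)
  define NC where "NC = real N * C"
  define NNC where "NNC = real N * (real N * C)"
  have NC0: "NC \<ge> 0" "NNC \<ge> 0" using C0 by (auto simp: NC_def NNC_def)
  \<comment> \<open>Q dominates all constants met below, and the summand 1 makes division by it
    harmless. The resulting \<delta> gives the \<rho>/4 bounds for the field and the initial
    displacement, and the Lipschitz constant 1/2 for both the flow and its variation.\<close>
  define Q where "Q = NC + NNC + a + 1"
  have Q1: "Q \<ge> 1" using NC0 a0 by (simp add: Q_def)
  define \<delta> where "\<delta> = min (\<rho> / 4) (1 / 2) / Q"
  have \<delta>: "\<delta> > 0" using \<rho> Q1 by (simp add: \<delta>_def)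
  have \<delta>Q: "\<delta> * Q \<le> \<rho> / 4" "\<delta> * Q \<le> 1 / 2" using Q1 by (auto simp: \<delta>_def)
  have \<delta>NC: "\<delta> * NC \<le> \<rho> / 4" "\<delta> * NNC \<le> 1 / 2" "\<delta> * a \<le> \<rho> / 4"
  proof -
    have "\<delta> * NC \<le> \<delta> * Q" "\<delta> * NNC \<le> \<delta> * Q" "\<delta> * a \<le> \<delta> * Q"
      by (intro mult_left_mono; use \<delta> NC0 a0 in \<open>simp add: Q_def\<close>)+
    then show "\<delta> * NC \<le> \<rho> / 4" "\<delta> * NNC \<le> 1 / 2" "\<delta> * a \<le> \<rho> / 4" using \<delta>Q by auto
  qed
  let ?B = "cube N (\<lambda>_. 0) \<delta>"
  have v\<delta>: "\<bar>v j\<bar> \<le> \<delta>" if "v \<in> ?B" "j < N" for v j using that by (auto simp: cube_def less_imp_le)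
  have mvt: "\<exists>\<xi>. (\<forall>l<N. \<xi> l \<in> D3 \<and> (\<forall>i<N. \<bar>\<xi> l i - x i\<bar> \<le> \<bar>y i - x i\<bar>)) \<and> f y - f x = (\<Sum>l<N. pd l f (\<xi> l) * (y l - x l))"
    if f: "C_infinity N S0 f" and x: "x \<in> D" and y: "y \<in> Rn N" "\<And>i. i < N \<Longrightarrow> \<bar>y i - x i\<bar> \<le> 2 * \<rho>" for f x y
  proof (rule mvt_telescope[of N D3 f "\<lambda>l. pd l f" x y])
    show "((\<lambda>t. f (x(j := t))) has_real_derivative pd j f x) (at (x j))" if "j < N" "x \<in> D3" for j x
      using smooth_has_partial[OF S0(1) f] that D3S by blast
    show "x \<in> Rn N" using x by (simp add: D_def)
    show "x' \<in> D3" if x': "x' \<in> Rn N" "\<forall>i<N. \<bar>x' i - x i\<bar> \<le> \<bar>y i - x i\<bar>" for x'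
    proof -
      have "\<bar>x' i - z0 i\<bar> \<le> 3 * \<rho>" if "i < N" for i
      proof -
        have "\<bar>x' i - x i\<bar> \<le> 2 * \<rho>" using x'(2) y(2)[OF that] that by fastforce
        moreover have "\<bar>x i - z0 i\<bar> \<le> \<rho>" using x that by (simp add: D_def)
        ultimately show ?thesis by linarith
      qed
      then show ?thesis using x'(1) by (simp add: D3_def)
    qed
  qed (use y in auto)
  have lip: "\<bar>f y - f x\<bar> \<le> NC * e"
    if f: "C_infinity N S0 f" and bd: "\<And>l x. l < N \<Longrightarrow> x \<in> D3 \<Longrightarrow> \<bar>pd l f x\<bar> \<le> C" and x: "x \<in> D" and y: "y \<in> Rn N" "\<And>i. i < N \<Longrightarrow> \<bar>y i - x i\<bar> \<le> 2 * \<rho>"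
      and e: "\<And>i. i < N \<Longrightarrow> \<bar>y i - x i\<bar> \<le> e" for f x y e
  proof -
    obtain \<xi> where \<xi>: "\<And>l. l < N \<Longrightarrow> \<xi> l \<in> D3" "f y - f x = (\<Sum>l<N. pd l f (\<xi> l) * (y l - x l))"
      using mvt[OF f x y] by blast
    have "\<bar>\<Sum>l<N. pd l f (\<xi> l) * (y l - x l)\<bar> \<le> (\<Sum>l<N. C * e)"
    proof (rule order_trans[OF sum_abs], rule sum_mono)
      fix l assume "l \<in> {..<N}"
      then have l: "l < N" by simp
      show "\<bar>pd l f (\<xi> l) * (y l - x l)\<bar> \<le> C * e" unfolding abs_mult
        by (rule mult_mono) (use bd[OF l \<xi>(1)[OF l]] e[OF l] C0 in auto)
    qed
    then show ?thesis unfolding \<xi>(2) by (simp add: NC_def)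
  qed
  have D2: "\<bar>y i - x i\<bar> \<le> 2 * \<rho>" if "x \<in> D" "y \<in> D" "i < N" for x y i
  proof -
    have "\<bar>x i - z0 i\<bar> \<le> \<rho>" "\<bar>y i - z0 i\<bar> \<le> \<rho>" using that by (auto simp: D_def)
    then show ?thesis by linarith
  qed
  have DR: "x \<in> Rn N" if "x \<in> D" for x using that by (simp add: D_def)
  define G where "G v x i = (\<Sum>j<N. K i j x * v j)" for v x i
  have lipG: "\<bar>G v x i - G v y i\<bar> \<le> e / 2"
    if v: "v \<in> ?B" and i: "i < N" and xy: "x \<in> D" "y \<in> D" "\<forall>j<N. \<bar>x j - y j\<bar> \<le> e" for v x y i e
  proof -
    have e0: "e \<ge> 0" using xy(3) i by force
    have "G v x i - G v y i = (\<Sum>j<N. (K i j x - K i j y) * v j)"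
      by (simp add: G_def sum_subtractf left_diff_distrib)
    also have "\<bar>\<dots>\<bar> \<le> (\<Sum>j<N. (NC * e) * \<delta>)"
    proof (rule order_trans[OF sum_abs], rule sum_mono)
      fix j assume "j \<in> {..<N}"
      then have j: "j < N" by simp
      have "\<bar>K i j x - K i j y\<bar> \<le> NC * e"
        by (rule lip[OF K[OF i j]]) (use C i j xy DR D2 in auto)
      then show "\<bar>(K i j x - K i j y) * v j\<bar> \<le> (NC * e) * \<delta>" unfolding abs_mult
        by (rule mult_mono) (use v\<delta>[OF v j] NC0 e0 in auto)
    qed
    also have "\<dots> = (\<delta> * NNC) * e" by (simp add: NC_def NNC_def)
    also have "\<dots> \<le> 1 / 2 * e" by (rule mult_right_mono[OF \<delta>NC(2) e0])
    finally show ?thesis by simp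
  qed
  have Kb: "\<bar>\<Sum>j<N. K i j x * h j\<bar> \<le> NC * e" if "i < N" "x \<in> D" "\<And>j. j < N \<Longrightarrow> \<bar>h j\<bar> \<le> e" for i x h e
  proof -
    have "\<bar>\<Sum>j<N. K i j x * h j\<bar> \<le> (\<Sum>j<N. C * e)"
    proof (rule order_trans[OF sum_abs], rule sum_mono)
      fix j assume "j \<in> {..<N}"
      then have j: "j < N" by simp
      show "\<bar>K i j x * h j\<bar> \<le> C * e" unfolding abs_mult
        by (rule mult_mono) (use C(1)[OF that(1) j j j] that DD3 C0 j in auto)
    qed
    then show ?thesis by (simp add: NC_def)
  qed
  have Ab: "\<bar>\<Sum>j<N. A i j * h j\<bar> \<le> a * e" if "i < N" "\<And>j. j < N \<Longrightarrow> \<bar>h j\<bar> \<le> e" for i h e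
  proof -
    have e0: "e \<ge> 0" using that by force
    have "\<bar>\<Sum>j<N. A i j * h j\<bar> \<le> (\<Sum>j<N. \<bar>A i j\<bar> * e)"
      by (rule order_trans[OF sum_abs], rule sum_mono) (use that in \<open>auto simp: abs_mult intro!: mult_left_mono\<close>)
    also have "\<dots> \<le> a * e" unfolding sum_distrib_right[symmetric] by (rule mult_right_mono[OF aA[OF that(1)] e0])
    finally show ?thesis .
  qed
  define sol where "sol v u \<longleftrightarrow> (\<forall>t\<in>{0..1}. u t \<in> D) \<and> (\<forall>i<N. u 0 i = z0 i + (\<Sum>j<N. A i j * v j)) \<and>
    (\<forall>i<N. \<forall>t\<in>{0..1}. ((\<lambda>t. u t i) has_real_derivative G v (u t) i) (at t within {0..1}))" for v u
  have ex: "\<exists>u. sol v u" if v: "v \<in> ?B" for v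
  proof (rule picard[OF D_def z0R, where G="\<lambda>t x i. G v x i" and ?w0.0="\<lambda>i. z0 i + (\<Sum>j<N. A i j * v j)"])
    show "continuous_on ({0..1} \<times> D) (\<lambda>(t, x). G v x i)" if "i < N" for i
    proof -
      have "continuous_on D (K i j)" if "j < N" for j
        using smooth_continuous[OF S0(1) K[OF \<open>i < N\<close> that]] DD3 D3S continuous_on_subset by blast
      then have "continuous_on D (\<lambda>x. G v x i)" unfolding G_def by (intro continuous_intros) auto
      then show ?thesis unfolding split_beta
        by (rule continuous_on_compose2[OF _ continuous_on_snd[OF continuous_on_id]]) auto
    qed
    show "\<bar>z0 i + (\<Sum>j<N. A i j * v j) - z0 i\<bar> \<le> \<rho> / 4" if "i < N" for i
    proof -
      have "\<bar>\<Sum>j<N. A i j * v j\<bar> \<le> a * \<delta>" by (rule Ab[OF that]) (rule v\<delta>[OF v])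
      then show ?thesis using \<delta>NC(3) by (simp add: mult.commute[of a])
    qed
    show "\<bar>G v z0 i\<bar> \<le> \<rho> / 4" if "i < N" for i
    proof -
      have "\<bar>\<Sum>j<N. K i j z0 * v j\<bar> \<le> NC * \<delta>" by (rule Kb[OF that z0D]) (rule v\<delta>[OF v])
      then show ?thesis using \<delta>NC(1) by (simp add: mult.commute[of NC] G_def)
    qed
    show "\<bar>G v x i - G v y i\<bar> \<le> c / 2" if "i < N" "x \<in> D" "y \<in> D" "\<forall>j<N. \<bar>x j - y j\<bar> \<le> c" for i x y c
      by (rule lipG[OF v that])
    fix u assume "\<And>t. t \<in> {0..1} \<Longrightarrow> u t \<in> D" "\<And>i. i < N \<Longrightarrow> u 0 i = z0 i + (\<Sum>j<N. A i j * v j)"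
      "\<And>i t. i < N \<Longrightarrow> t \<in> {0..1} \<Longrightarrow> ((\<lambda>t. u t i) has_real_derivative G v (u t) i) (at t within {0..1})"
    then show ?thesis unfolding sol_def by blast
  qed
  define u where "u t v = (SOME u. sol v u) t" for t v
  have sol: "sol v (\<lambda>t. u t v)" if "v \<in> ?B" for v
    using someI_ex[OF ex[OF that]] by (simp add: u_def)
  have uD: "u t v \<in> D" if "v \<in> ?B" "t \<in> {0..1}" for t v using sol[OF that(1)] that(2) by (simp add: sol_def)
  have u0: "u 0 v i = z0 i + (\<Sum>j<N. A i j * v j)" if "v \<in> ?B" "i < N" for v i using sol[OF that(1)] that(2) by (simp add: sol_def)
  have u': "((\<lambda>t. u t v i) has_real_derivative G v (u t v) i) (at t within {0..1})" if "v \<in> ?B" "i < N" "t \<in> {0..1}" for v i t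
    using sol[OF that(1)] that(2,3) by (simp add: sol_def)
  have uS: "u t v \<in> S0" if "v \<in> ?B" "t \<in> {0..1}" for t v using uD[OF that] DD3 D3S by blast
  have ulip: "\<bar>u t v' i - u t v i\<bar> \<le> 2 * Q * e"
    if v: "v \<in> ?B" "v' \<in> ?B" and e: "\<And>j. j < N \<Longrightarrow> \<bar>v' j - v j\<bar> \<le> e" and i: "i < N" "t \<in> {0..1}" for v v' e i t
  proof -
    have e0: "e \<ge> 0" using e[OF i(1)] by linarith
    have "\<bar>u t v' i - u t v i\<bar> \<le> 2 * (a * e + NC * e)"
    proof (rule half_lipschitz_bound[where m=N and \<phi>="\<lambda>i t. u t v' i - u t v i" and \<phi>'="\<lambda>i t. G v' (u t v') i - G v (u t v) i"])
      show "((\<lambda>t. u t v' i - u t v i) has_real_derivative G v' (u t v') i - G v (u t v) i) (at t within {0..1})"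
        if "i < N" "t \<in> {0..1}" for i t by (intro DERIV_diff u' v that)
      show "\<bar>u 0 v' i - u 0 v i\<bar> \<le> a * e" if "i < N" for i
      proof -
        have "u 0 v' i - u 0 v i = (\<Sum>j<N. A i j * (v' j - v j))"
          by (simp add: u0 v that sum_subtractf right_diff_distrib)
        then show ?thesis using Ab[OF that, of "\<lambda>j. v' j - v j" e] e by simp
      qed
      show "\<bar>G v' (u t v') i - G v (u t v) i\<bar> \<le> c / 2 + NC * e"
        if "i < N" "t \<in> {0..1}" "\<forall>j<N. \<bar>u t v' j - u t v j\<bar> \<le> c" for i t c
      proof -
        have "\<bar>G v' (u t v') i - G v' (u t v) i\<bar> \<le> c / 2"
          by (rule lipG[OF v(2) that(1) uD[OF v(2) that(2)] uD[OF v(1) that(2)] that(3)])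
        moreover have "G v' (u t v) i - G v (u t v) i = (\<Sum>j<N. K i j (u t v) * (v' j - v j))"
          by (simp add: G_def sum_subtractf right_diff_distrib)
        moreover have "\<bar>\<Sum>j<N. K i j (u t v) * (v' j - v j)\<bar> \<le> NC * e"
          by (rule Kb[OF that(1) uD[OF v(1) that(2)]]) (rule e)
        ultimately show ?thesis by linarith
      qed
    qed (use i in auto)
    also have "\<dots> \<le> 2 * Q * e" using e0 NC0 by (simp add: Q_def algebra_simps)
    finally show ?thesis .
  qed
  have cu: "continuous_on {0..1} (\<lambda>t. u t v i)" if "v \<in> ?B" for v i
  proof (cases "i < N")
    case True
    show ?thesis by (rule DERIV_continuous_on[OF u'[OF that True]])
  next
    case False
    show ?thesis
      by (rule continuous_on_eq[OF continuous_on_const[of _ 0]]) (use DR[OF uD[OF that]] False in \<open>auto simp: Rn_def\<close>)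
  qed
  have cF: "continuous_on {0..1} (\<lambda>t. f (u t v))" if "C_infinity N S0 f" "v \<in> ?B" for f v
    by (rule continuous_on_compose2[OF smooth_continuous[OF S0(1) that(1)] continuous_on_coordinatewise_then_product[OF cu[OF that(2)]]])
      (use uS[OF that(2)] in auto)
  define Ah where "Ah i l t v = (\<Sum>j<N. pd l (K i j) (u t v) * v j)" for i l t v
  have halfsum: "(\<Sum>l<N. \<bar>\<Sum>j<N. h l j * v j\<bar>) \<le> 1 / 2" if "\<And>l j. l < N \<Longrightarrow> j < N \<Longrightarrow> \<bar>h l j\<bar> \<le> C" "v \<in> ?B" for h :: "nat \<Rightarrow> nat \<Rightarrow> real" and v
  proof -
    have "(\<Sum>l<N. \<bar>\<Sum>j<N. h l j * v j\<bar>) \<le> (\<Sum>l<N. \<Sum>j<N. C * \<delta>)"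
    proof (rule sum_mono, rule order_trans[OF sum_abs], rule sum_mono)
      fix l j assume "l \<in> {..<N}" "j \<in> {..<N}"
      then show "\<bar>h l j * v j\<bar> \<le> C * \<delta>" unfolding abs_mult
        by (intro mult_mono) (use that v\<delta> C0 in auto)
    qed
    also have "\<dots> = \<delta> * NNC" by (simp add: NNC_def)
    finally show ?thesis using \<delta>NC(2) by linarith
  qed
  have Ahalf: "(\<Sum>l<N. \<bar>Ah i l t v\<bar>) \<le> 1 / 2" if "v \<in> ?B" "i < N" "t \<in> {0..1}" for i t v
    unfolding Ah_def
    by (rule halfsum[OF _ that(1)]) (use C(2) that uD DD3 in blast)
  \<comment> \<open>The candidate for the derivative of u in \<open>v q\<close>: a solution of the
    variational equation. That it is the derivative is shown in \<open>du\<close>.\<close>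
  define wsol where "wsol q v w \<longleftrightarrow> (\<forall>i<N. w i 0 = A i q) \<and>
    (\<forall>i<N. \<forall>t\<in>{0..1}. (w i has_real_derivative (\<Sum>l<N. Ah i l t v * w l t) + K i q (u t v)) (at t within {0..1}))" for q v w
  have wex: "\<exists>w. wsol q v w" if v: "v \<in> ?B" and q: "q < N" for q v
  proof (rule linear_ode_exists[where m=N and A="\<lambda>i l t. Ah i l t v" and b="\<lambda>i t. K i q (u t v)" and ?w0.0="\<lambda>i. A i q"])
    show "continuous_on {0..1} (\<lambda>t. Ah i l t v)" if "i < N" "l < N" for i l
      unfolding Ah_def using cF[OF sm1 v] that by (intro continuous_intros) auto
    show "continuous_on {0..1} (\<lambda>t. K i q (u t v))" if "i < N" for i
      by (rule cF[OF K[OF that q] v])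
    fix w assume "\<And>i. i < N \<Longrightarrow> w i 0 = A i q" "\<And>i t. i < N \<Longrightarrow> t \<in> {0..1} \<Longrightarrow>
      (w i has_real_derivative (\<Sum>l<N. Ah i l t v * w l t) + K i q (u t v)) (at t within {0..1})"
    then show ?thesis by (intro exI[of _ w]) (simp add: wsol_def)
  qed (use Ahalf[OF v] in auto)
  define w where "w q v = (SOME w. wsol q v w)" for q v
  have wsol: "wsol q v (w q v)" if "v \<in> ?B" "q < N" for q v
    unfolding w_def by (rule someI_ex[OF wex[OF that]])
  have w0: "w q v i 0 = A i q" if "v \<in> ?B" "q < N" "i < N" for q v i using wsol[OF that(1,2)] that(3) by (simp add: wsol_def)
  have w': "(w q v i has_real_derivative (\<Sum>l<N. Ah i l t v * w q v l t) + K i q (u t v)) (at t within {0..1})"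
    if "v \<in> ?B" "q < N" "i < N" "t \<in> {0..1}" for q v i t using wsol[OF that(1,2)] that(3,4) by (simp add: wsol_def)
  have du: "((\<lambda>s. u t (v(q := s)) i) has_real_derivative w q v i t) (at (v q))"
    if v: "v \<in> ?B" and q: "q < N" and i: "i < N" and t: "t \<in> {0..1}" for v q i t
  proof -
    have "\<exists>B. \<forall>t\<in>{0..1}. \<bar>w q v i t\<bar> \<le> B" if "i < N" for i
    proof -
      have "continuous_on {0..1} (w q v i)" by (rule DERIV_continuous_on[OF w'[OF v q that]])
      then show ?thesis
        using compact_imp_bounded[OF compact_continuous_image[of "{0..1}" "w q v i"]] by (auto simp: bounded_iff)
    qed
    then obtain B' where B': "\<And>i t. i < N \<Longrightarrow> t \<in> {0..1} \<Longrightarrow> \<bar>w q v i t\<bar> \<le> B' i" by metis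
    define B where "B = (\<Sum>i<N. \<bar>B' i\<bar>)"
    have B: "\<bar>w q v i t\<bar> \<le> B" if "i < N" "t \<in> {0..1}" for i t
      using B'[OF that] member_le_sum[of i "{..<N}" "\<lambda>i. \<bar>B' i\<bar>"] that unfolding B_def by fastforce
    have "\<forall>\<^sub>F s in at (v q). v(q := s) \<in> ?B"
      using openR_line[OF openR_cube v q] by (rule eventually_nhds_imp_at)
    moreover have "\<forall>\<^sub>F s in at (v q). s \<noteq> v q" by (simp add: eventually_at_filter)
    ultimately have "\<forall>\<^sub>F s in at (v q). \<bar>(u t (v(q := s)) i - u t (v(q := v q)) i) / (s - v q) - w q v i t\<bar>
      \<le> ((4 + 2 * real N * B) * (2 * Q * Q)) * \<bar>s - v q\<bar>"
    proof eventually_elim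
      case (elim s)
      define v' where "v' = v(q := s)"
      define h where "h = s - v q"
      have h: "h \<noteq> 0" using elim by (simp add: h_def)
      have v': "v' \<in> ?B" using elim by (simp add: v'_def)
      have v'j: "v' j = v j + (if j = q then h else 0)" for j by (simp add: v'_def h_def)
      let ?e = "2 * Q * \<bar>h\<bar>"
      have ue: "\<bar>u t v' i - u t v i\<bar> \<le> ?e" if "i < N" "t \<in> {0..1}" for i t
        by (rule ulip[OF v v' _ that]) (simp add: v'j)
      \<comment> \<open>Intermediate points for the increments of K. They are chosen separately for
        each t; this is admissible because the perturbed matrix in the comparison below enters only
        through bounds.\<close>
      define P where "P i j t \<xi> \<longleftrightarrow> (\<forall>l<N. \<xi> l \<in> D3 \<and> (\<forall>k<N. \<bar>\<xi> l k - u t v k\<bar> \<le> \<bar>u t v' k - u t v k\<bar>)) \<and>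
          K i j (u t v') - K i j (u t v) = (\<Sum>l<N. pd l (K i j) (\<xi> l) * (u t v' l - u t v l))" for i j t \<xi>
      define \<xi> where "\<xi> i j t = (SOME \<xi>. P i j t \<xi>)" for i j t
      have "P i j t (\<xi> i j t)" if "i < N" "j < N" "t \<in> {0..1}" for i j t
      proof -
        have "\<exists>\<xi>. P i j t \<xi>" unfolding P_def
          by (rule mvt[OF K[OF that(1,2)] uD[OF v that(3)]]) (use uD v v' that DR D2 in blast)+
        then show ?thesis unfolding \<xi>_def by (rule someI_ex)
      qed
      then have \<xi>0: "i < N \<and> j < N \<and> t \<in> {0..1} \<longrightarrow> (\<forall>l<N. \<xi> i j t l \<in> D3 \<and> (\<forall>k<N. \<bar>\<xi> i j t l k - u t v k\<bar> \<le> \<bar>u t v' k - u t v k\<bar>)) \<and>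
          K i j (u t v') - K i j (u t v) = (\<Sum>l<N. pd l (K i j) (\<xi> i j t l) * (u t v' l - u t v l))" for i j t
        unfolding P_def by blast
      have \<xi>: "\<xi> i j t l \<in> D3" "k < N \<Longrightarrow> \<bar>\<xi> i j t l k - u t v k\<bar> \<le> \<bar>u t v' k - u t v k\<bar>"
        if "i < N" "j < N" "t \<in> {0..1}" "l < N" for i j t l k
        using \<xi>0[of i j t] that by blast+
      have \<xi>eq: "K i j (u t v') - K i j (u t v) = (\<Sum>l<N. pd l (K i j) (\<xi> i j t l) * (u t v' l - u t v l))"
        if "i < N" "j < N" "t \<in> {0..1}" for i j t
        using \<xi>0[of i j t] that by blast
      have "\<bar>(u t v' i - u t v i) / h - w q v i t\<bar> \<le> (4 + 2 * real N * B) * (2 * Q * Q * \<bar>h\<bar>)"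
      proof (rule linear_ode_perturb[where v="\<lambda>i t. (u t v' i - u t v i) / h" and w="\<lambda>i t. w q v i t" and
          ?A1.0="\<lambda>i l t. \<Sum>j<N. pd l (K i j) (\<xi> i j t l) * v j" and ?A0.0="\<lambda>i l t. Ah i l t v"
          and ?b1.0="\<lambda>i t. K i q (u t v')" and ?b0.0="\<lambda>i t. K i q (u t v)"])
        fix i t assume it: "i < N" "t \<in> {0..1::real}"
        have "((\<lambda>t. (u t v' i - u t v i) / h) has_real_derivative (G v' (u t v') i - G v (u t v) i) / h) (at t within {0..1})"
          by (intro DERIV_cdivide DERIV_diff u' it v v')
        also have "G v' (u t v') i - G v (u t v) i = (\<Sum>j<N. (K i j (u t v') - K i j (u t v)) * v j) + h * K i q (u t v')"
        proof -
          have "(\<Sum>j<N. K i j (u t v') * (if j = q then h else 0)) = h * K i q (u t v')"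
            using q by (simp add: if_distrib[of "\<lambda>x. _ * x"] sum.delta cong: if_cong)
          then show ?thesis
            by (simp add: G_def v'j distrib_left sum.distrib left_diff_distrib sum_subtractf)
        qed
        also have "(\<Sum>j<N. (K i j (u t v') - K i j (u t v)) * v j) =
          (\<Sum>j<N. \<Sum>l<N. pd l (K i j) (\<xi> i j t l) * (u t v' l - u t v l) * v j)"
          by (rule sum.cong) (use \<xi>eq it in \<open>auto simp: sum_distrib_right\<close>)
        also have "\<dots> = (\<Sum>l<N. (\<Sum>j<N. pd l (K i j) (\<xi> i j t l) * v j) * (u t v' l - u t v l))"
          by (subst sum.swap) (simp add: sum_distrib_right sum_distrib_left mult_ac)
        finally show "((\<lambda>t. (u t v' i - u t v i) / h) has_real_derivative
          (\<Sum>l<N. (\<Sum>j<N. pd l (K i j) (\<xi> i j t l) * v j) * ((u t v' l - u t v l) / h)) + K i q (u t v')) (at t within {0..1})"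
          using h by (simp add: add_divide_distrib sum_divide_distrib)
        show "(w q v i has_real_derivative (\<Sum>l<N. Ah i l t v * w q v l t) + K i q (u t v)) (at t within {0..1})"
          by (rule w'[OF v q it])
        show "(\<Sum>l<N. \<bar>\<Sum>j<N. pd l (K i j) (\<xi> i j t l) * v j\<bar>) \<le> 1 / 2"
          by (rule halfsum[OF _ v]) (use C(2) it \<xi>(1) in blast)
        show "\<bar>w q v i t\<bar> \<le> B" by (rule B[OF it])
        have "\<bar>K i q (u t v') - K i q (u t v)\<bar> \<le> NC * ?e"
          by (rule lip[OF K[OF it(1) q] C(2)[OF it(1) q _ q] uD[OF v it(2)] DR[OF uD[OF v' it(2)]]])
            (use D2[OF uD[OF v it(2)] uD[OF v' it(2)]] ue it(2) in auto)
        also have "\<dots> \<le> Q * ?e" using NC0 a0 Q1 by (intro mult_right_mono) (auto simp: Q_def)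
        finally show "\<bar>K i q (u t v') - K i q (u t v)\<bar> \<le> 2 * Q * Q * \<bar>h\<bar>" by (simp add: mult_ac)
        show "\<bar>(\<Sum>j<N. pd l (K i j) (\<xi> i j t l) * v j) - Ah i l t v\<bar> \<le> 2 * Q * Q * \<bar>h\<bar>" if l: "l < N" for l
        proof -
          have "(\<Sum>j<N. pd l (K i j) (\<xi> i j t l) * v j) - Ah i l t v
            = (\<Sum>j<N. (pd l (K i j) (\<xi> i j t l) - pd l (K i j) (u t v)) * v j)"
            by (simp add: Ah_def sum_subtractf left_diff_distrib)
          also have "\<bar>\<dots>\<bar> \<le> (\<Sum>j<N. (NC * ?e) * \<delta>)"
          proof (rule order_trans[OF sum_abs], rule sum_mono)
            fix j assume "j \<in> {..<N}"
            then have j: "j < N" by simp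
            have 1: "\<bar>\<xi> i j t l k - u t v k\<bar> \<le> \<bar>u t v' k - u t v k\<bar>" if "k < N" for k
              by (rule \<xi>(2)[OF it(1) j it(2) l that])
            have "\<bar>pd l (K i j) (\<xi> i j t l) - pd l (K i j) (u t v)\<bar> \<le> NC * ?e"
            proof (rule lip[OF sm1[OF it(1) j l] C(3)[OF it(1) j l] uD[OF v it(2)]])
              show "\<xi> i j t l \<in> Rn N" using \<xi>(1)[OF it(1) j it(2) l] by (simp add: D3_def)
              show "\<bar>\<xi> i j t l k - u t v k\<bar> \<le> 2 * \<rho>" if "k < N" for k
                using 1[OF that] D2[OF uD[OF v it(2)] uD[OF v' it(2)] that] by linarith
              show "\<bar>\<xi> i j t l k - u t v k\<bar> \<le> ?e" if "k < N" for k
                using 1[OF that] ue[OF that it(2)] by linarith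
            qed
            then show "\<bar>(pd l (K i j) (\<xi> i j t l) - pd l (K i j) (u t v)) * v j\<bar> \<le> (NC * ?e) * \<delta>"
              unfolding abs_mult by (rule mult_mono) (use v\<delta>[OF v j] NC0 Q1 in auto)
          qed
          also have "\<dots> = (\<delta> * NNC) * ?e" by (simp add: NC_def NNC_def)
          also have "\<dots> \<le> Q * ?e" using \<delta>NC(2) Q1 by (intro mult_right_mono) auto
          finally show ?thesis by (simp add: mult_ac)
        qed
      next
        fix i assume im: "i < N"
        have "u 0 v' i - u 0 v i = (\<Sum>j<N. A i j * (if j = q then h else 0))"
          unfolding u0[OF v im] u0[OF v' im] by (simp add: v'j distrib_left sum.distrib)
        also have "\<dots> = A i q * h" using q by (simp add: if_distrib[of "\<lambda>x. _ * x"] sum.delta cong: if_cong)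
        finally show "\<bar>(u 0 v' i - u 0 v i) / h - w q v i 0\<bar> \<le> 2 * Q * Q * \<bar>h\<bar>"
          using h Q1 by (simp add: w0[OF v q im])
      qed (use i t in auto)
      then show ?case by (simp add: v'_def h_def mult.assoc)
    qed
    then show ?thesis by (rule derivative_limitI[of "\<lambda>s. u t (v(q := s)) i" "v q"])
  qed
  \<comment> \<open>Bootstrapping: if u has order r, so have the coefficients of the variational
    equation, hence its solution w by \<open>linear_ode_smooth\<close>; being the derivative of u,
    it gives order r + 1.\<close>
  have Cu: "\<forall>i<N. C_param N {0..1} r ?B (\<lambda>t v. u t v i)" for r
  proof (induction r)
    case 0
    have "continuous_on (?B \<times> {0..1}) (\<lambda>(v, t). u t v i)" if i: "i < N" for i
    proof (rule joint_continuityI)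
      fix v and e :: real assume v: "v \<in> ?B" and e: "e > 0"
      define \<eta> where "\<eta> = e / (2 * Q)"
      have \<eta>: "\<eta> > 0" "2 * Q * \<eta> = e" using e Q1 by (auto simp: \<eta>_def)
      have "\<forall>\<^sub>F v' in nhds v. \<forall>j\<in>{..<N}. \<bar>v' j - v j\<bar> < \<eta>"
      proof (intro eventually_ball_finite ballI)
        fix j
        have "((\<lambda>x. x) \<longlongrightarrow> v) (nhds v)" by (simp add: filterlim_ident)
        moreover have "isCont (\<lambda>x :: nat \<Rightarrow> real. x j) v"
        proof -
          have "continuous_on UNIV (\<lambda>x :: nat \<Rightarrow> real. x j)" by (rule continuous_on_product_coordinates)
          then show ?thesis using continuous_on_eq_continuous_at[OF open_UNIV, of "\<lambda>x :: nat \<Rightarrow> real. x j"] by simp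
        qed
        ultimately have "((\<lambda>x. x j) \<longlongrightarrow> v j) (nhds v)" by (rule isCont_tendsto_compose[rotated])
        from tendstoD[OF this \<eta>(1)] show "\<forall>\<^sub>F v' in nhds v. \<bar>v' j - v j\<bar> < \<eta>" by (simp add: dist_real_def)
      qed simp
      then show "\<forall>\<^sub>F v' in nhds v. v' \<in> ?B \<longrightarrow> (\<forall>t\<in>{0..1}. \<bar>u t v' i - u t v i\<bar> \<le> e)"
      proof eventually_elim
        case (elim v')
        show ?case
        proof (intro impI ballI)
          fix t :: real assume "v' \<in> ?B" "t \<in> {0..1}"
          then have "\<bar>u t v' i - u t v i\<bar> \<le> 2 * Q * \<eta>"
            by (intro ulip[OF v]) (use elim i in \<open>auto simp: less_imp_le\<close>)
          then show "\<bar>u t v' i - u t v i\<bar> \<le> e" using \<eta> by simp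
        qed
      qed
    qed (rule cu)
    then show ?case by simp
  next
    case (Suc r)
    show ?case
    proof (intro allI impI)
      fix i assume i: "i < N"
      have comp: "C_param N {0..1} r ?B (\<lambda>t v. f (u t v))" if "C_infinity N S0 f" for f
        by (rule C_param_compose[OF S0(1) openR_cube smooth_param[OF S0(1) that]]) (use Suc uS in auto)
      show "C_param N {0..1} (Suc r) ?B (\<lambda>t v. u t v i)"
      proof (rule C_param_SucI[OF openR_cube, where g="\<lambda>q t v. w q v i t"])
        show "continuous_on (?B \<times> {0..1}) (\<lambda>(z, p). u p z i)"
          using C_param_continuous[of N "{0..1}" r ?B "\<lambda>t v. u t v i"] Suc i by simp
        show "((\<lambda>s. u t (v(q := s)) i) has_real_derivative w q v i t) (at (v q))" if "q < N" "t \<in> {0..1}" "v \<in> ?B" for q t v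
          by (rule du[OF that(3,1) i that(2)])
        show "C_param N {0..1} r ?B (\<lambda>t v. w q v i t)" if q: "q < N" for q
        proof (rule linear_ode_smooth[where m=N and A=Ah and b="\<lambda>i t v. K i q (u t v)" and ?w0.0="\<lambda>i v. A i q" and w="\<lambda>i t v. w q v i t"])
          show "C_param N {0..1} r ?B (Ah i l)" if "i < N" "l < N" for i l
          proof -
            have "C_param N {0..1} r ?B (\<lambda>t v. \<Sum>j<N. pd l (K i j) (u t v) * v j)"
              using that by (intro C_param_sum C_param_mult C_param_coord openR_cube comp[OF sm1]) auto
            then show ?thesis by (simp add: Ah_def[abs_def])
          qed
          show "C_param N {0..1} r ?B (\<lambda>t v. K i q (u t v))" if "i < N" for i
            by (rule comp[OF K[OF that q]])
          show "C_param N {0..1} r ?B (\<lambda>t v. A i q)" for i by (rule C_param_const) auto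
        qed (use Ahalf w0 w' q i in auto)
      qed
    qed
  qed
  have pdu: "pd q (\<lambda>v. u t v i) v = w q v i t" if "v \<in> ?B" "q < N" "i < N" "t \<in> {0..1}" for v q i t
    by (rule partial_derivI[OF du[OF that]])
  have dw: "((\<lambda>t. pd q (\<lambda>v. u t v i) v) has_real_derivative
        (\<Sum>l<N. (\<Sum>j<N. pd l (K i j) (u t v) * v j) * pd q (\<lambda>v. u t v l) v) + K i q (u t v)) (at t within {0..1})"
    if "v \<in> ?B" "i < N" "q < N" "t \<in> {0..1}" for v i q t
  proof -
    have "((\<lambda>t. pd q (\<lambda>v. u t v i) v) has_real_derivative (\<Sum>l<N. Ah i l t v * w q v l t) + K i q (u t v)) (at t within {0..1})"
      by (rule has_real_derivative_transform[OF that(4) _ w'[OF that(1,3,2,4)]]) (use pdu that in simp)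
    then show ?thesis using pdu that by (simp add: Ah_def)
  qed
  have u'': "((\<lambda>t. u t v i) has_real_derivative (\<Sum>j<N. K i j (u t v) * v j)) (at t within {0..1})" if "v \<in> ?B" "i < N" "t \<in> {0..1}" for v i t
    using u'[OF that] by (simp add: G_def)
  have "pd q (\<lambda>v. u 0 v i) v = A i q" if "v \<in> ?B" "i < N" "q < N" for v i q
    using pdu[OF that(1,3,2), of 0] w0[OF that(1,3,2)] by simp
  then show thesis
    by (intro that[of \<delta> u] ballI allI impI) (use \<delta> uS u0 u'' Cu dw in blast)+
qed

subsection \<open>The inverse function theorem\<close>

lemma constant_derivative_increment:
  fixes f :: "real \<Rightarrow> real"
  assumes "\<And>t. t \<in> {0..1} \<Longrightarrow> (f has_real_derivative c) (at t within {0..1})"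
  shows "f 1 = f 0 + c"
proof -
  have "((\<lambda>t. f t - c * t) has_real_derivative 0) (at t within {0..1})" if "t \<in> {0..1}" for t
  proof -
    have "((\<lambda>t. f t - c * t) has_real_derivative c - c * 1) (at t within {0..1})"
      by (intro DERIV_diff assms[OF that] DERIV_cmult DERIV_ident)
    then show ?thesis by simp
  qed
  then obtain d where "\<And>t. t \<in> {0..1} \<Longrightarrow> f t - c * t = d"
    using has_field_derivative_zero_constant[of "{0..1}" "\<lambda>t. f t - c * t"] by auto
  from this[of 0] this[of 1] show ?thesis by simp
qed

lemma sum_delta_mult: "i < (N::nat) \<Longrightarrow> (\<Sum>j<N. (if i = j then 1 else 0) * f j) = (f i :: real)"
  by (simp add: if_distrib[of "\<lambda>x. x * _"] cong: if_cong)

text \<open>Follow the field given by the inverse Jacobian applied to a fixed v, starting at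
  \<open>z0\<close>. Along it f moves with constant velocity v, so the time-one point is sent to f
  z0 + v.\<close>

lemma smooth_right_inverse:
  fixes f :: "(nat \<Rightarrow> real) \<Rightarrow> nat \<Rightarrow> real" and N :: nat
  assumes S: "openR N S" "z0 \<in> S" and f: "\<And>i. i < N \<Longrightarrow> C_infinity N S (\<lambda>x. f x i)" "\<And>x. x \<in> S \<Longrightarrow> f x \<in> Rn N"
    and inj: "\<And>\<xi>. (\<forall>i<N. (\<Sum>j<N. pd j (\<lambda>x. f x i) z0 * \<xi> j) = 0) \<Longrightarrow> (\<forall>j<N. \<xi> j = 0)"
  obtains \<delta> g where "\<delta> > 0" "\<And>i. i < N \<Longrightarrow> C_infinity N (cube N (f z0) \<delta>) (\<lambda>y. g y i)"
    "\<And>y. y \<in> cube N (f z0) \<delta> \<Longrightarrow> g y \<in> S" "\<And>y. y \<in> cube N (f z0) \<delta> \<Longrightarrow> f (g y) = y" "g (f z0) = z0"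
proof -
  obtain r K where r: "r > 0" "cube N z0 r \<subseteq> S" and K: "\<And>i j. i < N \<Longrightarrow> j < N \<Longrightarrow> C_infinity N (cube N z0 r) (K i j)"
    and KM: "\<And>z i j. z \<in> cube N z0 r \<Longrightarrow> i < N \<Longrightarrow> j < N \<Longrightarrow> (\<Sum>l<N. K i l z * pd j (\<lambda>x. f x l) z) = (if i = j then 1 else 0)"
    and MK: "\<And>z i j. z \<in> cube N z0 r \<Longrightarrow> i < N \<Longrightarrow> j < N \<Longrightarrow> (\<Sum>l<N. pd l (\<lambda>x. f x i) z * K l j z) = (if i = j then 1 else 0)"
    using smooth_matrix_inverse[where n=N and N=N and M="\<lambda>i j. pd j (\<lambda>x. f x i)", OF S smooth_partial[OF S(1) f(1)] inj] by blast
  have z0: "z0 \<in> cube N z0 r" using S r openR_subset cube_self by blast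
  have z0R: "z0 \<in> Rn N" using z0 cube_subset_Rn by blast
  obtain \<delta> u where \<delta>: "\<delta> > 0" and uS: "\<forall>v\<in>cube N (\<lambda>_. 0) \<delta>. \<forall>t\<in>{0..1}. u t v \<in> cube N z0 r"
    and u0: "\<forall>v\<in>cube N (\<lambda>_. 0) \<delta>. \<forall>i<N. u 0 v i = z0 i + (\<Sum>j<N. 0 * v j)"
    and u': "\<forall>v\<in>cube N (\<lambda>_. 0) \<delta>. \<forall>i<N. \<forall>t\<in>{0..1}.
      ((\<lambda>t. u t v i) has_real_derivative (\<Sum>j<N. K i j (u t v) * v j)) (at t within {0..1})"
    and Cu: "\<forall>i<N. \<forall>r. C_param N {0..1} r (cube N (\<lambda>_. 0) \<delta>) (\<lambda>t v. u t v i)"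
    and w0: "\<forall>v\<in>cube N (\<lambda>_. 0) \<delta>. \<forall>i<N. \<forall>q<N. pd q (\<lambda>v. u 0 v i) v = 0"
    and w': "\<forall>v\<in>cube N (\<lambda>_. 0) \<delta>. \<forall>i<N. \<forall>q<N. \<forall>t\<in>{0..1}. ((\<lambda>t. pd q (\<lambda>v. u t v i) v) has_real_derivative
        (\<Sum>l<N. (\<Sum>j<N. pd l (K i j) (u t v) * v j) * pd q (\<lambda>v. u t v l) v) + K i q (u t v)) (at t within {0..1})"
    by (rule flow_exists[where A="\<lambda>_ _. 0", OF openR_cube z0 K])
  note uS = uS[rule_format] and u0 = u0[rule_format] and u' = u'[rule_format] and Cu = Cu[rule_format]
  have u00: "u 0 v = z0" if "v \<in> cube N (\<lambda>_. 0) \<delta>" for v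
    using uS[OF that, of 0] u0[OF that] by (intro Rn_eqI[of _ N]) (auto simp: cube_def z0R)
  have fu: "f (u 1 v) i = f z0 i + v i" if v: "v \<in> cube N (\<lambda>_. 0) \<delta>" and i: "i < N" for v i
  proof -
    have "f (u 1 v) i = f (u 0 v) i + v i"
    proof (rule constant_derivative_increment[of "\<lambda>t. f (u t v) i"])
      fix t :: real assume t: "t \<in> {0..1}"
      have "((\<lambda>t. f (u t v) i) has_real_derivative (\<Sum>l<N. pd l (\<lambda>x. f x i) (u t v) * (\<Sum>j<N. K l j (u t v) * v j))) (at t within {0..1})"
      proof (rule smooth_chain_curve[OF S(1) f(1)[OF i]])
        show "u t v \<in> S" using uS[OF v t] r by blast
        show "\<forall>\<^sub>F t in at t within {0..1}. u t v \<in> Rn N"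
          unfolding eventually_at_filter by (rule always_eventually) (use uS[OF v] cube_subset_Rn in blast)
      qed (rule u'[OF v _ t])
      also have "(\<Sum>l<N. pd l (\<lambda>x. f x i) (u t v) * (\<Sum>j<N. K l j (u t v) * v j))
          = (\<Sum>j<N. (\<Sum>l<N. pd l (\<lambda>x. f x i) (u t v) * K l j (u t v)) * v j)"
        unfolding sum_distrib_left sum_distrib_right by (subst sum.swap) (simp add: mult.assoc)
      also have "\<dots> = (\<Sum>j<N. (if i = j then 1 else 0) * v j)"
        by (rule sum.cong) (use MK[OF uS[OF v t] i] in auto)
      also have "\<dots> = v i" by (rule sum_delta_mult[OF i])
      finally show "((\<lambda>t. f (u t v) i) has_real_derivative v i) (at t within {0..1})" .
    qed
    then show ?thesis by (simp add: u00[OF v])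
  qed
  have fz0: "f z0 \<in> Rn N" using f(2) S by blast
  define sh where "sh y i = y i - f z0 i" for y i
  have sh: "sh y \<in> cube N (\<lambda>_. 0) \<delta>" if "y \<in> cube N (f z0) \<delta>" for y
    using that fz0 by (auto simp: sh_def cube_def Rn_def)
  define g where "g y = u 1 (sh y)" for y
  show thesis
  proof (rule that[OF \<delta>, of g])
    show "C_infinity N (cube N (f z0) \<delta>) (\<lambda>y. g y i)" if i: "i < N" for i
    proof -
      have "C_infinity N (cube N (\<lambda>_. 0) \<delta>) (\<lambda>v. u 1 v i)"
        unfolding C_infinity_def using C_param_slice[OF cube_subset_Rn _ Cu[OF i], of 1] by auto
      then show ?thesis unfolding g_def
        by (rule smooth_compose[OF openR_cube openR_cube]) (auto simp: sh_def[abs_def] sh intro!: smooth_diff smooth_coord smooth_const sh[unfolded sh_def[abs_def]])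
    qed
    show "g y \<in> S" if "y \<in> cube N (f z0) \<delta>" for y using uS[OF sh[OF that], of 1] r by (auto simp: g_def)
    then show "f (g y) = y" if "y \<in> cube N (f z0) \<delta>" for y
      using fu[OF sh[OF that]] f(2) that by (intro Rn_eqI[of _ N]) (auto simp: g_def sh_def cube_def)
    have 0: "f z0 \<in> cube N (f z0) \<delta>" using \<delta> fz0 by (rule cube_self)
    have "u 1 (sh (f z0)) i = z0 i" if i: "i < N" for i
    proof -
      have "u 1 (sh (f z0)) i = u 0 (sh (f z0)) i + 0"
        by (rule constant_derivative_increment[of "\<lambda>t. u t (sh (f z0)) i"])
          (use u'[OF sh[OF 0] i] in \<open>simp add: sh_def\<close>)
      then show ?thesis by (simp add: u00[OF sh[OF 0]])
    qed
    then show "g (f z0) = z0"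
      using uS[OF sh[OF 0], of 1] z0R by (intro Rn_eqI[of _ N]) (auto simp: g_def cube_def)
  qed
qed

lemma right_inverse_jacobian:
  fixes f g :: "(nat \<Rightarrow> real) \<Rightarrow> nat \<Rightarrow> real" and N :: nat
  assumes S: "openR N S" and T: "openR N T"
    and f: "\<And>i. i < N \<Longrightarrow> C_infinity N S (\<lambda>x. f x i)" and g: "\<And>i. i < N \<Longrightarrow> C_infinity N T (\<lambda>y. g y i)"
    and gS: "\<And>y. y \<in> T \<Longrightarrow> g y \<in> S" and fg: "\<And>y. y \<in> T \<Longrightarrow> f (g y) = y" and y: "y \<in> T" and ij: "i < N" "j < N"
  shows "(\<Sum>l<N. pd l (\<lambda>x. f x i) (g y) * pd j (\<lambda>y. g y l) y) = (if i = j then 1 else 0)"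
proof -
  have "(\<Sum>l<N. pd l (\<lambda>x. f x i) (g y) * pd j (\<lambda>y. g y l) y) = pd j (\<lambda>y. f (g y) i) y"
    by (rule partial_chain[OF S T f g gS y, symmetric]) (use ij in auto)
  also have "\<dots> = pd j (\<lambda>y. y i) y"
    by (rule partial_deriv_cong[OF T y ij(2)]) (simp add: fg)
  finally show ?thesis by (simp add: partial_coord)
qed

lemma right_inverse_injective:
  fixes A B :: "nat \<Rightarrow> nat \<Rightarrow> real" and N :: nat
  assumes "\<And>i j. i < N \<Longrightarrow> j < N \<Longrightarrow> (\<Sum>l<N. A i l * B l j) = (if i = j then 1 else 0)"
    and "\<forall>i<N. (\<Sum>j<N. B i j * \<xi> j) = 0"
  shows "\<forall>j<N. \<xi> j = 0"
proof (intro allI impI)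
  fix i assume i: "i < N"
  have "0 = (\<Sum>l<N. A i l * (\<Sum>j<N. B l j * \<xi> j))" using assms(2) by simp
  also have "\<dots> = (\<Sum>j<N. (\<Sum>l<N. A i l * B l j) * \<xi> j)"
    unfolding sum_distrib_left sum_distrib_right by (subst sum.swap) (simp add: mult.assoc)
  also have "\<dots> = (\<Sum>j<N. (if i = j then 1 else 0) * \<xi> j)" using assms(1)[OF i] by simp
  finally show "\<xi> i = 0" by (simp add: sum_delta_mult[OF i])
qed

text \<open>The right inverse g of f has an injective Jacobian and so a right inverse h of its own;
  applying f to g (h x) = x gives f = h, whence g inverts f from both sides near
  \<open>z0\<close>.\<close>

lemma inverse_function:
  fixes f :: "(nat \<Rightarrow> real) \<Rightarrow> nat \<Rightarrow> real" and N :: nat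
  assumes S: "openR N S" "z0 \<in> S" and f: "\<And>i. i < N \<Longrightarrow> C_infinity N S (\<lambda>x. f x i)" "\<And>x. x \<in> S \<Longrightarrow> f x \<in> Rn N"
    and inj: "\<And>\<xi>. (\<forall>i<N. (\<Sum>j<N. pd j (\<lambda>x. f x i) z0 * \<xi> j) = 0) \<Longrightarrow> (\<forall>j<N. \<xi> j = 0)"
  obtains \<delta> \<delta>' g where "\<delta> > 0" "\<And>i. i < N \<Longrightarrow> C_infinity N (cube N (f z0) \<delta>) (\<lambda>y. g y i)"
    "\<And>y. y \<in> cube N (f z0) \<delta> \<Longrightarrow> g y \<in> S" "\<And>y. y \<in> cube N (f z0) \<delta> \<Longrightarrow> f (g y) = y" "g (f z0) = z0"
    "\<delta>' > 0" "\<And>x. x \<in> cube N z0 \<delta>' \<Longrightarrow> x \<in> S \<and> f x \<in> cube N (f z0) \<delta> \<and> g (f x) = x"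
proof -
  obtain \<delta> g where \<delta>: "\<delta> > 0" and g: "\<And>i. i < N \<Longrightarrow> C_infinity N (cube N (f z0) \<delta>) (\<lambda>y. g y i)"
    and gS: "\<And>y. y \<in> cube N (f z0) \<delta> \<Longrightarrow> g y \<in> S" and fg: "\<And>y. y \<in> cube N (f z0) \<delta> \<Longrightarrow> f (g y) = y" and gz: "g (f z0) = z0"
    using smooth_right_inverse[OF S f inj] by blast
  have 0: "f z0 \<in> cube N (f z0) \<delta>" using \<delta> f(2)[OF S(2)] by (rule cube_self)
  have gR: "g y \<in> Rn N" if "y \<in> cube N (f z0) \<delta>" for y using gS[OF that] openR_subset[OF S(1)] by blast
  have inj2: "\<forall>j<N. \<xi> j = 0" if "\<forall>i<N. (\<Sum>j<N. pd j (\<lambda>y. g y i) (f z0) * \<xi> j) = 0" for \<xi>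
    by (rule right_inverse_injective[OF right_inverse_jacobian[OF S(1) openR_cube f(1) g gS fg 0] that])
  obtain \<delta>' h where \<delta>': "\<delta>' > 0" and "\<And>i. i < N \<Longrightarrow> C_infinity N (cube N (g (f z0)) \<delta>') (\<lambda>y. h y i)"
    and hS: "\<And>y. y \<in> cube N (g (f z0)) \<delta>' \<Longrightarrow> h y \<in> cube N (f z0) \<delta>" and gh: "\<And>y. y \<in> cube N (g (f z0)) \<delta>' \<Longrightarrow> g (h y) = y" and "h (g (f z0)) = f z0"
    using smooth_right_inverse[OF openR_cube 0 g gR inj2] by blast
  have "x \<in> S \<and> f x \<in> cube N (f z0) \<delta> \<and> g (f x) = x" if x: "x \<in> cube N z0 \<delta>'" for x
  proof -
    have h: "h x \<in> cube N (f z0) \<delta>" "g (h x) = x" using hS gh x by (auto simp: gz)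
    then have "f x = h x" using fg[OF h(1)] by simp
    then show ?thesis using h gS[OF h(1)] by simp
  qed
  then show thesis using that[OF \<delta> g gS fg gz \<delta>'] by blast
qed

subsection \<open>The Frobenius theorem\<close>

text \<open>Energy estimate: the sum E of squares satisfies E' \<le> L E, so E exp (- L t) decreases
  from 0. Here R may be large, unlike in the estimates with constant 1/2.\<close>

lemma linear_ode_zero:
  fixes \<eta> :: "nat \<Rightarrow> real \<Rightarrow> real" and q :: nat
  assumes \<eta>: "\<And>b t. b < q \<Longrightarrow> t \<in> {0..1} \<Longrightarrow> (\<eta> b has_real_derivative (\<Sum>c<q. R b c t * \<eta> c t)) (at t within {0..1})"
    and R: "\<And>b c. b < q \<Longrightarrow> c < q \<Longrightarrow> continuous_on {0..1} (R b c)"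
    and 0: "\<And>b. b < q \<Longrightarrow> \<eta> b 0 = 0" and bt: "b < q" "t \<in> {0..1}"
  shows "\<eta> b t = 0"
proof -
  have "\<exists>B. \<forall>t\<in>{0..1}. \<bar>R b c t\<bar> \<le> B" if "b < q" "c < q" for b c
    using compact_imp_bounded[OF compact_continuous_image[OF R[OF that]]] by (auto simp: bounded_iff)
  then obtain B where B: "\<And>b c t. b < q \<Longrightarrow> c < q \<Longrightarrow> t \<in> {0..1} \<Longrightarrow> \<bar>R b c t\<bar> \<le> B b c" by metis
  define C where "C = (\<Sum>(b, c)\<in>{..<q} \<times> {..<q}. \<bar>B b c\<bar>)"
  have C: "\<bar>R b c t\<bar> \<le> C" if "b < q" "c < q" "t \<in> {0..1}" for b c t
  proof -
    have "\<bar>B b c\<bar> \<le> C" unfolding C_def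
      using member_le_sum[of "(b, c)" "{..<q} \<times> {..<q}" "\<lambda>(b, c). \<bar>B b c\<bar>"] that by auto
    then show ?thesis using B[OF that] by linarith
  qed
  define E where "E t = (\<Sum>b<q. \<eta> b t * \<eta> b t)" for t
  define E' where "E' t = (\<Sum>b<q. 2 * (\<eta> b t * (\<Sum>c<q. R b c t * \<eta> c t)))" for t
  have E': "(E has_real_derivative E' t) (at t within {0..1})" if "t \<in> {0..1}" for t
    unfolding E_def E'_def
  proof (rule DERIV_sum)
    have aux: "a * b + a * b = 2 * (b * a)" for a b :: real by simp
    show "((\<lambda>t. \<eta> b t * \<eta> b t) has_real_derivative 2 * (\<eta> b t * (\<Sum>c<q. R b c t * \<eta> c t))) (at t within {0..1})" if "b \<in> {..<q}" for b
      by (rule DERIV_cong[OF DERIV_mult aux]) (use \<eta>[OF _ \<open>t \<in> {0..1}\<close>] that in auto)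
  qed
  define L where "L = 2 * (C * real q)"
  have le: "E' t \<le> L * E t" if t: "t \<in> {0..1}" for t
  proof -
    have "E' t \<le> (\<Sum>b<q. \<Sum>c<q. C * (\<eta> b t * \<eta> b t) + C * (\<eta> c t * \<eta> c t))"
      unfolding E'_def
    proof (rule sum_mono)
      fix b assume b: "b \<in> {..<q}"
      have "2 * (\<eta> b t * (R b c t * \<eta> c t)) \<le> C * (\<eta> b t * \<eta> b t) + C * (\<eta> c t * \<eta> c t)" if c: "c < q" for c
      proof -
        have "2 * (\<eta> b t * (R b c t * \<eta> c t)) \<le> \<bar>R b c t\<bar> * (2 * \<bar>\<eta> b t * \<eta> c t\<bar>)"
          using abs_ge_self[of "R b c t * (2 * (\<eta> b t * \<eta> c t))"] by (simp add: abs_mult mult_ac)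
        also have "\<dots> \<le> C * (\<eta> b t * \<eta> b t + \<eta> c t * \<eta> c t)"
        proof (rule mult_mono)
          have "0 \<le> (\<bar>\<eta> b t\<bar> - \<bar>\<eta> c t\<bar>)\<^sup>2" by simp
          then show "2 * \<bar>\<eta> b t * \<eta> c t\<bar> \<le> \<eta> b t * \<eta> b t + \<eta> c t * \<eta> c t"
            by (simp add: power2_eq_square algebra_simps abs_mult)
          show "\<bar>R b c t\<bar> \<le> C" using C b c t by simp
          then show "0 \<le> C" using abs_ge_zero order_trans by blast
        qed simp
        finally show ?thesis by (simp add: distrib_left)
      qed
      then show "2 * (\<eta> b t * (\<Sum>c<q. R b c t * \<eta> c t)) \<le> (\<Sum>c<q. C * (\<eta> b t * \<eta> b t) + C * (\<eta> c t * \<eta> c t))"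
        unfolding sum_distrib_left by (intro sum_mono) auto
    qed
    also have "\<dots> = L * E t"
      by (simp add: E_def L_def sum.distrib sum_distrib_left mult_ac)
    finally show ?thesis .
  qed
  have dec: "E t * exp (- L * t) \<le> E 0 * exp (- L * 0)" if t: "t \<in> {0..1}" for t
  proof (cases "t = 0")
    case False
    then have t0: "0 < t" using t by auto
    have d: "((\<lambda>t. E t * exp (- L * t)) has_real_derivative (E' s - L * E s) * exp (- L * s)) (at s within {0..1})" if "s \<in> {0..1}" for s
    proof -
      have "((\<lambda>t. E t * exp (- L * t)) has_real_derivative E' s * exp (- L * s) + (exp (- L * s) * (- L * 1)) * E s) (at s within {0..1})"
        by (intro DERIV_mult E'[OF that] DERIV_chain2[OF DERIV_exp] DERIV_cmult DERIV_ident)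
      then show ?thesis by (simp add: algebra_simps)
    qed
    show ?thesis
    proof (rule DERIV_nonpos_imp_decreasing_open[OF less_imp_le[OF t0]])
      fix s assume s: "0 < s" "s < t"
      then have "((\<lambda>t. E t * exp (- L * t)) has_real_derivative (E' s - L * E s) * exp (- L * s)) (at s)"
        using d[of s] t at_within_Icc_at[of 0 s 1] by auto
      moreover have "(E' s - L * E s) * exp (- L * s) \<le> 0"
        using le[of s] s t by (intro mult_nonpos_nonneg) auto
      ultimately show "\<exists>y. ((\<lambda>t. E t * exp (- L * t)) has_real_derivative y) (at s) \<and> y \<le> 0" by blast
    next
      have "continuous_on {0..1} (\<lambda>t. E t * exp (- L * t))" by (rule DERIV_continuous_on[OF d])
      then show "continuous_on {0..t} (\<lambda>t. E t * exp (- L * t))" using t by (auto elim: continuous_on_subset)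
    qed
  qed simp
  have "E 0 = 0" by (simp add: E_def 0)
  then have "E t * exp (- L * t) \<le> 0" using dec[OF bt(2)] by simp
  then have "E t \<le> 0" by (simp add: mult_le_0_iff not_le[symmetric])
  moreover have "\<eta> b t * \<eta> b t \<le> E t" unfolding E_def using bt by (intro member_le_sum) auto
  ultimately have "\<eta> b t * \<eta> b t \<le> 0" by linarith
  then show ?thesis by (metis mult_eq_0_iff antisym zero_le_square)
qed

lemma smooth_cube_nbhd:
  fixes g :: "(nat \<Rightarrow> real) \<Rightarrow> nat \<Rightarrow> real"
  assumes S: "openR n S" "x \<in> S" and e: "e > 0" and g: "\<And>j. j < m \<Longrightarrow> C_infinity n S (\<lambda>y. g y j)"
  obtains d where "d > 0" "cube n x d \<subseteq> S" "\<forall>y\<in>cube n x d. \<forall>j<m. \<bar>g y j - g x j\<bar> < e"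
proof -
  have "\<exists>d>0. cube n x d \<subseteq> S \<and> (\<forall>y\<in>cube n x d. \<forall>j<k. \<bar>g y j - g x j\<bar> < e)" if "k \<le> m" for k
    using that
  proof (induction k)
    case 0
    then show ?case using openR_cubeE[OF S] by (metis less_zeroE)
  next
    case (Suc k)
    then obtain d where d: "d > 0" "cube n x d \<subseteq> S" "\<forall>y\<in>cube n x d. \<forall>j<k. \<bar>g y j - g x j\<bar> < e" by auto
    obtain d' where d': "d' > 0" "\<And>y. y \<in> cube n x d' \<Longrightarrow> \<bar>g y k - g x k\<bar> < e"
      using continuous_cubeE[OF smooth_continuous[OF S(1) g[OF Suc_le_lessD[OF Suc.prems]]] S e] by metis
    have "cube n x (min d d') \<subseteq> cube n x d" "cube n x (min d d') \<subseteq> cube n x d'" by (auto intro!: cube_mono)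
    then show ?case using d d' by (intro exI[of _ "min d d'"]) (auto simp: less_Suc_eq)
  qed
  then show thesis using that by blast
qed

text \<open>The first q coordinates g of the inverse of the map \<open>\<Psi>\<close>, which sends v to the time one value of the flow of
  \<open>\<Sum>\<^sub>j v\<^sub>j X\<^sub>j\<close> (over the \<open>j \<ge> q\<close>) started on a transversal, are the first integrals.\<close>

lemma frobenius_coframe:
  fixes al :: "nat \<Rightarrow> nat \<Rightarrow> (nat \<Rightarrow> real) \<Rightarrow> real" and N q :: nat
  assumes S: "openR N S" "z0 \<in> S" and al: "\<And>a i. a < N \<Longrightarrow> i < N \<Longrightarrow> C_infinity N S (al a i)" and q: "q \<le> N"
    and inj: "\<And>\<xi>. (\<forall>a<N. (\<Sum>i<N. al a i z0 * \<xi> i) = 0) \<Longrightarrow> (\<forall>i<N. \<xi> i = 0)"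
    and closed: "\<And>a z \<xi> \<eta>. a < q \<Longrightarrow> z \<in> S \<Longrightarrow> (\<forall>b<q. (\<Sum>i<N. al b i z * \<xi> i) = 0) \<Longrightarrow> (\<forall>b<q. (\<Sum>i<N. al b i z * \<eta> i) = 0) \<Longrightarrow>
      (\<Sum>i<N. \<Sum>j<N. (pd i (al a j) z - pd j (al a i) z) * \<xi> i * \<eta> j) = 0"
  obtains r g where "r > 0" "cube N z0 r \<subseteq> S" "\<And>a. a < q \<Longrightarrow> C_infinity N (cube N z0 r) (g a)"
    "\<And>a z \<xi>. a < q \<Longrightarrow> z \<in> cube N z0 r \<Longrightarrow> (\<forall>b<q. (\<Sum>i<N. al b i z * \<xi> i) = 0) \<Longrightarrow> (\<Sum>i<N. pd i (g a) z * \<xi> i) = 0"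
    "\<And>a i. a < q \<Longrightarrow> i < N \<Longrightarrow> pd i (g a) z0 = al a i z0"
proof -
  obtain r1 X where r1: "r1 > 0" "cube N z0 r1 \<subseteq> S" and X: "\<And>i j. i < N \<Longrightarrow> j < N \<Longrightarrow> C_infinity N (cube N z0 r1) (X i j)"
    and Xal: "\<And>z i j. z \<in> cube N z0 r1 \<Longrightarrow> i < N \<Longrightarrow> j < N \<Longrightarrow> (\<Sum>l<N. X i l z * al l j z) = (if i = j then 1 else 0)"
    and alX: "\<And>z i j. z \<in> cube N z0 r1 \<Longrightarrow> i < N \<Longrightarrow> j < N \<Longrightarrow> (\<Sum>l<N. al i l z * X l j z) = (if i = j then 1 else 0)"
    using smooth_matrix_inverse[where n=N and N=N and M=al, OF S al inj] by blast
  let ?S = "cube N z0 r1"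
  have z0: "z0 \<in> ?S" using S r1 openR_subset cube_self by blast
  have z0R: "z0 \<in> Rn N" using z0 cube_subset_Rn by blast
  have alS: "C_infinity N ?S (al a i)" if "a < N" "i < N" for a i
    by (rule smooth_subset[OF al[OF that] S(1) openR_cube r1(2)])
  \<comment> \<open>Only the dual fields with index j \<ge> q are kept: they span the common kernel
    of the first q forms.\<close>
  define K where "K i j = (if j < q then (\<lambda>_. 0) else X i j)" for i j
  \<comment> \<open>The remaining parameters move the initial point along an affine transversal
    spanned by the first q dual vectors at \<open>z0\<close>.\<close>
  define A where "A i j = (if j < q then X i j z0 else 0)" for i j
  have K: "C_infinity N ?S (K i j)" if "i < N" "j < N" for i j
    using X[OF that] smooth_const[OF openR_cube] by (auto simp: K_def)
  have alK: "(\<Sum>l<N. al b l z * K l j z) = 0" if "b < q" "j < N" "z \<in> ?S" for b j z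
    using alX[OF that(3), of b j] that q by (cases "j < q") (auto simp: K_def)
  obtain \<delta> u where \<delta>: "\<delta> > 0" and uS: "\<forall>v\<in>cube N (\<lambda>_. 0) \<delta>. \<forall>t\<in>{0..1}. u t v \<in> ?S"
    and u0: "\<forall>v\<in>cube N (\<lambda>_. 0) \<delta>. \<forall>i<N. u 0 v i = z0 i + (\<Sum>j<N. A i j * v j)"
    and u': "\<forall>v\<in>cube N (\<lambda>_. 0) \<delta>. \<forall>i<N. \<forall>t\<in>{0..1}.
      ((\<lambda>t. u t v i) has_real_derivative (\<Sum>j<N. K i j (u t v) * v j)) (at t within {0..1})"
    and Cu: "\<forall>i<N. \<forall>r. C_param N {0..1} r (cube N (\<lambda>_. 0) \<delta>) (\<lambda>t v. u t v i)"
    and w0: "\<forall>v\<in>cube N (\<lambda>_. 0) \<delta>. \<forall>i<N. \<forall>q<N. pd q (\<lambda>v. u 0 v i) v = A i q"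
    and w': "\<forall>v\<in>cube N (\<lambda>_. 0) \<delta>. \<forall>i<N. \<forall>q<N. \<forall>t\<in>{0..1}. ((\<lambda>t. pd q (\<lambda>v. u t v i) v) has_real_derivative
        (\<Sum>l<N. (\<Sum>j<N. pd l (K i j) (u t v) * v j) * pd q (\<lambda>v. u t v l) v) + K i q (u t v)) (at t within {0..1})"
    by (rule flow_exists[where A="A", OF openR_cube z0 K])
  note uS = uS[rule_format] and u0 = u0[rule_format] and u' = u'[rule_format] and Cu = Cu[rule_format]
    and w0 = w0[rule_format] and w' = w'[rule_format]
  let ?B = "cube N (\<lambda>_. 0) \<delta>"
  have zB: "(\<lambda>_. 0) \<in> ?B" using \<delta> by (auto simp: cube_def Rn_def)
  have \<Psi>: "C_infinity N ?B (\<lambda>v. u 1 v i)" if "i < N" for i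
    unfolding C_infinity_def using C_param_slice[OF cube_subset_Rn _ Cu[OF that], of 1] by auto
  have uR: "u t v \<in> Rn N" if "v \<in> ?B" "t \<in> {0..1}" for t v using uS[OF that] cube_subset_Rn by blast
  have cu: "continuous_on {0..1} (\<lambda>t. u t v i)" if "v \<in> ?B" for v i
  proof (cases "i < N")
    case True
    show ?thesis by (rule DERIV_continuous_on[OF u'[OF that True]])
  next
    case False
    show ?thesis
      by (rule continuous_on_eq[OF continuous_on_const[of _ 0]]) (use uR[OF that] False in \<open>auto simp: Rn_def\<close>)
  qed
  have cF: "continuous_on {0..1} (\<lambda>t. f (u t v))" if "C_infinity N ?S f" "v \<in> ?B" for f v
    by (rule continuous_on_compose2[OF smooth_continuous[OF openR_cube that(1)] continuous_on_coordinatewise_then_product[OF cu[OF that(2)]]])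
      (use uS[OF that(2)] in auto)
  have uz: "u t (\<lambda>_. 0) = z0" if t: "t \<in> {0..1}" for t
  proof (rule Rn_eqI[OF uR[OF zB t] z0R])
    fix i assume i: "i < N"
    obtain c where "\<And>t. t \<in> {0..1} \<Longrightarrow> u t (\<lambda>_. 0) i = c"
      using has_field_derivative_zero_constant[of "{0..1}" "\<lambda>t. u t (\<lambda>_. 0) i"] u'[OF zB i] by auto
    from this[OF t] this[of 0] show "u t (\<lambda>_. 0) i = z0 i" using u0[OF zB i] by simp
  qed
  \<comment> \<open>At v = 0 the flow stands still. Transversal parameters contribute through A and
    kernel parameters through K, so the Jacobian is the full dual frame at \<open>z0\<close>, hence
    invertible.\<close>
  have W0: "pd j (\<lambda>v. u 1 v i) (\<lambda>_. 0) = X i j z0" if ij: "i < N" "j < N" for i j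
  proof -
    have "pd j (\<lambda>v. u 1 v i) (\<lambda>_. 0) = pd j (\<lambda>v. u 0 v i) (\<lambda>_. 0) + K i j z0"
      by (rule constant_derivative_increment[of "\<lambda>t. pd j (\<lambda>v. u t v i) (\<lambda>_. 0)"])
        (use w'[OF zB ij] uz in auto)
    then show ?thesis by (simp add: w0[OF zB ij] A_def K_def)
  qed
  text \<open>The variation of the flow along \<open>v\<^sub>j\<close> stays in the kernel, as its components satisfy a homogeneous linear equation.\<close>
  have ker: "(\<Sum>i<N. al b i (u 1 v) * pd j (\<lambda>v. u 1 v i) v) = 0"
    if v: "v \<in> ?B" and j: "q \<le> j" "j < N" and b: "b < q" for v j b
  proof -
    define w where "w i t = pd j (\<lambda>v. u t v i) v" for i t
    define du where "du l t = (\<Sum>m<N. K l m (u t v) * v m)" for l t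
    define \<eta> where "\<eta> b t = (\<Sum>i<N. al b i (u t v) * w i t)" for b t
    define dal where "dal b l i t = pd l (al b i) (u t v) - pd i (al b l) (u t v)" for b l i t
    \<comment> \<open>This is d \<alpha>_b evaluated on the velocity of the flow and the dual field
      \<open>X c\<close>.\<close>
    define R where "R b c t = (\<Sum>l<N. \<Sum>i<N. dal b l i t * du l t * X i c (u t v))" for b c t
    have dual: "w i t = (\<Sum>c<N. X i c (u t v) * \<eta> c t)" if "i < N" "t \<in> {0..1}" for i t
    proof -
      have "(\<Sum>c<N. X i c (u t v) * \<eta> c t) = (\<Sum>l<N. (\<Sum>c<N. X i c (u t v) * al c l (u t v)) * w l t)"
        unfolding \<eta>_def sum_distrib_left sum_distrib_right by (subst sum.swap) (simp add: mult.assoc)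
      also have "\<dots> = (\<Sum>l<N. (if i = l then 1 else 0) * w l t)"
        by (rule sum.cong) (use Xal[OF uS[OF v that(2)] that(1)] in auto)
      finally show ?thesis by (simp add: sum_delta_mult[OF that(1)])
    qed
    \<comment> \<open>Differentiating the identity that the form b vanishes on the columns of K
      moves the derivative from K to the form, so that the antisymmetric d \<alpha>_b
      appears.\<close>
    have dder: "(\<Sum>i<N. al b i x * pd l (K i m) x) = - (\<Sum>i<N. pd l (al b i) x * K i m x)"
      if "b < q" "l < N" "m < N" "x \<in> ?S" for b l m x
    proof -
      have bN: "b < N" using that(1) q by simp
      have "pd l (\<lambda>x. \<Sum>i<N. al b i x * K i m x) x = (\<Sum>i<N. pd l (\<lambda>x. al b i x * K i m x) x)"
        by (rule partial_sum[OF openR_cube _ that(4,2)]) (use alS K bN that in \<open>auto intro!: smooth_mult\<close>)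
      also have "\<dots> = (\<Sum>i<N. pd l (al b i) x * K i m x + al b i x * pd l (K i m) x)"
        by (rule sum.cong) (use partial_mult[OF openR_cube alS K that(4,2)] bN that in auto)
      finally have "(\<Sum>i<N. pd l (al b i) x * K i m x + al b i x * pd l (K i m) x) = pd l (\<lambda>x. 0) x"
        using partial_deriv_cong[OF openR_cube that(4,2), of "\<lambda>x. \<Sum>i<N. al b i x * K i m x" "\<lambda>x. 0"] alK[OF that(1,3)] by simp
      then show ?thesis by (simp add: partial_const sum.distrib)
    qed
    have "\<eta> b 1 = 0"
    proof (rule linear_ode_zero[where \<eta>=\<eta> and R=R and q=q])
      fix b t assume bq: "b < q" and t: "t \<in> {0..1::real}"
      have bN: "b < N" using bq q by simp
      let ?x = "u t v"
      have x: "?x \<in> ?S" by (rule uS[OF v t])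
      have d1: "((\<lambda>t. al b i (u t v)) has_real_derivative (\<Sum>l<N. pd l (al b i) ?x * du l t)) (at t within {0..1})"
        if i: "i < N" for i
      proof (rule smooth_chain_curve[where y="\<lambda>t. u t v", OF openR_cube alS[OF bN i] x])
        show "\<forall>\<^sub>F t in at t within {0..1}. u t v \<in> Rn N"
          unfolding eventually_at_filter by (rule always_eventually) (use uR[OF v] in blast)
        show "((\<lambda>t. u t v l) has_real_derivative du l t) (at t within {0..1})" if "l < N" for l
          unfolding du_def by (rule u'[OF v that t])
      qed
      have d2: "((\<lambda>t. w i t) has_real_derivative (\<Sum>l<N. (\<Sum>m<N. pd l (K i m) ?x * v m) * w l t) + K i j ?x) (at t within {0..1})"
        if "i < N" for i unfolding w_def by (rule w'[OF v that j(2) t])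
      have "(\<eta> b has_real_derivative (\<Sum>i<N. (\<Sum>l<N. pd l (al b i) ?x * du l t) * w i t +
          ((\<Sum>l<N. (\<Sum>m<N. pd l (K i m) ?x * v m) * w l t) + K i j ?x) * al b i ?x)) (at t within {0..1})"
        unfolding \<eta>_def by (intro DERIV_sum DERIV_mult d1 d2) auto
      also have "(\<Sum>i<N. (\<Sum>l<N. pd l (al b i) ?x * du l t) * w i t +
          ((\<Sum>l<N. (\<Sum>m<N. pd l (K i m) ?x * v m) * w l t) + K i j ?x) * al b i ?x)
        = (\<Sum>i<N. \<Sum>l<N. pd l (al b i) ?x * du l t * w i t) + (\<Sum>i<N. al b i ?x * (\<Sum>l<N. (\<Sum>m<N. pd l (K i m) ?x * v m) * w l t))
          + (\<Sum>i<N. al b i ?x * K i j ?x)"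
        by (simp add: sum.distrib sum_distrib_left sum_distrib_right algebra_simps)
      also have "(\<Sum>i<N. al b i ?x * K i j ?x) = 0" by (rule alK[OF bq j(2) x])
      also have "(\<Sum>i<N. al b i ?x * (\<Sum>l<N. (\<Sum>m<N. pd l (K i m) ?x * v m) * w l t))
        = (\<Sum>l<N. \<Sum>m<N. (\<Sum>i<N. al b i ?x * pd l (K i m) ?x) * v m * w l t)"
      proof -
        have "(\<Sum>i<N. al b i ?x * (\<Sum>l<N. (\<Sum>m<N. pd l (K i m) ?x * v m) * w l t))
          = (\<Sum>i<N. \<Sum>l<N. \<Sum>m<N. al b i ?x * pd l (K i m) ?x * v m * w l t)"
          by (simp add: sum_distrib_left sum_distrib_right mult.assoc)
        also have "\<dots> = (\<Sum>l<N. \<Sum>i<N. \<Sum>m<N. al b i ?x * pd l (K i m) ?x * v m * w l t)"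
          by (rule sum.swap)
        also have "\<dots> = (\<Sum>l<N. \<Sum>m<N. \<Sum>i<N. al b i ?x * pd l (K i m) ?x * v m * w l t)"
          by (rule sum.cong[OF refl]) (rule sum.swap)
        finally show ?thesis by (simp add: sum_distrib_right)
      qed
      also have "\<dots> = (\<Sum>l<N. \<Sum>m<N. (- (\<Sum>i<N. pd l (al b i) ?x * K i m ?x)) * v m * w l t)"
        by (intro sum.cong refl) (use dder[OF bq _ _ x] in auto)
      also have "\<dots> = - (\<Sum>l<N. \<Sum>i<N. pd l (al b i) ?x * du i t * w l t)"
      proof -
        have "(\<Sum>m<N. (- (\<Sum>i<N. pd l (al b i) ?x * K i m ?x)) * v m * w l t)
          = - (\<Sum>i<N. pd l (al b i) ?x * du i t * w l t)" for l
        proof -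
          have "(\<Sum>m<N. (- (\<Sum>i<N. pd l (al b i) ?x * K i m ?x)) * v m * w l t)
            = - (\<Sum>m<N. \<Sum>i<N. pd l (al b i) ?x * K i m ?x * v m * w l t)"
            by (simp add: sum_distrib_right sum_negf)
          also have "(\<Sum>m<N. \<Sum>i<N. pd l (al b i) ?x * K i m ?x * v m * w l t)
            = (\<Sum>i<N. \<Sum>m<N. pd l (al b i) ?x * K i m ?x * v m * w l t)" by (rule sum.swap)
          finally show ?thesis by (simp add: du_def sum_distrib_left sum_distrib_right mult.assoc)
        qed
        then show ?thesis by (simp add: sum_negf)
      qed
      also have "(\<Sum>i<N. \<Sum>l<N. pd l (al b i) ?x * du l t * w i t) + - (\<Sum>l<N. \<Sum>i<N. pd l (al b i) ?x * du i t * w l t) + 0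
        = (\<Sum>i<N. \<Sum>l<N. dal b l i t * du l t * w i t)"
        by (simp add: dal_def left_diff_distrib sum_subtractf)
      also have "\<dots> = (\<Sum>l<N. \<Sum>i<N. dal b l i t * du l t * w i t)" by (rule sum.swap)
      also have "\<dots> = (\<Sum>l<N. \<Sum>i<N. \<Sum>c<N. dal b l i t * du l t * X i c ?x * \<eta> c t)"
        by (intro sum.cong refl) (use dual[OF _ t] in \<open>simp add: sum_distrib_left mult.assoc\<close>)
      also have "\<dots> = (\<Sum>l<N. \<Sum>c<N. \<Sum>i<N. dal b l i t * du l t * X i c ?x * \<eta> c t)"
        by (rule sum.cong[OF refl]) (rule sum.swap)
      also have "\<dots> = (\<Sum>c<N. \<Sum>l<N. \<Sum>i<N. dal b l i t * du l t * X i c ?x * \<eta> c t)"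
        by (rule sum.swap)
      also have "\<dots> = (\<Sum>c<N. R b c t * \<eta> c t)"
        by (simp add: R_def sum_distrib_right)
      also have "\<dots> = (\<Sum>c<q. R b c t * \<eta> c t)"
      proof (rule sum.mono_neutral_right)
        \<comment> \<open>Integrability enters here: velocity and \<open>X c\<close> both lie in the
          kernel when c \<ge> q, so d \<alpha>_b vanishes on them and the linear system closes up on
          the first q components.\<close>
        show "\<forall>c\<in>{..<N} - {..<q}. R b c t * \<eta> c t = 0"
        proof
          fix c assume c: "c \<in> {..<N} - {..<q}"
          have "(\<Sum>l<N. \<Sum>i<N. (pd l (al b i) ?x - pd i (al b l) ?x) * du l t * X i c ?x) = 0"
          proof (rule closed[OF bq])
            show "?x \<in> S" using x r1 by blast
            show "\<forall>b<q. (\<Sum>i<N. al b i ?x * du i t) = 0"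
            proof (intro allI impI)
              fix b' assume b': "b' < q"
              have "(\<Sum>i<N. al b' i ?x * du i t) = (\<Sum>m<N. (\<Sum>i<N. al b' i ?x * K i m ?x) * v m)"
                unfolding du_def sum_distrib_left sum_distrib_right by (subst sum.swap) (simp add: mult.assoc)
              then show "(\<Sum>i<N. al b' i ?x * du i t) = 0" using alK[OF b' _ x] by simp
            qed
            show "\<forall>b<q. (\<Sum>i<N. al b i ?x * X i c ?x) = 0"
              using alX[OF x] c q by auto
          qed
          then show "R b c t * \<eta> c t = 0" by (simp add: R_def dal_def)
        qed
      qed (use q in auto)
      finally show "(\<eta> b has_real_derivative (\<Sum>c<q. R b c t * \<eta> c t)) (at t within {0..1})" .
    next
      fix b c assume bc: "b < q" "c < q"
      then have "b < N" "c < N" using q by auto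
      then show "continuous_on {0..1} (R b c)"
        unfolding R_def dal_def du_def
        by (intro continuous_on_sum continuous_on_mult continuous_on_diff continuous_on_const cF[OF _ v] smooth_partial[OF openR_cube] alS K X) auto
    next
      fix b assume "b < q"
      show "\<eta> b 0 = 0"
        unfolding \<eta>_def w_def using w0[OF v _ j(2)] j by (simp add: A_def)
    qed (use b in auto)
    then show ?thesis by (simp add: \<eta>_def w_def)
  qed
  have alu: "C_infinity N ?B (\<lambda>v. al a i (u 1 v))" if "a < N" "i < N" for a i
    by (rule smooth_compose[OF openR_cube openR_cube alS[OF that] \<Psi>]) (use uS in auto)
  have alu': "C_infinity N ?B (\<lambda>v. \<Sum>i<N. al b i (u 1 v) * pd j (\<lambda>v. u 1 v i) v)" if "b < N" "j < N" for b j
    using that by (intro smooth_sum smooth_mult openR_cube alu smooth_partial[OF openR_cube \<Psi>]) auto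
  have B0: "(\<Sum>i<N. al b i (u 1 (\<lambda>_. 0)) * pd j (\<lambda>v. u 1 v i) (\<lambda>_. 0)) = (if b = j then 1 else 0)" if "b < N" "j < N" for b j
    using alX[OF z0 that] uz[of 1] W0 that by simp
  \<comment> \<open>At the origin the first q forms, applied to the first q partials of the map,
    give the identity matrix. It stays invertible nearby, so kernel vectors cannot have transversal
    components.\<close>
  obtain r4 K4 where r4: "r4 > 0" "cube N (\<lambda>_. 0) r4 \<subseteq> ?B" and K4: "\<And>v i j. v \<in> cube N (\<lambda>_. 0) r4 \<Longrightarrow> i < q \<Longrightarrow> j < q \<Longrightarrow>
      (\<Sum>l<q. K4 i l v * (\<Sum>i<N. al l i (u 1 v) * pd j (\<lambda>v. u 1 v i) v)) = (if i = j then 1 else 0)"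
  proof (rule smooth_matrix_inverse[where n=N and N=q and M="\<lambda>b j v. \<Sum>i<N. al b i (u 1 v) * pd j (\<lambda>v. u 1 v i) v", OF openR_cube zB])
    show "C_infinity N ?B (\<lambda>v. \<Sum>i<N. al i' i (u 1 v) * pd j (\<lambda>v. u 1 v i) v)" if "i' < q" "j < q" for i' j
      using alu' that q by auto
    show "\<forall>j<q. \<xi> j = 0" if h: "\<forall>i<q. (\<Sum>j<q. (\<Sum>ia<N. al i ia (u 1 (\<lambda>_. 0)) * pd j (\<lambda>v. u 1 v ia) (\<lambda>_. 0)) * \<xi> j) = 0" for \<xi>
    proof (intro allI impI)
      fix i assume i: "i < q"
      have "(\<Sum>j<q. (if i = j then 1 else 0) * \<xi> j) = 0" using h i B0 q by auto
      then show "\<xi> i = 0" by (simp add: sum_delta_mult[OF i])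
    qed
  qed blast
  have u1z: "u 1 (\<lambda>_. 0) = z0" using uz by simp
  have inj\<Psi>: "\<forall>j<N. \<xi> j = 0" if "\<forall>i<N. (\<Sum>j<N. pd j (\<lambda>v. u 1 v i) (\<lambda>_. 0) * \<xi> j) = 0" for \<xi>
    by (rule right_inverse_injective[of N "\<lambda>i j. al i j z0" "\<lambda>i j. X i j z0"]) (use alX[OF z0] that W0 in auto)
  obtain \<delta>2 G where \<delta>2: "\<delta>2 > 0" and G: "\<And>i. i < N \<Longrightarrow> C_infinity N (cube N (u 1 (\<lambda>_. 0)) \<delta>2) (\<lambda>y. G y i)"
    and GB: "\<And>y. y \<in> cube N (u 1 (\<lambda>_. 0)) \<delta>2 \<Longrightarrow> G y \<in> ?B" and \<Psi>G: "\<And>y. y \<in> cube N (u 1 (\<lambda>_. 0)) \<delta>2 \<Longrightarrow> u 1 (G y) = y"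
    and Gz: "G (u 1 (\<lambda>_. 0)) = (\<lambda>_. 0)"
    using smooth_right_inverse[where f="u 1", OF openR_cube zB \<Psi> uR[of _ 1] inj\<Psi>] by auto
  note G = G[unfolded u1z] and GB = GB[unfolded u1z] and \<Psi>G = \<Psi>G[unfolded u1z] and Gz = Gz[unfolded u1z]
  let ?T = "cube N z0 \<delta>2"
  have jac: "(\<Sum>l<N. pd l (\<lambda>v. u 1 v i) (G y) * pd j (\<lambda>y. G y l) y) = (if i = j then 1 else 0)"
    if "y \<in> ?T" "i < N" "j < N" for y i j
    by (rule right_inverse_jacobian[where f="u 1", OF openR_cube openR_cube \<Psi> G GB \<Psi>G that])
  obtain r5 where r5: "r5 > 0" "cube N z0 r5 \<subseteq> ?T" "\<forall>y\<in>cube N z0 r5. \<forall>j<N. \<bar>G y j - G z0 j\<bar> < r4"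
    by (rule smooth_cube_nbhd[where g=G, OF openR_cube cube_self[OF \<delta>2 z0R] r4(1) G])
  define r where "r = min r5 r1"
  have r: "r > 0" "cube N z0 r \<subseteq> cube N z0 r5" "cube N z0 r \<subseteq> ?S" using r5 r1 by (auto simp: r_def intro!: cube_mono)
  have Gr: "G y \<in> cube N (\<lambda>_. 0) r4" if "y \<in> cube N z0 r" for y
  proof -
    have "y \<in> cube N z0 r5" "y \<in> ?T" using that r r5 by auto
    then show ?thesis using r5(3) GB[of y] cube_subset_Rn[of N "\<lambda>_. 0" \<delta>] by (auto simp: Gz cube_def)
  qed
  show thesis
  proof (rule that[OF r(1), of "\<lambda>a y. G y a"])
    show "cube N z0 r \<subseteq> S" using r r1 by blast
    show "C_infinity N (cube N z0 r) (\<lambda>y. G y a)" if "a < q" for a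
      by (rule smooth_subset[OF G openR_cube openR_cube]) (use that q r r5 in auto)
    show "(\<Sum>i<N. pd i (\<lambda>y. G y a) y * \<xi> i) = 0" if a: "a < q" and y: "y \<in> cube N z0 r" and \<xi>: "\<forall>b<q. (\<Sum>i<N. al b i y * \<xi> i) = 0" for a y \<xi>
    proof -
      have yT: "y \<in> ?T" using y r r5 by blast
      \<comment> \<open>The components of \<xi> in the frame of partials of the flow map. If \<xi>
        is in the kernel, \<open>ker\<close> removes the terms with j \<ge> q, and the invertible q
        by q system forces the others to vanish.\<close>
      define \<zeta> where "\<zeta> j = (\<Sum>i<N. pd i (\<lambda>y. G y j) y * \<xi> i)" for j
      let ?W = "\<lambda>i j. pd j (\<lambda>v. u 1 v i) (G y)"
      have \<xi>\<zeta>: "\<xi> i = (\<Sum>j<N. ?W i j * \<zeta> j)" if "i < N" for i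
      proof -
        have "(\<Sum>j<N. ?W i j * \<zeta> j) = (\<Sum>m<N. (\<Sum>j<N. ?W i j * pd m (\<lambda>y. G y j) y) * \<xi> m)"
          unfolding \<zeta>_def sum_distrib_left sum_distrib_right by (subst sum.swap) (simp add: mult.assoc)
        also have "\<dots> = (\<Sum>m<N. (if i = m then 1 else 0) * \<xi> m)" using jac[OF yT that] by simp
        finally show ?thesis by (simp add: sum_delta_mult[OF that])
      qed
      have z: "(\<Sum>j<q. (\<Sum>i<N. al b i y * ?W i j) * \<zeta> j) = 0" if b: "b < q" for b
      proof -
        have "0 = (\<Sum>i<N. al b i y * (\<Sum>j<N. ?W i j * \<zeta> j))" using \<xi> b \<xi>\<zeta> by simp
        also have "\<dots> = (\<Sum>j<N. (\<Sum>i<N. al b i y * ?W i j) * \<zeta> j)"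
          unfolding sum_distrib_left sum_distrib_right by (subst sum.swap) (simp add: mult.assoc)
        also have "\<dots> = (\<Sum>j<q. (\<Sum>i<N. al b i y * ?W i j) * \<zeta> j)"
        proof (rule sum.mono_neutral_right)
          show "\<forall>j\<in>{..<N} - {..<q}. (\<Sum>i<N. al b i y * ?W i j) * \<zeta> j = 0"
            using ker[OF GB[OF yT] _ _ b] \<Psi>G[OF yT] by auto
        qed (use q in auto)
        finally show ?thesis by simp
      qed
      have "\<forall>j<q. \<zeta> j = 0"
        by (rule right_inverse_injective[of q "\<lambda>i l. K4 i l (G y)" "\<lambda>l j. \<Sum>i<N. al l i (u 1 (G y)) * ?W i j"])
          (use K4[OF Gr[OF y]] z \<Psi>G[OF yT] in auto)
      then show ?thesis using a by (simp add: \<zeta>_def)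
    qed
    show "pd i (\<lambda>y. G y a) z0 = al a i z0" if a: "a < q" and i: "i < N" for a i
    proof -
      have aN: "a < N" using a q by simp
      have zT: "z0 \<in> ?T" by (rule cube_self[OF \<delta>2 z0R])
      have "al a i z0 = (\<Sum>m<N. al a m z0 * (if m = i then 1 else 0))"
        using i by (simp add: if_distrib[of "\<lambda>x. _ * x"] cong: if_cong)
      also have "\<dots> = (\<Sum>m<N. al a m z0 * (\<Sum>l<N. X m l z0 * pd i (\<lambda>y. G y l) z0))"
        by (intro sum.cong refl) (use jac[OF zT _ i] W0 Gz in auto)
      also have "\<dots> = (\<Sum>l<N. (\<Sum>m<N. al a m z0 * X m l z0) * pd i (\<lambda>y. G y l) z0)"
        unfolding sum_distrib_left sum_distrib_right by (subst sum.swap) (simp add: mult.assoc)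
      also have "\<dots> = (\<Sum>l<N. (if a = l then 1 else 0) * pd i (\<lambda>y. G y l) z0)" using alX[OF z0 aN] by simp
      finally show ?thesis by (simp add: sum_delta_mult[OF aN])
    qed
  qed
qed

section \<open>Finite dimensional subspaces\<close>

text \<open>The ambient types of lists of tensors need not be finite dimensional, and
  \<open>dim\<close> alone does not certify finiteness; the finite spanning set does.\<close>

definition finite_dim :: "'v::real_vector set \<Rightarrow> bool"
  where "finite_dim W \<longleftrightarrow> subspace W \<and> (\<exists>F. finite F \<and> W \<subseteq> span F)"

lemma finite_dimD: "finite_dim W \<Longrightarrow> subspace W"
  by (simp add: finite_dim_def)

lemma finite_dim_mono: "finite_dim W \<Longrightarrow> subspace V \<Longrightarrow> V \<subseteq> W \<Longrightarrow> finite_dim V"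
  by (auto simp: finite_dim_def)

lemma linear_eval_sum: "linear l \<Longrightarrow> l (\<Sum>i\<in>I. x i *\<^sub>R b i) = (\<Sum>i\<in>I. x i *\<^sub>R l (b i))"
  by (simp add: linear_sum linear_scale)

lemma linear_real_sum: "linear (l :: 'v::real_vector \<Rightarrow> real) \<Longrightarrow> l (\<Sum>i\<in>I. x i *\<^sub>R b i) = (\<Sum>i\<in>I. x i * l (b i))"
  by (simp add: linear_eval_sum)

text \<open>The forms are known only through their scalar components; this returns from scalar
  identities to vectors.\<close>

lemma separating_functional:
  fixes v w :: "'v::real_vector"
  assumes "\<And>l :: 'v \<Rightarrow> real. linear l \<Longrightarrow> l v = l w"
  shows "v = w"
proof (rule ccontr)
  assume "v \<noteq> w"
  then have "independent {v - w}" by simp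
  then obtain l where l: "linear (l :: 'v \<Rightarrow> real)" "\<forall>x\<in>{v - w}. l x = 1"
    using linear_independent_extend[of "{v - w}" "\<lambda>_. 1::real"] by blast
  then show False using assms[OF l(1)] by (simp add: linear_diff)
qed

text \<open>A basis of C is extended to W and the added vectors are listed first, so that the first
  q dual functionals cut out C, as the numbering in the Frobenius theorem requires. The functionals
  are extended to the whole type to make facts about \<open>linear\<close> applicable.\<close>

lemma adapted_basis:
  fixes W C :: "'v::real_vector set"
  assumes W: "finite_dim W" and C: "subspace C" "C \<subseteq> W"
  obtains q b c where "dim W = q + dim C" "\<forall>i<dim W. b i \<in> W" "\<forall>i<dim W. linear (c i :: 'v \<Rightarrow> real)"
    "\<forall>v\<in>W. v = (\<Sum>i<dim W. c i v *\<^sub>R b i)" "\<forall>i<dim W. \<forall>j<dim W. c i (b j) = (if i = j then 1 else 0)"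
    "\<forall>v\<in>W. v \<in> C \<longleftrightarrow> (\<forall>i<q. c i v = 0)"
proof -
  obtain F where F: "finite F" "W \<subseteq> span F" and sW: "subspace W" using W by (auto simp: finite_dim_def)
  obtain B1 where B1: "B1 \<subseteq> C" "independent B1" "C \<subseteq> span B1" using basis_exists by metis
  obtain B where B: "B1 \<subseteq> B" "B \<subseteq> W" "independent B" "W \<subseteq> span B"
    using maximal_independent_subset_extend[OF _ B1(2), of W] B1(1) C(2) by (metis order_trans)
  have spB: "span B = W" using B sW span_minimal by blast
  have spB1: "span B1 = C" using B1 C(1) span_minimal by blast
  have finB: "finite B" using independent_span_bound[OF F(1) B(3)] B(2) F(2) by auto
  have cardB: "card B = dim W" by (rule basis_card_eq_dim[OF B(2,4,3)])
  define q where "q = card (B - B1)"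
  have N: "dim W = q + card B1"
    using cardB card_Diff_subset[OF finite_subset[OF B(1) finB] B(1)] card_mono[OF finB B(1)] by (simp add: q_def)
  obtain f where f: "bij_betw f {0..<q} (B - B1)"
    unfolding q_def using ex_bij_betw_nat_finite[of "B - B1"] finB by auto
  obtain g where g: "bij_betw g {0..<card B1} B1"
    using ex_bij_betw_nat_finite[of B1] finite_subset[OF B(1) finB] by auto
  define b where "b i = (if i < q then f i else g (i - q))" for i
  have b1: "b i \<in> B - B1" if "i < q" for i using f that by (auto simp: b_def bij_betw_def)
  have b2: "b i \<in> B1" if "q \<le> i" "i < dim W" for i using g that N by (auto simp: b_def bij_betw_def)
  have bB: "b i \<in> B" if "i < dim W" for i using b1[of i] b2[of i] that B(1) by (cases "i < q") auto
  have inj: "inj_on b {..<dim W}"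
  proof (rule inj_onI)
    fix i j assume ij: "i \<in> {..<dim W}" "j \<in> {..<dim W}" "b i = b j"
    show "i = j"
    proof (cases "i < q"; cases "j < q")
      assume "i < q" "j < q"
      then show ?thesis using f ij(3) by (auto simp: b_def bij_betw_def inj_on_def)
    next
      assume h: "\<not> i < q" "\<not> j < q"
      then have "g (i - q) = g (j - q)" "i - q < card B1" "j - q < card B1" using ij N by (auto simp: b_def)
      then have "i - q = j - q" using g by (auto simp: bij_betw_def inj_on_def)
      then show ?thesis using h by auto
    qed (use b1[of i] b2[of j] b1[of j] b2[of i] ij in auto)
  qed
  have img: "b ` {..<dim W} = B"
    by (rule card_subset_eq[OF finB]) (use bB card_image[OF inj] cardB in auto)
  have img2: "b ` {q..<dim W} = B1"
  proof (rule card_subset_eq[OF finite_subset[OF B(1) finB]])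
    have "inj_on b {q..<dim W}" by (rule inj_on_subset[OF inj]) auto
    then show "card (b ` {q..<dim W}) = card B1" using card_image N by fastforce
  qed (use b2 in auto)
  have "\<exists>c. linear (c :: 'v \<Rightarrow> real) \<and> (\<forall>x\<in>B. c x = (if x = b i then 1 else 0))" for i
    by (rule linear_independent_extend[OF B(3)])
  then obtain c where c: "\<And>i. linear (c i :: 'v \<Rightarrow> real)" "\<And>i x. x \<in> B \<Longrightarrow> c i x = (if x = b i then 1 else 0)" by metis
  have cb: "c i (b j) = (if i = j then 1 else 0)" if "i < dim W" "j < dim W" for i j
    using c(2)[OF bB[OF that(2)]] inj that by (auto simp: inj_on_def)
  have rep: "v = (\<Sum>i<dim W. c i v *\<^sub>R b i)" if "v \<in> W" for v
  proof (rule linear_eq_on[of "\<lambda>v. v" "\<lambda>v. \<Sum>i<dim W. c i v *\<^sub>R b i"])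
    show "linear (\<lambda>v. v :: 'v)" by (simp add: linear_iff)
    show "linear (\<lambda>v. \<Sum>i<dim W. c i v *\<^sub>R b i)"
      using c(1) by (intro linear_compose_sum ballI) (auto simp: linear_iff scaleR_left_distrib)
    show "v \<in> span B" using that spB by simp
    fix x assume "x \<in> B"
    then obtain j where j: "j < dim W" "x = b j" using img by auto
    have "(\<Sum>i<dim W. c i x *\<^sub>R b i) = (\<Sum>i<dim W. if i = j then b i else 0)"
      by (rule sum.cong) (use j cb in auto)
    then show "x = (\<Sum>i<dim W. c i x *\<^sub>R b i)" using j by simp
  qed
  have Ciff: "v \<in> C \<longleftrightarrow> (\<forall>i<q. c i v = 0)" if v: "v \<in> W" for v
  proof
    assume "v \<in> C"
    show "\<forall>i<q. c i v = 0"
    proof (intro allI impI)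
      fix i assume i: "i < q"
      show "c i v = 0"
      proof (rule linear_eq_on[of "c i" "\<lambda>_. 0", OF c(1)])
        show "linear (\<lambda>_::'v. 0::real)" by (simp add: linear_iff)
        show "v \<in> span B1" using \<open>v \<in> C\<close> spB1 by simp
        show "c i x = 0" if "x \<in> B1" for x using c(2)[of x i] that b1[OF i] B(1) by auto
      qed
    qed
  next
    assume z: "\<forall>i<q. c i v = 0"
    have "v = (\<Sum>i<dim W. c i v *\<^sub>R b i)" by (rule rep[OF v])
    also have "\<dots> \<in> span B1"
    proof (rule span_sum)
      fix i assume "i \<in> {..<dim W}"
      then show "c i v *\<^sub>R b i \<in> span B1"
        using z b2[of i] by (cases "i < q") (auto intro: span_zero span_scale span_base)
    qed
    finally show "v \<in> C" using spB1 by simp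
  qed
  have "dim W = q + dim C" using N basis_card_eq_dim[OF B1(1,3,2)] by simp
  then show thesis
    by (rule that[of q b c]) (use bB B(2) c(1) rep cb Ciff in auto)
qed

lemma finite_dim_card:
  fixes W :: "'v::real_vector set"
  assumes W: "finite_dim W" and w: "\<And>i. i < dim W \<Longrightarrow> w i \<in> W"
    and inj: "\<And>\<xi>. (\<Sum>i<dim W. \<xi> i *\<^sub>R w i) = 0 \<Longrightarrow> (\<forall>i<dim W. \<xi> i = 0)" and v: "v \<in> W"
  obtains \<xi> where "v = (\<Sum>i<dim W. \<xi> i *\<^sub>R w i)"
proof -
  obtain F where F: "finite F" "W \<subseteq> span F" and sW: "subspace W" using W by (auto simp: finite_dim_def)
  have inj_w: "inj_on w {..<dim W}"
  proof (rule inj_onI, rule ccontr)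
    fix i j assume ij: "i \<in> {..<dim W}" "j \<in> {..<dim W}" "w i = w j" "i \<noteq> j"
    define \<xi> where "\<xi> l = (if l = i then 1 else if l = j then -1 else 0 :: real)" for l
    have "(\<Sum>l<dim W. \<xi> l *\<^sub>R w l) = (\<Sum>l<dim W. (if l = i then w l else 0) - (if l = j then w l else 0))"
      by (rule sum.cong) (use ij in \<open>auto simp: \<xi>_def\<close>)
    also have "\<dots> = 0" using ij by (simp add: sum_subtractf)
    finally have "\<xi> i = 0" using inj ij by blast
    then show False by (simp add: \<xi>_def)
  qed
  let ?B = "w ` {..<dim W}"
  have ind: "independent ?B"
  proof (rule independent_if_scalars_zero)
    fix f x assume f: "(\<Sum>x\<in>?B. f x *\<^sub>R x) = 0" and x: "x \<in> ?B"
    have "(\<Sum>i<dim W. f (w i) *\<^sub>R w i) = 0" using f by (simp add: sum.reindex[OF inj_w])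
    then show "f x = 0" using inj[of "\<lambda>i. f (w i)"] x by auto
  qed simp
  have card: "card ?B = dim W" using card_image[OF inj_w] by simp
  have "v \<in> span ?B"
  proof (rule ccontr)
    assume "v \<notin> span ?B"
    obtain B where B: "B \<subseteq> W" "independent B" "W \<subseteq> span B" "card B = dim W" using basis_exists by metis
    from \<open>v \<notin> span ?B\<close> have "independent (insert v ?B)" using ind by (simp add: independent_insert)
    moreover have "insert v ?B \<subseteq> W" using v w by auto
    moreover have "finite B" using independent_span_bound[OF F(1) B(2) order_trans[OF B(1) F(2)]] by simp
    ultimately have "card (insert v ?B) \<le> card B"
      using independent_span_bound[of B "insert v ?B"] B(3) by (meson order_trans)
    moreover have "v \<notin> ?B" using \<open>v \<notin> span ?B\<close> span_superset[of ?B] by (meson subsetD)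
    ultimately show False using card B(4) by simp
  qed
  then obtain u where "v = (\<Sum>x\<in>?B. u x *\<^sub>R x)" using span_finite[of ?B] by auto
  then have "v = (\<Sum>i<dim W. u (w i) *\<^sub>R w i)" by (simp add: sum.reindex[OF inj_w])
  then show thesis by (rule that)
qed

subsection \<open>Frames and the Frobenius theorem for vector valued forms\<close>

text \<open>A form on an open subset of Euclidean N-space is given by its values \<open>\<alpha> i\<close> on the coordinate fields.\<close>

definition dform :: "nat \<Rightarrow> (nat \<Rightarrow> (nat \<Rightarrow> real) \<Rightarrow> real) \<Rightarrow> (nat \<Rightarrow> real) \<Rightarrow> (nat \<Rightarrow> real) \<Rightarrow> (nat \<Rightarrow> real) \<Rightarrow> real"
  where "dform N \<alpha> z \<xi> \<eta> = (\<Sum>i<N. \<Sum>j<N. (pd i (\<alpha> j) z - pd j (\<alpha> i) z) * \<xi> i * \<eta> j)"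

text \<open>The numbers \<open>st v z i\<close> are the coordinate components of the vector field on
  which the form with coefficients w has the constant value v.\<close>

lemma smooth_dual_frame:
  fixes w :: "nat \<Rightarrow> (nat \<Rightarrow> real) \<Rightarrow> 'v::real_vector"
  assumes S: "openR n S" "z0 \<in> S" and W: "finite_dim W" "dim W = N"
    and w: "\<And>i l. i < N \<Longrightarrow> linear l \<Longrightarrow> C_infinity n S (\<lambda>z. l (w i z))" "\<And>i z. i < N \<Longrightarrow> z \<in> S \<Longrightarrow> w i z \<in> W"
    and inj: "\<And>\<xi>. (\<Sum>i<N. \<xi> i *\<^sub>R w i z0) = 0 \<Longrightarrow> (\<forall>i<N. \<xi> i = 0)"
  obtains r st where "r > 0" "cube n z0 r \<subseteq> S" "\<forall>z\<in>cube n z0 r. \<forall>v\<in>W. (\<Sum>i<N. st v z i *\<^sub>R w i z) = v"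
    "\<forall>z\<in>cube n z0 r. \<forall>\<xi>. \<forall>i<N. st (\<Sum>j<N. \<xi> j *\<^sub>R w j z) z i = \<xi> i" "\<forall>z i. linear (\<lambda>v. st v z i)"
    "\<forall>v. \<forall>i<N. C_infinity n (cube n z0 r) (\<lambda>z. st v z i)"
proof -
  have s0: "subspace {0::'v}" "{0} \<subseteq> W" using finite_dimD[OF W(1)] subspace_0 by auto
  obtain q b c where "N = q + dim {0::'v}" and b: "\<forall>i<N. b i \<in> W" and c: "\<forall>i<N. linear (c i :: 'v \<Rightarrow> real)"
    and rep: "\<forall>v\<in>W. v = (\<Sum>i<N. c i v *\<^sub>R b i)" and cb: "\<forall>i<N. \<forall>j<N. c i (b j) = (if i = j then 1 else 0)"
    and "\<forall>v\<in>W. v \<in> {0} \<longleftrightarrow> (\<forall>i<q. c i v = 0)"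
    by (rule adapted_basis[OF W(1) s0, unfolded W(2)])
  have inj': "\<forall>j<N. \<xi> j = 0" if h: "\<forall>i<N. (\<Sum>j<N. c i (w j z0) * \<xi> j) = 0" for \<xi>
  proof (rule inj)
    have mem: "(\<Sum>j<N. \<xi> j *\<^sub>R w j z0) \<in> W"
      using w(2) S finite_dimD[OF W(1)] by (intro subspace_sum subspace_scale) auto
    have "c i (\<Sum>j<N. \<xi> j *\<^sub>R w j z0) = 0" if "i < N" for i
      using h that by (simp add: linear_real_sum[OF c[rule_format, OF that]] mult.commute)
    then show "(\<Sum>j<N. \<xi> j *\<^sub>R w j z0) = 0" using bspec[OF rep mem] by simp
  qed
  have sm: "C_infinity n S (\<lambda>z. c i (w j z))" if "i < N" "j < N" for i j using w(1)[of j "c i"] c that by blast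
  obtain r K where r: "r > 0" "cube n z0 r \<subseteq> S" and K: "\<And>i j. i < N \<Longrightarrow> j < N \<Longrightarrow> C_infinity n (cube n z0 r) (K i j)"
    and KM: "\<And>z i j. z \<in> cube n z0 r \<Longrightarrow> i < N \<Longrightarrow> j < N \<Longrightarrow> (\<Sum>l<N. K i l z * c l (w j z)) = (if i = j then 1 else 0)"
    and MK: "\<And>z i j. z \<in> cube n z0 r \<Longrightarrow> i < N \<Longrightarrow> j < N \<Longrightarrow> (\<Sum>l<N. c i (w l z) * K l j z) = (if i = j then 1 else 0)"
    using smooth_matrix_inverse[where n=n and N=N and M="\<lambda>i j z. c i (w j z)", OF S sm inj'] by blast
  define st where "st v z i = (\<Sum>a<N. K i a z * c a v)" for v z i
  have mem: "(\<Sum>i<N. \<xi> i *\<^sub>R w i z) \<in> W" if "z \<in> cube n z0 r" for \<xi> z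
    using w(2) that r finite_dimD[OF W(1)] by (intro subspace_sum subspace_scale) auto
  have 1: "(\<Sum>i<N. st v z i *\<^sub>R w i z) = v" if z: "z \<in> cube n z0 r" and v: "v \<in> W" for z v
  proof -
    have "c a (\<Sum>i<N. st v z i *\<^sub>R w i z) = c a v" if a: "a < N" for a
    proof -
      have "c a (\<Sum>i<N. st v z i *\<^sub>R w i z) = (\<Sum>i<N. \<Sum>d<N. c a (w i z) * K i d z * c d v)"
        by (simp add: linear_real_sum[OF c[rule_format, OF a]] st_def sum_distrib_left sum_distrib_right mult_ac)
      also have "\<dots> = (\<Sum>d<N. (\<Sum>i<N. c a (w i z) * K i d z) * c d v)"
        by (subst sum.swap) (simp add: sum_distrib_right)
      also have "\<dots> = (\<Sum>d<N. (if a = d then 1 else 0) * c d v)" using MK[OF z a] by simp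
      finally show ?thesis by (simp add: sum_delta_mult[OF a])
    qed
    then show ?thesis using bspec[OF rep mem[OF z, of "st v z"]] bspec[OF rep v] by simp
  qed
  have 2: "st (\<Sum>j<N. \<xi> j *\<^sub>R w j z) z i = \<xi> i" if z: "z \<in> cube n z0 r" and i: "i < N" for z \<xi> i
  proof -
    have "st (\<Sum>j<N. \<xi> j *\<^sub>R w j z) z i = (\<Sum>a<N. \<Sum>j<N. K i a z * c a (w j z) * \<xi> j)"
      unfolding st_def by (intro sum.cong refl) (simp add: linear_real_sum[OF c[rule_format]] sum_distrib_left mult_ac)
    also have "\<dots> = (\<Sum>j<N. (\<Sum>a<N. K i a z * c a (w j z)) * \<xi> j)"
      by (subst sum.swap) (simp add: sum_distrib_right)
    also have "\<dots> = (\<Sum>j<N. (if i = j then 1 else 0) * \<xi> j)" using KM[OF z i] by simp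
    finally show ?thesis by (simp add: sum_delta_mult[OF i])
  qed
  have 3: "linear (\<lambda>v. st v z i)" for z i
    unfolding st_def using c by (intro linear_compose_sum ballI) (auto simp: linear_iff algebra_simps)
  have 4: "C_infinity n (cube n z0 r) (\<lambda>z. st v z i)" if "i < N" for v i
    unfolding st_def using K that by (intro smooth_sum smooth_mult smooth_const) auto
  show thesis by (rule that[OF r, of st]) (use 1 2 3 4 in blast)+
qed

text \<open>Basis-free version: every functional l vanishing on C receives a first integral
  \<open>G l\<close>, normalised so that its differential at \<open>z0\<close> is the component l of
  the form.\<close>

lemma frobenius_vector:
  fixes w :: "nat \<Rightarrow> (nat \<Rightarrow> real) \<Rightarrow> 'v::real_vector" and N :: nat
  assumes S: "openR N S" "z0 \<in> S" and W: "finite_dim W" "dim W = N" and C: "subspace C" "C \<subseteq> W"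
    and w: "\<And>i l. i < N \<Longrightarrow> linear l \<Longrightarrow> C_infinity N S (\<lambda>z. l (w i z))" "\<And>i z. i < N \<Longrightarrow> z \<in> S \<Longrightarrow> w i z \<in> W"
    and inj: "\<And>\<xi>. (\<Sum>i<N. \<xi> i *\<^sub>R w i z0) = 0 \<Longrightarrow> (\<forall>i<N. \<xi> i = 0)"
    and closed: "\<And>l z \<xi> \<eta>. linear l \<Longrightarrow> (\<forall>v\<in>C. l v = 0) \<Longrightarrow> z \<in> S \<Longrightarrow> (\<Sum>i<N. \<xi> i *\<^sub>R w i z) \<in> C \<Longrightarrow>
      (\<Sum>i<N. \<eta> i *\<^sub>R w i z) \<in> C \<Longrightarrow> dform N (\<lambda>i z. l (w i z)) z \<xi> \<eta> = 0"
  obtains r G where "r > 0" "cube N z0 r \<subseteq> S"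
    "\<forall>l. linear l \<and> (\<forall>v\<in>C. l v = 0) \<longrightarrow> C_infinity N (cube N z0 r) (G l) \<and>
      (\<forall>z\<in>cube N z0 r. \<forall>\<xi>. (\<Sum>i<N. \<xi> i *\<^sub>R w i z) \<in> C \<longrightarrow> (\<Sum>i<N. pd i (G l) z * \<xi> i) = 0) \<and>
      (\<forall>i<N. pd i (G l) z0 = l (w i z0))"
proof -
  obtain q b c where q: "N = q + dim C" and b: "\<forall>i<N. b i \<in> W" and c: "\<forall>i<N. linear (c i :: 'v \<Rightarrow> real)"
    and rep: "\<forall>v\<in>W. v = (\<Sum>i<N. c i v *\<^sub>R b i)" and cb: "\<forall>i<N. \<forall>j<N. c i (b j) = (if i = j then 1 else 0)"
    and Ciff: "\<forall>v\<in>W. v \<in> C \<longleftrightarrow> (\<forall>i<q. c i v = 0)"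
    by (rule adapted_basis[OF W(1) C, unfolded W(2)])
  from q have q: "q \<le> N" by simp
  have mem: "(\<Sum>i<N. \<xi> i *\<^sub>R w i z) \<in> W" if "z \<in> S" for \<xi> z
    using w(2) that finite_dimD[OF W(1)] by (intro subspace_sum subspace_scale) auto
  have cs: "c a (\<Sum>i<N. \<xi> i *\<^sub>R w i z) = (\<Sum>i<N. c a (w i z) * \<xi> i)" if "a < N" for a \<xi> z
    by (simp add: linear_real_sum[OF c[rule_format, OF that]] mult.commute)
  have inC: "(\<Sum>i<N. \<xi> i *\<^sub>R w i z) \<in> C \<longleftrightarrow> (\<forall>a<q. (\<Sum>i<N. c a (w i z) * \<xi> i) = 0)" if "z \<in> S" for \<xi> z
    using bspec[OF Ciff mem[OF that]] cs q by auto
  have inj': "\<forall>j<N. \<xi> j = 0" if h: "\<forall>i<N. (\<Sum>j<N. c i (w j z0) * \<xi> j) = 0" for \<xi>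
    by (rule inj, subst bspec[OF rep mem[OF S(2)]]) (use h cs in simp)
  have sm: "C_infinity N S (\<lambda>z. c i (w j z))" if "i < N" "j < N" for i j using w(1)[of j "c i"] c that by blast
  have cC: "\<forall>v\<in>C. c a v = 0" if "a < q" for a using Ciff C(2) that by blast
  have cl: "(\<Sum>i<N. \<Sum>j<N. (pd i (\<lambda>z. c a (w j z)) z - pd j (\<lambda>z. c a (w i z)) z) * \<xi> i * \<eta> j) = 0"
    if "a < q" "z \<in> S" "\<forall>b<q. (\<Sum>i<N. c b (w i z) * \<xi> i) = 0" "\<forall>b<q. (\<Sum>i<N. c b (w i z) * \<eta> i) = 0" for a z \<xi> \<eta>
    using closed[of "c a" z \<xi> \<eta>] cC[OF that(1)] c that q inC[OF that(2)] by (auto simp: dform_def)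
  obtain r g where r: "r > 0" "cube N z0 r \<subseteq> S" and g: "\<And>a. a < q \<Longrightarrow> C_infinity N (cube N z0 r) (g a)"
    and gk: "\<And>a z \<xi>. a < q \<Longrightarrow> z \<in> cube N z0 r \<Longrightarrow> (\<forall>b<q. (\<Sum>i<N. c b (w i z) * \<xi> i) = 0) \<Longrightarrow> (\<Sum>i<N. pd i (g a) z * \<xi> i) = 0"
    and g0: "\<And>a i. a < q \<Longrightarrow> i < N \<Longrightarrow> pd i (g a) z0 = c a (w i z0)"
    using frobenius_coframe[where al="\<lambda>a i z. c a (w i z)", OF S sm q inj' cl] by blast
  have z0: "z0 \<in> cube N z0 r" using S r openR_subset cube_self by blast
  define G where "G l z = (\<Sum>a<q. l (b a) * g a z)" for l :: "'v \<Rightarrow> real" and z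
  have pdG: "pd i (G l) z = (\<Sum>a<q. l (b a) * pd i (g a) z)" if "z \<in> cube N z0 r" "i < N" for l i z
  proof -
    have "pd i (G l) z = (\<Sum>a<q. pd i (\<lambda>z. l (b a) * g a z) z)"
      unfolding G_def by (rule partial_sum[OF openR_cube _ that]) (use g in \<open>auto intro!: smooth_mult smooth_const\<close>)
    then show ?thesis using partial_cmult[OF openR_cube g that] by simp
  qed
  \<comment> \<open>A functional that vanishes on C is a combination of the first q coordinates, so
    \<open>G l\<close> may be the same combination of the first integrals of those.\<close>
  have lq: "l v = (\<Sum>a<q. l (b a) * c a v)" if l: "linear l" "\<forall>v\<in>C. l v = 0" and v: "v \<in> W" for l :: "'v \<Rightarrow> real" and v
  proof -
    have "c a (b j) = 0" if "a < q" "q \<le> j" "j < N" for a j using cb that q by auto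
    then have bC: "b j \<in> C" if "q \<le> j" "j < N" for j using Ciff b that by auto
    have "l v = (\<Sum>i<N. c i v * l (b i))" by (subst bspec[OF rep v]) (simp add: linear_real_sum[OF l(1)])
    also have "\<dots> = (\<Sum>i<q. c i v * l (b i))"
      by (rule sum.mono_neutral_right) (use q bC l(2) in auto)
    finally show ?thesis by (simp add: mult.commute)
  qed
  show thesis
  proof (rule that[OF r, of G], intro allI impI, elim conjE, intro conjI ballI allI impI)
    fix l :: "'v \<Rightarrow> real" assume l: "linear l" "\<forall>v\<in>C. l v = 0"
    show "C_infinity N (cube N z0 r) (G l)"
      unfolding G_def[abs_def] using g by (intro smooth_sum smooth_mult smooth_const) auto
    show "pd i (G l) z0 = l (w i z0)" if "i < N" for i
      using pdG[OF z0 that] g0 that lq[OF l w(2)[OF that S(2)]] by simp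
    fix z \<xi> assume z: "z \<in> cube N z0 r" and \<xi>: "(\<Sum>i<N. \<xi> i *\<^sub>R w i z) \<in> C"
    have "(\<Sum>i<N. pd i (G l) z * \<xi> i) = (\<Sum>i<N. \<Sum>a<q. l (b a) * (pd i (g a) z * \<xi> i))"
      using pdG[OF z] by (simp add: sum_distrib_right mult.assoc)
    also have "\<dots> = (\<Sum>a<q. l (b a) * (\<Sum>i<N. pd i (g a) z * \<xi> i))"
      by (subst sum.swap) (simp add: sum_distrib_left)
    also have "\<dots> = 0" using gk[OF _ z] inC[of z \<xi>] \<xi> z r by (auto intro!: sum.neutral)
    finally show "(\<Sum>i<N. pd i (G l) z * \<xi> i) = 0" .
  qed
qed

section \<open>The spaces of jets\<close>

lemma linear_fun_component: "linear (\<lambda>X :: 'i \<Rightarrow> 'v::real_vector. X i)"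
  by (simp add: linear_iff scaleR_fun_def)

lemma VV_Suc: "X \<in> VV (Suc p) \<longleftrightarrow>
    X \<in> Hom_into (VV p) \<and> (\<forall>j. p = Suc j \<longrightarrow> (\<forall>u v. appl (appl X u) v = appl (appl X v) u))"
  by (cases p) auto

lemma appl_simps:
  "appl (X + Y) u = appl X u + appl Y u" "appl (c *\<^sub>R X) u = c *\<^sub>R appl X u" "appl 0 u = 0"
  by (auto simp: appl_def fun_eq_iff scaleR_fun_def)

lemma scaleR_fun_apply: "(c *\<^sub>R X) i = c *\<^sub>R X i"
  by (simp add: scaleR_fun_def)

lemma subspace_Hom_into: "subspace S \<Longrightarrow> subspace (Hom_into S)"
  by (rule subspaceI)
    (auto simp: Hom_into_def linear_iff appl_simps scaleR_fun_apply subspace_0 subspace_add subspace_scale algebra_simps)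

lemma subspace_VV: "subspace (VV p :: ('a::real_vector, 'b::real_vector) tensor set)"
proof (induction p)
  case 0
  then show ?case by (rule subspaceI) (auto simp: scaleR_fun_def)
next
  case (Suc p)
  note h = subspace_Hom_into[OF Suc]
  show ?case
    by (rule subspaceI) (auto simp: VV_Suc appl_simps subspace_0[OF h] subspace_add[OF h] subspace_scale[OF h])
qed

lemma VV_length: "X \<in> VV p \<Longrightarrow> length us \<noteq> p \<Longrightarrow> X us = (0 :: 'b::real_vector)"
proof (induction p arbitrary: X us)
  case (Suc p X us)
  show ?case
  proof (cases us)
    case (Cons u vs)
    have "appl X u \<in> VV p" using Suc.prems by (auto simp: VV_Suc Hom_into_def)
    from Suc.IH[OF this, of vs] Cons Suc show ?thesis by (auto simp: appl_def)
  qed (use Suc.prems in \<open>auto simp: VV_Suc Hom_into_def\<close>)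
qed auto

text \<open>The recursion for \<open>VV\<close> only inspects the first arguments; requiring the
  conditions at every position lets them pass to \<open>appl X u\<close>. Adjacent transpositions
  are the form in which commuting derivatives deliver symmetry.\<close>

lemma VV_intro:
  fixes X :: "('a::real_vector, 'b::real_vector) tensor"
  assumes "\<And>us. length us \<noteq> p \<Longrightarrow> X us = 0"
    and "\<And>us vs u v. length us + Suc (length vs) = p \<Longrightarrow> X (us @ (u + v) # vs) = X (us @ u # vs) + X (us @ v # vs)"
    and "\<And>us vs u c. length us + Suc (length vs) = p \<Longrightarrow> X (us @ (c *\<^sub>R u) # vs) = c *\<^sub>R X (us @ u # vs)"
    and "\<And>us vs u v. length us + Suc (Suc (length vs)) = p \<Longrightarrow> X (us @ u # v # vs) = X (us @ v # u # vs)"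
  shows "X \<in> VV p"
  using assms
proof (induction p arbitrary: X)
  case 0
  then show ?case by auto
next
  case (Suc p)
  have lin: "linear (appl X)"
  proof (rule linearI)
    fix u v
    have "X ((u + v) # vs) = X (u # vs) + X (v # vs)" for vs
      using Suc.prems(2)[of "[]" vs u v] Suc.prems(1)[of "(u + v) # vs"] Suc.prems(1)[of "u # vs"] Suc.prems(1)[of "v # vs"]
      by (cases "length vs = p") auto
    then show "appl X (u + v) = appl X u + appl X v" by (auto simp: appl_def fun_eq_iff)
    fix c
    have "X ((c *\<^sub>R u) # vs) = c *\<^sub>R X (u # vs)" for vs
      using Suc.prems(3)[of "[]" vs c u] Suc.prems(1)[of "(c *\<^sub>R u) # vs"] Suc.prems(1)[of "u # vs"]
      by (cases "length vs = p") auto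
    then show "appl X (c *\<^sub>R u) = c *\<^sub>R appl X u" by (auto simp: appl_def fun_eq_iff scaleR_fun_def)
  qed
  have mem: "appl X u \<in> VV p" for u
  proof (rule Suc.IH)
    show "appl X u us = 0" if "length us \<noteq> p" for us using Suc.prems(1)[of "u # us"] that by (simp add: appl_def)
    show "appl X u (us @ (v + v') # vs) = appl X u (us @ v # vs) + appl X u (us @ v' # vs)" if "length us + Suc (length vs) = p" for us vs v v'
      using Suc.prems(2)[of "u # us" vs v v'] that by (simp add: appl_def)
    show "appl X u (us @ (c *\<^sub>R v) # vs) = c *\<^sub>R appl X u (us @ v # vs)" if "length us + Suc (length vs) = p" for us vs v c
      using Suc.prems(3)[of "u # us" vs c v] that by (simp add: appl_def)
    show "appl X u (us @ v # v' # vs) = appl X u (us @ v' # v # vs)" if "length us + Suc (Suc (length vs)) = p" for us vs v v'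
      using Suc.prems(4)[of "u # us" vs v v'] that by (simp add: appl_def)
  qed
  have hom: "X \<in> Hom_into (VV p)" using lin mem Suc.prems(1)[of "[]"] by (auto simp: Hom_into_def)
  show ?case
  proof (cases p)
    case (Suc j)
    have "X (u # v # vs) = X (v # u # vs)" for u v vs
      using Suc.prems(4)[of "[]" vs u v] Suc.prems(1)[of "u # v # vs"] Suc.prems(1)[of "v # u # vs"] Suc
      by (cases "length vs = j") auto
    then show ?thesis using hom Suc by (auto simp: appl_def)
  qed (use hom in auto)
qed

lemma finite_dim_VV:
  assumes A: "\<exists>B :: 'a::real_vector set. finite B \<and> span B = UNIV" and B: "\<exists>B :: 'b::real_vector set. finite B \<and> span B = UNIV"
  shows "finite_dim (VV p :: ('a, 'b) tensor set)"
proof -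
  have fa: "finite_dim (UNIV :: 'a set)" using A by (auto simp: finite_dim_def)
  obtain q b c where b: "\<forall>v\<in>(UNIV :: 'a set). v = (\<Sum>i<dim (UNIV :: 'a set). c i v *\<^sub>R b i)" and c: "\<forall>i<dim (UNIV :: 'a set). linear (c i :: 'a \<Rightarrow> real)"
    by (rule adapted_basis[OF fa subspace_UNIV]) blast
  let ?n = "dim (UNIV :: 'a set)"
  have Hom: "\<exists>F. finite F \<and> Hom_into S \<subseteq> span F" if S: "finite F0" "S \<subseteq> span F0" for F0 and S :: "('a, 'b) tensor set"
  proof -
    \<comment> \<open>The tensor product of the i-th dual basis vector with X; these products span
      the homomorphisms.\<close>
    define tens where "tens i X us = (case us of [] \<Rightarrow> 0 | u # vs \<Rightarrow> c i u *\<^sub>R X vs)" for i and X :: "('a, 'b) tensor" and us :: "'a list"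
    have lt: "linear (tens i)" for i
      by (rule linearI) (auto simp: tens_def fun_eq_iff scaleR_fun_def algebra_simps split: list.split)
    have "X \<in> span (\<Union>i<?n. tens i ` F0)" if X: "X \<in> Hom_into S" for X
    proof -
      have lin: "linear (appl X)" using X by (simp add: Hom_into_def)
      have "X = (\<Sum>i<?n. tens i (appl X (b i)))"
      proof
        fix us show "X us = (\<Sum>i<?n. tens i (appl X (b i))) us"
        proof (cases us)
          case Nil
          have "(\<Sum>i<?n. tens i (appl X (b i))) [] = (\<Sum>i<?n. tens i (appl X (b i)) [])"
            using linear_sum[OF linear_fun_component[of "[]"]] .
          then show ?thesis using X Nil by (simp add: tens_def Hom_into_def)
        next
          case (Cons u vs)
          have "X us = appl X (\<Sum>i<?n. c i u *\<^sub>R b i) vs" using b Cons by (simp add: appl_def)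
          also have "\<dots> = (\<Sum>i<?n. c i u *\<^sub>R appl X (b i)) vs" by (simp add: linear_eval_sum[OF lin])
          also have "\<dots> = (\<Sum>i<?n. c i u *\<^sub>R appl X (b i) vs)"
            using linear_sum[OF linear_fun_component[of vs], of "\<lambda>i. c i u *\<^sub>R appl X (b i)" "{..<?n}"] by (simp add: scaleR_fun_def)
          also have "\<dots> = (\<Sum>i<?n. tens i (appl X (b i)) us)" using Cons by (simp add: tens_def)
          also have "\<dots> = (\<Sum>i<?n. tens i (appl X (b i))) us"
            using linear_sum[OF linear_fun_component[of us], symmetric] .
          finally show ?thesis .
        qed
      qed
      also have "\<dots> \<in> span (\<Union>i<?n. tens i ` F0)"
      proof (rule span_sum)
        fix i assume i: "i \<in> {..<?n}"
        have "appl X (b i) \<in> span F0" using X S(2) by (auto simp: Hom_into_def)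
        then have "tens i (appl X (b i)) \<in> span (tens i ` F0)" using linear_span_image[OF lt] by auto
        moreover have "span (tens i ` F0) \<subseteq> span (\<Union>i<?n. tens i ` F0)" using i by (intro span_mono) auto
        ultimately show "tens i (appl X (b i)) \<in> span (\<Union>i<?n. tens i ` F0)" by blast
      qed
      finally show ?thesis .
    qed
    then show ?thesis using S(1) by (intro exI[of _ "\<Union>i<?n. tens i ` F0"]) auto
  qed
  have "\<exists>F. finite F \<and> (VV p :: ('a, 'b) tensor set) \<subseteq> span F"
  proof (induction p)
    case 0
    obtain F where F: "finite F" "span F = (UNIV :: 'b set)" using B by blast
    define e where "e y us = (if us = [] then y else 0)" for y :: 'b and us :: "'a list"
    have le: "linear e" by (rule linearI) (auto simp: e_def fun_eq_iff scaleR_fun_def)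
    have "X \<in> span (e ` F)" if "X \<in> VV 0" for X
    proof -
      have "X = e (X [])" using that by (auto simp: e_def fun_eq_iff)
      moreover have "e (X []) \<in> span (e ` F)" using linear_span_image[OF le, of F] F by auto
      ultimately show ?thesis by simp
    qed
    then show ?case using F(1) by (intro exI[of _ "e ` F"]) auto
  next
    case (Suc p)
    then obtain F where "finite F" "(VV p :: ('a, 'b) tensor set) \<subseteq> span F" by blast
    from Hom[OF this] show ?case by (metis VV_Suc subsetI subset_trans)
  qed
  then show ?thesis using subspace_VV by (auto simp: finite_dim_def)
qed

section \<open>The graded spaces as finite dimensional vector spaces\<close>

lemma WW_iff: "w \<in> WW k \<longleftrightarrow> (\<forall>p\<le>k. snd w p \<in> VV p) \<and> (\<forall>p>k. snd w p = 0)"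
  by (cases w) (auto simp: WW_def)

lemma snd_scaleR_component: "snd (c *\<^sub>R w) p = c *\<^sub>R snd w p"
  by (simp add: scaleR_fun_def)

lemma subspace_WW: "subspace (WW k)"
  by (rule subspaceI) (auto simp: WW_iff snd_scaleR_component simp del: snd_scaleR
      intro: subspace_0[OF subspace_VV] subspace_add[OF subspace_VV] subspace_scale[OF subspace_VV])

lemma linear_hom_m1: "linear (hom_m1 :: 'a::real_vector \<Rightarrow> ('a, 'b::real_vector) graded)"
  by (rule linearI) (auto simp: hom_m1_def)

lemma linear_hom_p: "linear (hom_p p)"
  by (rule linearI) (auto simp: hom_p_def fun_eq_iff scaleR_fun_def)

lemma linear_snd_component: "linear (\<lambda>w :: ('a::real_vector, 'b::real_vector) graded. snd w p)"
  by (rule linearI) (auto simp: scaleR_fun_def)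

lemma linear_rho: "linear (rho k :: ('a::real_vector, 'b::real_vector) graded \<Rightarrow> _)"
  by (rule linearI) (auto simp: rho_def fun_eq_iff scaleR_fun_def)

lemma finite_dim_WW:
  assumes A: "\<exists>B :: 'a::real_vector set. finite B \<and> span B = UNIV" and B: "\<exists>B :: 'b::real_vector set. finite B \<and> span B = UNIV"
  shows "finite_dim (WW k :: ('a, 'b) graded set)"
proof -
  obtain E where E: "finite E" "span E = (UNIV :: 'a set)" using A by blast
  have "\<exists>F. finite F \<and> (VV p :: ('a, 'b) tensor set) \<subseteq> span F" for p
    using finite_dim_VV[OF A B] by (auto simp: finite_dim_def)
  then obtain F where F: "\<And>p. finite (F p)" "\<And>p. (VV p :: ('a, 'b) tensor set) \<subseteq> span (F p)" by metis
  let ?F = "hom_m1 ` E \<union> (\<Union>p\<le>k. hom_p p ` F p) :: ('a, 'b) graded set"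
  have "w \<in> span ?F" if w: "w \<in> WW k" for w :: "('a, 'b) graded"
  proof -
    have "snd w q = (\<Sum>p\<le>k. (if q = p then snd w p else 0))" for q
      using w by (simp add: WW_iff)
    moreover have "snd (\<Sum>p\<le>k. hom_p p (snd w p)) q = (\<Sum>p\<le>k. (if q = p then snd w p else 0))" for q
      using linear_sum[OF linear_snd_component[of q], of "\<lambda>p. hom_p p (snd w p)" "{..k}"] by (simp add: hom_p_def fun_upd_def)
    moreover have "fst (\<Sum>p\<le>k. hom_p p (snd w p) :: ('a, 'b) graded) = 0"
      using linear_sum[OF linear_fst, of "\<lambda>p. hom_p p (snd w p) :: ('a, 'b) graded" "{..k}"] by (simp add: hom_p_def)
    ultimately have "w = hom_m1 (fst w) + (\<Sum>p\<le>k. hom_p p (snd w p))"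
      by (auto simp: prod_eq_iff hom_m1_def fun_eq_iff)
    also have "\<dots> \<in> span ?F"
    proof (rule span_add)
      have "hom_m1 (fst w) \<in> span (hom_m1 ` E :: ('a, 'b) graded set)"
        using linear_span_image[OF linear_hom_m1, of E] E by auto
      then show "hom_m1 (fst w) \<in> span ?F" using span_mono[of "hom_m1 ` E" ?F] by blast
      show "(\<Sum>p\<le>k. hom_p p (snd w p)) \<in> span ?F"
      proof (rule span_sum)
        fix p assume p: "p \<in> {..k}"
        have "snd w p \<in> span (F p)" using w F(2) p by (auto simp: WW_iff)
        then have "hom_p p (snd w p) \<in> span (hom_p p ` F p)" using linear_span_image[OF linear_hom_p] by auto
        then show "hom_p p (snd w p) \<in> span ?F" using span_mono[of "hom_p p ` F p" ?F] p by auto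
      qed
    qed
    finally show ?thesis .
  qed
  then show ?thesis using subspace_WW E(1) F(1) unfolding finite_dim_def by (intro conjI exI[of _ ?F]) auto
qed

lemma subspace_WW0: "subspace V \<Longrightarrow> subspace (WW0 k V)"
  by (rule subspaceI) (auto simp: WW0_def snd_scaleR_component simp del: snd_scaleR
      intro: subspace_0 subspace_add subspace_scale subspace_0[OF subspace_WW] subspace_add[OF subspace_WW] subspace_scale[OF subspace_WW])

lemma WW_pred_subset_WW0:
  assumes "subspace V" "0 < k" shows "WW (k - 1) \<subseteq> WW0 k V"
proof
  fix w :: "('a, 'b) graded" assume w: "w \<in> WW (k - 1)"
  have "snd w p \<in> VV p" if "p \<le> k" for p
    using w that assms(2) subspace_0[OF subspace_VV[of p]] by (cases "p = k") (auto simp: WW_iff)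
  moreover have "snd w k = 0" "\<forall>p>k. snd w p = 0" using w assms(2) by (auto simp: WW_iff)
  ultimately show "w \<in> WW0 k V" using subspace_0[OF assms(1)] by (auto simp: WW0_def WW_iff)
qed

section \<open>Smooth manifolds\<close>

lemma chartD:
  assumes "smooth_manifold M" "(U, \<phi>) \<in> atlas M"
  shows "openin (mtop M) U" "openR (mdim M) (\<phi> ` U)" "U \<subseteq> points M" "inj_on \<phi> U"
    "homeomorphic_map (subtopology (mtop M) U) (subtopology (Euclidean_space (mdim M)) (\<phi> ` U)) \<phi>"
proof -
  show U: "openin (mtop M) U" and "openR (mdim M) (\<phi> ` U)"
    and h: "homeomorphic_map (subtopology (mtop M) U) (subtopology (Euclidean_space (mdim M)) (\<phi> ` U)) \<phi>"
    using assms unfolding smooth_manifold_def by blast+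
  then show "U \<subseteq> points M" using openin_subset by blast
  then show "inj_on \<phi> U" using h by (auto simp: homeomorphic_eq_everything_map Int_absorb1)
qed

lemma chart_transition:
  assumes "smooth_manifold M" "(U, \<phi>) \<in> atlas M" "(V, \<psi>) \<in> atlas M" "i < mdim M"
  shows "C_infinity (mdim M) (\<phi> ` (U \<inter> V)) (\<lambda>z. \<psi> (inv_into U \<phi> z) i)"
  using assms unfolding smooth_manifold_def by blast

lemma chart_exists: "smooth_manifold M \<Longrightarrow> x \<in> points M \<Longrightarrow> \<exists>U \<phi>. (U, \<phi>) \<in> atlas M \<and> x \<in> U"
  unfolding smooth_manifold_def by blast

lemma chart_image_open:
  assumes "smooth_manifold M" "(U, \<phi>) \<in> atlas M" "openin (mtop M) A" "A \<subseteq> U"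
  shows "openR (mdim M) (\<phi> ` A)"
proof -
  note c = chartD[OF assms(1,2)]
  have "openin (subtopology (mtop M) U) A" using assms c by (simp add: openin_open_subtopology)
  then have "openin (subtopology (Euclidean_space (mdim M)) (\<phi> ` U)) (\<phi> ` A)"
    using homeomorphic_imp_open_map[OF c(5)] by (simp add: open_map_def)
  then show ?thesis using c(2) openin_open_subtopology by blast
qed

lemma smooth_fun_iff:
  "f \<in> smooth_fun M \<longleftrightarrow> (\<forall>U \<phi>. (U, \<phi>) \<in> atlas M \<longrightarrow> C_infinity (mdim M) (\<phi> ` U) (\<lambda>z. f (inv_into U \<phi> z)))"
  by (auto simp: smooth_fun_def)

lemma smooth_funD: "f \<in> smooth_fun M \<Longrightarrow> (U, \<phi>) \<in> atlas M \<Longrightarrow> C_infinity (mdim M) (\<phi> ` U) (\<lambda>z. f (inv_into U \<phi> z))"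
  by (auto simp: smooth_fun_iff)

lemma smooth_fun_cong:
  assumes "smooth_manifold M" "f \<in> smooth_fun M" "\<And>x. x \<in> points M \<Longrightarrow> f x = g x"
  shows "g \<in> smooth_fun M"
  unfolding smooth_fun_iff
proof (intro allI impI)
  fix U \<phi> assume c: "(U, \<phi>) \<in> atlas M"
  show "C_infinity (mdim M) (\<phi> ` U) (\<lambda>z. g (inv_into U \<phi> z))"
  proof (rule smooth_cong[OF chartD(2)[OF assms(1) c] smooth_funD[OF assms(2) c]])
    show "f (inv_into U \<phi> z) = g (inv_into U \<phi> z)" if "z \<in> \<phi> ` U" for z
      using assms(3) inv_into_into[OF that] chartD(3)[OF assms(1) c] by auto
  qed
qed

lemma smooth_fun_const: "smooth_manifold M \<Longrightarrow> (\<lambda>_. c) \<in> smooth_fun M"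
  unfolding smooth_fun_iff using chartD(2) smooth_const by blast

lemma smooth_fun_add: "smooth_manifold M \<Longrightarrow> f \<in> smooth_fun M \<Longrightarrow> g \<in> smooth_fun M \<Longrightarrow> (\<lambda>x. f x + g x) \<in> smooth_fun M"
  unfolding smooth_fun_iff using smooth_add[OF chartD(2)] by blast

lemma smooth_fun_mult: "smooth_manifold M \<Longrightarrow> f \<in> smooth_fun M \<Longrightarrow> g \<in> smooth_fun M \<Longrightarrow> (\<lambda>x. f x * g x) \<in> smooth_fun M"
  unfolding smooth_fun_iff using smooth_mult[OF chartD(2)] by blast

lemma smooth_fun_sum:
  assumes "smooth_manifold M" "\<And>i. i \<in> I \<Longrightarrow> f i \<in> smooth_fun M"
  shows "(\<lambda>x. \<Sum>i\<in>I. f i x) \<in> smooth_fun M"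
  using assms(2) by (induction I rule: infinite_finite_induct) (auto intro: smooth_fun_const smooth_fun_add assms(1))

lemma smooth_fun_compose:
  assumes M: "smooth_manifold M" and Q: "openR n Q" "C_infinity n Q h"
    and \<kappa>: "\<And>i. i < n \<Longrightarrow> (\<lambda>x. \<kappa> x i) \<in> smooth_fun M" "\<And>x. x \<in> points M \<Longrightarrow> \<kappa> x \<in> Q"
  shows "(\<lambda>x. h (\<kappa> x)) \<in> smooth_fun M"
  unfolding smooth_fun_iff
proof (intro allI impI)
  fix U \<phi> assume c: "(U, \<phi>) \<in> atlas M"
  show "C_infinity (mdim M) (\<phi> ` U) (\<lambda>z. h (\<kappa> (inv_into U \<phi> z)))"
  proof (rule smooth_compose[OF Q(1) chartD(2)[OF M c] Q(2) smooth_funD[OF \<kappa>(1) c]])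
    show "\<kappa> (inv_into U \<phi> z) \<in> Q" if "z \<in> \<phi> ` U" for z
      using \<kappa>(2) inv_into_into[OF that] chartD(3)[OF M c] by auto
  qed
qed

lemma smooth_fun_continuous:
  assumes M: "smooth_manifold M" and f: "f \<in> smooth_fun M"
  shows "continuous_map (mtop M) euclideanreal f"
proof (rule pasting_lemma[where I="atlas M" and T=fst and f="\<lambda>_. f"])
  fix c assume c: "c \<in> atlas M"
  obtain U \<phi> where U: "c = (U, \<phi>)" by (cases c)
  note ch = chartD[OF M c[unfolded U]]
  have 1: "continuous_map (subtopology (mtop M) U) (subtopology (Euclidean_space (mdim M)) (\<phi> ` U)) \<phi>"
    using ch(5) by (simp add: homeomorphic_eq_everything_map)
  have "C_times (mdim M) 0 (\<phi> ` U) (\<lambda>z. f (inv_into U \<phi> z))"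
    using smooth_funD[OF f c[unfolded U]] unfolding C_infinity_def by blast
  then have 2: "continuous_map (subtopology (Euclidean_space (mdim M)) (\<phi> ` U)) euclideanreal (\<lambda>z. f (inv_into U \<phi> z))" by simp
  have "continuous_map (subtopology (mtop M) U) euclideanreal (\<lambda>x. f (inv_into U \<phi> (\<phi> x)))"
    using continuous_map_compose[OF 1 2] by (simp add: o_def)
  then show "continuous_map (subtopology (mtop M) (fst c)) euclideanreal f"
    unfolding U fst_conv by (rule continuous_map_eq) (use ch(4) U in auto)
qed (use chartD(1)[OF M] chart_exists[OF M] in force)+

lemma smooth_manifold_open_submfd:
  assumes M: "smooth_manifold M" and S: "openin (mtop M) S"
  shows "smooth_manifold (open_submfd M S)" "points (open_submfd M S) = S"
proof -
  show p: "points (open_submfd M S) = S" using openin_subset[OF S] by (auto simp: open_submfd_def)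
  have SM: "S \<subseteq> points M" using openin_subset[OF S] .
  show "smooth_manifold (open_submfd M S)" unfolding smooth_manifold_def
  proof (intro conjI)
    show "Hausdorff_space (mtop (open_submfd M S))" "second_countable (mtop (open_submfd M S))"
      using M by (auto simp: open_submfd_def smooth_manifold_def Hausdorff_space_subtopology second_countable_subtopology)
    show "(\<Union>(U, \<phi>)\<in>atlas (open_submfd M S). U) = points (open_submfd M S)"
      unfolding p using chart_exists[OF M] SM by (fastforce simp: open_submfd_def)
    show "\<forall>(U, \<phi>)\<in>atlas (open_submfd M S). openin (mtop (open_submfd M S)) U \<and>
        openin (Euclidean_space (mdim (open_submfd M S))) (\<phi> ` U) \<and>
        homeomorphic_map (subtopology (mtop (open_submfd M S)) U)
          (subtopology (Euclidean_space (mdim (open_submfd M S))) (\<phi> ` U)) \<phi>"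
    proof (clarify)
      fix V \<phi> assume "(V, \<phi>) \<in> atlas (open_submfd M S)"
      then obtain U where U: "(U, \<phi>) \<in> atlas M" "V = U \<inter> S" by (auto simp: open_submfd_def)
      note c = chartD[OF M U(1)]
      have V: "openin (mtop M) V" using U(2) c(1) S by auto
      have "homeomorphic_map (subtopology (subtopology (mtop M) U) S)
          (subtopology (subtopology (Euclidean_space (mdim M)) (\<phi> ` U)) (\<phi> ` V)) \<phi>"
        by (rule homeomorphic_map_subtopologies[OF c(5)])
          (use c(2,3) U(2) openR_subset[OF c(2)] topspace_Rn[of "mdim M"] in auto)
      moreover have "subtopology (subtopology (mtop M) U) S = subtopology (subtopology (mtop M) S) V"
        by (simp add: subtopology_subtopology U(2) Int_ac)
      moreover have "subtopology (subtopology (Euclidean_space (mdim M)) (\<phi> ` U)) (\<phi> ` V) = subtopology (Euclidean_space (mdim M)) (\<phi> ` V)"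
        using U(2) by (simp add: subtopology_subtopology) (metis Int_absorb1 Int_lower1 image_mono)
      ultimately show "openin (mtop (open_submfd M S)) V \<and>
        openin (Euclidean_space (mdim (open_submfd M S))) (\<phi> ` V) \<and>
        homeomorphic_map (subtopology (mtop (open_submfd M S)) V)
          (subtopology (Euclidean_space (mdim (open_submfd M S))) (\<phi> ` V)) \<phi>"
        using chart_image_open[OF M U(1) V] U(2) V S by (auto simp: open_submfd_def openin_open_subtopology)
    qed
    have "C_infinity (mdim M) (\<phi> ` ((U \<inter> S) \<inter> (V \<inter> S))) (\<lambda>z. \<psi> (inv_into (U \<inter> S) \<phi> z) i)"
      if U: "(U, \<phi>) \<in> atlas M" and V: "(V, \<psi>) \<in> atlas M" and i: "i < mdim M" for U \<phi> V \<psi> i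
    proof -
      note c = chartD[OF M U] and d = chartD[OF M V]
      have o: "openR (mdim M) (\<phi> ` (U \<inter> V))" "openR (mdim M) (\<phi> ` ((U \<inter> S) \<inter> (V \<inter> S)))"
        using chart_image_open[OF M U, of "U \<inter> V"] chart_image_open[OF M U, of "(U \<inter> S) \<inter> (V \<inter> S)"] c(1) d(1) S by auto
      have "C_infinity (mdim M) (\<phi> ` ((U \<inter> S) \<inter> (V \<inter> S))) (\<lambda>z. \<psi> (inv_into U \<phi> z) i)"
        by (rule smooth_subset[OF chart_transition[OF M U V i] o]) auto
      then show ?thesis
      proof (rule smooth_cong[OF o(2)])
        fix z assume "z \<in> \<phi> ` ((U \<inter> S) \<inter> (V \<inter> S))"
        then obtain x where x: "x \<in> U \<inter> S" "z = \<phi> x" by auto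
        have "inv_into U \<phi> z = x" "inv_into (U \<inter> S) \<phi> z = x"
          using x c(4) by (auto intro!: inv_into_f_eq inj_on_subset[OF c(4)])
        then show "\<psi> (inv_into U \<phi> z) i = \<psi> (inv_into (U \<inter> S) \<phi> z) i" by simp
      qed
    qed
    then show "\<forall>(U, \<phi>)\<in>atlas (open_submfd M S). \<forall>(V, \<psi>)\<in>atlas (open_submfd M S). \<forall>i<mdim (open_submfd M S).
       C_infinity (mdim (open_submfd M S)) (\<phi> ` (U \<inter> V)) (\<lambda>z. \<psi> (inv_into U \<phi> z) i)"
      by (auto simp: open_submfd_def)
  qed
qed

subsection \<open>Tangent vectors\<close>

lemma tangentD:
  assumes "v \<in> tangent M x"
  shows "f \<notin> smooth_fun M \<Longrightarrow> v f = 0"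
    "f \<in> smooth_fun M \<Longrightarrow> g \<in> smooth_fun M \<Longrightarrow> v (\<lambda>y. f y + g y) = v f + v g"
    "f \<in> smooth_fun M \<Longrightarrow> v (\<lambda>y. c * f y) = c * v f"
    "f \<in> smooth_fun M \<Longrightarrow> g \<in> smooth_fun M \<Longrightarrow> v (\<lambda>y. f y * g y) = f x * v g + g x * v f"
  using assms by (auto simp: tangent_def linear_on_def plus_fun_def scaleR_fun_def)

lemma tangent_const:
  assumes M: "smooth_manifold M" and v: "v \<in> tangent M x"
  shows "v (\<lambda>_. c) = 0"
proof -
  have "v (\<lambda>_. 1 * 1) = 1 * v (\<lambda>_. 1) + 1 * v (\<lambda>_. 1)"
    by (rule tangentD(4)[OF v]) (auto intro: smooth_fun_const M)
  then have "v (\<lambda>_. 1) = 0" by simp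
  then show ?thesis using tangentD(3)[OF v smooth_fun_const[OF M, of 1], of c] by simp
qed

lemma tangent_sum:
  assumes M: "smooth_manifold M" and v: "v \<in> tangent M x" and f: "\<And>i. i \<in> I \<Longrightarrow> f i \<in> smooth_fun M"
  shows "v (\<lambda>y. \<Sum>i\<in>I. f i y) = (\<Sum>i\<in>I. v (f i))"
  using f
proof (induction I rule: infinite_finite_induct)
  case (insert i I)
  then show ?case using tangentD(2)[OF v, of "f i" "\<lambda>y. \<Sum>i\<in>I. f i y"] smooth_fun_sum[OF M, of I f] by simp
qed (simp_all add: tangent_const[OF M v])

text \<open>A tangent vector only sees the values on the manifold: multiply by the indicator of the complement.\<close>

lemma tangent_cong:
  assumes M: "smooth_manifold M" and v: "v \<in> tangent M x" and x: "x \<in> points M"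
    and f: "f \<in> smooth_fun M" and eq: "\<And>y. y \<in> points M \<Longrightarrow> f y = g y"
  shows "v f = v g"
proof -
  have g: "g \<in> smooth_fun M" by (rule smooth_fun_cong[OF M f eq])
  define d where "d y = f y + (- 1) * g y" for y
  have g': "(\<lambda>y. (- 1) * g y) \<in> smooth_fun M" by (rule smooth_fun_mult[OF M smooth_fun_const[OF M] g])
  have d: "d \<in> smooth_fun M" unfolding d_def by (rule smooth_fun_add[OF M f g'])
  define ind where "ind y = (if y \<in> points M then 0 else 1::real)" for y
  have ind: "ind \<in> smooth_fun M" by (rule smooth_fun_cong[OF M smooth_fun_const[OF M, of 0]]) (simp add: ind_def)
  have "d = (\<lambda>y. d y * ind y)" using eq by (auto simp: d_def ind_def)
  then have "v d = d x * v ind + ind x * v d" using tangentD(4)[OF v d ind] by simp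
  then have "v d = 0" using x eq by (simp add: d_def ind_def)
  moreover have "v d = v f + (- 1) * v g"
    using tangentD(2)[OF v f g'] tangentD(3)[OF v g, of "- 1"] by (simp add: d_def[abs_def])
  ultimately show ?thesis by simp
qed

lemma tangent_chart:
  assumes M: "smooth_manifold M" and c: "(U, \<phi>) \<in> atlas M" and x: "x \<in> U"
  shows "(\<lambda>f. if f \<in> smooth_fun M then \<Sum>i<mdim M. a i * pd i (\<lambda>z. f (inv_into U \<phi> z)) (\<phi> x) else 0) \<in> tangent M x"
proof -
  note ch = chartD[OF M c]
  have \<phi>x: "\<phi> x \<in> \<phi> ` U" "inv_into U \<phi> (\<phi> x) = x" using x ch(4) by auto
  note sm = smooth_funD[OF _ c]
  show ?thesis
    unfolding tangent_def linear_on_def plus_fun_def scaleR_fun_def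
    using smooth_fun_add[OF M] smooth_fun_mult[OF M] smooth_fun_mult[OF M smooth_fun_const[OF M]]
    by (auto simp: partial_add[OF ch(2) sm sm \<phi>x(1)] partial_mult[OF ch(2) sm sm \<phi>x(1)] partial_cmult[OF ch(2) sm \<phi>x(1)]
        \<phi>x(2) distrib_left sum.distrib sum_distrib_left mult_ac)
qed

subsection \<open>Hadamard's lemma\<close>

text \<open>The increment from z to y is the integral of the derivative along the segment, which is
  linear in y - z with coefficients h. Convexity of the cube keeps the segment inside.\<close>

lemma hadamard:
  fixes f :: "(nat \<Rightarrow> real) \<Rightarrow> real"
  assumes f: "C_infinity n (cube n c r) f" and z: "z \<in> cube n c r"
  obtains h where "\<forall>i<n. C_infinity n (cube n c r) (h i)" "\<forall>i<n. h i z = pd i f z"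
    "\<forall>y\<in>cube n c r. f y = f z + (\<Sum>i<n. (y i - z i) * h i y)"
proof -
  let ?Q = "cube n c r"
  define g where "g t y i = z i + t * (y i - z i)" for t :: real and y i
  have gQ: "g t y \<in> ?Q" if "t \<in> {0..1}" "y \<in> ?Q" for t y
  proof -
    have "\<bar>g t y i - c i\<bar> < r" if "i < n" for i
    proof -
      have "g t y i - c i = (1 - t) * (z i - c i) + t * (y i - c i)" by (simp add: g_def algebra_simps)
      also have "\<bar>\<dots>\<bar> \<le> (1 - t) * \<bar>z i - c i\<bar> + t * \<bar>y i - c i\<bar>"
        using \<open>t \<in> {0..1}\<close> by (intro order_trans[OF abs_triangle_ineq]) (simp add: abs_mult)
      also have "\<dots> < r"
        by (rule convex_bound_lt) (use \<open>t \<in> {0..1}\<close> \<open>y \<in> ?Q\<close> z that in \<open>auto simp: cube_def\<close>)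
      finally show ?thesis .
    qed
    then show ?thesis using that z by (auto simp: cube_def Rn_def g_def)
  qed
  have gC: "C_param n {0..1} k ?Q (\<lambda>t y. g t y j)" for j k
    unfolding g_def by (intro C_param_add C_param_mult C_param_diff C_param_const C_param_coord openR_cube continuous_intros)
  have bC: "C_param n {0..1} k ?Q (\<lambda>t y. pd i f (g t y))" if "i < n" for i k
    by (rule C_param_compose[OF openR_cube openR_cube smooth_param[OF openR_cube smooth_partial[OF openR_cube f that]] gC gQ])
  have bc: "continuous_on {0..1} (\<lambda>t. pd i f (g t y))" if "i < n" "y \<in> ?Q" for i y
    by (rule continuous_slice[OF C_param_continuous[OF bC[OF that(1)]] that(2)])
  define w where "w i t y = integral {0..t} (\<lambda>t. pd i f (g t y))" for i t y
  have w': "((\<lambda>t. w i t y) has_real_derivative pd i f (g t y)) (at t within {0..1})" if "i < n" "y \<in> ?Q" "t \<in> {0..1}" for i t y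
    unfolding w_def by (rule integral_has_real_derivative[OF bc[OF that(1,2)] that(3)])
  \<comment> \<open>Smoothness of a parameter integral is the special case of one linear equation
    with zero matrix.\<close>
  have wC: "C_param n {0..1} k ?Q (w i)" if "i < n" for i k
    by (rule linear_ode_smooth[where m=1 and w="\<lambda>_. w i" and A="\<lambda>_ _ _ _. 0" and b="\<lambda>_ t y. pd i f (g t y)" and ?w0.0="\<lambda>_ _. 0", of n ?Q k 0])
      (use bC w' that in \<open>auto simp: w_def intro!: C_param_const\<close>)
  have gz: "g t z = z" for t by (auto simp: g_def)
  show thesis
  proof (rule that[of "\<lambda>i. w i 1"]; intro allI impI ballI)
    show "C_infinity n ?Q (w i 1)" if "i < n" for i
      unfolding C_infinity_def using C_param_slice[OF cube_subset_Rn _ wC[OF that], of 1] by auto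
    show "w i 1 z = pd i f z" if "i < n" for i
    proof -
      have "w i 1 z = w i 0 z + pd i f z"
        by (rule constant_derivative_increment[of "\<lambda>t. w i t z"]) (use w'[OF that z] gz in simp)
      then show ?thesis by (simp add: w_def)
    qed
    fix y assume y: "y \<in> ?Q"
    have "f (g 1 y) - (\<Sum>i<n. (y i - z i) * w i 1 y) = f (g 0 y) - (\<Sum>i<n. (y i - z i) * w i 0 y) + 0"
    proof (rule constant_derivative_increment[of "\<lambda>t. f (g t y) - (\<Sum>i<n. (y i - z i) * w i t y)"])
      fix t :: real assume t: "t \<in> {0..1}"
      have "((\<lambda>t. f (g t y)) has_real_derivative (\<Sum>i<n. pd i f (g t y) * (1 * (y i - z i)))) (at t within {0..1})"
      proof (rule smooth_chain_curve[where y="\<lambda>t. g t y", OF openR_cube f gQ[OF t y]])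
        show "\<forall>\<^sub>F t in at t within {0..1}. g t y \<in> Rn n"
          unfolding eventually_at_filter by (rule always_eventually) (use gQ y cube_subset_Rn in blast)
        show "((\<lambda>t. g t y i) has_real_derivative 1 * (y i - z i)) (at t within {0..1})" for i
          unfolding g_def by (auto intro!: derivative_eq_intros)
      qed
      moreover have "((\<lambda>t. \<Sum>i<n. (y i - z i) * w i t y) has_real_derivative (\<Sum>i<n. (y i - z i) * pd i f (g t y))) (at t within {0..1})"
        by (intro DERIV_sum DERIV_cmult w' y t) auto
      ultimately show "((\<lambda>t. f (g t y) - (\<Sum>i<n. (y i - z i) * w i t y)) has_real_derivative 0) (at t within {0..1})"
        using DERIV_diff by (fastforce simp: mult.commute)
    qed
    moreover have "g 1 y = y" "g 0 y = z" by (auto simp: g_def)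
    ultimately show "f y = f z + (\<Sum>i<n. (y i - z i) * w i 1 y)" by (simp add: w_def)
  qed
qed

text \<open>In Hadamard's expansion a derivation at x kills the constant, and in each product one
  factor vanishes at x. Since \<kappa> is defined on all of M, no localisation is involved.\<close>

lemma tangent_expand:
  assumes M: "smooth_manifold M" and v: "v \<in> tangent M x" and x: "x \<in> points M"
    and \<kappa>: "\<And>i. i < n \<Longrightarrow> (\<lambda>x. \<kappa> x i) \<in> smooth_fun M" "\<And>x. x \<in> points M \<Longrightarrow> \<kappa> x \<in> cube n c r"
    and h: "C_infinity n (cube n c r) h" and f: "\<And>y. y \<in> points M \<Longrightarrow> f y = h (\<kappa> y)"
  shows "v f = (\<Sum>i<n. pd i h (\<kappa> x) * v (\<lambda>y. \<kappa> y i))"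
proof -
  obtain g where g: "\<forall>i<n. C_infinity n (cube n c r) (g i)" "\<forall>i<n. g i (\<kappa> x) = pd i h (\<kappa> x)"
    "\<forall>y\<in>cube n c r. h y = h (\<kappa> x) + (\<Sum>i<n. (y i - \<kappa> x i) * g i y)"
    by (rule hadamard[OF h \<kappa>(2)[OF x]])
  have 1: "(\<lambda>y. g i (\<kappa> y)) \<in> smooth_fun M" if "i < n" for i
    by (rule smooth_fun_compose[OF M openR_cube g(1)[rule_format, OF that] \<kappa>])
  have 2: "(\<lambda>y. \<kappa> y i + - \<kappa> x i) \<in> smooth_fun M" if "i < n" for i
    by (rule smooth_fun_add[OF M \<kappa>(1)[OF that] smooth_fun_const[OF M]])
  have 3: "(\<lambda>y. (\<kappa> y i + - \<kappa> x i) * g i (\<kappa> y)) \<in> smooth_fun M" if "i < n" for i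
    by (rule smooth_fun_mult[OF M 2[OF that] 1[OF that]])
  have 4: "(\<lambda>y. \<Sum>i<n. (\<kappa> y i + - \<kappa> x i) * g i (\<kappa> y)) \<in> smooth_fun M" by (rule smooth_fun_sum[OF M]) (use 3 in auto)
  have "v f = v (\<lambda>y. h (\<kappa> x) + (\<Sum>i<n. (\<kappa> y i + - \<kappa> x i) * g i (\<kappa> y)))"
    by (rule tangent_cong[OF M v x, symmetric])
      (use smooth_fun_add[OF M smooth_fun_const[OF M] 4] g(3) \<kappa>(2) f in auto)
  also have "\<dots> = (\<Sum>i<n. v (\<lambda>y. (\<kappa> y i + - \<kappa> x i) * g i (\<kappa> y)))"
    using tangentD(2)[OF v smooth_fun_const[OF M] 4] tangent_const[OF M v] tangent_sum[OF M v, of "{..<n}" "\<lambda>i y. (\<kappa> y i + - \<kappa> x i) * g i (\<kappa> y)"] 3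
    by simp
  also have "\<dots> = (\<Sum>i<n. pd i h (\<kappa> x) * v (\<lambda>y. \<kappa> y i))"
  proof (rule sum.cong[OF refl])
    fix i assume "i \<in> {..<n}"
    then have i: "i < n" by simp
    have "v (\<lambda>y. \<kappa> y i + - \<kappa> x i) = v (\<lambda>y. \<kappa> y i) + v (\<lambda>_. - \<kappa> x i)"
      by (rule tangentD(2)[OF v \<kappa>(1)[OF i] smooth_fun_const[OF M]])
    then have "v (\<lambda>y. \<kappa> y i + - \<kappa> x i) = v (\<lambda>y. \<kappa> y i)" using tangent_const[OF M v] by simp
    then show "v (\<lambda>y. (\<kappa> y i + - \<kappa> x i) * g i (\<kappa> y)) = pd i h (\<kappa> x) * v (\<lambda>y. \<kappa> y i)"
      using tangentD(4)[OF v 2[OF i] 1[OF i]] g(2) i by simp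
  qed
  finally show ?thesis .
qed

lemma tangent_eqI:
  assumes M: "smooth_manifold M" and v: "v \<in> tangent M x" "v' \<in> tangent M x" and x: "x \<in> points M"
    and \<kappa>: "\<And>i. i < n \<Longrightarrow> (\<lambda>x. \<kappa> x i) \<in> smooth_fun M" "\<And>x. x \<in> points M \<Longrightarrow> \<kappa> x \<in> cube n c r"
    and h: "\<And>f. f \<in> smooth_fun M \<Longrightarrow> \<exists>h. C_infinity n (cube n c r) h \<and> (\<forall>y\<in>points M. f y = h (\<kappa> y))"
    and eq: "\<And>i. i < n \<Longrightarrow> v (\<lambda>y. \<kappa> y i) = v' (\<lambda>y. \<kappa> y i)"
  shows "v = v'"
proof
  fix f show "v f = v' f"
  proof (cases "f \<in> smooth_fun M")
    case True
    then obtain g where "C_infinity n (cube n c r) g" "\<forall>y\<in>points M. f y = g (\<kappa> y)" using h by blast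
    then show ?thesis using tangent_expand[OF M v(1) x \<kappa>, of g f] tangent_expand[OF M v(2) x \<kappa>, of g f] eq by simp
  qed (use tangentD(1) v in metis)
qed

subsection \<open>Vector spaces as manifolds\<close>

lemma linear_chart_exists:
  fixes V :: "'v::real_vector set"
  assumes "finite_dim V"
  obtains \<phi> b where "linear \<phi>" "\<phi> \<in> linear_charts V" "\<forall>y\<in>Rn (dim V). (\<Sum>i<dim V. y i *\<^sub>R b i) \<in> V \<and> \<phi> (\<Sum>i<dim V. y i *\<^sub>R b i) = y"
    "\<forall>v\<in>V. v = (\<Sum>i<dim V. \<phi> v i *\<^sub>R b i)"
proof -
  have s0: "subspace {0::'v}" "{0} \<subseteq> V" using finite_dimD[OF assms] subspace_0 by auto
  obtain q b c where "dim V = q + dim {0::'v}" and b: "\<forall>i<dim V. b i \<in> V" and c: "\<forall>i<dim V. linear (c i :: 'v \<Rightarrow> real)"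
    and rep: "\<forall>v\<in>V. v = (\<Sum>i<dim V. c i v *\<^sub>R b i)" and cb: "\<forall>i<dim V. \<forall>j<dim V. c i (b j) = (if i = j then 1 else 0)"
    and "\<forall>v\<in>V. v \<in> {0} \<longleftrightarrow> (\<forall>i<q. c i v = 0)"
    by (rule adapted_basis[OF assms s0])
  define \<phi> where "\<phi> v i = (if i < dim V then c i v else 0)" for v i
  have lin: "linear \<phi>"
    by (rule linearI) (use c in \<open>auto simp: \<phi>_def fun_eq_iff scaleR_fun_def linear_add linear_scale\<close>)
  have mem: "(\<Sum>i<dim V. y i *\<^sub>R b i) \<in> V" for y
    using b finite_dimD[OF assms] by (intro subspace_sum subspace_scale) auto
  have inv: "\<phi> (\<Sum>i<dim V. y i *\<^sub>R b i) = y" if "y \<in> Rn (dim V)" for y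
  proof
    fix i show "\<phi> (\<Sum>i<dim V. y i *\<^sub>R b i) i = y i"
    proof (cases "i < dim V")
      case True
      have "(\<Sum>j<dim V. y j * c i (b j)) = (\<Sum>j<dim V. (if i = j then 1 else 0) * y j)"
        by (rule sum.cong) (use cb True in auto)
      then show ?thesis using True by (simp add: \<phi>_def linear_real_sum[OF c[rule_format, OF True]] sum_delta_mult[OF True])
    next
      case False
      then show ?thesis using that by (auto simp: \<phi>_def Rn_def)
    qed
  qed
  have rep': "v = (\<Sum>i<dim V. \<phi> v i *\<^sub>R b i)" if "v \<in> V" for v using rep that by (simp add: \<phi>_def)
  have "bij_betw \<phi> V (Rn (dim V))"
    by (rule bij_betw_byWitness[where f'="\<lambda>y. \<Sum>i<dim V. y i *\<^sub>R b i"])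
      (use rep' inv mem in \<open>auto simp: \<phi>_def Rn_def\<close>)
  then have "\<phi> \<in> linear_charts V"
    using lin by (auto simp: linear_charts_def linear_on_def topspace_Rn linear_add linear_scale)
  then show thesis using that[OF lin] mem inv rep' by blast
qed

lemma linear_on_sum:
  assumes "linear_on V f" "subspace V" "\<And>i. i \<in> I \<Longrightarrow> b i \<in> V" "finite I"
  shows "f (\<Sum>i\<in>I. x i *\<^sub>R b i) = (\<Sum>i\<in>I. x i *\<^sub>R f (b i))"
  using assms(4,3)
proof (induction I rule: finite_induct)
  case empty
  have "f (0 *\<^sub>R 0) = 0 *\<^sub>R f 0" using assms(1) subspace_0[OF assms(2)] unfolding linear_on_def by blast
  then show ?case by simp
next
  case (insert i I)
  then have "x i *\<^sub>R b i \<in> V" "(\<Sum>i\<in>I. x i *\<^sub>R b i) \<in> V"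
    using assms(2) by (auto intro!: subspace_scale subspace_sum)
  then show ?case using insert assms(1) unfolding linear_on_def by (simp add: insert)
qed

text \<open>Membership in \<open>linear_charts\<close> restricts \<psi> on V only and leaves it
  arbitrary elsewhere; a globally linear representative is needed for the lemmas on
  functionals.\<close>

lemma linear_chart_extend:
  fixes V :: "'v::real_vector set"
  assumes V: "finite_dim V" and \<psi>: "\<psi> \<in> linear_charts V"
  obtains \<psi>' where "linear (\<psi>' :: 'v \<Rightarrow> nat \<Rightarrow> real)" "\<forall>v\<in>V. \<psi> v = \<psi>' v"
proof -
  obtain \<phi> b where \<phi>: "linear \<phi>" "\<phi> \<in> linear_charts V" "\<forall>y\<in>Rn (dim V). (\<Sum>i<dim V. y i *\<^sub>R b i) \<in> V \<and> \<phi> (\<Sum>i<dim V. y i *\<^sub>R b i) = y"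
    "\<forall>v\<in>V. v = (\<Sum>i<dim V. \<phi> v i *\<^sub>R b i)"
    by (rule linear_chart_exists[OF V])
  have b: "b j \<in> V" if "j < dim V" for j
  proof -
    have "(\<lambda>i. if i = j then 1 else 0) \<in> Rn (dim V)" using that by (auto simp: Rn_def)
    from bspec[OF \<phi>(3) this] have "(\<Sum>i<dim V. (if i = j then 1 else 0) *\<^sub>R b i) \<in> V" by (rule conjunct1)
    then show ?thesis using that by (simp add: if_distrib[of "\<lambda>x. x *\<^sub>R _"] cong: if_cong)
  qed
  define \<psi>' where "\<psi>' v = (\<Sum>i<dim V. \<phi> v i *\<^sub>R \<psi> (b i))" for v
  have "linear \<psi>'" unfolding \<psi>'_def
    using \<phi>(1) by (intro linear_compose_sum ballI) (auto simp: linear_iff scaleR_left_distrib scaleR_fun_apply)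
  moreover have "\<psi> v = \<psi>' v" if "v \<in> V" for v
  proof -
    have "\<psi> v = \<psi> (\<Sum>i<dim V. \<phi> v i *\<^sub>R b i)" using \<phi>(4) that by simp
    also have "\<dots> = \<psi>' v" unfolding \<psi>'_def
      by (rule linear_on_sum) (use \<psi> b finite_dimD[OF V] in \<open>auto simp: linear_charts_def\<close>)
    finally show ?thesis .
  qed
  ultimately show thesis using that by blast
qed

lemma linear_Rn_coordinate_sum:
  fixes g :: "(nat \<Rightarrow> real) \<Rightarrow> real"
  assumes "openR n S" and g: "linear l" and eq: "\<And>y. y \<in> S \<Longrightarrow> g y = l (\<Sum>i<n. y i *\<^sub>R b i)"
  shows "C_infinity n S g"
proof (rule smooth_cong[OF assms(1)])
  show "C_infinity n S (\<lambda>y. \<Sum>i<n. y i * l (b i))" by (intro smooth_sum smooth_mult smooth_coord smooth_const assms(1))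
  show "(\<Sum>i<n. y i * l (b i)) = g y" if "y \<in> S" for y using eq[OF that] by (simp add: linear_real_sum[OF g])
qed

lemma vector_mfd_simps [simp]: "mdim (vector_mfd V) = dim V" "atlas (vector_mfd V) = {V} \<times> linear_charts V"
  by (auto simp: vector_mfd_def)

lemma vector_mfd_transition:
  fixes V :: "'v::real_vector set"
  assumes V: "finite_dim V" and \<phi>: "\<phi> \<in> linear_charts V" and \<psi>: "\<psi> \<in> linear_charts V"
  shows "C_infinity (dim V) (Rn (dim V)) (\<lambda>z. \<psi> (inv_into V \<phi> z) i)"
proof -
  obtain \<phi>' where \<phi>': "linear \<phi>'" "\<forall>v\<in>V. \<phi> v = \<phi>' v" by (rule linear_chart_extend[OF V \<phi>])
  obtain \<psi>' where \<psi>': "linear \<psi>'" "\<forall>v\<in>V. \<psi> v = \<psi>' v" by (rule linear_chart_extend[OF V \<psi>])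
  have bij: "bij_betw \<phi> V (Rn (dim V))" using \<phi> by (simp add: linear_charts_def topspace_Rn)
  define e where "e j i = (if i = j then 1 else 0 :: real)" for j i :: nat
  define b where "b j = inv_into V \<phi> (e j)" for j
  have eR: "e j \<in> Rn (dim V)" if "j < dim V" for j using that by (auto simp: e_def Rn_def)
  have b: "b j \<in> V" "\<phi> (b j) = e j" if "j < dim V" for j
    using bij eR[OF that] by (auto simp: b_def bij_betw_def inv_into_into f_inv_into_f)
  have "inv_into V \<phi> z = (\<Sum>j<dim V. z j *\<^sub>R b j)" if z: "z \<in> Rn (dim V)" for z
  proof (rule inv_into_f_eq)
    show "inj_on \<phi> V" using bij by (simp add: bij_betw_def)
    show m: "(\<Sum>j<dim V. z j *\<^sub>R b j) \<in> V" using b finite_dimD[OF V] by (intro subspace_sum subspace_scale) auto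
    have "\<phi> (\<Sum>j<dim V. z j *\<^sub>R b j) = (\<Sum>j<dim V. z j *\<^sub>R \<phi> (b j))"
      by (rule linear_on_sum) (use \<phi> b finite_dimD[OF V] in \<open>auto simp: linear_charts_def\<close>)
    also have "\<dots> = z"
    proof
      fix i
      have "(\<Sum>j<dim V. z j *\<^sub>R \<phi> (b j)) i = (\<Sum>j<dim V. z j * e j i)"
        using linear_sum[OF linear_fun_component[of i], of "\<lambda>j. z j *\<^sub>R \<phi> (b j)" "{..<dim V}"] b by (simp add: scaleR_fun_apply)
      also have "\<dots> = z i" using z by (auto simp: e_def Rn_def if_distrib[of "\<lambda>x. _ * x"] cong: if_cong)
      finally show "(\<Sum>j<dim V. z j *\<^sub>R \<phi> (b j)) i = z i" .
    qed
    finally show "\<phi> (\<Sum>j<dim V. z j *\<^sub>R b j) = z" .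
  qed
  moreover have "inv_into V \<phi> z \<in> V" if "z \<in> Rn (dim V)" for z using bij that by (auto simp: bij_betw_def inv_into_into)
  moreover have "linear (\<lambda>v. \<psi>' v i)" using linear_compose[OF \<psi>'(1) linear_fun_component[of i]] by (simp add: o_def)
  ultimately show ?thesis
    using \<psi>'(2) topspace_Rn[of "dim V"] openin_topspace[of "Euclidean_space (dim V)"]
    by (intro linear_Rn_coordinate_sum[where l="\<lambda>v. \<psi>' v i" and b=b]) auto
qed

text \<open>Transitions between linear charts are linear, hence continuous, so openness seen in one
  chart is openness in all of them.\<close>

lemma openin_vector_mfd_chart:
  assumes V: "finite_dim V" and \<phi>: "\<phi> \<in> linear_charts V"
  shows "openin (mtop (vector_mfd V)) S \<longleftrightarrow> S \<subseteq> V \<and> openR (dim V) (\<phi> ` S)"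
proof -
  have "openR (dim V) (\<psi> ` S)" if S: "S \<subseteq> V" "openR (dim V) (\<phi> ` S)" and \<psi>: "\<psi> \<in> linear_charts V" for \<psi>
  proof -
    have b\<phi>: "bij_betw \<phi> V (Rn (dim V))" and b\<psi>: "bij_betw \<psi> V (Rn (dim V))"
      using \<phi> \<psi> by (auto simp: linear_charts_def topspace_Rn)
    let ?h = "\<lambda>z. \<phi> (inv_into V \<psi> z)"
    have oR: "openR (dim V) (Rn (dim V))" using openin_topspace[of "Euclidean_space (dim V)"] topspace_Rn[of "dim V"] by simp
    have "continuous_on (Rn (dim V)) ?h"
      by (rule continuous_on_coordinatewise_then_product)
        (rule smooth_continuous[OF oR vector_mfd_transition[OF V \<psi> \<phi>]])
    then have "continuous_map (Euclidean_space (dim V)) (Euclidean_space (dim V)) ?h"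
      unfolding Euclidean_space_eq using b\<phi> b\<psi> by (auto simp: bij_betw_def inv_into_into)
    from openin_continuous_map_preimage[OF this S(2)]
    have "openR (dim V) {z \<in> Rn (dim V). ?h z \<in> \<phi> ` S}" by (simp add: topspace_Rn)
    moreover have "{z \<in> Rn (dim V). ?h z \<in> \<phi> ` S} = \<psi> ` S"
    proof (intro equalityI subsetI)
      fix z assume "z \<in> {z \<in> Rn (dim V). ?h z \<in> \<phi> ` S}"
      then obtain s where s: "z \<in> Rn (dim V)" "s \<in> S" "\<phi> (inv_into V \<psi> z) = \<phi> s" by auto
      have "inv_into V \<psi> z \<in> V" using b\<psi> s(1) by (auto simp: bij_betw_def inv_into_into)
      then have "inv_into V \<psi> z = s" using b\<phi> s S(1) by (auto simp: bij_betw_def inj_on_def)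
      then show "z \<in> \<psi> ` S" using s b\<psi> by (metis bij_betw_def f_inv_into_f imageI)
    next
      fix z assume "z \<in> \<psi> ` S"
      then obtain s where s: "s \<in> S" "z = \<psi> s" by auto
      then have "inv_into V \<psi> z = s" "z \<in> Rn (dim V)" using b\<psi> S(1) by (auto simp: bij_betw_def)
      then show "z \<in> {z \<in> Rn (dim V). ?h z \<in> \<phi> ` S}" using s by auto
    qed
    ultimately show ?thesis by simp
  qed
  then show ?thesis unfolding openin_vector_mfd using \<phi> by blast
qed

lemma points_vector_mfd: "finite_dim V \<Longrightarrow> points (vector_mfd V) = V"
proof -
  assume V: "finite_dim V"
  obtain \<phi> b where \<phi>: "linear \<phi>" "\<phi> \<in> linear_charts V" "\<forall>y\<in>Rn (dim V). (\<Sum>i<dim V. y i *\<^sub>R b i) \<in> V \<and> \<phi> (\<Sum>i<dim V. y i *\<^sub>R b i) = y"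
    "\<forall>v\<in>V. v = (\<Sum>i<dim V. \<phi> v i *\<^sub>R b i)"
    by (rule linear_chart_exists[OF V])
  have "openin (mtop (vector_mfd V)) V"
    using openin_vector_mfd_chart[OF V \<phi>(2)] \<phi>(2) openin_topspace[of "Euclidean_space (dim V)"]
    by (auto simp: linear_charts_def bij_betw_def)
  then show ?thesis using openin_subset[of "mtop (vector_mfd V)" V] openin_topspace[of "mtop (vector_mfd V)"] openin_vector_mfd[of V] by blast
qed

lemma homeomorphic_linear_chart:
  assumes V: "finite_dim V" and \<phi>: "\<phi> \<in> linear_charts V"
  shows "homeomorphic_map (mtop (vector_mfd V)) (Euclidean_space (dim V)) \<phi>"
proof (rule bijective_open_imp_homeomorphic_map)
  have b\<phi>: "bij_betw \<phi> V (Rn (dim V))" using \<phi> by (auto simp: linear_charts_def topspace_Rn)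
  show "\<phi> ` points (vector_mfd V) = topspace (Euclidean_space (dim V))" "inj_on \<phi> (points (vector_mfd V))"
    using b\<phi> by (auto simp: points_vector_mfd[OF V] topspace_Rn bij_betw_def)
  show "open_map (mtop (vector_mfd V)) (Euclidean_space (dim V)) \<phi>"
    unfolding open_map_def using openin_vector_mfd_chart[OF V \<phi>] by blast
  show "continuous_map (mtop (vector_mfd V)) (Euclidean_space (dim V)) \<phi>"
    unfolding continuous_map_def
  proof (intro conjI allI impI)
    show "\<phi> \<in> points (vector_mfd V) \<rightarrow> topspace (Euclidean_space (dim V))"
      using b\<phi> by (auto simp: points_vector_mfd[OF V] topspace_Rn bij_betw_def)
    fix T assume T: "openR (dim V) T"
    have "\<phi> ` {x \<in> V. \<phi> x \<in> T} = T" using b\<phi> openR_subset[OF T] by (auto simp: bij_betw_def)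
    then show "openin (mtop (vector_mfd V)) {x \<in> points (vector_mfd V). \<phi> x \<in> T}"
      using T by (simp add: openin_vector_mfd_chart[OF V \<phi>] points_vector_mfd[OF V])
  qed
qed

lemma second_countable_Euclidean_space: "second_countable (Euclidean_space n)"
proof -
  obtain B :: "(nat \<Rightarrow> real) set set" where B: "countable B" "topological_basis B" using ex_countable_basis by blast
  have "second_countable (euclidean :: (nat \<Rightarrow> real) topology)"
    unfolding second_countable_def
    by (rule exI[of _ B]) (use B in \<open>auto simp: topological_basis_open elim!: topological_basisE\<close>)
  then show ?thesis by (simp add: Euclidean_space_eq second_countable_subtopology)
qed

lemma smooth_manifold_vector_mfd:
  assumes V: "finite_dim V"
  shows "smooth_manifold (vector_mfd V)"
  unfolding smooth_manifold_def
proof (intro conjI)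
  obtain \<phi> b where \<phi>: "linear \<phi>" "\<phi> \<in> linear_charts V" "\<forall>y\<in>Rn (dim V). (\<Sum>i<dim V. y i *\<^sub>R b i) \<in> V \<and> \<phi> (\<Sum>i<dim V. y i *\<^sub>R b i) = y"
    "\<forall>v\<in>V. v = (\<Sum>i<dim V. \<phi> v i *\<^sub>R b i)"
    by (rule linear_chart_exists[OF V])
  have hs: "mtop (vector_mfd V) homeomorphic_space Euclidean_space (dim V)"
    using homeomorphic_linear_chart[OF V \<phi>(2)] homeomorphic_space by blast
  show "Hausdorff_space (mtop (vector_mfd V))"
    using homeomorphic_Hausdorff_space[OF hs] Hausdorff_Euclidean_space by blast
  show "second_countable (mtop (vector_mfd V))"
    using homeomorphic_space_second_countability[OF hs] second_countable_Euclidean_space by blast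
  show "(\<Union>(U, \<phi>)\<in>atlas (vector_mfd V). U) = points (vector_mfd V)"
    using \<phi>(2) by (auto simp: points_vector_mfd[OF V])
  have img: "\<psi> ` V = topspace (Euclidean_space (dim V))" if "\<psi> \<in> linear_charts V" for \<psi>
    using that by (auto simp: linear_charts_def bij_betw_def)
  show "\<forall>(U, \<phi>)\<in>atlas (vector_mfd V). openin (mtop (vector_mfd V)) U \<and>
      openin (Euclidean_space (mdim (vector_mfd V))) (\<phi> ` U) \<and>
      homeomorphic_map (subtopology (mtop (vector_mfd V)) U) (subtopology (Euclidean_space (mdim (vector_mfd V))) (\<phi> ` U)) \<phi>"
    using homeomorphic_linear_chart[OF V] openin_topspace[of "mtop (vector_mfd V)"] subtopology_topspace[of "mtop (vector_mfd V)"]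
    by (auto simp: img points_vector_mfd[OF V])
  show "\<forall>(U, \<phi>)\<in>atlas (vector_mfd V). \<forall>(W, \<psi>)\<in>atlas (vector_mfd V). \<forall>i<mdim (vector_mfd V).
      C_infinity (mdim (vector_mfd V)) (\<phi> ` (U \<inter> W)) (\<lambda>z. \<psi> (inv_into U \<phi> z) i)"
    using vector_mfd_transition[OF V] by (auto simp: img topspace_Rn)
qed

lemma linear_functional_smooth:
  fixes V :: "'v::real_vector set"
  assumes V: "finite_dim V" and l: "linear l"
  shows "l \<in> smooth_fun (vector_mfd V)"
  unfolding smooth_fun_iff
proof (intro allI impI)
  fix U \<phi> assume "(U, \<phi>) \<in> atlas (vector_mfd V)"
  then have U: "U = V" and \<phi>: "\<phi> \<in> linear_charts V" by auto
  obtain \<psi> b where \<psi>: "linear \<psi>" "\<psi> \<in> linear_charts V" "\<forall>y\<in>Rn (dim V). (\<Sum>i<dim V. y i *\<^sub>R b i) \<in> V \<and> \<psi> (\<Sum>i<dim V. y i *\<^sub>R b i) = y"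
    "\<forall>v\<in>V. v = (\<Sum>i<dim V. \<psi> v i *\<^sub>R b i)"
    by (rule linear_chart_exists[OF V])
  have img: "\<phi> ` V = Rn (dim V)" using \<phi> by (auto simp: linear_charts_def bij_betw_def topspace_Rn)
  have oR: "openR (dim V) (Rn (dim V))" using openin_topspace[of "Euclidean_space (dim V)"] topspace_Rn[of "dim V"] by simp
  have "C_infinity (dim V) (Rn (dim V)) (\<lambda>z. \<Sum>i<dim V. \<psi> (inv_into V \<phi> z) i * l (b i))"
    by (intro smooth_sum smooth_mult smooth_const oR vector_mfd_transition[OF V \<phi> \<psi>(2)])
  then have "C_infinity (dim V) (Rn (dim V)) (\<lambda>z. l (inv_into V \<phi> z))"
  proof (rule smooth_cong[OF oR])
    fix z assume "z \<in> Rn (dim V)"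
    then have "inv_into V \<phi> z \<in> V" using img inv_into_into by metis
    then have "l (inv_into V \<phi> z) = l (\<Sum>i<dim V. \<psi> (inv_into V \<phi> z) i *\<^sub>R b i)" using \<psi>(4) by metis
    then show "(\<Sum>i<dim V. \<psi> (inv_into V \<phi> z) i * l (b i)) = l (inv_into V \<phi> z)" by (simp add: linear_real_sum[OF l])
  qed
  then show "C_infinity (mdim (vector_mfd V)) (\<phi> ` U) (\<lambda>z. l (inv_into U \<phi> z))" by (simp add: U img)
qed

lemma smooth_map_vector_mfdD:
  fixes V :: "'v::real_vector set"
  assumes M: "smooth_manifold M" and V: "finite_dim V" and f: "smooth_map M (vector_mfd V) f"
  shows "\<And>x. x \<in> points M \<Longrightarrow> f x \<in> V" "linear l \<Longrightarrow> (\<lambda>x. l (f x)) \<in> smooth_fun M"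
proof -
  show fV: "f x \<in> V" if "x \<in> points M" for x
    using f that points_vector_mfd[OF V] by (auto simp: smooth_map_def continuous_map_def Pi_iff)
  assume l: "linear l"
  obtain \<phi> b where \<phi>: "linear \<phi>" "\<phi> \<in> linear_charts V" "\<forall>y\<in>Rn (dim V). (\<Sum>i<dim V. y i *\<^sub>R b i) \<in> V \<and> \<phi> (\<Sum>i<dim V. y i *\<^sub>R b i) = y"
    "\<forall>v\<in>V. v = (\<Sum>i<dim V. \<phi> v i *\<^sub>R b i)"
    by (rule linear_chart_exists[OF V])
  have sm: "(\<lambda>x. \<phi> (f x) i) \<in> smooth_fun M" if i: "i < dim V" for i
    unfolding smooth_fun_iff
  proof (intro allI impI)
    fix U \<psi> assume c: "(U, \<psi>) \<in> atlas M"
    have "U \<inter> f -` V = U" using chartD(3)[OF M c] fV by blast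
    moreover have "C_infinity (mdim M) (\<psi> ` (U \<inter> f -` V)) (\<lambda>z. \<phi> (f (inv_into U \<psi> z)) i)"
      using f c \<phi>(2) i unfolding smooth_map_def by fastforce
    ultimately show "C_infinity (mdim M) (\<psi> ` U) (\<lambda>z. \<phi> (f (inv_into U \<psi> z)) i)" by simp
  qed
  have "(\<lambda>x. \<Sum>i<dim V. \<phi> (f x) i * l (b i)) \<in> smooth_fun M"
    using sm by (intro smooth_fun_sum[OF M] smooth_fun_mult[OF M] smooth_fun_const[OF M]) auto
  then show "(\<lambda>x. l (f x)) \<in> smooth_fun M"
  proof (rule smooth_fun_cong[OF M])
    fix x assume "x \<in> points M"
    then have "l (f x) = l (\<Sum>i<dim V. \<phi> (f x) i *\<^sub>R b i)" using \<phi>(4) fV by metis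
    then show "(\<Sum>i<dim V. \<phi> (f x) i * l (b i)) = l (f x)" by (simp add: linear_real_sum[OF l])
  qed
qed

lemma continuous_map_vector_mfdI:
  fixes V :: "'v::real_vector set"
  assumes V: "finite_dim V" and fV: "\<And>x. x \<in> topspace X \<Longrightarrow> f x \<in> V"
    and f: "\<And>l. linear l \<Longrightarrow> continuous_map X euclideanreal (\<lambda>x. l (f x))"
  shows "continuous_map X (mtop (vector_mfd V)) f"
proof -
  obtain \<phi> b where \<phi>: "linear \<phi>" "\<phi> \<in> linear_charts V" "\<forall>y\<in>Rn (dim V). (\<Sum>i<dim V. y i *\<^sub>R b i) \<in> V \<and> \<phi> (\<Sum>i<dim V. y i *\<^sub>R b i) = y"
    "\<forall>v\<in>V. v = (\<Sum>i<dim V. \<phi> v i *\<^sub>R b i)"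
    by (rule linear_chart_exists[OF V])
  have l: "linear (\<lambda>v. \<phi> v i)" for i using linear_compose[OF \<phi>(1) linear_fun_component[of i]] by (simp add: o_def)
  have \<phi>R: "\<phi> v \<in> Rn (dim V)" if "v \<in> V" for v using \<phi>(2) that by (auto simp: linear_charts_def bij_betw_def topspace_Rn)
  have "continuous_map X (Euclidean_space (dim V)) (\<lambda>x i. if i < dim V then \<phi> (f x) i else 0)"
    using f[OF l] by (simp add: continuous_map_componentwise_Euclidean_space)
  then have 1: "continuous_map X (Euclidean_space (dim V)) (\<lambda>x. \<phi> (f x))"
  proof (rule continuous_map_eq)
    fix x assume "x \<in> topspace X"
    then show "(\<lambda>i. if i < dim V then \<phi> (f x) i else 0) = \<phi> (f x)"
      using \<phi>R[OF fV] by (auto simp: Rn_def fun_eq_iff)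
  qed
  obtain g where g: "homeomorphic_maps (mtop (vector_mfd V)) (Euclidean_space (dim V)) \<phi> g"
    using homeomorphic_linear_chart[OF V \<phi>(2)] homeomorphic_map_maps by blast
  have "continuous_map X (mtop (vector_mfd V)) (\<lambda>x. g (\<phi> (f x)))"
    using continuous_map_compose[OF 1, of "mtop (vector_mfd V)" g] g by (simp add: homeomorphic_maps_def o_def)
  then show ?thesis
    by (rule continuous_map_eq) (use g fV points_vector_mfd[OF V] in \<open>auto simp: homeomorphic_maps_def\<close>)
qed

text \<open>Chart coordinates agree on V with linear functionals, so smoothness reduces to scalar
  functions and charts of V disappear from later arguments.\<close>

lemma smooth_map_vector_mfdI:
  fixes V :: "'v::real_vector set"
  assumes M: "smooth_manifold M" and V: "finite_dim V" and fV: "\<And>x. x \<in> points M \<Longrightarrow> f x \<in> V"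
    and f: "\<And>l. linear l \<Longrightarrow> (\<lambda>x. l (f x)) \<in> smooth_fun M"
  shows "smooth_map M (vector_mfd V) f"
  unfolding smooth_map_def
proof (intro conjI)
  show "continuous_map (mtop M) (mtop (vector_mfd V)) f"
  proof (rule continuous_map_vector_mfdI[OF V fV])
    fix l :: "'v \<Rightarrow> real" assume "linear l"
    then show "continuous_map (mtop M) euclideanreal (\<lambda>x. l (f x))" by (rule smooth_fun_continuous[OF M f])
  qed
  have coord: "(\<lambda>x. \<psi> (f x) i) \<in> smooth_fun M" if \<psi>: "\<psi> \<in> linear_charts V" for \<psi> i
  proof -
    obtain \<psi>' where \<psi>': "linear \<psi>'" "\<forall>v\<in>V. \<psi> v = \<psi>' v" by (rule linear_chart_extend[OF V \<psi>])
    have "linear (\<lambda>v. \<psi>' v i)" using linear_compose[OF \<psi>'(1) linear_fun_component[of i]] by (simp add: o_def)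
    from f[OF this] show ?thesis by (rule smooth_fun_cong[OF M]) (use \<psi>'(2) fV in simp)
  qed
  have "C_infinity (mdim M) (\<psi> ` (U \<inter> f -` V)) (\<lambda>z. \<phi>' (f (inv_into U \<psi> z)) i)"
    if c: "(U, \<psi>) \<in> atlas M" and \<phi>': "\<phi>' \<in> linear_charts V" for U \<psi> \<phi>' i
  proof -
    have "U \<inter> f -` V = U" using chartD(3)[OF M c] fV by blast
    then show ?thesis using smooth_funD[OF coord[OF \<phi>'] c] by simp
  qed
  then show "\<forall>(U, \<phi>)\<in>atlas M. \<forall>(W, \<psi>)\<in>atlas (vector_mfd V). \<forall>i<mdim (vector_mfd V).
      C_infinity (mdim M) (\<phi> ` (U \<inter> f -` W)) (\<lambda>z. \<psi> (f (inv_into U \<phi> z)) i)"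
    by auto
qed

subsection \<open>Bump functions\<close>

text \<open>The classical flat function, with negative powers of x included so that the family is
  closed under differentiation.\<close>

definition flat :: "nat \<Rightarrow> real \<Rightarrow> real"
  where "flat k x = (if x > 0 then exp (- 1 / x) / x ^ k else 0)"

lemma power_le_fact_exp: "0 \<le> (y::real) \<Longrightarrow> y ^ n \<le> fact n * exp y"
proof -
  assume y: "0 \<le> y"
  have "(\<Sum>k\<in>{n}. y ^ k /\<^sub>R fact k) \<le> (\<Sum>k. y ^ k /\<^sub>R fact k)"
    by (rule sum_le_suminf[OF summable_exp_generic]) (use y in auto)
  then have "y ^ n / fact n \<le> exp y" by (simp add: exp_def divide_inverse mult.commute)
  then show ?thesis by (simp add: field_simps)
qed

text \<open>From \<open>power_le_fact_exp\<close> with exponent k + 1 at the point 1/x. With k + 1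
  in place of k it also bounds the difference quotients at 0.\<close>

lemma flat_bound: "\<bar>flat k x\<bar> \<le> fact (Suc k) * \<bar>x\<bar>"
proof (cases "x > 0")
  case True
  have "(1 / x) ^ Suc k \<le> fact (Suc k) * exp (1 / x)" by (rule power_le_fact_exp) (use True in auto)
  then have "exp (- 1 / x) * (1 / x) ^ Suc k \<le> exp (- 1 / x) * (fact (Suc k) * exp (1 / x))"
    by (intro mult_left_mono) auto
  also have "\<dots> = fact (Suc k)" by (simp add: exp_minus field_simps)
  finally have "exp (- 1 / x) / x ^ k * (1 / x) \<le> fact (Suc k)" using True by (simp add: field_simps power_divide)
  then have "exp (- 1 / x) / x ^ k \<le> fact (Suc k) * x" using True by (simp add: field_simps)
  then show ?thesis using True by (simp add: flat_def)
next
  case False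
  then have "flat k x = 0" by (simp add: flat_def)
  moreover have "0 \<le> fact (Suc k) * \<bar>x\<bar>" by (rule mult_nonneg_nonneg[OF fact_ge_zero abs_ge_zero])
  ultimately show ?thesis by (simp only: abs_zero)
qed

lemma flat_deriv_pos:
  assumes x: "x > 0"
  shows "((\<lambda>x. exp (- 1 / x) / x ^ k) has_real_derivative exp (- 1 / x) / x ^ (k + 2) - real k * (exp (- 1 / x) / x ^ (k + 1))) (at x)"
proof (induction k)
  case 0
  show ?case using x by (auto intro!: derivative_eq_intros simp: power2_eq_square)
next
  case (Suc k)
  let ?E = "exp (- 1 / x)" and ?y = "x ^ k"
  have "((\<lambda>x. exp (- 1 / x) / x ^ k / x) has_real_derivative
      ((?E / x ^ (k + 2) - real k * (?E / x ^ (k + 1))) * x - ?E / ?y * 1) / (x * x)) (at x)"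
    by (rule DERIV_divide[OF Suc DERIV_ident]) (use x in simp)
  moreover have "((?E / x ^ (k + 2) - real k * (?E / x ^ (k + 1))) * x - ?E / ?y * 1) / (x * x)
    = ?E / x ^ (Suc k + 2) - real (Suc k) * (?E / x ^ (Suc k + 1))"
  proof -
    have pw: "x ^ (k + 2) = ?y * x * x" "x ^ (k + 1) = ?y * x" "x ^ (Suc k + 2) = ?y * x * x * x" "x ^ (Suc k + 1) = ?y * x * x"
      by simp_all
    have nz: "?y \<noteq> 0" "x \<noteq> 0" using x by auto
    have id: "((E / (y * x * x) - a * (E / (y * x))) * x - E / y * 1) / (x * x) = E / (y * x * x * x) - (a + 1) * (E / (y * x * x))"
      if "y \<noteq> 0" "x \<noteq> 0" for E a y :: real
      using that by (simp add: field_simps)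
    show ?thesis unfolding pw of_nat_Suc add.commute[of 1] by (rule id[OF nz])
  qed
  ultimately show ?case by (simp add: mult.commute)
qed

lemma flat_deriv: "(flat k has_real_derivative flat (k + 2) x - real k * flat (k + 1) x) (at x)"
proof -
  consider "x > 0" | "x < 0" | "x = 0" by linarith
  then show ?thesis
  proof cases
    case 1
    have "((\<lambda>x. exp (- 1 / x) / x ^ k) has_real_derivative flat (k + 2) x - real k * flat (k + 1) x) (at x)"
      using flat_deriv_pos[OF 1, of k] 1 by (simp add: flat_def)
    then show ?thesis
      by (rule has_field_derivative_transform_within_open[where S="{0<..}"]) (use 1 in \<open>auto simp: flat_def\<close>)
  next
    case 2
    have "((\<lambda>_. 0) has_real_derivative 0) (at x)" by simp
    then have "(flat k has_real_derivative 0) (at x)"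
      by (rule has_field_derivative_transform_within_open[where S="{..<0}"]) (use 2 in \<open>auto simp: flat_def\<close>)
    then show ?thesis using 2 by (simp add: flat_def)
  next
    \<comment> \<open>Dividing \<open>flat k s\<close> by s gives \<open>flat (k + 1) s\<close>,
      which is O(s), so the derivative at 0 is 0.\<close>
    case 3
    have "\<forall>\<^sub>F s in at 0. \<bar>(flat k s - flat k 0) / (s - 0) - 0\<bar> \<le> fact (Suc (Suc k)) * \<bar>s - 0\<bar>"
    proof (rule always_eventually, rule allI)
      fix s show "\<bar>(flat k s - flat k 0) / (s - 0) - 0\<bar> \<le> fact (Suc (Suc k)) * \<bar>s - 0\<bar>"
        using flat_bound[of "Suc k" s] by (auto simp: flat_def field_simps split: if_splits)
    qed
    from derivative_limitI[OF this] have "(flat k has_real_derivative 0) (at 0)" .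
    moreover have "flat (k + 2) 0 = 0" "flat (k + 1) 0 = 0" by (simp_all add: flat_def)
    ultimately show ?thesis using 3 by simp
  qed
qed

lemma smooth_flat:
  assumes S: "openR n S" and g: "C_infinity n S g"
  shows "C_infinity n S (\<lambda>z. flat k (g z))"
proof -
  have "C_param n {0::real} r S (\<lambda>_ z. flat k (g z))" for r
  proof (induction r arbitrary: k)
    case (0 k)
    have "isCont (flat k) x" for x by (rule DERIV_isCont[OF flat_deriv])
    then have "continuous_on UNIV (flat k)" by (simp add: continuous_at_imp_continuous_on)
    then have "continuous_on S (\<lambda>z. flat k (g z))"
      by (rule continuous_on_compose2[OF _ smooth_continuous[OF S g]]) simp
    then show ?case by (simp add: continuous_on_single_param)
  next
    case (Suc r k)
    show ?case
    proof (rule C_param_SucI[OF S C_param_continuous[OF Suc[of k]],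
        where g="\<lambda>i _ z. (flat (k + 2) (g z) - real k * flat (k + 1) (g z)) * pd i g z"])
      show "((\<lambda>t. flat k (g (x(i := t)))) has_real_derivative
          (flat (k + 2) (g x) - real k * flat (k + 1) (g x)) * pd i g x) (at (x i))" if "i < n" "x \<in> S" for i x
      proof -
        have "((\<lambda>t. flat k (g (x(i := t)))) has_real_derivative
          (flat (k + 2) (g (x(i := x i))) - real k * flat (k + 1) (g (x(i := x i)))) * pd i g x) (at (x i))"
          by (rule DERIV_chain2[OF flat_deriv smooth_has_partial[OF S g that(2,1)]])
        then show ?thesis by (simp only: fun_upd_triv)
      qed
      show "C_param n {0::real} r S (\<lambda>_ z. (flat (k + 2) (g z) - real k * flat (k + 1) (g z)) * pd i g z)" if "i < n" for i
        by (intro C_param_mult C_param_diff C_param_const S Suc continuous_on_const smooth_param[OF S smooth_partial[OF S g that]])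
    qed
  qed
  then show ?thesis by (simp add: smooth_iff_param[OF S])
qed

text \<open>The argument s is at least 1 where the i-th distance from c is at most r, and at most 0
  where it is at least 2 r; the quotient is a smooth step from 0 to 1.\<close>

definition bump :: "nat \<Rightarrow> (nat \<Rightarrow> real) \<Rightarrow> real \<Rightarrow> (nat \<Rightarrow> real) \<Rightarrow> real"
  where "bump n c r z = (\<Prod>i<n. let s = (4 * r\<^sup>2 - (z i - c i)\<^sup>2) / (3 * r\<^sup>2) in
    flat 0 s / (flat 0 s + flat 0 (1 - s)))"

lemma flat_pos: "0 < flat 0 s + flat 0 (1 - s)"
  by (auto simp: flat_def add_pos_nonneg add_nonneg_pos)

lemma smooth_bump:
  assumes S: "openR n S" shows "C_infinity n S (bump n c r)"
proof -
  define s where "s i z = (4 * r\<^sup>2 - (z i - c i)\<^sup>2) / (3 * r\<^sup>2)" for i and z :: "nat \<Rightarrow> real"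
  have 1: "C_infinity n S (s i)" for i
    unfolding s_def divide_inverse power2_eq_square by (intro smooth_mult smooth_diff smooth_const smooth_coord S)
  have 2: "C_infinity n S (\<lambda>z. 1 - s i z)" for i by (intro smooth_diff smooth_const 1 S)
  have "C_infinity n S (\<lambda>z. flat 0 (s i z) * inverse (flat 0 (s i z) + flat 0 (1 - s i z)))" for i
    by (intro smooth_mult smooth_inverse smooth_add smooth_flat S 1 2) (metis flat_pos less_irrefl)
  then have "C_infinity n S (\<lambda>z. \<Prod>i<n. flat 0 (s i z) * inverse (flat 0 (s i z) + flat 0 (1 - s i z)))"
    by (intro smooth_prod S)
  moreover have "bump n c r = (\<lambda>z. \<Prod>i<n. flat 0 (s i z) * inverse (flat 0 (s i z) + flat 0 (1 - s i z)))"
    by (simp only: bump_def[abs_def] Let_def s_def divide_inverse[of "flat 0 _"])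
  ultimately show ?thesis by simp
qed

lemma bump_one:
  assumes "r > 0" "z \<in> cube n c r" shows "bump n c r z = 1"
  unfolding bump_def
proof (rule prod.neutral, rule ballI)
  fix i assume "i \<in> {..<n}"
  then have "\<bar>z i - c i\<bar> < r" using assms(2) by (simp add: cube_def)
  then have "(z i - c i)\<^sup>2 \<le> r\<^sup>2" using assms(1) by (simp add: abs_le_square_iff[symmetric])
  then have s: "(4 * r\<^sup>2 - (z i - c i)\<^sup>2) / (3 * r\<^sup>2) \<ge> 1" using assms(1) by (simp add: field_simps)
  then show "(let s = (4 * r\<^sup>2 - (z i - c i)\<^sup>2) / (3 * r\<^sup>2) in flat 0 s / (flat 0 s + flat 0 (1 - s))) = 1"
    by (auto simp: Let_def flat_def)
qed

lemma bump_zero: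
  assumes "r > 0" "i < n" "\<bar>z i - c i\<bar> \<ge> 2 * r" shows "bump n c r z = 0"
  unfolding bump_def
proof (rule prod_zero[OF finite_lessThan], rule bexI[of _ i])
  have "(2 * r)\<^sup>2 \<le> \<bar>z i - c i\<bar>\<^sup>2" by (rule power_mono) (use assms in auto)
  then have "(4 * r\<^sup>2 - (z i - c i)\<^sup>2) / (3 * r\<^sup>2) \<le> 0" using assms(1) by (simp add: field_simps power_mult_distrib)
  then show "(let s = (4 * r\<^sup>2 - (z i - c i)\<^sup>2) / (3 * r\<^sup>2) in flat 0 s / (flat 0 s + flat 0 (1 - s))) = 0"
    by (auto simp: Let_def flat_def)
qed (use assms in simp)

section \<open>Coordinate fields in a chart\<close>

text \<open>Three radii: the bump function is 1 on the cube of radius r and 0 outside that of radius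
  2 r, while radius 4 r is still inside the chart, so that the closed cube of radius 2 r is a
  compact subset of it.\<close>

locale coframe_chart =
  fixes M :: "'m mfd" and W :: "'v::real_vector set" and \<omega> :: "('m, 'v) form1" and U \<phi> x0 r
  assumes M: "smooth_manifold M" and ap: "absolute_parallelism M W \<omega>" and W: "finite_dim W"
    and c: "(U, \<phi>) \<in> atlas M" and x0: "x0 \<in> U" and r: "r > 0" and sub: "cube (mdim M) (\<phi> x0) (4 * r) \<subseteq> \<phi> ` U"
begin

abbreviation "N \<equiv> mdim M"
abbreviation "z0 \<equiv> \<phi> x0"
abbreviation "p \<equiv> inv_into U \<phi>"
abbreviation "S \<equiv> cube N z0 r"
abbreviation "\<beta> \<equiv> bump N z0 r"

lemmas ch = chartD[OF M c]

lemma Q_open: "openR N (\<phi> ` U)" by (rule ch(2))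

lemma S_sub: "S \<subseteq> \<phi> ` U" using cube_mono[of r "4 * r" N z0] r sub by auto

lemma pU: "z \<in> \<phi> ` U \<Longrightarrow> p z \<in> U" and \<phi>p: "z \<in> \<phi> ` U \<Longrightarrow> \<phi> (p z) = z"
  by (auto simp: inv_into_into f_inv_into_f)

lemma p_points: "z \<in> S \<Longrightarrow> p z \<in> points M"
  using pU S_sub ch(3) by blast

lemma p\<phi>: "x \<in> U \<Longrightarrow> p (\<phi> x) = x" using ch(4) by simp

lemma z0S: "z0 \<in> S" using r x0 openR_subset[OF Q_open] by (intro cube_self) auto

text \<open>The support corresponds to a compact part K of the chart, whose copy in M is closed
  because M is Hausdorff. The chart domain and the complement of that copy cover M, and the function
  is smooth on both.\<close>

lemma extend_smooth:
  assumes h: "C_infinity N (\<phi> ` U) h"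
  shows "(\<lambda>x. if x \<in> U then \<beta> (\<phi> x) * h (\<phi> x) else 0) \<in> smooth_fun M"
  unfolding smooth_fun_iff
proof (intro allI impI)
  fix V \<psi> assume d: "(V, \<psi>) \<in> atlas M"
  note dh = chartD[OF M d]
  let ?f = "\<lambda>x. if x \<in> U then \<beta> (\<phi> x) * h (\<phi> x) else 0"
  define K where "K = {z \<in> Rn N. \<forall>i<N. \<bar>z i - z0 i\<bar> \<le> 2 * r}"
  have KU: "K \<subseteq> \<phi> ` U"
  proof
    fix z assume z: "z \<in> K"
    have "\<bar>z i - z0 i\<bar> < 4 * r" if "i < N" for i
    proof -
      have "\<bar>z i - z0 i\<bar> \<le> 2 * r" using z that by (simp add: K_def)
      then show ?thesis using r by linarith
    qed
    then show "z \<in> \<phi> ` U" using z sub by (auto simp: K_def cube_def)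
  qed
  have "compact K" unfolding K_def by (rule compact_closed_cube)
  then have "compactin (subtopology (Euclidean_space N) (\<phi> ` U)) K"
    using KU openR_subset[OF Q_open] by (auto simp: Euclidean_space_eq compactin_subtopology)
  moreover obtain g where g: "homeomorphic_maps (subtopology (mtop M) U) (subtopology (Euclidean_space N) (\<phi> ` U)) \<phi> g"
    using ch(5) homeomorphic_map_maps by blast
  ultimately have "compactin (subtopology (mtop M) U) (g ` K)"
    by (intro image_compactin) (auto simp: homeomorphic_maps_def)
  then have closed: "closedin (mtop M) (g ` K)"
    using M by (intro compactin_imp_closedin) (auto simp: smooth_manifold_def compactin_subtopology)
  have g\<phi>: "g (\<phi> x) = x" if "x \<in> U" for x using g that ch(3) by (auto simp: homeomorphic_maps_def)
  have zero: "?f x = 0" if "x \<in> points M" "x \<notin> g ` K" for x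
  proof (cases "x \<in> U")
    case True
    then have "\<phi> x \<notin> K" using g\<phi> that by (metis imageI)
    moreover have "\<phi> x \<in> Rn N" using True openR_subset[OF Q_open] by blast
    ultimately obtain i where "i < N" "\<bar>\<phi> x i - z0 i\<bar> > 2 * r" by (auto simp: K_def not_le)
    then show ?thesis using bump_zero[OF r, of i N "\<phi> x" z0] by simp
  qed simp
  show "C_infinity N (\<psi> ` V) (\<lambda>z. ?f (inv_into V \<psi> z))"
  proof (rule smooth_local[OF openR_subset[OF dh(2)]])
    fix z assume "z \<in> \<psi> ` V"
    then obtain y where y: "y \<in> V" "z = \<psi> y" by auto
    show "\<exists>T. openR N T \<and> z \<in> T \<and> C_infinity N T (\<lambda>z. ?f (inv_into V \<psi> z))"
    proof (cases "y \<in> U")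
      case True
      let ?T = "\<psi> ` (V \<inter> U)"
      have T: "openR N ?T" using chart_image_open[OF M d, of "V \<inter> U"] dh(1) ch(1) by auto
      have inv: "inv_into V \<psi> z \<in> V \<inter> U" if "z \<in> ?T" for z using that dh(4) by auto
      have "C_infinity N (\<phi> ` U) (\<lambda>z. \<beta> z * h z)" by (intro smooth_mult Q_open smooth_bump h)
      from smooth_compose[where g="\<lambda>z. \<phi> (inv_into V \<psi> z)", OF Q_open T this chart_transition[OF M d c]]
      have "C_infinity N ?T (\<lambda>z. \<beta> (\<phi> (inv_into V \<psi> z)) * h (\<phi> (inv_into V \<psi> z)))" using inv by auto
      then have "C_infinity N ?T (\<lambda>z. ?f (inv_into V \<psi> z))"
        by (rule smooth_cong[OF T]) (use inv in simp)
      then show ?thesis using T y True by blast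
    next
      case False
      let ?T = "\<psi> ` (V - g ` K)"
      have T: "openR N ?T" using chart_image_open[OF M d, of "V - g ` K"] dh(1) closed by (auto intro: openin_diff)
      have "C_infinity N ?T (\<lambda>z. ?f (inv_into V \<psi> z))"
      proof (rule smooth_cong[OF T smooth_const[OF T, of 0]])
        fix z assume "z \<in> ?T"
        then have "inv_into V \<psi> z \<in> V - g ` K" using dh(4) by auto
        then show "0 = ?f (inv_into V \<psi> z)" using zero[of "inv_into V \<psi> z"] dh(3) by auto
      qed
      moreover have "y \<notin> g ` K"
      proof
        assume "y \<in> g ` K"
        then obtain k where "k \<in> K" "y = g k" by auto
        then have "y \<in> U" using KU g\<phi> by auto
        then show False using False by simp
      qed
      ultimately show ?thesis using T y by blast
    qed
  qed
qed

text \<open>The coordinate field with constant components \<xi>, damped by the bump function: the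
  congruences and the definition of smooth forms only speak of fields on all of M.\<close>

definition Xf :: "(nat \<Rightarrow> real) \<Rightarrow> 'm vfield"
  where "Xf \<xi> x f = (if f \<in> smooth_fun M \<and> x \<in> U then \<Sum>i<N. \<beta> (\<phi> x) * \<xi> i * pd i (\<lambda>z. f (p z)) (\<phi> x) else 0)"

lemma Xf_tangent: "x \<in> points M \<Longrightarrow> Xf \<xi> x \<in> tangent M x"
proof (cases "x \<in> U")
  case True
  have "Xf \<xi> x = (\<lambda>f. if f \<in> smooth_fun M then \<Sum>i<N. (\<beta> (\<phi> x) * \<xi> i) * pd i (\<lambda>z. f (p z)) (\<phi> x) else 0)"
    using True by (auto simp: Xf_def)
  then show ?thesis using tangent_chart[OF M c True, of "\<lambda>i. \<beta> (\<phi> x) * \<xi> i"] by simp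
next
  case False
  then have "Xf \<xi> x = (\<lambda>f. 0)" by (auto simp: Xf_def)
  then show ?thesis by (simp add: tangent_def linear_on_def)
qed

lemma Xf_smooth:
  assumes f: "f \<in> smooth_fun M" shows "(\<lambda>x. Xf \<xi> x f) \<in> smooth_fun M"
proof -
  have "C_infinity N (\<phi> ` U) (\<lambda>z. \<Sum>i<N. \<xi> i * pd i (\<lambda>z. f (p z)) z)"
    by (intro smooth_sum smooth_mult smooth_const Q_open smooth_partial[OF Q_open smooth_funD[OF f c]]) auto
  from extend_smooth[OF this] show ?thesis
    using f by (simp add: Xf_def sum_distrib_left mult.assoc cong: if_cong)
qed

lemma Xf_vector_field: "vector_field M (Xf \<xi>)"
  using Xf_tangent Xf_smooth by (simp add: vector_field_def)

lemma Xf_at: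
  assumes "z \<in> S" "f \<in> smooth_fun M"
  shows "Xf \<xi> (p z) f = (\<Sum>i<N. \<xi> i * pd i (\<lambda>z. f (p z)) z)"
  using assms pU \<phi>p S_sub bump_one[OF r assms(1)] by (auto simp: Xf_def subset_iff)

lemma subspace_tangent: "subspace (tangent M x)"
  by (rule subspaceI) (auto simp: tangent_def linear_on_def scaleR_fun_def algebra_simps)

lemma \<omega>_linear: "x \<in> points M \<Longrightarrow> linear_on (tangent M x) (\<omega> x)"
  and \<omega>_mem: "x \<in> points M \<Longrightarrow> v \<in> tangent M x \<Longrightarrow> \<omega> x v \<in> W"
  and \<omega>_inj: "x \<in> points M \<Longrightarrow> inj_on (\<omega> x) (tangent M x)"
  and \<omega>_zero: "x \<in> points M \<Longrightarrow> \<omega> x 0 = 0"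
  and dimW: "dim W = N"
proof -
  show *: "linear_on (tangent M x) (\<omega> x)" if "x \<in> points M" for x
    using ap that by (auto simp: absolute_parallelism_def one_form_def)
  show "x \<in> points M \<Longrightarrow> v \<in> tangent M x \<Longrightarrow> \<omega> x v \<in> W"
    using ap unfolding absolute_parallelism_def one_form_def by blast
  show "x \<in> points M \<Longrightarrow> inj_on (\<omega> x) (tangent M x)"
    using ap by (auto simp: absolute_parallelism_def bij_betw_def)
  show "dim W = N" using ap by (simp add: absolute_parallelism_def)
  assume x: "x \<in> points M"
  have "\<omega> x (0 *\<^sub>R 0) = 0 *\<^sub>R \<omega> x 0" using *[OF x] subspace_0[OF subspace_tangent] unfolding linear_on_def by blast
  then show "\<omega> x 0 = 0" by simp
qed

definition w :: "nat \<Rightarrow> (nat \<Rightarrow> real) \<Rightarrow> 'v"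
  where "w i z = \<omega> (p z) (Xf (\<lambda>j. if j = i then 1 else 0) (p z))"

lemma Xf_sum: "Xf \<xi> x = (\<Sum>i<N. \<xi> i *\<^sub>R Xf (\<lambda>j. if j = i then 1 else 0) x)"
proof
  fix f
  have "(\<Sum>i<N. \<xi> i *\<^sub>R Xf (\<lambda>j. if j = i then 1 else 0) x) f = (\<Sum>i<N. \<xi> i * Xf (\<lambda>j. if j = i then 1 else 0) x f)"
    using linear_sum[OF linear_fun_component[of f], of "\<lambda>i. \<xi> i *\<^sub>R Xf (\<lambda>j. if j = i then 1 else 0) x" "{..<N}"]
    by (simp add: scaleR_fun_apply)
  also have "\<dots> = Xf \<xi> x f"
    by (auto simp: Xf_def if_distrib[of "\<lambda>x. _ * x"] if_distrib[of "\<lambda>x. x * _"] mult_ac cong: if_cong)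
  finally show "Xf \<xi> x f = (\<Sum>i<N. \<xi> i *\<^sub>R Xf (\<lambda>j. if j = i then 1 else 0) x) f" by simp
qed

lemma \<omega>_Xf: "z \<in> S \<Longrightarrow> \<omega> (p z) (Xf \<xi> (p z)) = (\<Sum>i<N. \<xi> i *\<^sub>R w i z)"
  unfolding w_def Xf_sum[of \<xi>]
  by (rule linear_on_sum[OF \<omega>_linear[OF p_points] subspace_tangent]) (auto intro: Xf_tangent p_points)

lemma w_mem: "z \<in> S \<Longrightarrow> w i z \<in> W"
  unfolding w_def by (intro \<omega>_mem Xf_tangent p_points)

lemma \<omega>_field_smooth: "linear l \<Longrightarrow> (\<lambda>x. l (\<omega> x (Xf \<xi> x))) \<in> smooth_fun M"
  using smooth_map_vector_mfdD(2)[OF M W, of "\<lambda>x. \<omega> x (Xf \<xi> x)" l] ap Xf_vector_field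
  by (auto simp: absolute_parallelism_def one_form_def)

lemma w_smooth: "linear l \<Longrightarrow> C_infinity N S (\<lambda>z. l (w i z))"
  unfolding w_def by (rule smooth_subset[OF smooth_funD[OF \<omega>_field_smooth c] Q_open openR_cube S_sub])

lemma w_inj:
  assumes z: "z \<in> S" and 0: "(\<Sum>i<N. \<xi> i *\<^sub>R w i z) = 0"
  shows "\<forall>i<N. \<xi> i = 0"
proof (intro allI impI)
  fix j assume j: "j < N"
  have "\<omega> (p z) (Xf \<xi> (p z)) = \<omega> (p z) 0" using \<omega>_Xf[OF z] 0 \<omega>_zero[OF p_points[OF z]] by simp
  then have X0: "Xf \<xi> (p z) = 0"
    using \<omega>_inj[OF p_points[OF z]] Xf_tangent[OF p_points[OF z]] subspace_0[OF subspace_tangent] by (auto simp: inj_on_def)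
  \<comment> \<open>The j-th coordinate, cut off to become a global smooth function; on S the field
    reads off \<xi> j from it.\<close>
  define f where "f x = (if x \<in> U then \<beta> (\<phi> x) * \<phi> x j else 0)" for x
  have f: "f \<in> smooth_fun M" unfolding f_def by (rule extend_smooth[OF smooth_coord[OF Q_open]])
  have "pd i (\<lambda>z. f (p z)) z = (if i = j then 1 else 0)" if "i < N" for i
  proof -
    have "pd i (\<lambda>z. f (p z)) z = pd i (\<lambda>z. z j) z"
      by (rule partial_deriv_cong[OF openR_cube z that])
        (use pU \<phi>p S_sub bump_one[OF r] in \<open>auto simp: f_def subset_iff\<close>)
    then show ?thesis by (simp add: partial_coord)
  qed
  then have "Xf \<xi> (p z) f = (\<Sum>i<N. (if j = i then 1 else 0) * \<xi> i)"
    unfolding Xf_at[OF z f] by (intro sum.cong) auto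
  then show "\<xi> j = 0" using X0 by (simp add: sum_delta_mult[OF j])
qed

text \<open>On the open cube S the bump function is 1, so there the fields have constant
  coefficients and mixed partials commute.\<close>

lemma bracket_zero:
  assumes z: "z \<in> S" shows "lie_bracket (Xf \<xi>) (Xf \<eta>) (p z) = 0"
proof
  fix f show "lie_bracket (Xf \<xi>) (Xf \<eta>) (p z) f = 0 f"
  proof (cases "f \<in> smooth_fun M")
    case True
    let ?F = "\<lambda>z. f (p z)"
    have F: "C_infinity N S ?F" by (rule smooth_subset[OF smooth_funD[OF True c] Q_open openR_cube S_sub])
    have *: "Xf \<xi> (p z) (\<lambda>y. Xf \<eta> y f) = (\<Sum>i<N. \<Sum>j<N. \<xi> i * (\<eta> j * pd i (pd j ?F) z))" for \<xi> \<eta>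
    proof -
      have "pd i (\<lambda>z. Xf \<eta> (p z) f) z = (\<Sum>j<N. \<eta> j * pd i (pd j ?F) z)" if i: "i < N" for i
      proof -
        have "pd i (\<lambda>z. Xf \<eta> (p z) f) z = pd i (\<lambda>z. \<Sum>j<N. \<eta> j * pd j ?F z) z"
          by (rule partial_deriv_cong[OF openR_cube z i]) (rule Xf_at[OF _ True])
        also have "\<dots> = (\<Sum>j<N. pd i (\<lambda>z. \<eta> j * pd j ?F z) z)"
          by (rule partial_sum[OF openR_cube _ z i]) (auto intro!: smooth_mult smooth_const smooth_partial F)
        also have "\<dots> = (\<Sum>j<N. \<eta> j * pd i (pd j ?F) z)"
          by (rule sum.cong[OF refl]) (rule partial_cmult[OF openR_cube smooth_partial[OF openR_cube F] z i], simp)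
        finally show ?thesis .
      qed
      then show ?thesis unfolding Xf_at[OF z Xf_smooth[OF True]] by (simp add: sum_distrib_left)
    qed
    have "(\<Sum>i<N. \<Sum>j<N. \<eta> i * (\<xi> j * pd i (pd j ?F) z)) = (\<Sum>j<N. \<Sum>i<N. \<xi> j * (\<eta> i * pd j (pd i ?F) z))"
      by (subst sum.swap, intro sum.cong refl) (use partial_commute[OF openR_cube F z] in auto)
    then show ?thesis by (simp add: lie_bracket_def *)
  next
    case False
    then have "Xf \<xi> y f = 0" for \<xi> y by (simp add: Xf_def)
    then show ?thesis using tangent_const[OF M Xf_tangent[OF p_points[OF z]]] by (simp add: lie_bracket_def)
  qed
qed

lemma ext_deriv_field:
  assumes z: "z \<in> S" and l: "linear l"
  shows "ext_deriv (\<lambda>y v. l (\<omega> y v)) (Xf \<xi>) (Xf \<eta>) (p z) = dform N (\<lambda>i z. l (w i z)) z \<xi> \<eta>"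
proof -
  have lw: "l (\<Sum>i<N. \<eta> i *\<^sub>R w i z) = (\<Sum>i<N. \<eta> i * l (w i z))" for \<eta> z by (rule linear_real_sum[OF l])
  have *: "Xf \<xi> (p z) (\<lambda>y. l (\<omega> y (Xf \<eta> y))) = (\<Sum>i<N. \<Sum>j<N. pd i (\<lambda>z. l (w j z)) z * \<xi> i * \<eta> j)" for \<xi> \<eta>
  proof -
    have "pd i (\<lambda>z. l (\<omega> (p z) (Xf \<eta> (p z)))) z = (\<Sum>j<N. \<eta> j * pd i (\<lambda>z. l (w j z)) z)" if i: "i < N" for i
    proof -
      have "pd i (\<lambda>z. l (\<omega> (p z) (Xf \<eta> (p z)))) z = pd i (\<lambda>z. \<Sum>j<N. \<eta> j * l (w j z)) z"
        by (rule partial_deriv_cong[OF openR_cube z i]) (simp add: \<omega>_Xf lw)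
      also have "\<dots> = (\<Sum>j<N. pd i (\<lambda>z. \<eta> j * l (w j z)) z)"
        by (rule partial_sum[OF openR_cube _ z i]) (rule smooth_mult[OF openR_cube smooth_const[OF openR_cube] w_smooth[OF l]])
      also have "\<dots> = (\<Sum>j<N. \<eta> j * pd i (\<lambda>z. l (w j z)) z)"
        by (rule sum.cong[OF refl]) (rule partial_cmult[OF openR_cube w_smooth[OF l] z i])
      finally show ?thesis .
    qed
    then show ?thesis unfolding Xf_at[OF z \<omega>_field_smooth[OF l]] by (simp add: sum_distrib_left mult_ac)
  qed
  have "(\<Sum>i<N. \<Sum>j<N. pd i (\<lambda>z. l (w j z)) z * \<eta> i * \<xi> j) = (\<Sum>i<N. \<Sum>j<N. pd j (\<lambda>z. l (w i z)) z * \<xi> i * \<eta> j)"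
    by (subst sum.swap) (simp add: mult_ac)
  then show ?thesis
    unfolding ext_deriv_def * bracket_zero[OF z] \<omega>_zero[OF p_points[OF z]] dform_def
    by (simp add: linear_0[OF l] left_diff_distrib sum_subtractf)
qed

text \<open>The congruence is evaluated on two coordinate fields. A product with a generating 1-form
  disappears only if the generator kills both arguments, a multiple of a 2-form if the generator
  kills the pair; what remains is a pointwise identity. The map P selects a component of the
  form.\<close>

lemma structure_at:
  assumes sc: "structure_congruence M G1 G2 (\<lambda>x v. P (\<omega> x v)) \<Phi>" and P: "linear P"
    and z: "z \<in> S" and G1: "\<And>\<alpha>. \<alpha> \<in> G1 \<Longrightarrow> \<alpha> (p z) (Xf \<xi> (p z)) = 0 \<and> \<alpha> (p z) (Xf \<eta> (p z)) = 0"
    and G2: "\<And>\<Omega>. \<Omega> \<in> G2 \<Longrightarrow> \<Omega> (Xf \<xi>) (Xf \<eta>) (p z) = 0" and l: "linear (l :: _ \<Rightarrow> real)"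
  shows "dform N (\<lambda>i z. l (P (w i z))) z \<xi> \<eta> + l (\<Phi> (Xf \<xi>) (Xf \<eta>) (p z)) = 0"
proof -
  have lP: "linear (\<lambda>v. l (P v))" using linear_compose[OF P l] by (simp add: o_def)
  have "in_ideal M G1 G2 (\<lambda>X Y x. ext_deriv (\<lambda>y v. l (P (\<omega> y v))) X Y x + l (\<Phi> X Y x))"
    using sc l unfolding structure_congruence_def by blast
  then obtain r' :: nat and \<alpha> \<eta>' and s :: nat and f \<Omega> where
    a: "\<forall>i<r'. \<alpha> i \<in> G1 \<and> one_form M (UNIV :: real set) (\<eta>' i)" and o: "\<forall>j<s. f j \<in> smooth_fun M \<and> \<Omega> j \<in> G2"
    and eq: "\<forall>X Y. vector_field M X \<longrightarrow> vector_field M Y \<longrightarrow> (\<forall>x\<in>points M.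
      ext_deriv (\<lambda>y v. l (P (\<omega> y v))) X Y x + l (\<Phi> X Y x) = (\<Sum>i<r'. wedge (\<eta>' i) (\<alpha> i) X Y x) + (\<Sum>j<s. f j x * \<Omega> j X Y x))"
    unfolding in_ideal_def by blast
  have "dform N (\<lambda>i z. l (P (w i z))) z \<xi> \<eta> + l (\<Phi> (Xf \<xi>) (Xf \<eta>) (p z)) =
    (\<Sum>i<r'. wedge (\<eta>' i) (\<alpha> i) (Xf \<xi>) (Xf \<eta>) (p z)) + (\<Sum>j<s. f j (p z) * \<Omega> j (Xf \<xi>) (Xf \<eta>) (p z))"
    using eq[rule_format, OF Xf_vector_field[of \<xi>] Xf_vector_field[of \<eta>] p_points[OF z]] ext_deriv_field[OF z lP, of \<xi> \<eta>] by simp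
  also have "(\<Sum>i<r'. wedge (\<eta>' i) (\<alpha> i) (Xf \<xi>) (Xf \<eta>) (p z)) = 0"
  proof (rule sum.neutral, rule ballI)
    fix i assume "i \<in> {..<r'}"
    then have "\<alpha> i \<in> G1" using a by simp
    then show "wedge (\<eta>' i) (\<alpha> i) (Xf \<xi>) (Xf \<eta>) (p z) = 0" using G1[of "\<alpha> i"] by (simp add: wedge_def)
  qed
  also have "(\<Sum>j<s. f j (p z) * \<Omega> j (Xf \<xi>) (Xf \<eta>) (p z)) = 0"
    by (rule sum.neutral) (use o G2 in simp)
  finally show ?thesis by simp
qed

end

section \<open>The jet map of an adapted coframe\<close>

lemma partial_diff_sum:
  assumes "openR n S" "\<And>j. j \<in> J \<Longrightarrow> C_infinity n S (f j)" "\<And>j. j \<in> J \<Longrightarrow> C_infinity n S (g j)" "x \<in> S" "i < n"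
  shows "pd i (\<lambda>x. \<Sum>j\<in>J. f j x * g j x) x = (\<Sum>j\<in>J. pd i (f j) x * g j x + f j x * pd i (g j) x)"
proof -
  have "pd i (\<lambda>x. \<Sum>j\<in>J. f j x * g j x) x = (\<Sum>j\<in>J. pd i (\<lambda>x. f j x * g j x) x)"
    by (rule partial_sum[OF assms(1) smooth_mult[OF assms(1-3)] assms(4,5)])
  also have "\<dots> = (\<Sum>j\<in>J. pd i (f j) x * g j x + f j x * pd i (g j) x)"
    by (rule sum.cong[OF refl]) (rule partial_mult[OF assms(1-3) assms(4,5)])
  finally show ?thesis .
qed

text \<open>The forms dx, \<open>\<omega>\<^sup>0\<close>, \dots, \<open>\<omega>\<^sup>k\<close> with coefficients w and dual frame st; Y are the components of y in the
  basis eb.\<close>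

locale jet_frame =
  fixes N k :: nat and S z0 and W :: "('a::real_vector, 'b::real_vector) graded set"
    and w :: "nat \<Rightarrow> (nat \<Rightarrow> real) \<Rightarrow> ('a, 'b) graded" and st :: "('a, 'b) graded \<Rightarrow> (nat \<Rightarrow> real) \<Rightarrow> nat \<Rightarrow> real"
    and Y :: "nat \<Rightarrow> (nat \<Rightarrow> real) \<Rightarrow> real" and d0 :: nat and eb :: "nat \<Rightarrow> 'b" and T :: "'a \<Rightarrow> ('a, 'b) tensor \<Rightarrow> ('a, 'b) tensor"
  assumes k: "k \<ge> 1" and S: "openR N S" "z0 \<in> S" and W: "subspace W" "W \<subseteq> WW k" "\<And>u. hom_m1 u \<in> W"
    and w_mem: "\<And>i z. i < N \<Longrightarrow> z \<in> S \<Longrightarrow> w i z \<in> W"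
    and w_smooth: "\<And>i l. i < N \<Longrightarrow> linear l \<Longrightarrow> C_infinity N S (\<lambda>z. l (w i z))"
    and st_linear: "\<And>z i. linear (\<lambda>v. st v z i)"
    and st_smooth: "\<And>v i. i < N \<Longrightarrow> C_infinity N S (\<lambda>z. st v z i)"
    and st_frame: "\<And>v z. v \<in> W \<Longrightarrow> z \<in> S \<Longrightarrow> (\<Sum>i<N. st v z i *\<^sub>R w i z) = v"
    and st_inverse: "\<And>z \<xi> i. z \<in> S \<Longrightarrow> i < N \<Longrightarrow> st (\<Sum>j<N. \<xi> j *\<^sub>R w j z) z i = \<xi> i"
    and closed_x: "\<And>l z \<xi> \<eta>. linear l \<Longrightarrow> z \<in> S \<Longrightarrow> dform N (\<lambda>i z. l (fst (w i z))) z \<xi> \<eta> = 0"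
    and S2: "\<And>p l z v u. p + 2 \<le> k \<Longrightarrow> linear l \<Longrightarrow> z \<in> S \<Longrightarrow> v \<in> W \<Longrightarrow> u \<in> W \<Longrightarrow>
      (\<forall>r\<le>p + 1. snd v r = 0 \<and> snd u r = 0) \<Longrightarrow> dform N (\<lambda>i z. l (snd (w i z) p)) z (st v z) (st u z) = 0"
    and S2_z0: "\<And>p l v u. p + 2 \<le> k \<Longrightarrow> linear l \<Longrightarrow> v \<in> W \<Longrightarrow> (\<forall>r\<le>p. snd v r = 0) \<Longrightarrow> fst v = 0 \<Longrightarrow>
      dform N (\<lambda>i z. l (snd (w i z) p)) z0 (st v z0) (st (hom_m1 u) z0) = - l (appl (snd v (p + 1)) u)"
    and S3_z0: "\<And>l v u. linear l \<Longrightarrow> v \<in> W \<Longrightarrow> (\<forall>r<k. snd v r = 0) \<Longrightarrow> fst v = 0 \<Longrightarrow>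
      dform N (\<lambda>i z. l (snd (w i z) (k - 1))) z0 (st v z0) (st (hom_m1 u) z0) = l (T u (snd v k))"
    and Y_smooth: "\<And>b. b < d0 \<Longrightarrow> C_infinity N S (Y b)"
    and Y_kill: "\<And>b v z. b < d0 \<Longrightarrow> v \<in> W \<Longrightarrow> fst v = 0 \<Longrightarrow> snd v 0 = 0 \<Longrightarrow> z \<in> S \<Longrightarrow> (\<Sum>i<N. st v z i * pd i (Y b) z) = 0"
    and Y_z0: "\<And>v. v \<in> W \<Longrightarrow> fst v = 0 \<Longrightarrow> (\<Sum>b<d0. (\<Sum>i<N. st v z0 i * pd i (Y b) z0) *\<^sub>R eb b) = snd v 0 []"
begin

text \<open>Differentiation along the field on which the coframe has the constant value v; for
  \<open>hom_m1 u\<close> this is the field \<open>X\<^sub>u\<close> of the overview.\<close>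

definition D :: "('a, 'b) graded \<Rightarrow> ((nat \<Rightarrow> real) \<Rightarrow> real) \<Rightarrow> (nat \<Rightarrow> real) \<Rightarrow> real"
  where "D v f z = (\<Sum>i<N. st v z i * pd i f z)"

lemma D_smooth: "C_infinity N S f \<Longrightarrow> C_infinity N S (D v f)"
  unfolding D_def by (intro smooth_sum smooth_mult S st_smooth smooth_partial) auto

lemma D_cong: "z \<in> S \<Longrightarrow> (\<And>x. x \<in> S \<Longrightarrow> f x = g x) \<Longrightarrow> D v f z = D v g z"
  unfolding D_def by (intro sum.cong refl arg_cong2[where f="(*)"] partial_deriv_cong[OF S(1)]) auto

lemma D_zero: "z \<in> S \<Longrightarrow> (\<And>x. x \<in> S \<Longrightarrow> f x = 0) \<Longrightarrow> D v f z = 0"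
  using D_cong[of z f "\<lambda>_. 0" v] by (simp add: D_def partial_const)

lemma D_linear: "linear (\<lambda>v. D v f z)"
  unfolding D_def using st_linear by (intro linear_compose_sum ballI) (auto simp: linear_iff algebra_simps)

lemma D_add: "z \<in> S \<Longrightarrow> C_infinity N S f \<Longrightarrow> C_infinity N S g \<Longrightarrow> D v (\<lambda>x. f x + g x) z = D v f z + D v g z"
  by (simp add: D_def partial_add[OF S(1)] distrib_left sum.distrib)

lemma D_cmult: "z \<in> S \<Longrightarrow> C_infinity N S f \<Longrightarrow> D v (\<lambda>x. c * f x) z = c * D v f z"
  by (simp add: D_def partial_cmult[OF S(1)] sum_distrib_left mult_ac)

text \<open>The vector e is the value of the coframe on the bracket of the two dual fields at z. As
  the coframe is constant on both fields, only the bracket term of Cartan's formula for the exterior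
  derivative survives.\<close>

lemma bracket_field:
  assumes vu: "v \<in> W" "u \<in> W" and z: "z \<in> S"
  obtains e where "e \<in> W" "\<forall>f. C_infinity N S f \<longrightarrow> D v (D u f) z - D u (D v f) z = D e f z"
    "\<forall>l. linear l \<longrightarrow> l e = - dform N (\<lambda>i z. l (w i z)) z (st v z) (st u z)"
proof -
  let ?ds = "\<lambda>j u i. pd j (\<lambda>z. st u z i) z"
  define \<zeta> where "\<zeta> i = (\<Sum>j<N. st v z j * ?ds j u i - st u z j * ?ds j v i)" for i
  define e where "e = (\<Sum>i<N. \<zeta> i *\<^sub>R w i z)"
  have eW: "e \<in> W" unfolding e_def using w_mem z W by (intro subspace_sum subspace_scale) auto
  have comm: "D v (D u f) z - D u (D v f) z = D e f z" if f: "C_infinity N S f" for f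
  proof -
    have 1: "D v (D u f) z = (\<Sum>j<N. \<Sum>i<N. st v z j * ?ds j u i * pd i f z) +
        (\<Sum>j<N. \<Sum>i<N. st v z j * st u z i * pd j (pd i f) z)" for v u
    proof -
      have "pd j (D u f) z = (\<Sum>i<N. ?ds j u i * pd i f z + st u z i * pd j (pd i f) z)" if "j < N" for j
        unfolding D_def by (rule partial_diff_sum[OF S(1) st_smooth smooth_partial[OF S(1) f] z that]) auto
      then show ?thesis by (simp add: D_def[of v] sum_distrib_left distrib_left sum.distrib mult.assoc)
    qed
    have 2: "(\<Sum>j<N. \<Sum>i<N. st u z j * st v z i * pd j (pd i f) z) = (\<Sum>j<N. \<Sum>i<N. st v z j * st u z i * pd j (pd i f) z)"
      by (subst sum.swap, intro sum.cong refl) (use partial_commute[OF S(1) f z] in \<open>auto simp: mult_ac\<close>)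
    have "D e f z = (\<Sum>i<N. \<zeta> i * pd i f z)" unfolding D_def e_def using st_inverse[OF z] by simp
    also have "\<dots> = (\<Sum>i<N. \<Sum>j<N. st v z j * ?ds j u i * pd i f z - st u z j * ?ds j v i * pd i f z)"
      by (simp add: \<zeta>_def sum_distrib_right left_diff_distrib)
    also have "\<dots> = (\<Sum>j<N. \<Sum>i<N. st v z j * ?ds j u i * pd i f z - st u z j * ?ds j v i * pd i f z)"
      by (rule sum.swap)
    finally show ?thesis unfolding 1[of v u] 1[of u v] 2 by (simp add: sum_subtractf)
  qed
  have le: "l e = - dform N (\<lambda>i z. l (w i z)) z (st v z) (st u z)" if l: "linear l" for l
  proof -
    let ?\<alpha> = "\<lambda>i z. l (w i z)"
    \<comment> \<open>Obtained by differentiating the constancy of l u = \<Sum> st u z i * l (w i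
      z): derivatives of the dual frame become derivatives of the coframe.\<close>
    have dst: "(\<Sum>i<N. ?ds j u i * ?\<alpha> i z) = - (\<Sum>i<N. st u z i * pd j (?\<alpha> i) z)" if u: "u \<in> W" and j: "j < N" for u j
    proof -
      have "(\<Sum>i<N. ?ds j u i * ?\<alpha> i z + st u z i * pd j (?\<alpha> i) z) = pd j (\<lambda>z. \<Sum>i<N. st u z i * ?\<alpha> i z) z"
        by (rule partial_diff_sum[OF S(1) st_smooth w_smooth[OF _ l] z j, symmetric]) auto
      also have "\<dots> = pd j (\<lambda>z. l u) z"
        by (rule partial_deriv_cong[OF S(1) z j]) (use st_frame[OF u] in \<open>simp flip: linear_real_sum[OF l]\<close>)
      finally show ?thesis by (simp add: partial_const sum.distrib)
    qed
    have "l e = (\<Sum>i<N. \<Sum>j<N. st v z j * (?ds j u i * ?\<alpha> i z) - st u z j * (?ds j v i * ?\<alpha> i z))"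
      unfolding e_def \<zeta>_def by (simp add: linear_real_sum[OF l] sum_distrib_right left_diff_distrib mult.assoc)
    also have "\<dots> = (\<Sum>j<N. \<Sum>i<N. st v z j * (?ds j u i * ?\<alpha> i z) - st u z j * (?ds j v i * ?\<alpha> i z))" by (rule sum.swap)
    also have "\<dots> = (\<Sum>j<N. st v z j * (\<Sum>i<N. ?ds j u i * ?\<alpha> i z)) - (\<Sum>j<N. st u z j * (\<Sum>i<N. ?ds j v i * ?\<alpha> i z))"
      by (simp add: sum_subtractf sum_distrib_left)
    also have "\<dots> = (\<Sum>j<N. \<Sum>i<N. st u z j * (st v z i * pd j (?\<alpha> i) z)) - (\<Sum>j<N. \<Sum>i<N. st v z j * (st u z i * pd j (?\<alpha> i) z))"
      using dst[OF vu(1)] dst[OF vu(2)] by (simp add: sum_distrib_left sum_negf)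
    also have "(\<Sum>j<N. \<Sum>i<N. st u z j * (st v z i * pd j (?\<alpha> i) z)) = (\<Sum>i<N. \<Sum>j<N. st u z j * (st v z i * pd j (?\<alpha> i) z))"
      by (rule sum.swap)
    finally show ?thesis by (simp add: dform_def left_diff_distrib right_diff_distrib sum_subtractf mult_ac)
  qed
  show thesis by (rule that[OF eW]) (use comm le in blast)+
qed

lemma bracket_components:
  assumes e: "\<forall>l. linear l \<longrightarrow> l e = - dform N (\<lambda>i z. l (w i z)) z (st v z) (st u z)" and z: "z \<in> S"
  shows "fst e = 0" "linear l \<Longrightarrow> l (snd e p) = - dform N (\<lambda>i z. l (snd (w i z) p)) z (st v z) (st u z)"
proof -
  show "fst e = 0"
  proof (rule separating_functional)
    fix l :: "'a \<Rightarrow> real" assume l: "linear l"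
    have "linear (\<lambda>w :: ('a, 'b) graded. l (fst w))" using linear_compose[OF linear_fst l] by (simp add: o_def)
    from e[rule_format, OF this] show "l (fst e) = l 0" using closed_x[OF l z] linear_0[OF l] by simp
  qed
  assume l: "linear l"
  have "linear (\<lambda>w :: ('a, 'b) graded. l (snd w p))" using linear_compose[OF linear_snd_component l] by (simp add: o_def)
  from e[rule_format, OF this] show "l (snd e p) = - dform N (\<lambda>i z. l (snd (w i z) p)) z (st v z) (st u z)" .
qed

text \<open>In degree p the structure equation pairs degree -1 with degree p + 1, modulo degrees 0
  to p, so arguments without components in degrees 0 to p + 1 contribute nothing, whatever their
  part of degree -1.\<close>

lemma snd_bracket_zero:
  assumes e: "\<forall>l. linear l \<longrightarrow> l e = - dform N (\<lambda>i z. l (w i z)) z (st v z) (st u z)" and z: "z \<in> S"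
    and vu: "v \<in> W" "u \<in> W" "\<forall>r\<le>p + 1. snd v r = 0 \<and> snd u r = 0" and p: "p + 2 \<le> k"
  shows "snd e p = 0"
proof (rule separating_functional)
  fix l :: "('a, 'b) tensor \<Rightarrow> real" assume l: "linear l"
  show "l (snd e p) = l 0" using bracket_components(2)[OF e z l] S2[OF p l z vu] linear_0[OF l] by simp
qed

text \<open>The head of the list is the derivative applied last, matching \<open>appl\<close>, which
  removes the first argument of a tensor.\<close>

fun Qc :: "nat \<Rightarrow> 'a list \<Rightarrow> (nat \<Rightarrow> real) \<Rightarrow> real"
  where "Qc b [] = Y b" | "Qc b (u # us) = D (hom_m1 u) (Qc b us)"

definition Q :: "'a list \<Rightarrow> (nat \<Rightarrow> real) \<Rightarrow> 'b"
  where "Q us z = (\<Sum>b<d0. Qc b us z *\<^sub>R eb b)"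

definition DQ :: "('a, 'b) graded \<Rightarrow> 'a list \<Rightarrow> 'b"
  where "DQ v us = (\<Sum>b<d0. D v (Qc b us) z0 *\<^sub>R eb b)"

lemma Qc_smooth: "b < d0 \<Longrightarrow> C_infinity N S (Qc b us)"
  by (induction us) (auto intro: Y_smooth D_smooth)

lemma snd_hom_m1: "snd (hom_m1 u) r = 0" "fst (hom_m1 u) = u"
  by (auto simp: hom_m1_def)

text \<open>Commuting v past \<open>hom_m1 u\<close> leaves a bracket term. The bracket loses one
  vanishing degree while the list loses one derivative, so the induction hypothesis applies to it
  with p - 1. The claim is made on all of S because it gets differentiated again.\<close>

lemma Q_kill:
  "b < d0 \<Longrightarrow> length us \<le> p \<Longrightarrow> p + 1 \<le> k \<Longrightarrow> v \<in> W \<Longrightarrow> fst v = 0 \<Longrightarrow> (\<forall>r\<le>p. snd v r = 0) \<Longrightarrow> z \<in> S \<Longrightarrow> D v (Qc b us) z = 0"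
proof (induction us arbitrary: p v z)
  case Nil
  have "snd v 0 = 0" using Nil.prems(6) by blast
  from Y_kill[OF Nil.prems(1,4,5) this Nil.prems(7)] show ?case by (simp only: D_def Qc.simps)
next
  case (Cons u us)
  obtain e where e: "e \<in> W" "\<forall>f. C_infinity N S f \<longrightarrow> D v (D (hom_m1 u) f) z - D (hom_m1 u) (D v f) z = D e f z"
    "\<forall>l. linear l \<longrightarrow> l e = - dform N (\<lambda>i z. l (w i z)) z (st v z) (st (hom_m1 u) z)"
    by (rule bracket_field[OF Cons.prems(4) W(3) Cons.prems(7)])
  have "D (hom_m1 u) (D v (Qc b us)) z = 0"
    by (rule D_zero[OF Cons.prems(7)]) (rule Cons.IH[of p], use Cons.prems in auto)
  moreover have "D e (Qc b us) z = 0"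
  proof (rule Cons.IH[of "p - 1"])
    show "\<forall>r\<le>p - 1. snd e r = 0"
    proof (intro allI impI)
      fix r assume "r \<le> p - 1"
      then show "snd e r = 0"
        by (intro snd_bracket_zero[OF e(3) Cons.prems(7,4) W(3)]) (use Cons.prems snd_hom_m1 in auto)
    qed
  qed (use Cons.prems e(1) bracket_components(1)[OF e(3) Cons.prems(7)] in auto)
  ultimately show ?case using e(2) Qc_smooth[OF Cons.prems(1), of us] by auto
qed

text \<open>The bracket of two fields of degree -1 has no components in degrees -1 to k - 2. Its
  remaining components do not act on derivatives of order at most k - 2, so the two outer
  derivatives commute even when the total order is k.\<close>

lemma Qc_swap:
  assumes b: "b < d0" and len: "length vs + 2 \<le> k" and z: "z \<in> S"
  shows "Qc b (us @ u # v # vs) z = Qc b (us @ v # u # vs) z"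
  using z
proof (induction us arbitrary: z)
  case Nil
  obtain e where e: "e \<in> W" "\<forall>f. C_infinity N S f \<longrightarrow> D (hom_m1 u) (D (hom_m1 v) f) z - D (hom_m1 v) (D (hom_m1 u) f) z = D e f z"
    "\<forall>l. linear l \<longrightarrow> l e = - dform N (\<lambda>i z. l (w i z)) z (st (hom_m1 u) z) (st (hom_m1 v) z)"
    by (rule bracket_field[OF W(3) W(3) Nil])
  have "D e (Qc b vs) z = 0"
  proof (rule Q_kill[OF b, of vs "k - 2"])
    show "\<forall>r\<le>k - 2. snd e r = 0"
    proof (intro allI impI)
      fix r assume "r \<le> k - 2"
      then show "snd e r = 0"
        by (intro snd_bracket_zero[OF e(3) Nil W(3) W(3)]) (use len snd_hom_m1 in auto)
    qed
  qed (use len e(1) bracket_components(1)[OF e(3) Nil] Nil in auto)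
  then show ?case using e(2) Qc_smooth[OF b, of vs] by auto
next
  case (Cons a us)
  show ?case by (simp, rule D_cong[OF Cons.prems], simp add: Cons.IH)
qed

lemma Qc_add:
  assumes b: "b < d0" and z: "z \<in> S"
  shows "Qc b (us @ (u + v) # vs) z = Qc b (us @ u # vs) z + Qc b (us @ v # vs) z"
  using z
proof (induction us arbitrary: z)
  case Nil
  show ?case using linear_add[OF D_linear[of "Qc b vs" z], of "hom_m1 u" "hom_m1 v"] by (simp add: linear_add[OF linear_hom_m1])
next
  case (Cons a us)
  have "D (hom_m1 a) (Qc b (us @ (u + v) # vs)) z = D (hom_m1 a) (\<lambda>z. Qc b (us @ u # vs) z + Qc b (us @ v # vs) z) z"
    by (rule D_cong[OF Cons.prems Cons.IH])
  then show ?case using D_add[OF Cons.prems Qc_smooth[OF b] Qc_smooth[OF b]] by simp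
qed

lemma Qc_scale:
  assumes b: "b < d0" and z: "z \<in> S"
  shows "Qc b (us @ (c *\<^sub>R u) # vs) z = c * Qc b (us @ u # vs) z"
  using z
proof (induction us arbitrary: z)
  case Nil
  show ?case using linear_scale[OF D_linear[of "Qc b vs" z], of c "hom_m1 u"] by (simp add: linear_scale[OF linear_hom_m1])
next
  case (Cons a us)
  have "D (hom_m1 a) (Qc b (us @ (c *\<^sub>R u) # vs)) z = D (hom_m1 a) (\<lambda>z. c * Qc b (us @ u # vs) z) z"
    by (rule D_cong[OF Cons.prems Cons.IH])
  then show ?case using D_cmult[OF Cons.prems Qc_smooth[OF b]] by simp
qed

lemma Q_VV:
  assumes p: "p \<le> k" and z: "z \<in> S"
  shows "(\<lambda>us. if length us = p then Q us z else 0) \<in> VV p"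
proof (rule VV_intro)
  show "(if length (us @ u # v # vs) = p then Q (us @ u # v # vs) z else 0) = (if length (us @ v # u # vs) = p then Q (us @ v # u # vs) z else 0)"
    if "length us + Suc (Suc (length vs)) = p" for us vs u v
    using Qc_swap[of _ vs z us u v] that p z by (auto simp: Q_def intro!: sum.cong)
qed (use Qc_add[OF _ z] Qc_scale[OF _ z] in \<open>auto simp: Q_def scaleR_left_distrib sum.distrib scaleR_sum_right\<close>)

text \<open>The derivative along v of \<open>Qc b us\<close> vanishes identically near
  \<open>z0\<close> by \<open>Q_kill\<close>, so of the commutator only the bracket term is
  left.\<close>

lemma DQ_bracket:
  assumes v: "v \<in> W" "fst v = 0" "\<forall>r\<le>length us. snd v r = 0" and len: "length us + 1 \<le> k"
  obtains e where "e \<in> W" "fst e = 0" "\<forall>r<length us. snd e r = 0" "DQ v (u # us) = DQ e us"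
    "\<forall>l p. linear l \<longrightarrow> l (snd e p) = - dform N (\<lambda>i z. l (snd (w i z) p)) z0 (st v z0) (st (hom_m1 u) z0)"
proof -
  obtain e where e: "e \<in> W" "\<forall>f. C_infinity N S f \<longrightarrow> D v (D (hom_m1 u) f) z0 - D (hom_m1 u) (D v f) z0 = D e f z0"
    "\<forall>l. linear l \<longrightarrow> l e = - dform N (\<lambda>i z. l (w i z)) z0 (st v z0) (st (hom_m1 u) z0)"
    by (rule bracket_field[OF v(1) W(3) S(2)])
  have "D v (Qc b (u # us)) z0 = D e (Qc b us) z0" if b: "b < d0" for b
  proof -
    have "D (hom_m1 u) (D v (Qc b us)) z0 = 0"
      by (rule D_zero[OF S(2)]) (rule Q_kill[OF b order_refl len v])
    then show ?thesis using e(2) Qc_smooth[OF b, of us] by auto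
  qed
  then have DQ: "DQ v (u # us) = DQ e us" by (simp add: DQ_def)
  have "snd e r = 0" if "r < length us" for r
    by (rule snd_bracket_zero[OF e(3) S(2) v(1) W(3)]) (use that v(3) len snd_hom_m1 in auto)
  then show thesis using that[OF e(1) bracket_components(1)[OF e(3) S(2)] _ DQ] bracket_components(2)[OF e(3) S(2)] by blast
qed

text \<open>Each bracket with \<open>hom_m1 u\<close> inserts u into the lowest component of v and
  lowers its degree by one; after all arguments are inserted, the normalisation of Y at
  \<open>z0\<close> gives the value.\<close>

lemma DQ_top:
  "length us + 1 \<le> k \<Longrightarrow> v \<in> W \<Longrightarrow> fst v = 0 \<Longrightarrow> (\<forall>r<length us. snd v r = 0) \<Longrightarrow> DQ v us = snd v (length us) us"
proof (induction us arbitrary: v)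
  case Nil
  then show ?case using Y_z0[of v] by (simp add: DQ_def D_def)
next
  case (Cons u us)
  obtain e where e: "e \<in> W" "fst e = 0" "\<forall>r<length us. snd e r = 0" "DQ v (u # us) = DQ e us"
    "\<forall>l p. linear l \<longrightarrow> l (snd e p) = - dform N (\<lambda>i z. l (snd (w i z) p)) z0 (st v z0) (st (hom_m1 u) z0)"
    by (rule DQ_bracket[OF Cons.prems(2,3), of us u]) (use Cons.prems in auto)
  have "snd e (length us) = appl (snd v (length us + 1)) u"
  proof (rule separating_functional)
    fix l :: "('a, 'b) tensor \<Rightarrow> real" assume l: "linear l"
    show "l (snd e (length us)) = l (appl (snd v (length us + 1)) u)"
    proof -
      have 1: "length us + 2 \<le> k" using Cons.prems(1) by simp
      have 2: "\<forall>r\<le>length us. snd v r = 0" using Cons.prems(4) by (metis le_imp_less_Suc length_Cons)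
      show ?thesis using e(5)[rule_format, OF l, of "length us"] S2_z0[OF 1 l Cons.prems(2) 2 Cons.prems(3), of u] by linarith
    qed
  qed
  then show ?case using Cons.IH[OF _ e(1-3)] e(4) Cons.prems(1) by (simp add: appl_def)
qed

text \<open>The first bracket uses the structure equation of degree k - 1, where T stands in place
  of the bracket; the sign is that of Cartan's formula. The remaining k - 1 arguments are handled by
  \<open>DQ_top\<close>.\<close>

lemma DQ_T:
  assumes v: "v \<in> W" "fst v = 0" "\<forall>r<k. snd v r = 0" and len: "length us + 1 = k"
  shows "DQ v (u # us) = - T u (snd v k) us"
proof -
  obtain e where e: "e \<in> W" "fst e = 0" "\<forall>r<length us. snd e r = 0" "DQ v (u # us) = DQ e us"
    "\<forall>l p. linear l \<longrightarrow> l (snd e p) = - dform N (\<lambda>i z. l (snd (w i z) p)) z0 (st v z0) (st (hom_m1 u) z0)"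
    by (rule DQ_bracket[OF v(1,2), of us u]) (use v len in auto)
  have "snd e (length us) = - T u (snd v k)"
  proof (rule separating_functional)
    fix l :: "('a, 'b) tensor \<Rightarrow> real" assume l: "linear l"
    have "k - 1 = length us" using len by simp
    then have "l (snd e (length us)) = - l (T u (snd v k))"
      using e(5)[rule_format, OF l, of "length us"] S3_z0[OF l v(1,3,2), of u] by simp
    then show "l (snd e (length us)) = l (- T u (snd v k))" by (simp only: linear_neg[OF l])
  qed
  then show ?thesis using DQ_top[OF _ e(1-3)] e(4) len by simp
qed

text \<open>The derivative is block triangular with identity blocks: once the components below
  degree r vanish, the derivatives of order r return the component of degree r.\<close>

lemma DQ_lower_zero:
  assumes v: "v \<in> W" "fst v = 0" and DQ: "\<And>us. length us < k \<Longrightarrow> DQ v us = 0"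
  shows "\<forall>r<k. snd v r = 0"
proof (intro allI impI)
  fix r assume "r < k"
  then show "snd v r = 0"
  proof (induction r rule: less_induct)
    case (less r)
    have mem: "snd v r \<in> VV r" using v(1) W(2) less.prems by (auto simp: WW_iff)
    have "snd v r us = 0" for us
    proof (cases "length us = r")
      case True
      have "DQ v us = snd v (length us) us" by (rule DQ_top[OF _ v]) (use True less in auto)
      then show ?thesis using DQ[of us] True less.prems by simp
    next
      case False
      then show ?thesis using VV_length[OF mem] by simp
    qed
    then show ?case by (auto simp: fun_eq_iff)
  qed
qed

end

section \<open>The immersion into jets obtained from a coframe in coordinates\<close>

lemma dim_less:
  assumes V: "finite_dim V" and C: "subspace C" "C \<subseteq> V" and v: "v \<in> V" "v \<notin> C"
  shows "dim C < dim V"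
proof -
  obtain q b c where "dim V = q + dim C" "\<forall>i<dim V. b i \<in> V" "\<forall>i<dim V. linear (c i :: _ \<Rightarrow> real)"
    "\<forall>v\<in>V. v = (\<Sum>i<dim V. c i v *\<^sub>R b i)" "\<forall>i<dim V. \<forall>j<dim V. c i (b j) = (if i = j then 1 else 0)"
    "\<forall>v\<in>V. v \<in> C \<longleftrightarrow> (\<forall>i<q. c i v = 0)"
    by (rule adapted_basis[OF V C])
  then show ?thesis using v by (cases q) auto
qed

text \<open>The functionals in E span the dual space of V.\<close>

lemma separating_smooth:
  fixes F :: "(nat \<Rightarrow> real) \<Rightarrow> 'v::real_vector"
  assumes V: "finite_dim V" and S: "openR N S" and F: "\<And>z. z \<in> S \<Longrightarrow> F z \<in> V"
    and E: "\<And>e. e \<in> E \<Longrightarrow> linear e" "\<And>v. v \<in> V \<Longrightarrow> (\<forall>e\<in>E. e v = 0) \<Longrightarrow> v = 0" "\<And>e. e \<in> E \<Longrightarrow> C_infinity N S (\<lambda>z. e (F z))"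
    and l: "linear l"
  shows "C_infinity N S (\<lambda>z. l (F z))"
  using V F E(2,3)
proof (induction "dim V" arbitrary: V F rule: less_induct)
  case less
  note sub = finite_dimD[OF less.prems(1)]
  show ?case
  proof (cases "\<forall>v\<in>V. v = 0")
    case True
    have "l (F z) = 0" if "z \<in> S" for z using True less.prems(2)[OF that] linear_0[OF l] by metis
    then show ?thesis by (intro smooth_cong[OF S smooth_const[OF S, of 0]]) auto
  next
    case False
    then obtain v where v: "v \<in> V" "v \<noteq> 0" by blast
    then obtain e where e: "e \<in> E" "e v \<noteq> 0" using less.prems(3) by blast
    note le = E(1)[OF e(1)]
    define V1 where "V1 = {u \<in> V. e u = 0}"
    have s1: "subspace V1" unfolding V1_def
      by (rule subspaceI) (auto simp: subspace_0[OF sub] subspace_add[OF sub] subspace_scale[OF sub] linear_0[OF le] linear_add[OF le] linear_scale[OF le])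
    have f1: "finite_dim V1" by (rule finite_dim_mono[OF less.prems(1) s1]) (auto simp: V1_def)
    have d1: "dim V1 < dim V" by (rule dim_less[OF less.prems(1) s1 _ v(1)]) (use e in \<open>auto simp: V1_def\<close>)
    \<comment> \<open>Removing the multiple of v that e detects pushes F into the kernel of e, of
      smaller dimension. The removed coefficient is smooth because e belongs to E.\<close>
    define F1 where "F1 z = F z - (inverse (e v) * e (F z)) *\<^sub>R v" for z
    have F1e: "e' (F1 z) = e' (F z) - inverse (e v) * e (F z) * e' v" if "linear e'" for e' :: "'v \<Rightarrow> real" and z
      by (simp add: F1_def linear_diff[OF that] linear_scale[OF that])
    have "C_infinity N S (\<lambda>z. l (F1 z))"
    proof (rule less.hyps[OF d1 f1])
      show "F1 z \<in> V1" if "z \<in> S" for z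
        using less.prems(2)[OF that] v e(2) F1e[OF le, of z] subspace_diff[OF sub] subspace_scale[OF sub]
        by (auto simp: V1_def F1_def)
      show "u = 0" if "u \<in> V1" "\<forall>e\<in>E. e u = 0" for u using less.prems(3) that by (auto simp: V1_def)
      show "C_infinity N S (\<lambda>z. e' (F1 z))" if "e' \<in> E" for e'
        unfolding F1e[OF E(1)[OF that]]
        by (intro smooth_diff smooth_mult smooth_const S less.prems(4) that e)
    qed
    then have "C_infinity N S (\<lambda>z. l (F1 z) + inverse (e v) * e (F z) * l v)"
      by (intro smooth_add smooth_mult smooth_const S less.prems(4) e)
    then show ?thesis by (simp add: F1e[OF l])
  qed
qed

lemma dform_cong:
  assumes "openR N S" "z \<in> S" "\<And>i x. i < N \<Longrightarrow> x \<in> S \<Longrightarrow> \<alpha> i x = \<alpha>' i x"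
  shows "dform N \<alpha> z \<xi> \<eta> = dform N \<alpha>' z \<xi> \<eta>"
  unfolding dform_def
  by (intro sum.cong refl arg_cong2[where f="(*)"] arg_cong2[where f="(-)"] partial_deriv_cong[OF assms(1,2)]) (auto simp: assms(3))

lemma dform_add:
  assumes "openR N S" "z \<in> S" "\<And>i. i < N \<Longrightarrow> C_infinity N S (\<alpha> i)" "\<And>i. i < N \<Longrightarrow> C_infinity N S (\<alpha>' i)"
  shows "dform N (\<lambda>i x. \<alpha> i x + \<alpha>' i x) z \<xi> \<eta> = dform N \<alpha> z \<xi> \<eta> + dform N \<alpha>' z \<xi> \<eta>"
proof -
  have "pd i (\<lambda>x. \<alpha> j x + \<alpha>' j x) z = pd i (\<alpha> j) z + pd i (\<alpha>' j) z" if "i < N" "j < N" for i j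
    by (rule partial_add[OF assms(1) assms(3,4) assms(2)]) (use that in auto)
  then show ?thesis unfolding dform_def by (simp add: sum.distrib[symmetric] algebra_simps)
qed

lemma dform_gradient:
  assumes "openR N S" "z \<in> S" "C_infinity N S g"
  shows "dform N (\<lambda>i. pd i g) z \<xi> \<eta> = 0"
  unfolding dform_def using partial_commute[OF assms(1,3,2)] by (auto intro!: sum.neutral)

abbreviation comb :: "nat \<Rightarrow> (nat \<Rightarrow> (nat \<Rightarrow> real) \<Rightarrow> 'v::real_vector) \<Rightarrow> (nat \<Rightarrow> real) \<Rightarrow> (nat \<Rightarrow> real) \<Rightarrow> 'v"
  where "comb N w z \<xi> \<equiv> \<Sum>i<N. \<xi> i *\<^sub>R w i z"

lemma fst_comb: "fst (\<Sum>i\<in>I. x i *\<^sub>R (b i :: 'v::real_vector \<times> 'u::real_vector)) = (\<Sum>i\<in>I. x i *\<^sub>R fst (b i))"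
  by (rule linear_eval_sum[OF linear_fst])

lemma snd_comb: "snd (\<Sum>i\<in>I. x i *\<^sub>R (b i :: 'v::real_vector \<times> 'u::real_vector)) = (\<Sum>i\<in>I. x i *\<^sub>R snd (b i))"
  by (rule linear_eval_sum[OF linear_snd])

lemma rho_WW: "k \<ge> 1 \<Longrightarrow> w \<in> WW k \<Longrightarrow> rho k w \<in> WW (k - 1)"
  by (auto simp: rho_def WW_iff)

text \<open>F is the jet map (x, y, Xy, XXy, \dots).\<close>

lemma local_embedding:
  fixes w :: "nat \<Rightarrow> (nat \<Rightarrow> real) \<Rightarrow> ('a::real_vector, 'b::real_vector) graded"
    and T :: "(nat \<Rightarrow> real) \<Rightarrow> 'a \<Rightarrow> ('a, 'b) tensor \<Rightarrow> ('a, 'b) tensor" and N k :: nat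
  assumes fa: "\<exists>B :: 'a set. finite B \<and> span B = UNIV" and fb: "\<exists>B :: 'b set. finite B \<and> span B = UNIV"
    and k: "k \<ge> 1" and V0: "subspace Vk0" "Vk0 \<subseteq> VV k" and N: "dim (WW0 k Vk0) = N"
    and S: "openR N S" "z0 \<in> S" and w_mem: "\<And>i z. i < N \<Longrightarrow> z \<in> S \<Longrightarrow> w i z \<in> WW0 k Vk0"
    and w_smooth: "\<And>i l. i < N \<Longrightarrow> linear l \<Longrightarrow> C_infinity N S (\<lambda>z. l (w i z))"
    and w_inj: "\<And>z \<xi>. z \<in> S \<Longrightarrow> comb N w z \<xi> = 0 \<Longrightarrow> \<forall>i<N. \<xi> i = 0"
    and S1: "\<And>l z \<xi> \<eta>. linear l \<Longrightarrow> z \<in> S \<Longrightarrow> fst (comb N w z \<xi>) = 0 \<Longrightarrow> fst (comb N w z \<eta>) = 0 \<Longrightarrow>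
      dform N (\<lambda>i z. l (fst (w i z))) z \<xi> \<eta> = 0"
    and S2: "\<And>p l z \<xi> \<eta>. p + 2 \<le> k \<Longrightarrow> linear l \<Longrightarrow> z \<in> S \<Longrightarrow> (\<forall>r\<le>p. snd (comb N w z \<xi>) r = 0 \<and> snd (comb N w z \<eta>) r = 0) \<Longrightarrow>
      dform N (\<lambda>i z. l (snd (w i z) p)) z \<xi> \<eta> =
        l (appl (snd (comb N w z \<eta>) (p + 1)) (fst (comb N w z \<xi>))) - l (appl (snd (comb N w z \<xi>) (p + 1)) (fst (comb N w z \<eta>)))"
    and S3: "\<And>l z \<xi> \<eta>. linear l \<Longrightarrow> z \<in> S \<Longrightarrow> (\<forall>r<k. snd (comb N w z \<xi>) r = 0 \<and> snd (comb N w z \<eta>) r = 0) \<Longrightarrow> fst (comb N w z \<xi>) = 0 \<Longrightarrow>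
      dform N (\<lambda>i z. l (snd (w i z) (k - 1))) z \<xi> \<eta> = l (T z (fst (comb N w z \<eta>)) (snd (comb N w z \<xi>) k))"
    and T0: "\<And>z X. z \<in> S \<Longrightarrow> X \<in> Vk0 \<Longrightarrow> T z 0 X = 0" and TV: "\<And>u X. X \<in> Vk0 \<Longrightarrow> T z0 u X \<in> VV (k - 1)"
    and Tinj: "\<And>X. X \<in> Vk0 \<Longrightarrow> (\<forall>u. T z0 u X = 0) \<Longrightarrow> X = 0"
  obtains r F \<Lambda> and \<chi>' :: "('a, 'b) graded \<Rightarrow> nat \<Rightarrow> real" where "r > 0" "cube N z0 r \<subseteq> S" "\<forall>z\<in>cube N z0 r. F z \<in> WW k"
    "\<forall>l. linear l \<longrightarrow> C_infinity N (cube N z0 r) (\<lambda>z. l (F z))"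
    "dim (WW (k - 1) :: ('a, 'b) graded set) \<le> N" "linear \<chi>'" "\<chi>' \<in> linear_charts (WW (k - 1))" "\<forall>i. linear (\<Lambda> i)"
    "\<forall>i<dim (WW (k - 1) :: ('a, 'b) graded set). \<forall>v. \<Lambda> i v = \<chi>' (rho k v) i"
    "\<forall>\<xi>. (\<forall>i<N. (\<Sum>j<N. pd j (\<lambda>z. \<Lambda> i (F z)) z0 * \<xi> j) = 0) \<longrightarrow> (\<forall>j<N. \<xi> j = 0)"
proof -
  define W where "W = WW0 k Vk0"
  have sW: "subspace W" unfolding W_def by (rule subspace_WW0[OF V0(1)])
  have WWk: "W \<subseteq> WW k" by (auto simp: W_def WW0_def)
  have fWW: "finite_dim (WW j :: ('a, 'b) graded set)" for j by (rule finite_dim_WW[OF fa fb])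
  have fW: "finite_dim W" by (rule finite_dim_mono[OF fWW sW WWk])
  have dW: "dim W = N" using N by (simp add: W_def)
  have w_mem: "w i z \<in> W" if "i < N" "z \<in> S" for i z using w_mem[OF that] by (simp add: W_def)
  have combW: "comb N w z \<xi> \<in> W" if "z \<in> S" for z \<xi> using w_mem that sW by (intro subspace_sum subspace_scale) auto
  have m1W: "hom_m1 u \<in> W" for u
    using subspace_0[OF subspace_VV] subspace_0[OF V0(1)] by (auto simp: W_def WW0_def WW_iff hom_m1_def)
  have p0W: "hom_p 0 (snd v 0) \<in> W" if "v \<in> W" for v
    using that k subspace_0[OF subspace_VV] subspace_0[OF V0(1)] by (auto simp: W_def WW0_def WW_iff hom_p_def)
  have sVk: "snd v k \<in> Vk0" if "v \<in> W" for v using that by (simp add: W_def WW0_def)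
  have appl0: "appl (snd v (p + 1)) 0 = 0" if "v \<in> W" "p + 1 \<le> k" for v p
  proof -
    have "snd v (p + 1) \<in> VV (Suc p)" using that WWk by (auto simp: WW_iff)
    then have "linear (appl (snd v (p + 1)))" by (auto simp: VV_Suc Hom_into_def)
    then show ?thesis by (rule linear_0)
  qed
  have inj0: "\<forall>i<N. \<xi> i = 0" if "comb N w z0 \<xi> = 0" for \<xi> by (rule w_inj[OF S(2) that])
  have lm1: "linear (\<lambda>a. l (hom_m1 a :: ('a, 'b) graded))" if "linear l" for l :: "('a, 'b) graded \<Rightarrow> real"
    using linear_compose[OF linear_hom_m1 that] by (simp add: o_def)
  have lp0: "linear (\<lambda>X. l (hom_p 0 X :: ('a, 'b) graded))" if "linear l" for l :: "('a, 'b) graded \<Rightarrow> real"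
    using linear_compose[OF linear_hom_p that] by (simp add: o_def)
  have lfst: "linear (\<lambda>v :: ('a, 'b) graded. l (fst v))" if "linear l" for l :: "'a \<Rightarrow> real"
    using linear_compose[OF linear_fst that] by (simp add: o_def)
  have lsnd: "linear (\<lambda>v :: ('a, 'b) graded. l (snd v p))" if "linear l" for l :: "('a, 'b) tensor \<Rightarrow> real" and p
    using linear_compose[OF linear_snd_component that] by (simp add: o_def)
  have leval: "linear (\<lambda>v :: ('a, 'b) graded. \<mu> (snd v p us))" if "linear \<mu>" for \<mu> :: "'b \<Rightarrow> real" and p us
    using lsnd[of "\<lambda>X. \<mu> (X us)" p] linear_compose[OF linear_fun_component that, of us] by (simp add: o_def)

  \<comment> \<open>The values of fields tangent to the fibres of x; \<open>C2\<close> below plays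
    the same part for the pair (x, y). Frobenius' theorem is applied to both.\<close>
  define C1 where "C1 = {v \<in> W. fst v = 0}"
  have C1: "subspace C1" "C1 \<subseteq> W" unfolding C1_def
    by (rule subspaceI) (auto simp: subspace_0[OF sW] subspace_add[OF sW] subspace_scale[OF sW])
  define C2 where "C2 = {v \<in> W. fst v = 0 \<and> snd v 0 = 0}"
  have C2: "subspace C2" "C2 \<subseteq> W" unfolding C2_def
    by (rule subspaceI) (auto simp: subspace_0[OF sW] subspace_add[OF sW] subspace_scale[OF sW] snd_scaleR_component simp del: snd_scaleR)
  \<comment> \<open>A functional vanishing on \<open>C1\<close> factors through the component of
    degree -1, whose differential is controlled by the first structure equation.\<close>
  have cl1: "dform N (\<lambda>i z. l (w i z)) z \<xi> \<eta> = 0"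
    if l: "linear l" "\<forall>v\<in>C1. l v = 0" and z: "z \<in> S" and \<xi>: "comb N w z \<xi> \<in> C1" "comb N w z \<eta> \<in> C1" for l :: "('a, 'b) graded \<Rightarrow> real" and z \<xi> \<eta>
  proof -
    have "l v = l (hom_m1 (fst v))" if "v \<in> W" for v
    proof -
      have "v - hom_m1 (fst v) \<in> C1" using that m1W subspace_diff[OF sW] by (auto simp: C1_def hom_m1_def)
      then have "l (v - hom_m1 (fst v)) = 0" using l(2) by blast
      then show ?thesis by (simp add: linear_diff[OF l(1)])
    qed
    then have "dform N (\<lambda>i z. l (w i z)) z \<xi> \<eta> = dform N (\<lambda>i z. l (hom_m1 (fst (w i z)))) z \<xi> \<eta>"
      by (intro dform_cong[OF S(1) z]) (use w_mem in auto)
    also have "\<dots> = 0" by (rule S1[OF lm1[OF l(1)] z]) (use \<xi> in \<open>auto simp: C1_def\<close>)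
    finally show ?thesis .
  qed
  have cl2: "dform N (\<lambda>i z. l (w i z)) z \<xi> \<eta> = 0"
    if l: "linear l" "\<forall>v\<in>C2. l v = 0" and z: "z \<in> S" and \<xi>: "comb N w z \<xi> \<in> C2" "comb N w z \<eta> \<in> C2" for l :: "('a, 'b) graded \<Rightarrow> real" and z \<xi> \<eta>
  proof -
    have "l v = l (hom_m1 (fst v)) + l (hom_p 0 (snd v 0))" if "v \<in> W" for v
    proof -
      have "v - (hom_m1 (fst v) + hom_p 0 (snd v 0)) \<in> C2"
        unfolding C2_def using subspace_diff[OF sW that subspace_add[OF sW m1W p0W[OF that]]] by (auto simp: hom_m1_def hom_p_def)
      then have "l (v - (hom_m1 (fst v) + hom_p 0 (snd v 0))) = 0" using l(2) by blast
      then show ?thesis by (simp add: linear_diff[OF l(1)] linear_add[OF l(1)])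
    qed
    then have "dform N (\<lambda>i z. l (w i z)) z \<xi> \<eta> = dform N (\<lambda>i z. l (hom_m1 (fst (w i z))) + l (hom_p 0 (snd (w i z) 0))) z \<xi> \<eta>"
      by (intro dform_cong[OF S(1) z]) (use w_mem in auto)
    also have "\<dots> = dform N (\<lambda>i z. l (hom_m1 (fst (w i z)))) z \<xi> \<eta> + dform N (\<lambda>i z. l (hom_p 0 (snd (w i z) 0))) z \<xi> \<eta>"
    proof (rule dform_add[OF S(1) z])
      show "C_infinity N S (\<lambda>z. l (hom_m1 (fst (w i z))))" if "i < N" for i by (rule w_smooth[OF that lfst[OF lm1[OF l(1)]]])
      show "C_infinity N S (\<lambda>z. l (hom_p 0 (snd (w i z) 0)))" if "i < N" for i by (rule w_smooth[OF that lsnd[OF lp0[OF l(1)]]])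
    qed
    also have "dform N (\<lambda>i z. l (hom_m1 (fst (w i z)))) z \<xi> \<eta> = 0"
      by (rule S1[OF lm1[OF l(1)] z]) (use \<xi> in \<open>auto simp: C2_def\<close>)
    also have "dform N (\<lambda>i z. l (hom_p 0 (snd (w i z) 0))) z \<xi> \<eta> = 0"
    \<comment> \<open>The form of degree 0 obeys the equation with the bracket when k \<ge> 2, but
      for k = 1 it is already the top equation with T. Either right-hand side vanishes when both
      arguments have no part of degree -1.\<close>
    proof (cases "k \<ge> 2")
      case True
      have "dform N (\<lambda>i z. l (hom_p 0 (snd (w i z) 0))) z \<xi> \<eta> =
          l (hom_p 0 (appl (snd (comb N w z \<eta>) (0 + 1)) (fst (comb N w z \<xi>)))) - l (hom_p 0 (appl (snd (comb N w z \<xi>) (0 + 1)) (fst (comb N w z \<eta>))))"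
        by (rule S2[OF _ lp0[OF l(1)] z]) (use True \<xi> in \<open>auto simp: C2_def\<close>)
      also have "\<dots> = 0"
        using \<xi> appl0[OF combW[OF z], of 0] True linear_0[OF lp0[OF l(1)]] by (simp add: C2_def)
      finally show ?thesis .
    next
      case False
      then have k1: "k = 1" using k by simp
      have "dform N (\<lambda>i z. l (hom_p 0 (snd (w i z) (k - 1)))) z \<xi> \<eta> = l (hom_p 0 (T z (fst (comb N w z \<eta>)) (snd (comb N w z \<xi>) k)))"
        by (rule S3[OF lp0[OF l(1)] z]) (use k1 \<xi> in \<open>auto simp: C2_def\<close>)
      also have "\<dots> = 0" using \<xi> T0[OF z sVk[OF combW[OF z]]] linear_0[OF lp0[OF l(1)]] by (simp add: C2_def)
      finally show ?thesis using k1 by simp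
    qed
    finally show ?thesis by simp
  qed
  obtain r1 G1 where r1: "r1 > 0" "cube N z0 r1 \<subseteq> S" and G1: "\<forall>l. linear l \<and> (\<forall>v\<in>C1. l v = 0) \<longrightarrow> C_infinity N (cube N z0 r1) (G1 l) \<and>
      (\<forall>z\<in>cube N z0 r1. \<forall>\<xi>. comb N w z \<xi> \<in> C1 \<longrightarrow> (\<Sum>i<N. pd i (G1 l) z * \<xi> i) = 0) \<and> (\<forall>i<N. pd i (G1 l) z0 = l (w i z0))"
    by (rule frobenius_vector[where w=w, OF S fW dW C1 w_smooth w_mem inj0 cl1])
  obtain r2 G2 where r2: "r2 > 0" "cube N z0 r2 \<subseteq> S" and G2: "\<forall>l. linear l \<and> (\<forall>v\<in>C2. l v = 0) \<longrightarrow> C_infinity N (cube N z0 r2) (G2 l) \<and>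
      (\<forall>z\<in>cube N z0 r2. \<forall>\<xi>. comb N w z \<xi> \<in> C2 \<longrightarrow> (\<Sum>i<N. pd i (G2 l) z * \<xi> i) = 0) \<and> (\<forall>i<N. pd i (G2 l) z0 = l (w i z0))"
    by (rule frobenius_vector[where w=w, OF S fW dW C2 w_smooth w_mem inj0 cl2])
  have fA: "finite_dim (UNIV :: 'a set)" and fB: "finite_dim (UNIV :: 'b set)" using fa fb by (auto simp: finite_dim_def)
  obtain ea ca where ca: "\<forall>i<dim (UNIV :: 'a set). linear (ca i :: 'a \<Rightarrow> real)" and ea: "\<forall>v. v = (\<Sum>i<dim (UNIV :: 'a set). ca i v *\<^sub>R ea i)"
    by (rule adapted_basis[OF fA subspace_UNIV order_refl]) (metis UNIV_I)
  obtain eb cb where cb: "\<forall>i<dim (UNIV :: 'b set). linear (cb i :: 'b \<Rightarrow> real)" and eb: "\<forall>v. v = (\<Sum>i<dim (UNIV :: 'b set). cb i v *\<^sub>R eb i)"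
    by (rule adapted_basis[OF fB subspace_UNIV order_refl]) (metis UNIV_I)
  define d1 where "d1 = dim (UNIV :: 'a set)"
  define d0 where "d0 = dim (UNIV :: 'b set)"
  note ca = ca[folded d1_def] and ea = ea[folded d1_def] and cb = cb[folded d0_def] and eb = eb[folded d0_def]
  define r3 where "r3 = min r1 r2"
  let ?R = "cube N z0 r3"
  have r3: "r3 > 0" "?R \<subseteq> cube N z0 r1" "?R \<subseteq> cube N z0 r2" using r1 r2 by (auto simp: r3_def intro!: cube_mono)
  have RS: "?R \<subseteq> S" using r3 r1 by blast
  have z0N: "z0 \<in> Rn N" using S openR_subset by blast
  have z0R: "z0 \<in> ?R" by (rule cube_self[OF r3(1) z0N])
  define X where "X a = G1 (\<lambda>v. ca a (fst v))" for a
  have X: "C_infinity N (cube N z0 r1) (X a)" "z \<in> cube N z0 r1 \<Longrightarrow> comb N w z \<xi> \<in> C1 \<Longrightarrow> (\<Sum>i<N. pd i (X a) z * \<xi> i) = 0"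
    "i < N \<Longrightarrow> pd i (X a) z0 = ca a (fst (w i z0))" if "a < d1" for a z \<xi> i
  proof -
    have la: "linear (ca a)" using ca that by blast
    have "linear (\<lambda>v :: ('a, 'b) graded. ca a (fst v)) \<and> (\<forall>v\<in>C1. ca a (fst v) = 0)"
      using lfst[OF la] linear_0[OF la] by (simp add: C1_def)
    from G1[THEN spec, THEN mp, OF this, folded X_def]
    show "C_infinity N (cube N z0 r1) (X a)" "z \<in> cube N z0 r1 \<Longrightarrow> comb N w z \<xi> \<in> C1 \<Longrightarrow> (\<Sum>i<N. pd i (X a) z * \<xi> i) = 0"
      "i < N \<Longrightarrow> pd i (X a) z0 = ca a (fst (w i z0))" by blast+
  qed
  have XR: "C_infinity N ?R (X a)" if "a < d1" for a by (rule smooth_subset[OF X(1)[OF that] openR_cube openR_cube r3(2)])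
  define Y where "Y b = G2 (\<lambda>v. cb b (snd v 0 []))" for b
  have Y: "C_infinity N (cube N z0 r2) (Y b)" "z \<in> cube N z0 r2 \<Longrightarrow> comb N w z \<xi> \<in> C2 \<Longrightarrow> (\<Sum>i<N. pd i (Y b) z * \<xi> i) = 0"
    "i < N \<Longrightarrow> pd i (Y b) z0 = cb b (snd (w i z0) 0 [])" if "b < d0" for b z \<xi> i
  proof -
    have lb: "linear (cb b)" using cb that by blast
    have "linear (\<lambda>v :: ('a, 'b) graded. cb b (snd v 0 [])) \<and> (\<forall>v\<in>C2. cb b (snd v 0 []) = 0)"
      using leval[OF lb] linear_0[OF lb] by (simp add: C2_def)
    from G2[THEN spec, THEN mp, OF this, folded Y_def]
    show "C_infinity N (cube N z0 r2) (Y b)" "z \<in> cube N z0 r2 \<Longrightarrow> comb N w z \<xi> \<in> C2 \<Longrightarrow> (\<Sum>i<N. pd i (Y b) z * \<xi> i) = 0"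
      "i < N \<Longrightarrow> pd i (Y b) z0 = cb b (snd (w i z0) 0 [])" by blast+
  qed
  \<comment> \<open>The differential of x. By the normalisation of the first integrals it agrees
    with the original form at \<open>z0\<close>, so \<open>w'\<close> is still a coframe near that
    point.\<close>
  define dx where "dx i z = (\<Sum>a<d1. pd i (X a) z *\<^sub>R ea a)" for i z
  define w' where "w' i z = (dx i z, snd (w i z))" for i z
  have dx0: "dx i z0 = fst (w i z0)" if "i < N" for i using X(3) that ea by (simp add: dx_def)
  have w'0: "w' i z0 = w i z0" if "i < N" for i by (simp add: w'_def dx0[OF that])
  have comb0: "comb N w' z0 \<xi> = comb N w z0 \<xi>" for \<xi> using w'0 by (intro sum.cong) auto
  have snd_w': "snd (comb N w' z \<xi>) = snd (comb N w z \<xi>)" for z \<xi> unfolding snd_comb by (simp add: w'_def)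
  have fst_w': "fst (comb N w' z \<xi>) = (\<Sum>a<d1. (\<Sum>i<N. pd i (X a) z * \<xi> i) *\<^sub>R ea a)" for z \<xi>
  proof -
    have "fst (comb N w' z \<xi>) = (\<Sum>i<N. \<Sum>a<d1. (\<xi> i * pd i (X a) z) *\<^sub>R ea a)"
      unfolding fst_comb by (simp add: w'_def dx_def scaleR_sum_right)
    also have "\<dots> = (\<Sum>a<d1. \<Sum>i<N. (\<xi> i * pd i (X a) z) *\<^sub>R ea a)" by (rule sum.swap)
    finally show ?thesis by (simp add: scaleR_sum_left mult.commute)
  qed
  have w'_mem: "w' i z \<in> W" if "i < N" "z \<in> ?R" for i z
    using w_mem[OF that(1)] that(2) RS by (fastforce simp: w'_def W_def WW0_def WW_iff)
  have ldx: "l (dx i z) = (\<Sum>a<d1. pd i (X a) z * l (ea a))" if "linear l" for l :: "'a \<Rightarrow> real" and i z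
    by (simp add: dx_def linear_real_sum[OF that])
  have w'_smooth: "C_infinity N ?R (\<lambda>z. l (w' i z))" if i: "i < N" and l: "linear l" for i l
  proof -
    have "linear (\<lambda>v :: ('a, 'b) graded. (0 :: 'a, snd v))" by (rule linearI) auto
    from linear_compose[OF this l] have l2: "linear (\<lambda>v :: ('a, 'b) graded. l (0, snd v))" by (simp add: o_def)
    have "l (w' i z) = (\<Sum>a<d1. pd i (X a) z * l (hom_m1 (ea a))) + l (0, snd (w i z))" for z
    proof -
      have "w' i z = hom_m1 (dx i z) + (0, snd (w i z))" by (simp add: w'_def hom_m1_def)
      then show ?thesis using ldx[OF lm1[OF l]] by (simp add: linear_add[OF l])
    qed
    moreover have "C_infinity N ?R (\<lambda>z. l (0, snd (w i z)))"
      by (rule smooth_subset[OF w_smooth[OF i l2] S(1) openR_cube RS])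
    ultimately show ?thesis
      using i by (auto intro!: smooth_add smooth_sum smooth_mult smooth_const smooth_partial XR)
  qed
  have inj': "\<forall>i<N. \<xi> i = 0" if "comb N w' z0 \<xi> = 0" for \<xi> using inj0 that by (simp add: comb0)
  obtain r st where r: "r > 0" "cube N z0 r \<subseteq> ?R" and st1: "\<forall>z\<in>cube N z0 r. \<forall>v\<in>W. (\<Sum>i<N. st v z i *\<^sub>R w' i z) = v"
    and st2: "\<forall>z\<in>cube N z0 r. \<forall>\<xi>. \<forall>i<N. st (\<Sum>j<N. \<xi> j *\<^sub>R w' j z) z i = \<xi> i" and st3: "\<forall>z i. linear (\<lambda>v. st v z i)"
    and st4: "\<forall>v. \<forall>i<N. C_infinity N (cube N z0 r) (\<lambda>z. st v z i)"
    by (rule smooth_dual_frame[where w=w', OF openR_cube z0R fW dW w'_smooth w'_mem inj'])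
  let ?S = "cube N z0 r"
  have SR: "?S \<subseteq> ?R" by (rule r(2))
  have SS: "?S \<subseteq> S" using SR RS by blast
  have z0S: "z0 \<in> ?S" by (rule cube_self[OF r(1) z0N])
  \<comment> \<open>Away from \<open>z0\<close> the two coframes agree on vectors without a part of
    degree -1: there dx vanishes because the original form does, and the higher components were not
    changed.\<close>
  have comb_st: "comb N w z (st v z) = v" if v: "v \<in> W" "fst v = 0" and z: "z \<in> ?S" for v z
  proof -
    obtain \<xi> where \<xi>: "v = comb N w z \<xi>"
      using finite_dim_card[OF fW, of "\<lambda>i. w i z" v] w_mem w_inj z SS v(1) unfolding dW by blast
    have "comb N w z \<xi> \<in> C1" using v \<xi> by (simp add: C1_def)
    then have "fst (comb N w' z \<xi>) = fst v" unfolding fst_w' using X(2) z SR r3(2) v(2) by (auto intro!: sum.neutral)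
    then have "comb N w' z \<xi> = v" using snd_w'[where z=z and \<xi>=\<xi>] \<xi> by (simp add: prod_eq_iff)
    then have "st v z i = \<xi> i" if "i < N" for i using st2[rule_format, OF z that, of \<xi>] by simp
    then show ?thesis using \<xi> by simp
  qed
  have comb_z0: "comb N w z0 (st v z0) = v" if "v \<in> W" for v using st1 z0S that by (simp flip: comb0)
  have snd_st: "snd (comb N w z (st v z)) = snd v" if "v \<in> W" "z \<in> ?S" for v z using st1 that by (simp flip: snd_w')
  have snd_w'_fun: "(\<lambda>i z. l (snd (w' i z) p)) = (\<lambda>i z. l (snd (w i z) p))" for l :: "('a, 'b) tensor \<Rightarrow> real" and p
    by (simp add: w'_def)
  have m1: "snd (hom_m1 u :: ('a, 'b) graded) p = 0" "fst (hom_m1 u :: ('a, 'b) graded) = u" for u p by (auto simp: hom_m1_def)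
  \<comment> \<open>The vanishing conditions are checked on the whole cube, through
    \<open>snd_st\<close> and \<open>comb_st\<close>; those with exact right-hand sides use
    \<open>comb_z0\<close> and so hold at \<open>z0\<close> only.\<close>
  interpret jet_frame N k ?S z0 W w' st Y d0 eb "T z0"
  proof (rule jet_frame.intro)
    show "w' i z \<in> W" if "i < N" "z \<in> ?S" for i z using w'_mem that SR by blast
    show "C_infinity N ?S (\<lambda>z. l (w' i z))" if "i < N" "linear l" for i l
      by (rule smooth_subset[OF w'_smooth[OF that] openR_cube openR_cube SR])
    show "dform N (\<lambda>i z. l (fst (w' i z))) z \<xi> \<eta> = 0" if l: "linear l" and z: "z \<in> ?S" for l z \<xi> \<eta>
    proof -
      define g where "g z = (\<Sum>a<d1. X a z * l (ea a))" for z
      have g: "C_infinity N ?R g" unfolding g_def by (intro smooth_sum smooth_mult smooth_const XR) auto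
      have "l (fst (w' i z)) = pd i g z" if "i < N" "z \<in> ?R" for i z
      proof -
        have "pd i g z = (\<Sum>a<d1. pd i (\<lambda>z. X a z * l (ea a)) z)"
          unfolding g_def by (rule partial_sum[OF openR_cube smooth_mult[OF openR_cube XR smooth_const[OF openR_cube]] that(2,1)]) auto
        also have "\<dots> = (\<Sum>a<d1. pd i (X a) z * l (ea a))"
        proof (rule sum.cong[OF refl])
          fix a assume "a \<in> {..<d1}"
          then show "pd i (\<lambda>z. X a z * l (ea a)) z = pd i (X a) z * l (ea a)"
            using partial_mult[OF openR_cube XR smooth_const[OF openR_cube] that(2,1), of a "l (ea a)"] by (simp add: partial_const)
        qed
        finally show ?thesis by (simp add: w'_def ldx[OF l])
      qed
      then have "dform N (\<lambda>i z. l (fst (w' i z))) z \<xi> \<eta> = dform N (\<lambda>i. pd i g) z \<xi> \<eta>"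
        using z SR by (intro dform_cong[OF openR_cube[of N z0 r3]]) auto
      then show ?thesis using dform_gradient[OF openR_cube _ g] z SR by auto
    qed
    show "dform N (\<lambda>i z. l (snd (w' i z) p)) z (st v z) (st u z) = 0"
      if p: "p + 2 \<le> k" and l: "linear l" and z: "z \<in> ?S" and vu: "v \<in> W" "u \<in> W" "\<forall>r\<le>p + 1. snd v r = 0 \<and> snd u r = 0" for p l z v u
    proof -
      have s: "snd (comb N w z (st v z)) = snd v" "snd (comb N w z (st u z)) = snd u" using snd_st vu z by auto
      have z': "z \<in> S" using z SS by blast
      have "\<forall>r\<le>p. snd (comb N w z (st v z)) r = 0 \<and> snd (comb N w z (st u z)) r = 0" unfolding s using vu(3) by simp
      from S2[OF p l z' this] have "dform N (\<lambda>i z. l (snd (w i z) p)) z (st v z) (st u z) = l (appl 0 (fst (comb N w z (st v z)))) - l (appl 0 (fst (comb N w z (st u z))))"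
        unfolding s using vu(3) by simp
      then show ?thesis by (simp add: snd_w'_fun appl_simps(3) linear_0[OF l])
    qed
    show "dform N (\<lambda>i z. l (snd (w' i z) p)) z0 (st v z0) (st (hom_m1 u) z0) = - l (appl (snd v (p + 1)) u)"
      if p: "p + 2 \<le> k" and l: "linear l" and v: "v \<in> W" "\<forall>r\<le>p. snd v r = 0" "fst v = 0" for p l v u
    proof -
      have "\<forall>r\<le>p. snd (comb N w z0 (st v z0)) r = 0 \<and> snd (comb N w z0 (st (hom_m1 u) z0)) r = 0"
        unfolding comb_z0[OF v(1)] comb_z0[OF m1W] using v(2) m1 by simp
      from S2[OF p l S(2) this] show ?thesis
        unfolding comb_z0[OF v(1)] comb_z0[OF m1W] m1 by (simp add: snd_w'_fun appl_simps(3) linear_0[OF l])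
    qed
    show "dform N (\<lambda>i z. l (snd (w' i z) (k - 1))) z0 (st v z0) (st (hom_m1 u) z0) = l (T z0 u (snd v k))"
      if l: "linear l" and v: "v \<in> W" "\<forall>r<k. snd v r = 0" "fst v = 0" for l v u
    proof -
      have "\<forall>r<k. snd (comb N w z0 (st v z0)) r = 0 \<and> snd (comb N w z0 (st (hom_m1 u) z0)) r = 0"
        unfolding comb_z0[OF v(1)] comb_z0[OF m1W] using v(2) m1 by simp
      from S3[OF l S(2) this] show ?thesis
        unfolding comb_z0[OF v(1)] comb_z0[OF m1W] m1 using v(3) by (simp add: snd_w'_fun)
    qed
    show "C_infinity N ?S (Y b)" if "b < d0" for b
      by (rule smooth_subset[OF Y(1)[OF that] openR_cube openR_cube]) (use SR r3 in blast)
    show "(\<Sum>i<N. st v z i * pd i (Y b) z) = 0" if "b < d0" "v \<in> W" "fst v = 0" "snd v 0 = 0" "z \<in> ?S" for b v z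
    proof -
      have "comb N w z (st v z) \<in> C2" using comb_st[OF that(2,3,5)] that by (simp add: C2_def)
      then have "(\<Sum>i<N. pd i (Y b) z * st v z i) = 0" using Y(2)[OF that(1)] that(5) SR r3(3) by blast
      then show ?thesis by (simp add: mult.commute)
    qed
    show "(\<Sum>b<d0. (\<Sum>i<N. st v z0 i * pd i (Y b) z0) *\<^sub>R eb b) = snd v 0 []" if "v \<in> W" for v
    proof -
      have "(\<Sum>i<N. st v z0 i * pd i (Y b) z0) = cb b (snd v 0 [])" if b: "b < d0" for b
      proof -
        have "(\<Sum>i<N. st v z0 i * pd i (Y b) z0) = (\<Sum>i<N. st v z0 i * cb b (snd (w i z0) 0 []))"
          using Y(3)[OF b] by simp
        also have "\<dots> = cb b (snd (comb N w z0 (st v z0)) 0 [])"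
          by (rule linear_real_sum[OF leval[OF cb[rule_format, OF b]], symmetric])
        finally show ?thesis unfolding comb_z0[OF \<open>v \<in> W\<close>] .
      qed
      then have "(\<Sum>b<d0. (\<Sum>i<N. st v z0 i * pd i (Y b) z0) *\<^sub>R eb b) = (\<Sum>b<d0. cb b (snd v 0 []) *\<^sub>R eb b)" by simp
      also have "\<dots> = snd v 0 []" by (rule eb[rule_format, symmetric])
      finally show ?thesis .
    qed
    show "(\<Sum>i<N. st v z i *\<^sub>R w' i z) = v" if "v \<in> W" "z \<in> ?S" for v z using st1 that by blast
    show "st (\<Sum>j<N. \<xi> j *\<^sub>R w' j z) z i = \<xi> i" if "z \<in> ?S" "i < N" for z \<xi> i using st2 that by blast
  qed (rule openR_cube k z0S sW WWk m1W st3[rule_format] st4[rule_format] | assumption)+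

  define F :: "(nat \<Rightarrow> real) \<Rightarrow> ('a, 'b) graded"
    where "F z = (\<Sum>a<d1. X a z *\<^sub>R ea a, \<lambda>p. if p \<le> k then (\<lambda>us. if length us = p then Q us z else 0) else 0)" for z
  have F_mem: "F z \<in> WW k" if "z \<in> ?S" for z using Q_VV[OF _ that] by (auto simp: F_def WW_iff)
  \<comment> \<open>Functionals of single components, against which F is smooth by construction.
    They separate points, so \<open>separating_smooth\<close> extends this to every linear
    functional.\<close>
  define E :: "(('a, 'b) graded \<Rightarrow> real) set"
    where "E = {\<lambda>v. \<mu> (fst v) |\<mu>. linear \<mu>} \<union> {\<lambda>v. \<mu> (snd v p us) |\<mu> p us. linear \<mu>}"
  have Ffst: "\<mu> (fst (F z)) = (\<Sum>a<d1. X a z * \<mu> (ea a))" if "linear \<mu>" for \<mu> :: "'a \<Rightarrow> real" and z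
    by (simp add: F_def linear_real_sum[OF that])
  have Fsnd: "\<mu> (snd (F z) p us) = (if p \<le> k \<and> length us = p then \<Sum>b<d0. Qc b us z * \<mu> (eb b) else 0)" if "linear \<mu>" for \<mu> :: "'b \<Rightarrow> real" and z p us
    using linear_0[OF that] by (auto simp: F_def Q_def linear_real_sum[OF that])
  have F_smooth: "C_infinity N ?S (\<lambda>z. l (F z))" if l: "linear l" for l
  proof (rule separating_smooth[where E=E, OF fWW openR_cube F_mem _ _ _ l])
    show "linear e" if "e \<in> E" for e using that lfst leval by (auto simp: E_def)
    show "v = 0" if "\<forall>e\<in>E. e v = 0" for v
    proof -
      have "fst v = 0" by (rule separating_functional) (use that linear_0 in \<open>fastforce simp: E_def\<close>)
      moreover have "snd v p us = 0" for p us
        by (rule separating_functional) (use that linear_0 in \<open>fastforce simp: E_def\<close>)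
      ultimately show ?thesis by (auto simp: prod_eq_iff fun_eq_iff)
    qed
    show "C_infinity N ?S (\<lambda>z. e (F z))" if "e \<in> E" for e
      using that unfolding E_def
    proof (elim UnE CollectE exE conjE)
      fix \<mu> assume e: "e = (\<lambda>v. \<mu> (fst v))" "linear \<mu>"
      show ?thesis unfolding e(1) Ffst[OF e(2)]
        by (intro smooth_sum smooth_mult smooth_const smooth_subset[OF XR openR_cube openR_cube SR]) auto
    next
      fix \<mu> p us assume e: "e = (\<lambda>v. \<mu> (snd v p us))" "linear \<mu>"
      show ?thesis unfolding e(1) Fsnd[OF e(2)]
        by (cases "p \<le> k \<and> length us = p") (auto intro!: smooth_sum smooth_mult smooth_const Qc_smooth)
    qed
  qed

  text \<open>P is the derivative of F at z0 in terms of the frame.\<close>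
  obtain bW cW where cW: "\<forall>i<dim (WW k :: ('a, 'b) graded set). linear (cW i :: ('a, 'b) graded \<Rightarrow> real)"
    and bW: "\<forall>v\<in>WW k. v = (\<Sum>i<dim (WW k :: ('a, 'b) graded set). cW i v *\<^sub>R bW i)" and bW_mem: "\<forall>i<dim (WW k :: ('a, 'b) graded set). bW i \<in> WW k"
    by (rule adapted_basis[OF fWW subspace_WW order_refl]) blast
  define M where "M = dim (WW k :: ('a, 'b) graded set)"
  note cW = cW[folded M_def] and bW = bW[folded M_def] and bW_mem = bW_mem[folded M_def]
  define P where "P v = (\<Sum>i<M. D v (\<lambda>z. cW i (F z)) z0 *\<^sub>R bW i)" for v
  have linP: "linear P" unfolding P_def using D_linear by (intro linear_compose_sum ballI) (auto simp: linear_iff scaleR_left_distrib)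
  have P_mem: "P v \<in> WW k" for v unfolding P_def using bW_mem by (intro subspace_sum subspace_scale subspace_WW) auto
  have lP: "l (P v) = D v (\<lambda>z. l (F z)) z0" if l: "linear l" for l v
  proof -
    have eq: "l (F z) = (\<Sum>i<M. l (bW i) * cW i (F z))" if "z \<in> ?S" for z
    proof -
      have "l (F z) = l (\<Sum>i<M. cW i (F z) *\<^sub>R bW i)" by (rule arg_cong[OF bW[rule_format, OF F_mem[OF that]]])
      also have "\<dots> = (\<Sum>i<M. cW i (F z) * l (bW i))" by (rule linear_real_sum[OF l])
      finally show ?thesis by (simp only: mult.commute)
    qed
    have "D v (\<lambda>z. l (F z)) z0 = D v (\<lambda>z. \<Sum>i<M. l (bW i) * cW i (F z)) z0" by (rule D_cong[OF z0S eq])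
    also have "\<dots> = (\<Sum>j<N. st v z0 j * (\<Sum>i<M. l (bW i) * pd j (\<lambda>z. cW i (F z)) z0))"
      unfolding D_def
    proof (intro sum.cong refl arg_cong2[where f="(*)"])
      fix j assume j: "j \<in> {..<N}"
      have s: "C_infinity N ?S (\<lambda>z. cW i (F z))" if "i < M" for i using F_smooth cW that by blast
      have "pd j (\<lambda>z. \<Sum>i<M. l (bW i) * cW i (F z)) z0 = (\<Sum>i<M. pd j (\<lambda>z. l (bW i) * cW i (F z)) z0)"
        by (rule partial_sum[OF openR_cube _ z0S]) (use s j in \<open>auto intro!: smooth_mult smooth_const\<close>)
      then show "pd j (\<lambda>z. \<Sum>i<M. l (bW i) * cW i (F z)) z0 = (\<Sum>i<M. l (bW i) * pd j (\<lambda>z. cW i (F z)) z0)"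
        using partial_cmult[OF openR_cube s z0S] j by simp
    qed
    also have "\<dots> = (\<Sum>i<M. l (bW i) * D v (\<lambda>z. cW i (F z)) z0)"
      unfolding D_def sum_distrib_left by (subst sum.swap) (simp add: mult_ac)
    finally show ?thesis unfolding P_def by (simp add: linear_real_sum[OF l] mult.commute)
  qed
  have P_fst: "fst (P v) = fst v" if "v \<in> W" for v
  proof (rule separating_functional)
    fix \<mu> :: "'a \<Rightarrow> real" assume \<mu>: "linear \<mu>"
    define g where "g z = (\<Sum>a<d1. X a z * \<mu> (ea a))" for z
    have "\<mu> (fst (P v)) = D v g z0" using lP[OF lfst[OF \<mu>]] by (simp add: Ffst[OF \<mu>] g_def[abs_def])
    also have "\<dots> = (\<Sum>i<N. st v z0 i * \<mu> (dx i z0))"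
      unfolding D_def
    proof (intro sum.cong refl arg_cong2[where f="(*)"])
      fix i assume "i \<in> {..<N}"
      then have i: "i < N" by simp
      have "pd i g z0 = (\<Sum>a<d1. pd i (X a) z0 * \<mu> (ea a) + X a z0 * pd i (\<lambda>_. \<mu> (ea a)) z0)"
        unfolding g_def by (rule partial_diff_sum[OF openR_cube XR smooth_const[OF openR_cube] z0R i]) auto
      then show "pd i g z0 = \<mu> (dx i z0)" by (simp add: partial_const ldx[OF \<mu>])
    qed
    also have "\<dots> = \<mu> (fst (comb N w z0 (st v z0)))" unfolding fst_comb linear_real_sum[OF \<mu>] using dx0 by simp
    finally show "\<mu> (fst (P v)) = \<mu> (fst v)" unfolding comb_z0[OF that] .
  qed
  have P_snd: "snd (P v) p us = DQ v us" if "p \<le> k" "length us = p" for v p us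
  proof (rule separating_functional)
    fix \<mu> :: "'b \<Rightarrow> real" assume \<mu>: "linear \<mu>"
    have "\<mu> (snd (P v) p us) = D v (\<lambda>z. \<Sum>b<d0. Qc b us z * \<mu> (eb b)) z0"
      using lP[OF leval[OF \<mu>, of p us]] that by (simp add: Fsnd[OF \<mu>])
    also have "\<dots> = (\<Sum>i<N. st v z0 i * (\<Sum>b<d0. pd i (Qc b us) z0 * \<mu> (eb b)))"
      unfolding D_def
    proof (intro sum.cong refl arg_cong2[where f="(*)"])
      fix i assume "i \<in> {..<N}"
      then have i: "i < N" by simp
      have "pd i (\<lambda>z. \<Sum>b<d0. Qc b us z * \<mu> (eb b)) z0 = (\<Sum>b<d0. pd i (Qc b us) z0 * \<mu> (eb b) + Qc b us z0 * pd i (\<lambda>_. \<mu> (eb b)) z0)"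
        by (rule partial_diff_sum[OF openR_cube Qc_smooth smooth_const[OF openR_cube] z0S i]) auto
      then show "pd i (\<lambda>z. \<Sum>b<d0. Qc b us z * \<mu> (eb b)) z0 = (\<Sum>b<d0. pd i (Qc b us) z0 * \<mu> (eb b))"
        by (simp add: partial_const)
    qed
    also have "\<dots> = (\<Sum>b<d0. D v (Qc b us) z0 * \<mu> (eb b))"
      unfolding D_def sum_distrib_left sum_distrib_right by (subst sum.swap) (simp add: mult.assoc)
    finally show "\<mu> (snd (P v) p us) = \<mu> (DQ v us)" by (simp add: DQ_def linear_real_sum[OF \<mu>])
  qed
  \<comment> \<open>The derivative of the (k-1)-jet kills only vectors concentrated in degree k, by
    the triangular structure.\<close>
  have lower: "fst v = 0 \<and> (\<forall>r<k. snd v r = 0)" if v: "v \<in> W" and 0: "fst (P v) = 0" "\<forall>p<k. snd (P v) p = 0" for v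
  proof -
    have f0: "fst v = 0" using P_fst[OF v] 0 by simp
    have "DQ v us = 0" if "length us < k" for us using P_snd[of "length us" us v] 0(2) that by simp
    then show ?thesis using f0 DQ_lower_zero[OF v f0] by blast
  qed
  have zeroI: "v = 0" if "v \<in> W" "fst v = 0" "\<forall>r<k. snd v r = 0" "snd v k = 0" for v
  proof -
    have "snd v r = 0" for r using that WWk by (cases r k rule: linorder_cases) (auto simp: WW_iff)
    then show ?thesis using that(2) by (auto simp: prod_eq_iff fun_eq_iff)
  qed
  \<comment> \<open>On such vectors the derivatives of order k give T up to sign, and the
    nondegeneracy of T at \<open>z0\<close> finishes the argument.\<close>
  have Pinj: "v = 0" if v: "v \<in> W" and 0: "P v = 0" for v
  proof -
    have l: "fst v = 0" "\<forall>r<k. snd v r = 0" using lower[OF v] 0 by auto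
    have "T z0 u (snd v k) us = 0" for u us
    proof (cases "length us + 1 = k")
      case True
      have "DQ v (u # us) = snd (P v) k (u # us)" using P_snd[of k "u # us" v] True by simp
      then show ?thesis using DQ_T[OF v l True, of u] 0 by simp
    next
      case False
      then show ?thesis using VV_length[OF TV[OF sVk[OF v]]] k by auto
    qed
    then have "snd v k = 0" by (intro Tinj sVk[OF v]) (auto simp: fun_eq_iff)
    then show ?thesis using zeroI[OF v l] by simp
  qed
  have "inj_on P W"
  proof (rule inj_onI)
    fix u v assume h: "u \<in> W" "v \<in> W" "P u = P v"
    have "u - v = 0" by (rule Pinj) (use h subspace_diff[OF sW] linear_diff[OF linP] in auto)
    then show "u = v" by simp
  qed
  \<comment> \<open>The left inverse transports functionals on W to functionals on k-jets with
    prescribed values on the image of the derivative.\<close>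
  from linear_exists_left_inverse_on[OF linP sW this]
  obtain P' where P': "linear P'" "\<forall>v\<in>W. P' (P v) = v" by blast
  have WkW: "WW (k - 1) \<subseteq> W" unfolding W_def by (rule WW_pred_subset_WW0[OF V0(1)]) (use k in simp)
  obtain q b c where q: "dim W = q + dim (WW (k - 1) :: ('a, 'b) graded set)" "\<forall>i<dim W. b i \<in> W" and c: "\<forall>i<dim W. linear (c i :: ('a, 'b) graded \<Rightarrow> real)"
    "\<forall>v\<in>W. v = (\<Sum>i<dim W. c i v *\<^sub>R b i)" "\<forall>i<dim W. \<forall>j<dim W. c i (b j) = (if i = j then 1 else 0)"
    and Ciff: "\<forall>v\<in>W. v \<in> WW (k - 1) \<longleftrightarrow> (\<forall>i<q. c i v = 0)"
    by (rule adapted_basis[OF fW subspace_WW WkW])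
  obtain \<chi>' b\<chi> where \<chi>: "linear \<chi>'" "\<chi>' \<in> linear_charts (WW (k - 1) :: ('a, 'b) graded set)"
    "\<forall>y\<in>Rn (dim (WW (k - 1) :: ('a, 'b) graded set)). (\<Sum>i<dim (WW (k - 1) :: ('a, 'b) graded set). y i *\<^sub>R b\<chi> i) \<in> WW (k - 1) \<and> \<chi>' (\<Sum>i<dim (WW (k - 1) :: ('a, 'b) graded set). y i *\<^sub>R b\<chi> i) = y"
    "\<forall>v\<in>WW (k - 1). v = (\<Sum>i<dim (WW (k - 1) :: ('a, 'b) graded set). \<chi>' v i *\<^sub>R b\<chi> i)"
    by (rule linear_chart_exists[OF fWW])
  define m where "m = dim (WW (k - 1) :: ('a, 'b) graded set)"
  \<comment> \<open>The first m functionals are chart coordinates of the (k-1)-jet. The next q = N -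
    m are the coordinates of W transversal to \<open>WW (k - 1)\<close>, that is, of the degree k
    part; the value 0 afterwards is padding.\<close>
  define \<Lambda> where "\<Lambda> i v = (if i < m then \<chi>' (rho k v) i else if i - m < q then c (i - m) (P' v) else 0)" for i v
  have \<Lambda>_lin: "linear (\<Lambda> i)" for i
  proof -
    have "linear (\<lambda>v. \<chi>' (rho k v) i)"
      using linear_compose[OF linear_compose[OF linear_rho \<chi>(1)] linear_fun_component[of i]] by (simp add: o_def)
    moreover have "linear (\<lambda>v. c (i - m) (P' v))" if "i - m < q"
      using linear_compose[OF P'(1), of "c (i - m)"] c(1) that q by (simp add: o_def)
    moreover have "linear (\<lambda>v :: ('a, 'b) graded. 0 :: real)" by (simp add: linear_iff)
    ultimately show ?thesis unfolding \<Lambda>_def[abs_def] by (cases "i < m"; cases "i - m < q"; simp)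
  qed
  have jac: "\<forall>j<N. \<xi> j = 0" if h: "\<forall>i<N. (\<Sum>j<N. pd j (\<lambda>z. \<Lambda> i (F z)) z0 * \<xi> j) = 0" for \<xi>
  proof -
    define v where "v = comb N w' z0 \<xi>"
    have v: "v \<in> W" unfolding v_def comb0 by (rule combW[OF subsetD[OF SS z0S]])
    have st: "st v z0 j = \<xi> j" if "j < N" for j using st2 z0S that by (simp add: v_def)
    have 0: "\<Lambda> i (P v) = 0" if "i < N" for i
      using h that st lP[OF \<Lambda>_lin, of i v] by (simp add: D_def mult.commute)
    have Nq: "N = q + m" using q(1) dW by (simp add: m_def)
    have "\<chi>' (rho k (P v)) i = 0" if "i < m" for i using 0[of i] that Nq by (simp add: \<Lambda>_def)
    moreover have "rho k (P v) = (\<Sum>i<m. \<chi>' (rho k (P v)) i *\<^sub>R b\<chi> i)"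
      unfolding m_def by (rule \<chi>(4)[rule_format, OF rho_WW[OF k P_mem]])
    ultimately have r0: "rho k (P v) = 0" by (simp add: sum.neutral)
    have "fst (P v) = 0" using arg_cong[OF r0, of fst] by (simp add: rho_def)
    moreover have "snd (P v) p = 0" if "p < k" for p
      using fun_cong[OF arg_cong[OF r0, of snd], of p] that by (simp add: rho_def)
    ultimately have l: "fst v = 0" "\<forall>r<k. snd v r = 0" using lower[OF v] by auto
    \<comment> \<open>The functional with index i + m recovers this coordinate because P' (P v) = v.
      With the lower degrees already gone, v then lies in \<open>WW (k - 1)\<close> and must
      vanish.\<close>
    have "c i v = 0" if "i < q" for i using 0[of "i + m"] that Nq P'(2) v by (simp add: \<Lambda>_def)
    then have "v \<in> WW (k - 1)" using Ciff v by blast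
    then have "snd v k = 0" using k by (simp add: WW_iff)
    then have "v = 0" using zeroI[OF v l] by simp
    then show ?thesis using st linear_0[OF st3[rule_format]] by simp
  qed
  show thesis
  proof (rule that[of r F \<chi>' \<Lambda>])
    show "dim (WW (k - 1) :: ('a, 'b) graded set) \<le> N" using q(1) dW by simp
  qed (use r(1) SS F_mem F_smooth \<chi> \<Lambda>_lin jac in \<open>auto simp: \<Lambda>_def m_def\<close>)
qed

section \<open>Manifolds with cubic coordinates\<close>

lemma Rn_unit_sum: "y \<in> Rn n \<Longrightarrow> y = (\<Sum>i<n. y i *\<^sub>R (\<lambda>j. if j = i then 1 else 0 :: real))"
proof (rule Rn_eqI[where n=n])
  have c: "(\<Sum>i<n. y i *\<^sub>R (\<lambda>j. if j = i then 1 else 0 :: real)) j = (if j < n then y j else 0)" for j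
    using linear_eval_sum[OF linear_fun_component[of j], where I="{..<n}" and x=y and b="\<lambda>i j. if j = i then 1 else 0 :: real"]
    by (simp add: if_distrib[of "\<lambda>x. _ * x"] cong: if_cong)
  show "(\<Sum>i<n. y i *\<^sub>R (\<lambda>j. if j = i then 1 else 0 :: real)) \<in> Rn n" by (simp add: Rn_def c)
  show "y i = (\<Sum>i<n. y i *\<^sub>R (\<lambda>j. if j = i then 1 else 0 :: real)) i" if "i < n" for i using that c by simp
qed simp

lemma subspace_Rn: "subspace (Rn n)"
  by (rule subspaceI) (auto simp: Rn_def scaleR_fun_apply)

lemma finite_dim_Rn: "finite_dim (Rn n)" and dim_Rn: "dim (Rn n) = n"
proof -
  define e where "e i = (\<lambda>j. if j = i then 1 else 0 :: real)" for i :: nat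
  have span: "Rn n \<subseteq> span (e ` {..<n})"
  proof
    fix y assume "y \<in> Rn n"
    then have "y = (\<Sum>i<n. y i *\<^sub>R e i)" unfolding e_def by (rule Rn_unit_sum)
    moreover have "(\<Sum>i<n. y i *\<^sub>R e i) \<in> span (e ` {..<n})" by (intro span_sum span_scale span_base) auto
    ultimately show "y \<in> span (e ` {..<n})" by simp
  qed
  then show fd: "finite_dim (Rn n)" unfolding finite_dim_def using subspace_Rn by blast
  have inj: "inj_on e {..<n}" by (rule inj_onI) (metis e_def one_neq_zero)
  have "independent (e ` {..<n})"
  proof (rule independent_if_scalars_zero)
    fix f x assume 0: "(\<Sum>x\<in>e ` {..<n}. f x *\<^sub>R x) = 0" and "x \<in> e ` {..<n}"
    then obtain j where j: "j < n" "x = e j" by auto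
    have "(\<Sum>i<n. f (e i) *\<^sub>R e i) = 0" using 0 by (simp add: sum.reindex[OF inj])
    moreover have "(\<Sum>i<n. f (e i) *\<^sub>R e i) j = (\<Sum>i<n. f (e i) * e i j)"
      using linear_eval_sum[OF linear_fun_component[of j], where I="{..<n}" and x="\<lambda>i. f (e i)" and b=e] by simp
    moreover have "(\<Sum>i<n. f (e i) * e i j) = f (e j)" using j(1) by (simp add: e_def if_distrib[of "\<lambda>x. _ * x"] cong: if_cong)
    ultimately show "f x = 0" using j by simp
  qed simp
  moreover have "e ` {..<n} \<subseteq> Rn n" by (auto simp: e_def Rn_def)
  ultimately show "dim (Rn n) = n" using span inj by (intro dim_unique[of "e ` {..<n}"]) (auto simp: card_image)
qed

section \<open>Restriction of smooth maps to open submanifolds\<close>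

lemma smooth_fun_open_submfd:
  assumes M: "smooth_manifold M" and A: "openin (mtop M) A" and f: "f \<in> smooth_fun M"
  shows "f \<in> smooth_fun (open_submfd M A)"
  unfolding smooth_fun_iff
proof (intro allI impI)
  fix V \<phi> assume "(V, \<phi>) \<in> atlas (open_submfd M A)"
  then obtain U where U: "(U, \<phi>) \<in> atlas M" "V = U \<inter> A" by (auto simp: open_submfd_def)
  note c = chartD[OF M U(1)]
  have o: "openR (mdim M) (\<phi> ` V)" using chart_image_open[OF M U(1)] c(1) A U(2) by auto
  have "C_infinity (mdim M) (\<phi> ` V) (\<lambda>z. f (inv_into U \<phi> z))"
    by (rule smooth_subset[OF smooth_funD[OF f U(1)] c(2) o]) (use U in auto)
  then have "C_infinity (mdim M) (\<phi> ` V) (\<lambda>z. f (inv_into V \<phi> z))"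
  proof (rule smooth_cong[OF o])
    fix z assume "z \<in> \<phi> ` V"
    then obtain x where x: "x \<in> V" "z = \<phi> x" by auto
    then have "inv_into U \<phi> z = x" "inv_into V \<phi> z = x"
      using U(2) c(4) by (auto intro!: inv_into_f_eq inj_on_subset[OF c(4)])
    then show "f (inv_into U \<phi> z) = f (inv_into V \<phi> z)" by simp
  qed
  then show "C_infinity (mdim (open_submfd M A)) (\<phi> ` V) (\<lambda>z. f (inv_into V \<phi> z))" by (simp add: open_submfd_def)
qed

lemma smooth_map_open_submfd:
  assumes M: "smooth_manifold M" and f: "smooth_map M N f" "f ` points M \<subseteq> A"
  shows "smooth_map M (open_submfd N A) f"
  unfolding smooth_map_def
proof (intro conjI)
  show "continuous_map (mtop M) (mtop (open_submfd N A)) f"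
    using f by (auto simp: smooth_map_def open_submfd_def continuous_map_in_subtopology)
  have "U \<inter> f -` (V \<inter> A) = U \<inter> f -` V" if "(U, \<phi>) \<in> atlas M" for U V \<phi> using chartD(3)[OF M that] f(2) by auto
  then show "\<forall>(U, \<phi>)\<in>atlas M. \<forall>(V, \<psi>)\<in>atlas (open_submfd N A). \<forall>i<mdim (open_submfd N A).
      C_infinity (mdim M) (\<phi> ` (U \<inter> f -` V)) (\<lambda>z. \<psi> (f (inv_into U \<phi> z)) i)"
    using f(1) by (fastforce simp: smooth_map_def open_submfd_def)
qed

lemma smooth_embedding_open_submfd:
  assumes M: "smooth_manifold M" and N: "smooth_manifold N" "openin (mtop N) A"
    and f: "smooth_embedding M N f" "f ` points M \<subseteq> A"
  shows "smooth_embedding M (open_submfd N A) f"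
  unfolding smooth_embedding_def
proof (intro conjI ballI)
  show "smooth_map M (open_submfd N A) f"
    using f by (auto simp: smooth_embedding_def intro!: smooth_map_open_submfd[OF M])
  have "A \<inter> f ` points M = f ` points M" using f(2) by blast
  then show "embedding_map (mtop M) (mtop (open_submfd N A)) f"
    using f by (simp add: smooth_embedding_def embedding_map_def open_submfd_def subtopology_subtopology)
  fix x assume x: "x \<in> points M"
  show "inj_on (differential M (open_submfd N A) f) (tangent M x)"
  proof (rule inj_onI)
    fix v v' assume v: "v \<in> tangent M x" "v' \<in> tangent M x"
      and eq: "differential M (open_submfd N A) f v = differential M (open_submfd N A) f v'"
    have "differential M N f v g = differential M N f v' g" for g
      using fun_cong[OF eq, of g] smooth_fun_open_submfd[OF N, of g] by (auto simp: differential_def)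
    then show "v = v'" using f(1) v x unfolding smooth_embedding_def inj_on_def by blast
  qed
qed

text \<open>The coordinates \<open>\<kappa>\<close> need not belong to the atlas.\<close>

locale cube_coords =
  fixes M :: "'m mfd" and \<kappa> :: "'m \<Rightarrow> nat \<Rightarrow> real" and g :: "(nat \<Rightarrow> real) \<Rightarrow> 'm" and n :: nat and c :: "nat \<Rightarrow> real" and r :: real
  assumes M: "smooth_manifold M" and \<kappa>_smooth: "\<And>i. i < n \<Longrightarrow> (\<lambda>x. \<kappa> x i) \<in> smooth_fun M"
    and \<kappa>_mem: "\<And>x. x \<in> points M \<Longrightarrow> \<kappa> x \<in> cube n c r" and g\<kappa>: "\<And>x. x \<in> points M \<Longrightarrow> g (\<kappa> x) = x"
    and \<kappa>g: "\<And>y. y \<in> cube n c r \<Longrightarrow> \<kappa> (g y) = y"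
    and g_cont: "continuous_map (subtopology (Euclidean_space n) (cube n c r)) (mtop M) g"
    and g_smooth: "\<And>f. f \<in> smooth_fun M \<Longrightarrow> C_infinity n (cube n c r) (\<lambda>y. f (g y))"
begin

lemma smoothI:
  assumes "C_infinity n (cube n c r) h" "\<And>x. x \<in> points M \<Longrightarrow> f x = h (\<kappa> x)"
  shows "f \<in> smooth_fun M"
  by (rule smooth_fun_cong[OF M smooth_fun_compose[where \<kappa>=\<kappa>, OF M openR_cube assms(1) \<kappa>_smooth \<kappa>_mem]]) (auto simp: assms(2))

lemma tangent_eq:
  assumes "v \<in> tangent M x" "v' \<in> tangent M x" "x \<in> points M" "\<And>i. i < n \<Longrightarrow> v (\<lambda>y. \<kappa> y i) = v' (\<lambda>y. \<kappa> y i)"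
  shows "v = v'"
proof (rule tangent_eqI[where \<kappa>=\<kappa> and n=n and c=c and r=r, OF M assms(1-3) \<kappa>_smooth \<kappa>_mem _ assms(4)])
  fix f assume "f \<in> smooth_fun M"
  then show "\<exists>h. C_infinity n (cube n c r) h \<and> (\<forall>y\<in>points M. f y = h (\<kappa> y))"
    using g_smooth g\<kappa> by (intro exI[of _ "\<lambda>y. f (g y)"]) auto
qed

lemma tangent_exists:
  assumes x: "x \<in> points M"
  obtains v where "v \<in> tangent M x" "\<forall>i<n. v (\<lambda>y. \<kappa> y i) = a i"
proof
  let ?v = "\<lambda>f. if f \<in> smooth_fun M then \<Sum>i<n. a i * pd i (\<lambda>z. f (g z)) (\<kappa> x) else 0"
  note \<kappa>x = \<kappa>_mem[OF x]
  show "?v \<in> tangent M x"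
    unfolding tangent_def linear_on_def plus_fun_def scaleR_fun_def
    using smooth_fun_add[OF M] smooth_fun_mult[OF M] smooth_fun_mult[OF M smooth_fun_const[OF M]]
    by (auto simp: partial_add[OF openR_cube g_smooth g_smooth \<kappa>x] partial_mult[OF openR_cube g_smooth g_smooth \<kappa>x]
        partial_cmult[OF openR_cube g_smooth \<kappa>x] g\<kappa>[OF x] distrib_left sum.distrib sum_distrib_left mult_ac)
  show "\<forall>i<n. ?v (\<lambda>y. \<kappa> y i) = a i"
  proof (intro allI impI)
    fix i assume i: "i < n"
    have "pd j (\<lambda>z. \<kappa> (g z) i) (\<kappa> x) = (if i = j then 1 else 0)" if "j < n" for j
    proof -
      have "pd j (\<lambda>z. \<kappa> (g z) i) (\<kappa> x) = pd j (\<lambda>z. z i) (\<kappa> x)"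
        by (rule partial_deriv_cong[OF openR_cube \<kappa>x that]) (simp add: \<kappa>g)
      then show ?thesis by (auto simp: partial_coord)
    qed
    then have "?v (\<lambda>y. \<kappa> y i) = (\<Sum>j<n. (if i = j then 1 else 0) * a j)"
      using \<kappa>_smooth[OF i] by (auto intro!: sum.cong)
    then show "?v (\<lambda>y. \<kappa> y i) = a i" by (simp only: sum_delta_mult[OF i])
  qed
qed

text \<open>Global coordinates trivialise the tangent bundle: a tangent vector is sent to its
  derivatives of the coordinates.\<close>

lemma absolute_parallelism_exists:
  assumes n: "mdim M = n"
  shows "\<exists>\<omega>. absolute_parallelism M (topspace (Euclidean_space (mdim M))) \<omega>"
proof
  let ?\<omega> = "\<lambda>(x :: 'm) v i. if i < n then v (\<lambda>y. \<kappa> y i) else (0 :: real)"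
  have mem: "?\<omega> x v \<in> Rn n" for x v by (simp add: Rn_def)
  show "absolute_parallelism M (topspace (Euclidean_space (mdim M))) ?\<omega>"
    unfolding absolute_parallelism_def topspace_Rn n one_form_def
  proof (intro conjI allI impI ballI)
    show "smooth_map M (vector_mfd (Rn n)) (\<lambda>x. ?\<omega> x (X x))" if X: "vector_field M X" for X
    proof (rule smooth_map_vector_mfdI[OF M finite_dim_Rn mem])
      fix l :: "(nat \<Rightarrow> real) \<Rightarrow> real" assume l: "linear l"
      have "(\<lambda>x. \<Sum>i<n. X x (\<lambda>y. \<kappa> y i) * l (\<lambda>j. if j = i then 1 else 0)) \<in> smooth_fun M"
        using X \<kappa>_smooth by (intro smooth_fun_sum[OF M] smooth_fun_mult[OF M] smooth_fun_const[OF M]) (auto simp: vector_field_def)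
      moreover have "l (?\<omega> x (X x)) = (\<Sum>i<n. X x (\<lambda>y. \<kappa> y i) * l (\<lambda>j. if j = i then 1 else 0))" for x
        by (subst Rn_unit_sum[OF mem]) (simp add: linear_real_sum[OF l])
      ultimately show "(\<lambda>x. l (?\<omega> x (X x))) \<in> smooth_fun M" by simp
    qed
    fix x assume x: "x \<in> points M"
    show "linear_on (tangent M x) (?\<omega> x)" by (auto simp: linear_on_def fun_eq_iff scaleR_fun_apply)
    show "?\<omega> x ` tangent M x \<subseteq> Rn n" using mem by blast
    show "bij_betw (?\<omega> x) (tangent M x) (Rn n)"
    proof (rule bij_betw_imageI)
      show "inj_on (?\<omega> x) (tangent M x)"
        by (rule inj_onI, rule tangent_eq[OF _ _ x]) (auto dest: fun_cong split: if_splits)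
      have "y \<in> ?\<omega> x ` tangent M x" if y: "y \<in> Rn n" for y
      proof -
        obtain v where v: "v \<in> tangent M x" "\<forall>i<n. v (\<lambda>y. \<kappa> y i) = y i" by (rule tangent_exists[OF x])
        have "y = ?\<omega> x v" by (rule Rn_eqI[OF y mem]) (use v in simp)
        then show ?thesis using v by blast
      qed
      then show "?\<omega> x ` tangent M x = Rn n" using mem by blast
    qed
  qed (simp_all add: subspace_Rn dim_Rn)
qed

lemma differential_tangent:
  assumes N: "smooth_manifold N" and f: "\<And>h. h \<in> smooth_fun N \<Longrightarrow> (\<lambda>x. h (f x)) \<in> smooth_fun M" and v: "v \<in> tangent M x"
  shows "differential M N f v \<in> tangent N (f x)"
  unfolding tangent_def differential_def linear_on_def plus_fun_def scaleR_fun_def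
  using smooth_fun_add[OF N] smooth_fun_mult[OF N] smooth_fun_mult[OF N smooth_fun_const[OF N]]
  by (auto simp: tangentD(2,4)[OF v f f] tangentD(3)[OF v f])

end

text \<open>In the given coordinates f is the projection onto the first m of them, so a tangent
  vector downstairs lifts by prescribing its coordinate values.\<close>

lemma submersion_coords:
  assumes M: "cube_coords M \<kappa> g n c r" and N: "cube_coords N \<kappa>' g' m c r" and f: "smooth_map M N f"
    and mn: "m \<le> n" and f\<kappa>: "\<And>x i. x \<in> points M \<Longrightarrow> i < m \<Longrightarrow> \<kappa>' (f x) i = \<kappa> x i"
  shows "submersion M N f"
  unfolding submersion_def
proof (intro conjI f ballI)
  interpret M: cube_coords M \<kappa> g n c r by (rule M)
  interpret N: cube_coords N \<kappa>' g' m c r by (rule N)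
  have fN: "f x \<in> points N" if "x \<in> points M" for x using f that by (auto simp: smooth_map_def continuous_map_def)
  have fs: "(\<lambda>x. h (f x)) \<in> smooth_fun M" if h: "h \<in> smooth_fun N" for h
  proof (rule smooth_fun_cong[OF M.M])
    show "(\<lambda>x. h (g' (\<kappa>' (f x)))) \<in> smooth_fun M"
    proof (rule smooth_fun_compose[OF M.M openR_cube N.g_smooth[OF h]])
      show "(\<lambda>x. \<kappa>' (f x) i) \<in> smooth_fun M" if "i < m" for i
        by (rule smooth_fun_cong[OF M.M M.\<kappa>_smooth[of i]]) (use that mn f\<kappa> in auto)
    qed (simp add: N.\<kappa>_mem fN)
  qed (simp add: N.g\<kappa> fN)
  fix x assume x: "x \<in> points M"
  have "u \<in> differential M N f ` tangent M x" if u: "u \<in> tangent N (f x)" for u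
  proof -
    obtain v where v: "v \<in> tangent M x" "\<forall>i<n. v (\<lambda>y. \<kappa> y i) = u (\<lambda>y. \<kappa>' y i)" by (rule M.tangent_exists[OF x])
    have "differential M N f v = u"
    proof (rule N.tangent_eq[OF M.differential_tangent[where f=f, OF N.M fs v(1)] u fN[OF x]])
      fix i assume i: "i < m"
      have "v (\<lambda>y. \<kappa>' (f y) i) = v (\<lambda>y. \<kappa> y i)"
        by (rule tangent_cong[OF M.M v(1) x fs[OF N.\<kappa>_smooth[OF i]] f\<kappa>[OF _ i]])
      then show "differential M N f v (\<lambda>y. \<kappa>' y i) = u (\<lambda>y. \<kappa>' y i)"
        using v(2) i mn N.\<kappa>_smooth[OF i] by (simp add: differential_def)
    qed
    then show ?thesis using v by blast
  qed
  then show "differential M N f ` tangent M x = tangent N (f x)" using M.differential_tangent[where f=f, OF N.M fs] by blast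
qed

lemma atlas_open_submfd:
  assumes "(U, \<phi>) \<in> atlas M" "A \<subseteq> U" shows "(A, \<phi>) \<in> atlas (open_submfd M A)"
proof -
  have "(A, \<phi>) = (case (U, \<phi>) of (U, \<phi>) \<Rightarrow> (U \<inter> A, \<phi>))" using assms(2) by (simp add: Int_absorb1)
  then have "(A, \<phi>) \<in> (\<lambda>(U, \<phi>). (U \<inter> A, \<phi>)) ` atlas M" using assms(1) by (rule image_eqI)
  then show ?thesis by (simp add: open_submfd_def)
qed

lemma chart_coordinate_smooth:
  assumes M: "smooth_manifold M" and c: "(points M, \<kappa>) \<in> atlas M" and i: "i < mdim M"
  shows "(\<lambda>x. \<kappa> x i) \<in> smooth_fun M"
  unfolding smooth_fun_iff
proof (intro allI impI)
  fix U \<phi> assume U: "(U, \<phi>) \<in> atlas M"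
  then have "U \<inter> points M = U" using chartD(3)[OF M] by blast
  then show "C_infinity (mdim M) (\<phi> ` U) (\<lambda>z. \<kappa> (inv_into U \<phi> z) i)" using chart_transition[OF M U c i] by simp
qed

lemma chart_inverse_continuous:
  assumes M: "smooth_manifold M" and c: "(U, \<phi>) \<in> atlas M"
  shows "continuous_map (subtopology (Euclidean_space (mdim M)) (\<phi> ` U)) (mtop M) (inv_into U \<phi>)"
proof -
  note ch = chartD[OF M c]
  obtain g where g: "homeomorphic_maps (subtopology (mtop M) U) (subtopology (Euclidean_space (mdim M)) (\<phi> ` U)) \<phi> g"
    using ch(5) homeomorphic_map_maps by blast
  have "continuous_map (subtopology (Euclidean_space (mdim M)) (\<phi> ` U)) (mtop M) g"
    using g by (simp add: homeomorphic_maps_def continuous_map_in_subtopology)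
  then show ?thesis
    by (rule continuous_map_eq) (use g ch(3,4) in \<open>auto simp: homeomorphic_maps_def\<close>)
qed

lemma cube_coords_chart:
  assumes M: "smooth_manifold M" and c: "(points M, \<kappa>) \<in> atlas M" and im: "\<kappa> ` points M = cube (mdim M) c r"
  shows "cube_coords M \<kappa> (inv_into (points M) \<kappa>) (mdim M) c r"
proof
  note ch = chartD[OF M c]
  let ?g = "inv_into (points M) \<kappa>"
  show "(\<lambda>x. \<kappa> x i) \<in> smooth_fun M" if "i < mdim M" for i by (rule chart_coordinate_smooth[OF M c that])
  show "\<kappa> x \<in> cube (mdim M) c r" "?g (\<kappa> x) = x" if "x \<in> points M" for x using that im ch(4) by auto
  show "\<kappa> (?g y) = y" if "y \<in> cube (mdim M) c r" for y using that by (auto simp: f_inv_into_f simp flip: im)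
  show "continuous_map (subtopology (Euclidean_space (mdim M)) (cube (mdim M) c r)) (mtop M) ?g"
    using chart_inverse_continuous[OF M c] by (simp only: im)
  show "C_infinity (mdim M) (cube (mdim M) c r) (\<lambda>y. f (?g y))" if "f \<in> smooth_fun M" for f
    using smooth_funD[OF that c] im by simp
qed (rule M)

section \<open>Parametrised submanifolds of a vector space\<close>

text \<open>A parametrised piece of V whose parameters are recovered by ambient linear functionals.
  This left inverse makes the image embedded and supplies its chart.\<close>

locale cube_section =
  fixes V :: "'v::real_vector set" and E :: "(nat \<Rightarrow> real) \<Rightarrow> 'v" and \<Lambda> :: "nat \<Rightarrow> 'v \<Rightarrow> real" and n :: nat and c :: "nat \<Rightarrow> real" and r :: real
  assumes V: "finite_dim V" and E_mem: "\<And>y. y \<in> cube n c r \<Longrightarrow> E y \<in> V"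
    and E_smooth: "\<And>l. linear l \<Longrightarrow> C_infinity n (cube n c r) (\<lambda>y. l (E y))"
    and \<Lambda>: "\<And>i. linear (\<Lambda> i)" and \<Lambda>E: "\<And>y i. y \<in> cube n c r \<Longrightarrow> i < n \<Longrightarrow> \<Lambda> i (E y) = y i"
begin

abbreviation "Q \<equiv> cube n c r"

definition L :: "'v \<Rightarrow> nat \<Rightarrow> real"
  where "L v = (\<lambda>i. if i < n then \<Lambda> i v else 0)"

lemma LE: "y \<in> Q \<Longrightarrow> L (E y) = y"
  by (rule Rn_eqI[where n=n]) (auto simp: Rn_def cube_def \<Lambda>E L_def)

lemma topspace_Q: "topspace (subtopology (Euclidean_space n) Q) = Q"
  using cube_subset_Rn by (auto simp: topspace_Rn)

lemma E_continuous: "continuous_map (subtopology (Euclidean_space n) Q) (mtop (vector_mfd V)) E"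
proof (rule continuous_map_vector_mfdI[OF V])
  show "E y \<in> V" if "y \<in> topspace (subtopology (Euclidean_space n) Q)" for y using that E_mem unfolding topspace_Q by blast
  show "continuous_map (subtopology (Euclidean_space n) Q) euclideanreal (\<lambda>y. l (E y))" if "linear l" for l
    using E_smooth[OF that] C_times.simps(1) unfolding C_infinity_def by blast
qed

lemma L_continuous: "continuous_map (subtopology (mtop (vector_mfd V)) (E ` Q)) (subtopology (Euclidean_space n) Q) L"
proof -
  have "continuous_map (mtop (vector_mfd V)) euclideanreal (\<Lambda> i)" for i
    by (rule smooth_fun_continuous[OF smooth_manifold_vector_mfd[OF V] linear_functional_smooth[OF V \<Lambda>]])
  then have "continuous_map (mtop (vector_mfd V)) (Euclidean_space n) L"
    unfolding L_def by (simp add: continuous_map_componentwise_Euclidean_space)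
  then show ?thesis
    using LE by (auto simp: continuous_map_in_subtopology continuous_map_from_subtopology)
qed

text \<open>The inverse of f is g after L, continuous for the topology induced by V. Its
  differential is injective because the functionals \<Lambda> pull back to the coordinates
  \<kappa>.\<close>

lemma embedding:
  assumes M: "cube_coords M \<kappa> g n c r" and f: "\<And>x. x \<in> points M \<Longrightarrow> f x = E (\<kappa> x)"
  shows "smooth_embedding M (vector_mfd V) f"
  unfolding smooth_embedding_def
proof (intro conjI ballI)
  interpret M: cube_coords M \<kappa> g n c r by (rule M)
  note MV = points_vector_mfd[OF V]
  have fV: "f x \<in> V" if "x \<in> points M" for x using f E_mem M.\<kappa>_mem that by simp
  show sm: "smooth_map M (vector_mfd V) f"
  proof (rule smooth_map_vector_mfdI[OF M.M V fV])
    fix l :: "'v \<Rightarrow> real" assume l: "linear l"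
    show "(\<lambda>x. l (f x)) \<in> smooth_fun M" by (rule M.smoothI[OF E_smooth[OF l]]) (simp add: f)
  qed
  have im: "f ` points M \<subseteq> E ` Q" using f M.\<kappa>_mem by auto
  have Lf: "L (f x) = \<kappa> x" if "x \<in> points M" for x unfolding f[OF that] by (rule LE[OF M.\<kappa>_mem[OF that]])
  have "continuous_map (subtopology (mtop (vector_mfd V)) (E ` Q)) (mtop M) (g \<circ> L)"
    by (rule continuous_map_compose[OF L_continuous M.g_cont])
  then have 1: "continuous_map (subtopology (mtop (vector_mfd V)) (f ` points M)) (mtop M) (g \<circ> L)"
    using continuous_map_from_subtopology_mono[OF _ im] by blast
  have "homeomorphic_maps (mtop M) (subtopology (mtop (vector_mfd V)) (f ` points M)) f (g \<circ> L)"
    unfolding homeomorphic_maps_def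
  proof (intro conjI 1 ballI)
    show "continuous_map (mtop M) (subtopology (mtop (vector_mfd V)) (f ` points M)) f"
      using sm by (auto simp: smooth_map_def continuous_map_in_subtopology)
    show *: "(g \<circ> L) (f x) = x" if "x \<in> points M" for x using Lf M.g\<kappa> that by simp
    show "f ((g \<circ> L) y) = y" if "y \<in> topspace (subtopology (mtop (vector_mfd V)) (f ` points M))" for y
      using that * by auto
  qed
  then show "embedding_map (mtop M) (mtop (vector_mfd V)) f"
    unfolding embedding_map_def homeomorphic_map_maps by blast
  fix x assume x: "x \<in> points M"
  show "inj_on (differential M (vector_mfd V) f) (tangent M x)"
  proof (rule inj_onI)
    fix v v' assume v: "v \<in> tangent M x" "v' \<in> tangent M x"
      and eq: "differential M (vector_mfd V) f v = differential M (vector_mfd V) f v'"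
    show "v = v'"
    proof (rule M.tangent_eq[OF v x])
      fix i assume i: "i < n"
      have \<kappa>i: "\<kappa> y i = \<Lambda> i (f y)" if "y \<in> points M" for y using fun_cong[OF Lf[OF that], of i] i by (simp add: L_def)
      have "v (\<lambda>y. \<Lambda> i (f y)) = v' (\<lambda>y. \<Lambda> i (f y))"
        using fun_cong[OF eq, of "\<Lambda> i"] linear_functional_smooth[OF V \<Lambda>] by (simp add: differential_def)
      then show "v (\<lambda>y. \<kappa> y i) = v' (\<lambda>y. \<kappa> y i)"
        using tangent_cong[OF M.M v(1) x M.\<kappa>_smooth[OF i] \<kappa>i] tangent_cong[OF M.M v(2) x M.\<kappa>_smooth[OF i] \<kappa>i] by simp
    qed
  qed
qed

definition image_mfd :: "'v mfd"
  where "image_mfd = \<lparr>mtop = subtopology (mtop (vector_mfd V)) (E ` Q), mdim = n, atlas = {(E ` Q, L)}\<rparr>"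

lemma points_image_mfd: "points image_mfd = E ` Q"
  using E_mem points_vector_mfd[OF V] by (auto simp: image_mfd_def)

lemma L_image: "L ` E ` Q = Q"
  by (simp add: image_image LE cong: image_cong_simp)

lemma smooth_manifold_image_mfd: "smooth_manifold image_mfd"
proof -
  have inv: "inv_into (E ` Q) L y = E y" if "y \<in> Q" for y
    by (rule inv_into_f_eq) (use LE that in \<open>auto simp: inj_on_def\<close>)
  have "homeomorphic_maps (subtopology (mtop (vector_mfd V)) (E ` Q)) (subtopology (Euclidean_space n) Q) L E"
    unfolding homeomorphic_maps_def
  proof (intro conjI L_continuous ballI)
    show "continuous_map (subtopology (Euclidean_space n) Q) (subtopology (mtop (vector_mfd V)) (E ` Q)) E"
      using E_continuous topspace_Q by (auto simp: continuous_map_in_subtopology)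
    show "E (L v) = v" if "v \<in> topspace (subtopology (mtop (vector_mfd V)) (E ` Q))" for v
      using that LE by auto
    show "L (E y) = y" if "y \<in> topspace (subtopology (Euclidean_space n) Q)" for y using that LE unfolding topspace_Q by blast
  qed
  then have "homeomorphic_map (subtopology (mtop (vector_mfd V)) (E ` Q)) (subtopology (Euclidean_space n) Q) L"
    using homeomorphic_map_maps by blast
  moreover have "C_infinity n Q (\<lambda>z. L (inv_into (E ` Q) L z) i)" if "i < n" for i
    by (rule smooth_cong[OF openR_cube smooth_coord[OF openR_cube, of n c r i]]) (use that inv \<Lambda>E in \<open>simp add: L_def\<close>)
  moreover have "openin (subtopology (mtop (vector_mfd V)) (E ` Q)) (E ` Q)"
    using E_mem points_vector_mfd[OF V] openin_topspace[of "subtopology (mtop (vector_mfd V)) (E ` Q)"] by (simp add: Int_absorb1 image_subset_iff)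
  ultimately show ?thesis
    using smooth_manifold_vector_mfd[OF V] L_image openR_cube[of n c r] points_image_mfd
    unfolding smooth_manifold_def
    by (auto simp: image_mfd_def Hausdorff_space_subtopology second_countable_subtopology subtopology_subtopology)
qed

lemma cube_coords_image_mfd: "cube_coords image_mfd L (inv_into (E ` Q) L) n c r"
  using cube_coords_chart[OF smooth_manifold_image_mfd, of L c r] points_image_mfd L_image
  by (simp add: image_mfd_def)

lemma submanifold_image_mfd: "submanifold image_mfd (vector_mfd V)"
  unfolding submanifold_def points_image_mfd points_vector_mfd[OF V]
proof (intro conjI smooth_manifold_image_mfd embedding[OF cube_coords_image_mfd])
  show "E ` Q \<subseteq> V" using E_mem by blast
  show "v = E (L v)" if "v \<in> points image_mfd" for v
    using that LE by (auto simp: points_image_mfd)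
qed

end

text \<open>The first coordinates of the section factor through \<open>rho k\<close>. Hence in the
  chart \<chi>' the projected image is a cube, so it is open, and the projection is the coordinate
  projection between cubes.\<close>

lemma local_diff_eq_section:
  fixes E :: "(nat \<Rightarrow> real) \<Rightarrow> ('a::real_vector, 'b::real_vector) graded"
  assumes fa: "\<exists>B :: 'a set. finite B \<and> span B = UNIV" and fb: "\<exists>B :: 'b set. finite B \<and> span B = UNIV"
    and k: "k \<ge> 1" and r: "r > 0" and sec: "cube_section (WW k) E \<Lambda> n c r"
    and m: "dim (WW (k - 1) :: ('a, 'b) graded set) \<le> n" and ch: "\<chi>' \<in> linear_charts (WW (k - 1))"
    and \<Lambda>\<chi>: "\<And>i v. i < dim (WW (k - 1) :: ('a, 'b) graded set) \<Longrightarrow> \<Lambda> i v = \<chi>' (rho k v) i"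
  shows "local_diff_eq k (E ` cube n c r)"
proof -
  interpret cube_section "WW k" E \<Lambda> n c r by (rule sec)
  let ?m = "dim (WW (k - 1) :: ('a, 'b) graded set)" and ?V' = "WW (k - 1) :: ('a, 'b) graded set"
  have V': "finite_dim ?V'" by (rule finite_dim_WW[OF fa fb])
  define U where "U = rho k ` E ` Q"
  have UV: "U \<subseteq> ?V'" unfolding U_def using rho_WW[OF k E_mem] by blast
  have \<chi>R: "\<chi>' v \<in> Rn ?m" if "v \<in> ?V'" for v using ch that by (auto simp: linear_charts_def bij_betw_def topspace_Rn)
  have \<chi>E: "\<chi>' (rho k (E y)) i = y i" if "y \<in> Q" "i < ?m" for y i using \<Lambda>\<chi>[of i "E y"] \<Lambda>E[of y i] that m by simp
  have im: "\<chi>' ` U = cube ?m c r"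
  proof
    have "\<chi>' (rho k (E y)) \<in> cube ?m c r" if y: "y \<in> Q" for y
      using \<chi>R[OF rho_WW[OF k E_mem[OF y]]] \<chi>E[OF y] y m by (simp add: cube_def)
    then show "\<chi>' ` U \<subseteq> cube ?m c r" unfolding U_def by blast
    show "cube ?m c r \<subseteq> \<chi>' ` U"
    proof
      fix y assume y: "y \<in> cube ?m c r"
      \<comment> \<open>A preimage of y under the projection of cubes: the missing coordinates are
        put at the centre.\<close>
      define y' where "y' i = (if i < ?m then y i else if i < n then c i else 0)" for i
      have y': "y' \<in> Q" using y r m by (auto simp: cube_def Rn_def y'_def)
      have yR: "y \<in> Rn ?m" using y by (simp add: cube_def)
      have "y = \<chi>' (rho k (E y'))"
        by (rule Rn_eqI[OF yR \<chi>R[OF rho_WW[OF k E_mem[OF y']]]]) (simp add: \<chi>E[OF y'] y'_def)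
      then show "y \<in> \<chi>' ` U" using y' by (auto simp: U_def)
    qed
  qed
  have Uo: "openin (mtop (vector_mfd ?V')) U"
    using openin_vector_mfd_chart[OF V' ch] UV im openR_cube by metis
  define A where "A = {w \<in> WW k. rho k w \<in> U}"
  have rho_lin: "linear (\<lambda>v :: ('a, 'b) graded. l (rho k v))" if "linear l" for l :: "('a, 'b) graded \<Rightarrow> real"
    using linear_compose[OF linear_rho that] by (simp add: o_def)
  have "continuous_map (mtop (vector_mfd (WW k))) (mtop (vector_mfd ?V')) (rho k)"
  proof (rule continuous_map_vector_mfdI[OF V'])
    show "rho k v \<in> ?V'" if "v \<in> points (vector_mfd (WW k))" for v using rho_WW[OF k] that points_vector_mfd[OF V] by blast
    show "continuous_map (mtop (vector_mfd (WW k))) euclideanreal (\<lambda>v. l (rho k v))" if "linear l" for l :: "('a, 'b) graded \<Rightarrow> real"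
      by (rule smooth_fun_continuous[OF smooth_manifold_vector_mfd[OF V] linear_functional_smooth[OF V rho_lin[OF that]]])
  qed
  from openin_continuous_map_preimage[OF this Uo] have Ao: "openin (mtop (vector_mfd (WW k))) A"
    by (simp add: A_def points_vector_mfd[OF V])
  have QA: "E ` Q \<subseteq> A" using E_mem by (auto simp: A_def U_def)
  note VM = smooth_manifold_vector_mfd[OF V] and VM' = smooth_manifold_vector_mfd[OF V']
  note UM = smooth_manifold_open_submfd[OF VM' Uo]
  have cU: "cube_coords (open_submfd (vector_mfd ?V') U) \<chi>' (inv_into U \<chi>') ?m c r"
  proof -
    have "(U, \<chi>') \<in> atlas (open_submfd (vector_mfd ?V') U)"
      by (rule atlas_open_submfd[OF _ UV]) (use ch in simp)
    then show ?thesis using cube_coords_chart[OF UM(1), of \<chi>' c r] im unfolding UM(2) by (simp add: open_submfd_def)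
  qed
  have sm: "smooth_map image_mfd (open_submfd (vector_mfd ?V') U) (rho k)"
  proof (rule smooth_map_open_submfd[OF smooth_manifold_image_mfd smooth_map_vector_mfdI[OF smooth_manifold_image_mfd V']])
    show "rho k v \<in> ?V'" if "v \<in> points image_mfd" for v using that UV by (auto simp: points_image_mfd U_def)
    show "(\<lambda>v. l (rho k v)) \<in> smooth_fun image_mfd" if "linear l" for l :: "('a, 'b) graded \<Rightarrow> real"
      using submanifold_image_mfd smooth_map_vector_mfdD(2)[OF smooth_manifold_image_mfd V _ rho_lin[OF that]]
      by (auto simp: submanifold_def smooth_embedding_def)
    show "rho k ` points image_mfd \<subseteq> U" by (simp add: points_image_mfd U_def)
  qed
  have sub: "submersion image_mfd (open_submfd (vector_mfd ?V') U) (rho k)"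
    by (rule submersion_coords[OF cube_coords_image_mfd cU sm m]) (use \<Lambda>\<chi> m in \<open>simp add: L_def\<close>)
  have "submanifold image_mfd (open_submfd (vector_mfd (WW k)) A)"
    using submanifold_image_mfd smooth_manifold_open_submfd[OF VM Ao] QA
      smooth_embedding_open_submfd[OF smooth_manifold_image_mfd VM Ao, of "\<lambda>x. x"]
    by (auto simp: submanifold_def points_image_mfd)
  moreover have "\<exists>\<omega>. absolute_parallelism image_mfd (topspace (Euclidean_space (mdim image_mfd))) \<omega>"
    by (rule cube_coords.absolute_parallelism_exists[OF cube_coords_image_mfd]) (simp add: image_mfd_def)
  ultimately show ?thesis
    unfolding local_diff_eq_def using k points_image_mfd submanifold_image_mfd Uo sub by (auto simp: U_def A_def intro!: exI[of _ image_mfd] exI[of _ U])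
qed

section \<open>Transfer from the chart to the manifold and conclusion\<close>

lemma smooth_preimage_open:
  assumes S: "openR n S" and Q: "openR m Q" and \<kappa>: "\<And>j. j < m \<Longrightarrow> C_infinity n S (\<lambda>x. \<kappa> x j)" "\<And>x. x \<in> S \<Longrightarrow> \<kappa> x \<in> Rn m"
  shows "openR n {x \<in> S. \<kappa> x \<in> Q}"
  unfolding openR_iff
proof (intro conjI ballI)
  show "{x \<in> S. \<kappa> x \<in> Q} \<subseteq> Rn n" using openR_subset[OF S] by blast
  fix x assume "x \<in> {x \<in> S. \<kappa> x \<in> Q}"
  then have x: "x \<in> S" "\<kappa> x \<in> Q" by auto
  obtain e where e: "e > 0" "cube m (\<kappa> x) e \<subseteq> Q" by (rule openR_cubeE[OF Q x(2)])
  obtain d where d: "d > 0" "cube n x d \<subseteq> S" "\<forall>y\<in>cube n x d. \<forall>j<m. \<bar>\<kappa> y j - \<kappa> x j\<bar> < e"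
    by (rule smooth_cube_nbhd[where g=\<kappa>, OF S x(1) e(1) \<kappa>(1)])
  have "y \<in> S \<and> \<kappa> y \<in> Q" if y: "y \<in> cube n x d" for y
  proof -
    have yS: "y \<in> S" using y d(2) by blast
    then have "\<kappa> y \<in> cube m (\<kappa> x) e" using d(3) y \<kappa>(2) by (auto simp: cube_def)
    then show ?thesis using yS e(2) by blast
  qed
  then show "\<exists>r>0. cube n x r \<subseteq> {x \<in> S. \<kappa> x \<in> Q}" using d(1) by blast
qed

text \<open>A diffeomorphism of part of a chart image onto a cube makes the corresponding open part
  of M a manifold with cubic coordinates, without enlarging the atlas.\<close>

lemma chart_reparametrisation:
  assumes M: "smooth_manifold M" and ch: "(U, \<phi>) \<in> atlas M" and Z: "openR (mdim M) Z" "Z \<subseteq> \<phi> ` U"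
    and \<kappa>: "\<And>i. i < mdim M \<Longrightarrow> C_infinity (mdim M) Z (\<lambda>z. \<kappa> z i)" "\<And>z. z \<in> Z \<Longrightarrow> \<kappa> z \<in> cube (mdim M) c r"
    and g: "\<And>i. i < mdim M \<Longrightarrow> C_infinity (mdim M) (cube (mdim M) c r) (\<lambda>y. g y i)" "\<And>y. y \<in> cube (mdim M) c r \<Longrightarrow> g y \<in> Z"
    and g\<kappa>: "\<And>z. z \<in> Z \<Longrightarrow> g (\<kappa> z) = z" and \<kappa>g: "\<And>y. y \<in> cube (mdim M) c r \<Longrightarrow> \<kappa> (g y) = y"
  shows "openin (mtop M) {x \<in> U. \<phi> x \<in> Z}"
    "cube_coords (open_submfd M {x \<in> U. \<phi> x \<in> Z}) (\<lambda>x. \<kappa> (\<phi> x)) (\<lambda>y. inv_into U \<phi> (g y)) (mdim M) c r"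
proof -
  note c = chartD[OF M ch]
  let ?N = "mdim M" and ?Q = "cube (mdim M) c r" and ?p = "inv_into U \<phi>"
  define A where "A = {x \<in> U. \<phi> x \<in> Z}"
  obtain h where h: "homeomorphic_maps (subtopology (mtop M) U) (subtopology (Euclidean_space ?N) (\<phi> ` U)) \<phi> h"
    using c(5) homeomorphic_map_maps by blast
  have tU: "topspace (subtopology (mtop M) U) = U" using c(3) by auto
  have "openin (subtopology (mtop M) U) {x \<in> topspace (subtopology (mtop M) U). \<phi> x \<in> Z}"
    by (rule openin_continuous_map_preimage[OF _ Z(1)]) (use h in \<open>simp add: homeomorphic_maps_def continuous_map_in_subtopology\<close>)
  then have Ao: "openin (mtop M) A"
    unfolding tU A_def using c(1) openin_open_subtopology by blast
  then show "openin (mtop M) {x \<in> U. \<phi> x \<in> Z}" by (simp only: A_def)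
  note A = smooth_manifold_open_submfd[OF M Ao]
  have dA: "mdim (open_submfd M A) = ?N" by (simp add: open_submfd_def)
  have AU: "A \<subseteq> U" by (auto simp: A_def)
  have \<phi>A: "\<phi> ` A = Z" using Z(2) by (auto simp: A_def)
  have cA: "(A, \<phi>) \<in> atlas (open_submfd M A)" by (rule atlas_open_submfd[OF ch AU])
  have p\<phi>: "?p (\<phi> x) = x" if "x \<in> U" for x using c(4) that by simp
  have \<phi>p: "\<phi> (?p z) = z" "?p z \<in> A" if "z \<in> Z" for z
  proof -
    have "z \<in> \<phi> ` U" using that Z(2) by blast
    then show "\<phi> (?p z) = z" "?p z \<in> A" using that by (auto simp: A_def f_inv_into_f inv_into_into)
  qed
  have "cube_coords (open_submfd M A) (\<lambda>x. \<kappa> (\<phi> x)) (\<lambda>y. ?p (g y)) ?N c r"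
  proof
    show "(\<lambda>x. \<kappa> (\<phi> x) i) \<in> smooth_fun (open_submfd M A)" if i: "i < ?N" for i
    proof (rule smooth_fun_compose[OF A(1) Z(1) \<kappa>(1)[OF i]])
      show "(\<lambda>x. \<phi> x j) \<in> smooth_fun (open_submfd M A)" if "j < ?N" for j
        by (rule chart_coordinate_smooth[OF A(1)]) (use cA that A(2) dA in auto)
    qed (use A(2) in \<open>auto simp: A_def\<close>)
    show "\<kappa> (\<phi> x) \<in> ?Q" "?p (g (\<kappa> (\<phi> x))) = x" if "x \<in> points (open_submfd M A)" for x
      using that \<kappa>(2) g\<kappa> p\<phi> unfolding A(2) by (auto simp: A_def)
    show "\<kappa> (\<phi> (?p (g y))) = y" if "y \<in> ?Q" for y using \<phi>p(1)[OF g(2)[OF that]] \<kappa>g[OF that] by simp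
    have Qs: "?Q \<subseteq> Rn ?N" by (rule cube_subset_Rn)
    have gR: "g y \<in> Rn ?N" if "y \<in> ?Q" for y using g(2)[OF that] openR_subset[OF Z(1)] by blast
    have "continuous_map (subtopology (Euclidean_space ?N) ?Q) (Euclidean_space ?N) (\<lambda>y i. if i < ?N then g y i else 0)"
      using g(1) C_times.simps(1) unfolding C_infinity_def continuous_map_componentwise_Euclidean_space by blast
    then have "continuous_map (subtopology (Euclidean_space ?N) ?Q) (Euclidean_space ?N) g"
    proof (rule continuous_map_eq)
      fix y assume "y \<in> topspace (subtopology (Euclidean_space ?N) ?Q)"
      then show "(\<lambda>i. if i < ?N then g y i else 0) = g y" using gR[of y] by (auto simp: Rn_def)
    qed
    then have 1: "continuous_map (subtopology (Euclidean_space ?N) ?Q) (subtopology (Euclidean_space ?N) (\<phi> ` U)) g"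
      using g(2) Z(2) by (auto simp: continuous_map_in_subtopology)
    have "continuous_map (subtopology (Euclidean_space ?N) ?Q) (mtop M) (?p \<circ> g)"
      by (rule continuous_map_compose[OF 1 chart_inverse_continuous[OF M ch]])
    then show "continuous_map (subtopology (Euclidean_space ?N) ?Q) (mtop (open_submfd M A)) (\<lambda>y. ?p (g y))"
      using \<phi>p(2) g(2) by (auto simp: open_submfd_def continuous_map_in_subtopology o_def)
    show "C_infinity ?N ?Q (\<lambda>y. f (?p (g y)))" if f: "f \<in> smooth_fun (open_submfd M A)" for f
    proof -
      have "C_infinity ?N Z (\<lambda>z. f (inv_into A \<phi> z))" using smooth_funD[OF f cA] by (simp add: \<phi>A dA)
      then have "C_infinity ?N Z (\<lambda>z. f (?p z))"
      proof (rule smooth_cong[OF Z(1)])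
        fix z assume z: "z \<in> Z"
        have "inv_into A \<phi> z = ?p z" using \<phi>p[OF z] by (intro inv_into_f_eq inj_on_subset[OF c(4) AU]) auto
        then show "f (inv_into A \<phi> z) = f (?p z)" by simp
      qed
      then show ?thesis by (rule smooth_compose[where g=g, OF Z(1) openR_cube _ g])
    qed
  qed (rule A(1))
  then show "cube_coords (open_submfd M {x \<in> U. \<phi> x \<in> Z}) (\<lambda>x. \<kappa> (\<phi> x)) (\<lambda>y. ?p (g y)) ?N c r" by (simp only: A_def)
qed

theorem theorem4p1:
  fixes k :: nat
    and Vk0 :: "('a::real_vector, 'b::real_vector) tensor set"
    and R :: "'m mfd"
    and \<omega> :: "('m, ('a, 'b) graded) form1"
    and T :: "'m \<Rightarrow> 'a \<Rightarrow> ('a, 'b) tensor \<Rightarrow> ('a, 'b) tensor"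
  assumes "k \<ge> 1"
    and "\<exists>B :: 'a set. finite B \<and> span B = UNIV"
    and "\<exists>B :: 'b set. finite B \<and> span B = UNIV"
    and "subspace Vk0" and "Vk0 \<subseteq> VV k"
    and "smooth_manifold R" and "mdim R = dim (WW0 k Vk0)"
    and "absolute_parallelism R (WW0 k Vk0) \<omega>"
    and "smooth_map R (vector_mfd (Bilinear_maps Vk0 (VV (k - 1)))) T"
    and C1: "\<And>x X. x \<in> points R \<Longrightarrow> X \<in> Vk0 \<Longrightarrow> (\<forall>u. T x u X = 0) \<Longrightarrow> X = 0"
    and C2_i: "structure_congruence R (scalar_components (form_m1 \<omega>)) {} (form_m1 \<omega>) (\<lambda>X Y x. 0)"
    and C2_ii: "\<And>p. p + 2 \<le> k \<Longrightarrow>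
      structure_congruence R (lower_components p \<omega>) {} (form_p p \<omega>)
        (wedge_by (\<lambda>x. bracket_m1 p) (form_m1 \<omega>) (form_p (p + 1) \<omega>))"
    and C2_iii: "structure_congruence R (lower_components (k - 1) \<omega>) (wedge_m1_m1 \<omega>)
        (form_p (k - 1) \<omega>) (wedge_by T (form_m1 \<omega>) (form_p k \<omega>))"
  shows "\<forall>x\<in>points R. \<exists>N f. openin (mtop R) N \<and> x \<in> N \<and>
    smooth_embedding (open_submfd R N) (vector_mfd (WW k :: ('a, 'b) graded set)) f \<and>
    local_diff_eq k (f ` N)"
proof
  fix x0 assume x0: "x0 \<in> points R"
  note k = assms(1) and fa = assms(2) and fb = assms(3) and V0 = assms(4,5) and R = assms(6)
  have fW: "finite_dim (WW0 k Vk0)"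
    by (rule finite_dim_mono[OF finite_dim_WW[OF fa fb, of k] subspace_WW0[OF V0(1)]]) (auto simp: WW0_def)
  obtain U \<phi> where ch0: "(U, \<phi>) \<in> atlas R" "x0 \<in> U" using chart_exists[OF R x0] by blast
  obtain e where e: "e > 0" "cube (mdim R) (\<phi> x0) e \<subseteq> \<phi> ` U"
    by (rule openR_cubeE[OF chartD(2)[OF R ch0(1)] imageI[OF ch0(2)]])
  \<comment> \<open>A quarter of e, since the chart must contain the cube of four times the
    radius.\<close>
  interpret coframe_chart R "WW0 k Vk0" \<omega> U \<phi> x0 "e / 4"
    using R assms(8) fW ch0 e by unfold_locales auto
  \<comment> \<open>Open sets of \<open>vector_mfd V\<close> are subsets of V by definition, so the
    values of T lie in the space of bilinear maps.\<close>
  have TB: "T x \<in> Bilinear_maps Vk0 (VV (k - 1))" if "x \<in> points R" for x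
  proof -
    have "T x \<in> points (vector_mfd (Bilinear_maps Vk0 (VV (k - 1))))"
      using assms(9) that by (auto simp: smooth_map_def continuous_map_def)
    then show ?thesis using openin_topspace[of "mtop (vector_mfd (Bilinear_maps Vk0 (VV (k - 1))))"]
      unfolding openin_vector_mfd by blast
  qed
  have T0: "T (p z) 0 X = 0" if "z \<in> S" "X \<in> Vk0" for z X
  proof -
    have "linear (\<lambda>u. T (p z) u X)" using TB[OF p_points[OF that(1)]] that(2) by (auto simp: Bilinear_maps_def)
    then show ?thesis by (rule linear_0)
  qed
  have TV: "T (p z0) u X \<in> VV (k - 1)" if "X \<in> Vk0" for u X
    using TB[OF p_points[OF z0S]] that by (auto simp: Bilinear_maps_def)
  have Tinj: "X = 0" if "X \<in> Vk0" "\<forall>u. T (p z0) u X = 0" for X by (rule C1[OF p_points[OF z0S] that])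
  have S1: "dform N (\<lambda>i z. l (fst (w i z))) z \<xi> \<eta> = 0"
    if l: "linear l" and z: "z \<in> S" and 0: "fst (comb N w z \<xi>) = 0" "fst (comb N w z \<eta>) = 0" for l z \<xi> \<eta>
  proof -
    have "dform N (\<lambda>i z. l (fst (w i z))) z \<xi> \<eta> + l 0 = 0"
    proof (rule structure_at[OF C2_i[unfolded form_m1_def] linear_fst z _ _ l])
      show "\<alpha> (p z) (Xf \<xi> (p z)) = 0 \<and> \<alpha> (p z) (Xf \<eta> (p z)) = 0" if "\<alpha> \<in> scalar_components (\<lambda>x v. fst (\<omega> x v))" for \<alpha>
        using that 0 linear_0 by (auto simp: scalar_components_def \<omega>_Xf[OF z])
    qed simp
    then show ?thesis by (simp add: linear_0[OF l])
  qed
  have low: "\<alpha> (p z) (Xf \<xi> (p z)) = 0" if "z \<in> S" "\<alpha> \<in> lower_components q \<omega>" "\<forall>r\<le>q. snd (comb N w z \<xi>) r = 0" for \<alpha> z \<xi> q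
    using that by (auto simp: lower_components_def scalar_components_def form_p_def \<omega>_Xf dest: linear_0)
  have S2: "dform N (\<lambda>i z. l (snd (w i z) q)) z \<xi> \<eta> =
        l (appl (snd (comb N w z \<eta>) (q + 1)) (fst (comb N w z \<xi>))) - l (appl (snd (comb N w z \<xi>) (q + 1)) (fst (comb N w z \<eta>)))"
    if q: "q + 2 \<le> k" and l: "linear l" and z: "z \<in> S" and 0: "\<forall>r\<le>q. snd (comb N w z \<xi>) r = 0 \<and> snd (comb N w z \<eta>) r = 0" for q l z \<xi> \<eta>
  proof -
    have "dform N (\<lambda>i z. l (snd (w i z) q)) z \<xi> \<eta> + l (wedge_by (\<lambda>x. bracket_m1 q) (form_m1 \<omega>) (form_p (q + 1) \<omega>) (Xf \<xi>) (Xf \<eta>) (p z)) = 0"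
      by (rule structure_at[OF C2_ii[OF q, unfolded form_p_def[of q]] linear_snd_component z _ _ l]) (use low[OF z] 0 in auto)
    then show ?thesis
      by (simp add: wedge_by_def bracket_m1_eq form_m1_def form_p_def \<omega>_Xf[OF z] linear_diff[OF l] linear_neg[OF l])
  qed
  have S3: "dform N (\<lambda>i z. l (snd (w i z) (k - 1))) z \<xi> \<eta> = l (T (p z) (fst (comb N w z \<eta>)) (snd (comb N w z \<xi>) k))"
    if l: "linear l" and z: "z \<in> S" and 0: "\<forall>r<k. snd (comb N w z \<xi>) r = 0 \<and> snd (comb N w z \<eta>) r = 0" "fst (comb N w z \<xi>) = 0" for l z \<xi> \<eta>
  proof -
    have "comb N w z \<eta> \<in> WW0 k Vk0" using w_mem[OF z] by (intro subspace_sum subspace_scale subspace_WW0[OF V0(1)]) auto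
    \<comment> \<open>Since \<xi> has no part of degree -1, this term of the wedge product vanishes
      and only the one with the arguments exchanged, with a minus sign, remains.\<close>
    then have 1: "T (p z) 0 (snd (comb N w z \<eta>) k) = 0" by (intro T0[OF z]) (simp add: WW0_def)
    have "dform N (\<lambda>i z. l (snd (w i z) (k - 1))) z \<xi> \<eta> + l (wedge_by T (form_m1 \<omega>) (form_p k \<omega>) (Xf \<xi>) (Xf \<eta>) (p z)) = 0"
    proof (rule structure_at[OF C2_iii[unfolded form_p_def[of "k - 1"]] linear_snd_component z _ _ l])
      show "\<alpha> (p z) (Xf \<xi> (p z)) = 0 \<and> \<alpha> (p z) (Xf \<eta> (p z)) = 0" if "\<alpha> \<in> lower_components (k - 1) \<omega>" for \<alpha>
        using low[OF z that] 0(1) k by simp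
      show "\<Omega> (Xf \<xi>) (Xf \<eta>) (p z) = 0" if "\<Omega> \<in> wedge_m1_m1 \<omega>" for \<Omega>
        using that 0(2) by (auto simp: wedge_m1_m1_def wedge_def scalar_components_def form_m1_def \<omega>_Xf[OF z] dest!: linear_0)
    qed
    then show ?thesis
      using 1 0(2) by (simp add: wedge_by_def form_m1_def form_p_def \<omega>_Xf[OF z] linear_neg[OF l])
  qed
  obtain r F \<Lambda> and \<chi>' :: "('a, 'b) graded \<Rightarrow> nat \<Rightarrow> real" where r: "r > 0" "cube N z0 r \<subseteq> S" and F: "\<forall>z\<in>cube N z0 r. F z \<in> WW k"
    "\<forall>l. linear l \<longrightarrow> C_infinity N (cube N z0 r) (\<lambda>z. l (F z))"
    and m: "dim (WW (k - 1) :: ('a, 'b) graded set) \<le> N" and \<chi>: "linear \<chi>'" "\<chi>' \<in> linear_charts (WW (k - 1))" and \<Lambda>: "\<forall>i. linear (\<Lambda> i)"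
    "\<forall>i<dim (WW (k - 1) :: ('a, 'b) graded set). \<forall>v. \<Lambda> i v = \<chi>' (rho k v) i"
    and jac: "\<forall>\<xi>. (\<forall>i<N. (\<Sum>j<N. pd j (\<lambda>z. \<Lambda> i (F z)) z0 * \<xi> j) = 0) \<longrightarrow> (\<forall>j<N. \<xi> j = 0)"
    by (rule local_embedding[where w=w and T="\<lambda>z. T (p z)" and S=S and N=N, OF fa fb k V0 dimW openR_cube z0S w_mem w_smooth w_inj S1 S2 S3 T0 TV Tinj])
  let ?C = "cube N z0 r"
  have z0R: "z0 \<in> Rn N" using z0S cube_subset_Rn by blast
  have z0C: "z0 \<in> ?C" by (rule cube_self[OF r(1) z0R])
  define \<kappa> where "\<kappa> z i = (if i < N then \<Lambda> i (F z) else 0)" for z i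
  have \<kappa>R: "\<kappa> z \<in> Rn N" for z by (simp add: \<kappa>_def Rn_def)
  have \<kappa>s: "C_infinity N ?C (\<lambda>z. \<kappa> z i)" if "i < N" for i using that F(2) \<Lambda>(1) by (simp add: \<kappa>_def)
  have \<kappa>j: "\<forall>j<N. \<xi> j = 0" if "\<forall>i<N. (\<Sum>j<N. pd j (\<lambda>z. \<kappa> z i) z0 * \<xi> j) = 0" for \<xi>
    using jac that by (simp add: \<kappa>_def)
  obtain \<delta> \<delta>' g where \<delta>: "\<delta> > 0" and g: "\<And>i. i < N \<Longrightarrow> C_infinity N (cube N (\<kappa> z0) \<delta>) (\<lambda>y. g y i)"
    "\<And>y. y \<in> cube N (\<kappa> z0) \<delta> \<Longrightarrow> g y \<in> ?C" "\<And>y. y \<in> cube N (\<kappa> z0) \<delta> \<Longrightarrow> \<kappa> (g y) = y" "g (\<kappa> z0) = z0"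
    and \<delta>': "\<delta>' > 0" "\<And>x. x \<in> cube N z0 \<delta>' \<Longrightarrow> x \<in> ?C \<and> \<kappa> x \<in> cube N (\<kappa> z0) \<delta> \<and> g (\<kappa> x) = x"
    by (rule inverse_function[where f=\<kappa>, OF openR_cube z0C \<kappa>s \<kappa>R \<kappa>j], assumption, assumption) (rule that)
  \<comment> \<open>The target cube is shrunk until g maps it into the cube of radius \<delta>',
    where g inverts \<kappa> from the left as well.\<close>
  obtain d where d: "d > 0" "cube N (\<kappa> z0) d \<subseteq> cube N (\<kappa> z0) \<delta>" "\<forall>y\<in>cube N (\<kappa> z0) d. \<forall>j<N. \<bar>g y j - g (\<kappa> z0) j\<bar> < \<delta>'"
    by (rule smooth_cube_nbhd[where g=g, OF openR_cube cube_self[OF \<delta> \<kappa>R] \<delta>'(1) g(1)])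
  let ?Q = "cube N (\<kappa> z0) d"
  have gs: "C_infinity N ?Q (\<lambda>y. g y i)" if "i < N" for i
    by (rule smooth_subset[OF g(1)[OF that] openR_cube openR_cube d(2)])
  \<comment> \<open>Cutting the source to the preimage of the target cube makes \<kappa> a bijection
    of Z onto that cube with inverse g.\<close>
  define Z where "Z = {z \<in> cube N z0 \<delta>'. \<kappa> z \<in> ?Q}"
  have ZC: "cube N z0 \<delta>' \<subseteq> ?C" using \<delta>'(2) by blast
  have Z: "openR N Z" unfolding Z_def
    by (rule smooth_preimage_open[OF openR_cube openR_cube smooth_subset[OF \<kappa>s openR_cube openR_cube ZC] \<kappa>R])
  have ZU: "Z \<subseteq> \<phi> ` U" using ZC r(2) S_sub by (auto simp: Z_def)
  have gZ: "g y \<in> Z" if y: "y \<in> ?Q" for y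
  proof -
    have y': "y \<in> cube N (\<kappa> z0) \<delta>" using y d(2) by blast
    have "g y \<in> Rn N" using g(2)[OF y'] cube_subset_Rn by blast
    then have "g y \<in> cube N z0 \<delta>'" using d(3) y g(4) by (simp add: cube_def)
    then show ?thesis using y g(3)[OF y'] by (simp add: Z_def)
  qed
  define A where "A = {x \<in> U. \<phi> x \<in> Z}"
  have \<kappa>Z: "C_infinity N Z (\<lambda>z. \<kappa> z i)" if "i < N" for i
    by (rule smooth_subset[OF \<kappa>s[OF that] openR_cube Z]) (use ZC in \<open>auto simp: Z_def\<close>)
  have \<kappa>Q: "\<kappa> z \<in> ?Q" and g\<kappa>: "g (\<kappa> z) = z" if "z \<in> Z" for z using that \<delta>'(2) by (auto simp: Z_def)
  have \<kappa>g: "\<kappa> (g y) = y" if "y \<in> ?Q" for y using that d(2) g(3) by blast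
  note A = chart_reparametrisation[where \<kappa>=\<kappa> and g=g, OF M c Z ZU \<kappa>Z \<kappa>Q gs gZ g\<kappa> \<kappa>g, folded A_def]
  have "\<kappa> z0 \<in> ?Q" by (rule cube_self[OF d(1) \<kappa>R])
  then have "z0 \<in> Z" using gZ g(4) by fastforce
  then have x0A: "x0 \<in> A" using x0 ch0(2) by (simp add: A_def)
  have sec: "cube_section (WW k) (\<lambda>y. F (g y)) \<Lambda> N (\<kappa> z0) d"
  proof (rule cube_section.intro)
    show "finite_dim (WW k :: ('a, 'b) graded set)" by (rule finite_dim_WW[OF fa fb])
    show "F (g y) \<in> WW k" if "y \<in> ?Q" for y using F(1) g(2) d(2) that by blast
    show "C_infinity N ?Q (\<lambda>y. l (F (g y)))" if "linear l" for l
      by (rule smooth_compose[where g=g and F="\<lambda>z. l (F z)", OF openR_cube[of N z0 r] openR_cube _ gs]) (use F(2) that g(2) d(2) in auto)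
    show "\<Lambda> i (F (g y)) = y i" if "y \<in> ?Q" "i < N" for y i
    proof -
      from fun_cong[OF \<kappa>g[OF that(1)], of i] show ?thesis using that(2) by (simp add: \<kappa>_def)
    qed
  qed (use \<Lambda>(1) in blast)
  define f where "f x = F (\<phi> x)" for x
  have fA: "f x = F (g (\<kappa> (\<phi> x)))" if "x \<in> A" for x using that \<delta>'(2) by (auto simp: f_def A_def Z_def)
  have pts: "points (open_submfd R A) = A" by (rule smooth_manifold_open_submfd(2)[OF M A(1)])
  interpret A: cube_coords "open_submfd R A" "\<lambda>x. \<kappa> (\<phi> x)" "\<lambda>y. p (g y)" N "\<kappa> z0" d by (rule A(2))
  have "smooth_embedding (open_submfd R A) (vector_mfd (WW k)) f"
    by (rule cube_section.embedding[OF sec A(2)]) (use fA pts in auto)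
  moreover have "f ` A = (\<lambda>y. F (g y)) ` ?Q"
  proof
    show "f ` A \<subseteq> (\<lambda>y. F (g y)) ` ?Q" using fA A.\<kappa>_mem unfolding pts by auto
    have "F (g y) = f (p (g y)) \<and> p (g y) \<in> A" if "y \<in> ?Q" for y
      using gZ[OF that] ZU pU \<phi>p by (auto simp: f_def A_def subset_iff)
    then show "(\<lambda>y. F (g y)) ` ?Q \<subseteq> f ` A" by blast
  qed
  moreover have "local_diff_eq k ((\<lambda>y. F (g y)) ` ?Q)"
    by (rule local_diff_eq_section[OF fa fb k d(1) sec m \<chi>(2)]) (use \<Lambda>(2) in blast)
  ultimately show "\<exists>N f. openin (mtop R) N \<and> x0 \<in> N \<and>
    smooth_embedding (open_submfd R N) (vector_mfd (WW k :: ('a, 'b) graded set)) f \<and> local_diff_eq k (f ` N)"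
    using A(1) x0A by metis
qed

end
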